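(* The following is provable in $\mathbf{RCA}_0$: If $T$ is a normal prae-dilator, then $(\partial T,\xi^T)$ is a derivative of $T$.
   Context: We work in second order arithmetic; all orders have fields contained in $\mathbb N$, and finite objects are coded by natural numbers. Basic notation. Morphisms of linear orders are strictly increasing maps (embeddings). $[X]^{<\omega}$ is the set of finite subsets of $X$, and $[f]^{<\omega}(a)=\{f(x)\mid x\in a\}$. Write $n=\{0,\dots,n-1\}$ with the usual order; the category of natural numbers has these finite orders as objects and strictly increasing maps as morphisms. For a finite linear order $a$, $|a|$ is its cardinality (also viewed as the order $\{0,\dots,|a|-1\}$) and $\mathrm{en}_a:|a|\to a$ is the increasing enumeration. For an embedding $f:a\to b$ of finite orders, $|f|:|a|\to|b|$ is the unique increasing map with $\mathrm{en}_b\circ|f|=f\circ\mathrm{en}_a$. For $a\subseteq c$, $\iota_a^c:a\hookrightarrow c$ is the inclusion. For $a\in[X]^{<\omega}$ and $x\in X$, $a<^{\mathrm{fin}}_X x$ means $y<_Xx$ for all $y\in a$. Prae-dilators. A (coded) prae-dilator consists of a functor $T$ from the category of natural numbers to linear orders with fields $T_n\subseteq\mathbb N$ (action on morphisms written $T_f$) and a natural transformation $\mathrm{supp}^T:T\Rightarrow[\cdot]^{<\omega}$ such that any $\sigma\in T_n$ lies in the range of $T_{\iota\circ\mathrm{en}_a}$, where $a=\mathrm{supp}^T_n(\sigma)$ and $\iota:a\hookrightarrow n$ is the inclusion. For a linear order $X$ put $D^T_X=D^T(X)=\{\langle a,\sigma\rangle\mid a\in[X]^{<\omega},\ \sigma\in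 T_{|a|},\ \mathrm{supp}^T_{|a|}(\sigma)=|a|\}$, ordered by $\langle a,\sigma\rangle<\langle b,\tau\rangle$ iff $T_{|\iota_a^{a\cup b}|}(\sigma)<_{T_{|a\cup b|}}T_{|\iota_b^{a\cup b}|}(\tau)$; for an embedding $f:X\to Y$ put $D^T_f(\langle a,\sigma\rangle)=D^T(f)(\langle a,\sigma\rangle)=\langle[f]^{<\omega}(a),\sigma\rangle$. A normal prae-dilator is a prae-dilator $T$ with a natural family of order embeddings $\mu^T_n:n\to T_n$ such that $\sigma<_{T_n}\mu^T_n(m)\Leftrightarrow\mathrm{supp}^T_n(\sigma)<^{\mathrm{fin}}m$ for all $m<n$ and $\sigma\in T_n$. Upper derivatives and derivatives. For normal prae-dilators $T,S$, the composition $T\circ S$ is given by $(T\circ S)_n=D^T(S_n)$, $(T\circ S)_f=D^T(S_f)$, $\mathrm{supp}^{T\circ S}_n(\langle a,\tau\rangle)=\bigcup_{\sigma\in a}\mathrm{supp}^S_n(\sigma)$, $\mu^{T\circ S}_n(m)=\langle\{\mu^S_n(m)\},\mu^T_1(0)\rangle$. A morphism $T\Rightarrow S$ of normal prae-dilators is a natural transformation $\nu$ (with order embeddings $\nu_n:T_n\to S_n$) such that $\nu_n\circ\mu^T_n=\mu^S_n$ for all $n$. An upper derivative of a normal prae-dilator $T$ is a pair $(S,\xi)$ of a normal prae-dilator $S$ and a morphism $\xi:T\circ S\Rightarrow S$ of normal prae-dilators. For a natural transformation $\nu:S^1\Rightarrow S^2$ of prae-dilators define $T(\nu):T\circ S^1\Rightarrow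 T\circ S^2$ by $T(\nu)_n=D^T(\nu_n)$. A morphism of upper derivatives from $(S^1,\xi^1)$ to $(S^2,\xi^2)$ is a morphism $\nu:S^1\Rightarrow S^2$ of normal prae-dilators with $\nu\circ\xi^1=\xi^2\circ T(\nu)$. A derivative of $T$ is an upper derivative $(S,\xi)$ of $T$ such that for any upper derivative $(S',\xi')$ of $T$ there is a unique morphism $\nu:S\Rightarrow S'$ of upper derivatives. The construction $(\partial T,\xi^T)$. Given a normal prae-dilator $T$, the term systems $\partial T_n$ are defined inductively: (i) there is a term $\mu_m\in\partial T_n$ for each $m<n$; (ii) for each finite set $a\subseteq\partial T_n$ of terms and each $\sigma\in T_{|a|}$ with $\mathrm{supp}^T_{|a|}(\sigma)=|a|$ there is a term $\xi\langle a,\sigma\rangle\in\partial T_n$, provided that if $a=\{\mu_m\}$ for some $m<n$ then $\sigma\neq\mu^T_1(0)$. With $\ulcorner s\urcorner$ the Gödel number of $s$, put $L_n(\mu_m)=\ulcorner\mu_m\urcorner$ and $L_n(\xi\langle a,\sigma\rangle)=\max\{\ulcorner\xi\langle a,\sigma\rangle\urcorner,1+\sum_{t\in a}2\cdot L_n(t)\}$. By recursion on $L_n(s)+L_n(t)$, $s<_{\partial T_n}t$ holds iff one of the following does: $s=\mu_m$, $t=\mu_k$ and $m<k$; or $s=\mu_m$, $t=\xi\langle b,\tau\rangle$ and $s\leq_{\partial T_n}r$ for some $r\in b$ ($\leq$ means $<$ or equality of terms); or $s=\xi\langle a,\sigma\rangle$, $t=\mu_k$ and $r<_{\partial T_n}t$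 for all $r\in a$; or $s=\xi\langle a,\sigma\rangle$, $t=\xi\langle b,\tau\rangle$, the restriction of $<_{\partial T_n}$ to $a\cup b$ is linear, and $T_{|\iota_a^{a\cup b}|}(\sigma)<_{T_{|a\cup b|}}T_{|\iota_b^{a\cup b}|}(\tau)$. This is a linear order on $\partial T_n$. For strictly increasing $f:n\to l$ put $\partial T_f(\mu_m)=\mu_{f(m)}$, $\partial T_f(\xi\langle a,\sigma\rangle)=\xi\langle[\partial T_f]^{<\omega}(a),\sigma\rangle$. Put $\mathrm{supp}^{\partial T}_n(\mu_m)=\{m\}$, $\mathrm{supp}^{\partial T}_n(\xi\langle a,\sigma\rangle)=\bigcup_{t\in a}\mathrm{supp}^{\partial T}_n(t)$ and $\mu^{\partial T}_n(m)=\mu_m$. Then $\partial T=(\partial T,\mathrm{supp}^{\partial T},\mu^{\partial T})$. Finally $\xi^T_n:(T\circ\partial T)_n=D^T(\partial T_n)\to\partial T_n$ is defined by $\xi^T_n(\langle a,\sigma\rangle)=\mu_m$ if $\langle a,\sigma\rangle=\langle\{\mu_m\},\mu^T_1(0)\rangle$ with $m<n$, and $\xi^T_n(\langle a,\sigma\rangle)=\xi\langle a,\sigma\rangle$ otherwise. *)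

theory Defs
  imports Main
begin

section \<open>The language of second order arithmetic\<close>

text \<open>
  Formulas of two-sorted classical logic, with separate de Bruijn indices for number variables
  and for set variables. As usual, equality is primitive for numbers only; equality of sets
  is understood extensionally.
\<close>

datatype tm = Var nat | Zero | One | Add tm tm | Mul tm tm

datatype fm =
    Eq tm tm
  | Less tm tm
  | Mem tm nat
  | Fls
  | Imp fm fm
  | AllN fm
  | AllS fm

definition Neg :: "fm \<Rightarrow> fm" where "Neg A = Imp A Fls"
definition Conj :: "fm \<Rightarrow> fm \<Rightarrow> fm" where "Conj A B = Neg (Imp A (Neg B))"
definition Disj :: "fm \<Rightarrow> fm \<Rightarrow> fm" where "Disj A B = Imp (Neg A) B"
definition Iff :: "fm \<Rightarrow> fm \<Rightarrow> fm" where "Iff A B = Conj (Imp A B) (Imp B A)"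
definition ExN :: "fm \<Rightarrow> fm" where "ExN A = Neg (AllN (Neg A))"
definition ExS :: "fm \<Rightarrow> fm" where "ExS A = Neg (AllS (Neg A))"

text \<open>Simultaneous substitution of terms for number variables and of set variables for set variables.\<close>

primrec subst_tm :: "(nat \<Rightarrow> tm) \<Rightarrow> tm \<Rightarrow> tm" where
  "subst_tm s (Var i) = s i"
| "subst_tm s Zero = Zero"
| "subst_tm s One = One"
| "subst_tm s (Add t u) = Add (subst_tm s t) (subst_tm s u)"
| "subst_tm s (Mul t u) = Mul (subst_tm s t) (subst_tm s u)"

definition lift_tm :: "tm \<Rightarrow> tm" where "lift_tm = subst_tm (\<lambda>i. Var (Suc i))"

primrec subst :: "(nat \<Rightarrow> tm) \<Rightarrow> (nat \<Rightarrow> nat) \<Rightarrow> fm \<Rightarrow> fm" where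
  "subst s r (Eq t u) = Eq (subst_tm s t) (subst_tm s u)"
| "subst s r (Less t u) = Less (subst_tm s t) (subst_tm s u)"
| "subst s r (Mem t i) = Mem (subst_tm s t) (r i)"
| "subst s r Fls = Fls"
| "subst s r (Imp A B) = Imp (subst s r A) (subst s r B)"
| "subst s r (AllN A) = AllN (subst (case_nat (Var 0) (\<lambda>i. lift_tm (s i))) r A)"
| "subst s r (AllS A) = AllS (subst s (case_nat 0 (\<lambda>i. Suc (r i))) A)"

definition lift :: "fm \<Rightarrow> fm" where "lift = subst (\<lambda>i. Var (Suc i)) (\<lambda>i. i)"
definition lift_set :: "fm \<Rightarrow> fm" where "lift_set = subst Var Suc"
definition inst :: "tm \<Rightarrow> fm \<Rightarrow> fm" where "inst t = subst (case_nat t Var) (\<lambda>i. i)"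
definition inst_set :: "nat \<Rightarrow> fm \<Rightarrow> fm" where "inst_set j = subst Var (case_nat j (\<lambda>i. i))"

section \<open>Natural deduction\<close>

text \<open>
  \<open>derivable Ax \<Gamma> A\<close>: the formula \<open>A\<close> is derivable from the hypotheses \<open>\<Gamma>\<close> and from the axioms
  \<open>Ax\<close>, where free variables in elements of \<open>Ax\<close> are implicitly universally quantified.
\<close>

inductive derivable :: "fm set \<Rightarrow> fm list \<Rightarrow> fm \<Rightarrow> bool" for Ax :: "fm set" where
  Axiom: "A \<in> Ax \<Longrightarrow> derivable Ax \<Gamma> A"
| Hyp: "A \<in> set \<Gamma> \<Longrightarrow> derivable Ax \<Gamma> A"
| ImpI: "derivable Ax (A # \<Gamma>) B \<Longrightarrow> derivable Ax \<Gamma> (Imp A B)"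
| ImpE: "derivable Ax \<Gamma> (Imp A B) \<Longrightarrow> derivable Ax \<Gamma> A \<Longrightarrow> derivable Ax \<Gamma> B"
| Classical: "derivable Ax (Neg A # \<Gamma>) Fls \<Longrightarrow> derivable Ax \<Gamma> A"
| AllNI: "derivable Ax (map lift \<Gamma>) A \<Longrightarrow> derivable Ax \<Gamma> (AllN A)"
| AllNE: "derivable Ax \<Gamma> (AllN A) \<Longrightarrow> derivable Ax \<Gamma> (inst t A)"
| AllSI: "derivable Ax (map lift_set \<Gamma>) A \<Longrightarrow> derivable Ax \<Gamma> (AllS A)"
| AllSE: "derivable Ax \<Gamma> (AllS A) \<Longrightarrow> derivable Ax \<Gamma> (inst_set j A)"
| EqRefl: "derivable Ax \<Gamma> (Eq t t)"
| EqSubst: "derivable Ax \<Gamma> (Eq t u) \<Longrightarrow> derivable Ax \<Gamma> (inst t A) \<Longrightarrow> derivable Ax \<Gamma> (inst u A)"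

section \<open>The axioms of RCA0\<close>

text \<open>
  Formulas all of whose quantifiers are bounded number quantifiers; lifting \<open>t\<close> ensures that the
  bound does not contain the quantified variable. Bounded existential quantifiers are covered
  by negation, which is an instance of implication.
\<close>

inductive bounded :: "fm \<Rightarrow> bool" where
  "bounded (Eq t u)"
| "bounded (Less t u)"
| "bounded (Mem t i)"
| "bounded Fls"
| "bounded A \<Longrightarrow> bounded B \<Longrightarrow> bounded (Imp A B)"
| "bounded A \<Longrightarrow> bounded (AllN (Imp (Less (Var 0) (lift_tm t)) A))"

definition Sigma1 :: "fm set" where "Sigma1 = {ExN A | A. bounded A}"
definition Pi1 :: "fm set" where "Pi1 = {AllN A | A. bounded A}"

definition basic_axioms :: "fm set" where
  "basic_axioms =
    {Neg (Eq (Add (Var 0) One) Zero),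
     Imp (Eq (Add (Var 0) One) (Add (Var 1) One)) (Eq (Var 0) (Var 1)),
     Eq (Add (Var 0) Zero) (Var 0),
     Eq (Add (Var 0) (Add (Var 1) One)) (Add (Add (Var 0) (Var 1)) One),
     Eq (Mul (Var 0) Zero) Zero,
     Eq (Mul (Var 0) (Add (Var 1) One)) (Add (Mul (Var 0) (Var 1)) (Var 0)),
     Neg (Less (Var 0) Zero),
     Iff (Less (Var 0) (Add (Var 1) One)) (Disj (Less (Var 0) (Var 1)) (Eq (Var 0) (Var 1)))}"

text \<open>In the following two schemes the induction resp. comprehension variable is \<open>Var 0\<close>.\<close>

definition induction_axiom :: "fm \<Rightarrow> fm" where
  "induction_axiom A =
    Imp (Conj (inst Zero A)
              (AllN (Imp A (subst (case_nat (Add (Var 0) One) (\<lambda>i. Var (Suc i))) (\<lambda>i. i) A))))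
        (AllN A)"

definition comprehension_axiom :: "fm \<Rightarrow> fm \<Rightarrow> fm" where
  "comprehension_axiom A B =
    Imp (AllN (Iff A B)) (ExS (AllN (Iff (Mem (Var 0) 0) (lift_set A))))"

definition RCA0 :: "fm set" where
  "RCA0 = basic_axioms
    \<union> {induction_axiom A | A. A \<in> Sigma1}
    \<union> {comprehension_axiom A B | A B. A \<in> Sigma1 \<and> B \<in> Pi1}"

section \<open>Notation for writing formulas\<close>

text \<open>
  To write formulas with named variables, terms, set variables and formulas are parametrised by
  the numbers of number quantifiers and set quantifiers in whose scope they are placed. A
  quantifier passes to its body the variable that it binds: the variable bound
  at depth \<open>d\<close> has the de Bruijn index \<open>d' - Suc d\<close> when it is used at depth \<open>d'\<close>.
  HOL functions that return a \<open>form\<close> act as macros: they abbreviate formulas of second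
  order arithmetic. HOL functions from \<open>term\<close> to \<open>form\<close> are thus definable classes.
\<close>

type_synonym "term" = "nat \<Rightarrow> tm"
type_synonym setvar = "nat \<Rightarrow> nat"
type_synonym form = "nat \<Rightarrow> nat \<Rightarrow> fm"

definition b_zero :: "term" ("\<^bold>0") where "\<^bold>0 = (\<lambda>d. Zero)"
definition b_one :: "term" ("\<^bold>1") where "\<^bold>1 = (\<lambda>d. One)"
definition b_add :: "term \<Rightarrow> term \<Rightarrow> term" (infixl "\<^bold>+" 65) where
  "x \<^bold>+ y = (\<lambda>d. Add (x d) (y d))"
definition b_mul :: "term \<Rightarrow> term \<Rightarrow> term" (infixl "\<^bold>*" 70) where
  "x \<^bold>* y = (\<lambda>d. Mul (x d) (y d))"

definition b_eq :: "term \<Rightarrow> term \<Rightarrow> form" (infix "\<^bold>=" 50) where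
  "(x \<^bold>= y) = (\<lambda>d e. Eq (x d) (y d))"
definition b_less :: "term \<Rightarrow> term \<Rightarrow> form" (infix "\<^bold><" 50) where
  "(x \<^bold>< y) = (\<lambda>d e. Less (x d) (y d))"
definition b_mem :: "term \<Rightarrow> setvar \<Rightarrow> form" (infix "\<^bold>\<in>" 50) where
  "(x \<^bold>\<in> X) = (\<lambda>d e. Mem (x d) (X e))"
definition b_not :: "form \<Rightarrow> form" ("\<^bold>\<not> _" [40] 40) where
  "(\<^bold>\<not> A) = (\<lambda>d e. Neg (A d e))"
definition b_and :: "form \<Rightarrow> form \<Rightarrow> form" (infixr "\<^bold>\<and>" 35) where
  "(A \<^bold>\<and> B) = (\<lambda>d e. Conj (A d e) (B d e))"
definition b_or :: "form \<Rightarrow> form \<Rightarrow> form" (infixr "\<^bold>\<or>" 30) where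
  "(A \<^bold>\<or> B) = (\<lambda>d e. Disj (A d e) (B d e))"
definition b_imp :: "form \<Rightarrow> form \<Rightarrow> form" (infixr "\<^bold>\<longrightarrow>" 25) where
  "(A \<^bold>\<longrightarrow> B) = (\<lambda>d e. Imp (A d e) (B d e))"
definition b_iff :: "form \<Rightarrow> form \<Rightarrow> form" (infixr "\<^bold>\<longleftrightarrow>" 25) where
  "(A \<^bold>\<longleftrightarrow> B) = (\<lambda>d e. Iff (A d e) (B d e))"

definition b_all :: "(term \<Rightarrow> form) \<Rightarrow> form" (binder "\<^bold>\<forall>" 10) where
  "(\<^bold>\<forall>x. F x) = (\<lambda>d e. AllN (F (\<lambda>d'. Var (d' - Suc d)) (Suc d) e))"
definition b_ex :: "(term \<Rightarrow> form) \<Rightarrow> form" (binder "\<^bold>\<exists>" 10) where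
  "(\<^bold>\<exists>x. F x) = (\<lambda>d e. ExN (F (\<lambda>d'. Var (d' - Suc d)) (Suc d) e))"
definition b_all_set :: "(setvar \<Rightarrow> form) \<Rightarrow> form" (binder "\<^bold>\<forall>\<^sub>S" 10) where
  "(\<^bold>\<forall>\<^sub>SX. F X) = (\<lambda>d e. AllS (F (\<lambda>e'. e' - Suc e) d (Suc e)))"
definition b_ex_set :: "(setvar \<Rightarrow> form) \<Rightarrow> form" (binder "\<^bold>\<exists>\<^sub>S" 10) where
  "(\<^bold>\<exists>\<^sub>SX. F X) = (\<lambda>d e. ExS (F (\<lambda>e'. e' - Suc e) d (Suc e)))"

definition provable_in_RCA0 :: "form \<Rightarrow> bool" where
  "provable_in_RCA0 A \<longleftrightarrow> derivable RCA0 [] (A 0 0)"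

section \<open>Coding of finite objects\<close>

text \<open>
  Simpson's coding: the pair of \<open>x\<close> and \<open>y\<close> is \<open>(x + y)\<^sup>2 + x\<close>; a finite set is coded by the least
  number \<open>\<langle>k, \<langle>m, q\<rangle>\<rangle>\<close> such that \<open>x\<close> lies in the set iff \<open>x < k\<close> and \<open>m (x + 1) + 1\<close>
  divides \<open>q\<close>. Numbers that are not of this form have no elements, like the empty set, which has the
  code \<open>0 = \<langle>0, \<langle>0, 0\<rangle>\<rangle>\<close>; hence codes are precisely the numbers that are minimal among those
  with the same elements.
\<close>

definition pair :: "term \<Rightarrow> term \<Rightarrow> term" ("\<^bold>\<langle>_,/ _\<^bold>\<rangle>") where
  "\<^bold>\<langle>x, y\<^bold>\<rangle> = (x \<^bold>+ y) \<^bold>* (x \<^bold>+ y) \<^bold>+ x"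

definition elem :: "term \<Rightarrow> term \<Rightarrow> form" (infix "\<^bold>\<epsilon>" 50) where
  "(x \<^bold>\<epsilon> a) = (\<^bold>\<exists>k m q. a \<^bold>= \<^bold>\<langle>k, \<^bold>\<langle>m, q\<^bold>\<rangle>\<^bold>\<rangle> \<^bold>\<and> x \<^bold>< k \<^bold>\<and> (\<^bold>\<exists>r. (m \<^bold>* (x \<^bold>+ \<^bold>1) \<^bold>+ \<^bold>1) \<^bold>* r \<^bold>= q))"

definition is_fin :: "term \<Rightarrow> form" where
  "is_fin a = (\<^bold>\<forall>b. b \<^bold>< a \<^bold>\<longrightarrow> \<^bold>\<not> (\<^bold>\<forall>x. x \<^bold>\<epsilon> b \<^bold>\<longleftrightarrow> x \<^bold>\<epsilon> a))"

text \<open>\<open>is_fset a P\<close>: \<open>a\<close> is the code of the finite set \<open>{x | P x}\<close>.\<close>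

definition is_fset :: "term \<Rightarrow> (term \<Rightarrow> form) \<Rightarrow> form" where
  "is_fset a P = (is_fin a \<^bold>\<and> (\<^bold>\<forall>x. x \<^bold>\<epsilon> a \<^bold>\<longleftrightarrow> P x))"

section \<open>Linear orders and embeddings\<close>

record order =
  Fld :: "term \<Rightarrow> form"
  Lt :: "term \<Rightarrow> term \<Rightarrow> form"

definition linear :: "order \<Rightarrow> form" where
  "linear X =
    ((\<^bold>\<forall>x y. Lt X x y \<^bold>\<longrightarrow> Fld X x \<^bold>\<and> Fld X y)
     \<^bold>\<and> (\<^bold>\<forall>x. \<^bold>\<not> Lt X x x)
     \<^bold>\<and> (\<^bold>\<forall>x y z. Lt X x y \<^bold>\<and> Lt X y z \<^bold>\<longrightarrow> Lt X x z)
     \<^bold>\<and> (\<^bold>\<forall>x y. Fld X x \<^bold>\<and> Fld X y \<^bold>\<longrightarrow> Lt X x y \<^bold>\<or> x \<^bold>= y \<^bold>\<or> Lt X y x))"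

definition below :: "term \<Rightarrow> order" where
  "below n = \<lparr>Fld = (\<lambda>x. x \<^bold>< n), Lt = (\<lambda>x y. x \<^bold>< y \<^bold>\<and> y \<^bold>< n)\<rparr>"

definition restrict :: "order \<Rightarrow> term \<Rightarrow> order" where
  "restrict X a = \<lparr>Fld = (\<lambda>x. x \<^bold>\<epsilon> a), Lt = (\<lambda>x y. x \<^bold>\<epsilon> a \<^bold>\<and> y \<^bold>\<epsilon> a \<^bold>\<and> Lt X x y)\<rparr>"

text \<open>\<open>maps A B G\<close>: the relation \<open>G\<close> is the graph of a function from \<open>A\<close> to \<open>B\<close>.\<close>

definition maps ::
  "(term \<Rightarrow> form) \<Rightarrow> (term \<Rightarrow> form) \<Rightarrow> (term \<Rightarrow> term \<Rightarrow> form) \<Rightarrow> form" where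
  "maps A B G =
    ((\<^bold>\<forall>x y. G x y \<^bold>\<longrightarrow> A x \<^bold>\<and> B y)
     \<^bold>\<and> (\<^bold>\<forall>x. A x \<^bold>\<longrightarrow> (\<^bold>\<exists>y. G x y \<^bold>\<and> (\<^bold>\<forall>z. G x z \<^bold>\<longrightarrow> z \<^bold>= y))))"

definition embeds :: "order \<Rightarrow> order \<Rightarrow> (term \<Rightarrow> term \<Rightarrow> form) \<Rightarrow> form" where
  "embeds X Y G =
    (maps (Fld X) (Fld Y) G
     \<^bold>\<and> (\<^bold>\<forall>x y x' y'. G x y \<^bold>\<and> G x' y' \<^bold>\<and> Lt X x x' \<^bold>\<longrightarrow> Lt Y y y'))"

text \<open>
  \<open>enum X a k g\<close>: the finite graph \<open>g\<close> is the increasing enumeration \<open>en\<^sub>a : k = |a| \<rightarrow> a\<close>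
  of the finite suborder \<open>a\<close> of \<open>X\<close>.
\<close>

definition enum :: "order \<Rightarrow> term \<Rightarrow> term \<Rightarrow> term \<Rightarrow> form" where
  "enum X a k g =
    (is_fin g \<^bold>\<and> (\<^bold>\<forall>z. z \<^bold>\<epsilon> g \<^bold>\<longrightarrow> (\<^bold>\<exists>i x. z \<^bold>= \<^bold>\<langle>i, x\<^bold>\<rangle>))
     \<^bold>\<and> embeds (below k) (restrict X a) (\<lambda>i x. \<^bold>\<langle>i, x\<^bold>\<rangle> \<^bold>\<epsilon> g)
     \<^bold>\<and> (\<^bold>\<forall>x. x \<^bold>\<epsilon> a \<^bold>\<longrightarrow> (\<^bold>\<exists>i. \<^bold>\<langle>i, x\<^bold>\<rangle> \<^bold>\<epsilon> g)))"

definition has_card :: "term \<Rightarrow> term \<Rightarrow> form" where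
  "has_card a k =
    (\<^bold>\<exists>g. maps (\<lambda>i. i \<^bold>< k) (\<lambda>x. x \<^bold>\<epsilon> a) (\<lambda>i x. \<^bold>\<langle>i, x\<^bold>\<rangle> \<^bold>\<epsilon> g)
     \<^bold>\<and> (\<^bold>\<forall>x. x \<^bold>\<epsilon> a \<^bold>\<longrightarrow> (\<^bold>\<exists>i. \<^bold>\<langle>i, x\<^bold>\<rangle> \<^bold>\<epsilon> g \<^bold>\<and> (\<^bold>\<forall>j. \<^bold>\<langle>j, x\<^bold>\<rangle> \<^bold>\<epsilon> g \<^bold>\<longrightarrow> j \<^bold>= i))))"

section \<open>The category of natural numbers\<close>

text \<open>A morphism is coded together with its domain and codomain, as \<open>\<langle>n, \<langle>m, graph\<rangle>\<rangle>\<close>.\<close>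

definition app :: "term \<Rightarrow> term \<Rightarrow> term \<Rightarrow> form" where
  "app f i j = (\<^bold>\<exists>n m g. f \<^bold>= \<^bold>\<langle>n, \<^bold>\<langle>m, g\<^bold>\<rangle>\<^bold>\<rangle> \<^bold>\<and> \<^bold>\<langle>i, j\<^bold>\<rangle> \<^bold>\<epsilon> g)"

definition is_mor :: "term \<Rightarrow> term \<Rightarrow> term \<Rightarrow> form" where
  "is_mor f n m =
    ((\<^bold>\<exists>g. f \<^bold>= \<^bold>\<langle>n, \<^bold>\<langle>m, g\<^bold>\<rangle>\<^bold>\<rangle> \<^bold>\<and> is_fin g \<^bold>\<and> (\<^bold>\<forall>z. z \<^bold>\<epsilon> g \<^bold>\<longrightarrow> (\<^bold>\<exists>i j. z \<^bold>= \<^bold>\<langle>i, j\<^bold>\<rangle>)))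
     \<^bold>\<and> embeds (below n) (below m) (app f))"

text \<open>\<open>incl X a c f\<close>: \<open>f\<close> is \<open>|\<iota>|\<close> for the inclusion \<open>\<iota>\<close> of \<open>a\<close> into \<open>c\<close>, i.e. \<open>en\<^sub>c \<circ> f = en\<^sub>a\<close>.\<close>

definition incl :: "order \<Rightarrow> term \<Rightarrow> term \<Rightarrow> term \<Rightarrow> form" where
  "incl X a c f =
    (\<^bold>\<exists>k l u v. enum X a k u \<^bold>\<and> enum X c l v \<^bold>\<and> is_mor f k l
      \<^bold>\<and> (\<^bold>\<forall>i j. app f i j \<^bold>\<longrightarrow> (\<^bold>\<exists>x. \<^bold>\<langle>i, x\<^bold>\<rangle> \<^bold>\<epsilon> u \<^bold>\<and> \<^bold>\<langle>j, x\<^bold>\<rangle> \<^bold>\<epsilon> v)))"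

section \<open>Normal prae-dilators\<close>

text \<open>
  The data of a normal prae-dilator: the orders \<open>T\<^sub>n\<close>, the graphs of \<open>T\<^sub>f\<close>, of \<open>supp\<^sub>n\<close> (with codes
  of finite sets as values) and of \<open>\<mu>\<^sub>n\<close>. The components are definable classes, so that
  compositions are covered; quantification is over set-coded data (see \<open>coded\<close> below).
\<close>

record praedil =
  Obj :: "term \<Rightarrow> order"
  Act :: "term \<Rightarrow> term \<Rightarrow> term \<Rightarrow> form"
  Supp :: "term \<Rightarrow> term \<Rightarrow> term \<Rightarrow> form"
  Mu :: "term \<Rightarrow> term \<Rightarrow> term \<Rightarrow> form"

definition is_functor :: "praedil \<Rightarrow> form" where
  "is_functor T =
    ((\<^bold>\<forall>n. linear (Obj T n))
     \<^bold>\<and> (\<^bold>\<forall>f n m. is_mor f n m \<^bold>\<longrightarrow> embeds (Obj T n) (Obj T m) (Act T f))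
     \<^bold>\<and> (\<^bold>\<forall>f n. is_mor f n n \<^bold>\<and> (\<^bold>\<forall>i. i \<^bold>< n \<^bold>\<longrightarrow> app f i i) \<^bold>\<longrightarrow>
          (\<^bold>\<forall>x. Fld (Obj T n) x \<^bold>\<longrightarrow> Act T f x x))
     \<^bold>\<and> (\<^bold>\<forall>f g h n m l. is_mor f n m \<^bold>\<and> is_mor g m l \<^bold>\<and> is_mor h n l
            \<^bold>\<and> (\<^bold>\<forall>i j k. app f i j \<^bold>\<and> app g j k \<^bold>\<longrightarrow> app h i k) \<^bold>\<longrightarrow>
          (\<^bold>\<forall>x y z. Act T f x y \<^bold>\<and> Act T g y z \<^bold>\<longrightarrow> Act T h x z)))"

definition is_praedilator :: "praedil \<Rightarrow> form" where
  "is_praedilator T =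
    (is_functor T
     \<^bold>\<and> (\<^bold>\<forall>n. maps (Fld (Obj T n)) (\<lambda>a. is_fin a \<^bold>\<and> (\<^bold>\<forall>i. i \<^bold>\<epsilon> a \<^bold>\<longrightarrow> i \<^bold>< n)) (Supp T n))
     \<^bold>\<and> (\<^bold>\<forall>f n m x y a b. is_mor f n m \<^bold>\<and> Act T f x y \<^bold>\<and> Supp T n x a \<^bold>\<and> Supp T m y b \<^bold>\<longrightarrow>
          (\<^bold>\<forall>j. j \<^bold>\<epsilon> b \<^bold>\<longleftrightarrow> (\<^bold>\<exists>i. i \<^bold>\<epsilon> a \<^bold>\<and> app f i j)))
     \<^bold>\<and> (\<^bold>\<forall>n x a. Supp T n x a \<^bold>\<longrightarrow>
          (\<^bold>\<exists>k u f y. enum (below n) a k u \<^bold>\<and> is_mor f k n \<^bold>\<and> (\<^bold>\<forall>i j. app f i j \<^bold>\<longleftrightarrow> \<^bold>\<langle>i, j\<^bold>\<rangle> \<^bold>\<epsilon> u)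
            \<^bold>\<and> Fld (Obj T k) y \<^bold>\<and> Act T f y x)))"

definition is_normal_praedilator :: "praedil \<Rightarrow> form" where
  "is_normal_praedilator T =
    (is_praedilator T
     \<^bold>\<and> (\<^bold>\<forall>n. embeds (below n) (Obj T n) (Mu T n))
     \<^bold>\<and> (\<^bold>\<forall>f n m i j x y. is_mor f n m \<^bold>\<and> app f i j \<^bold>\<and> Mu T n i x \<^bold>\<and> Mu T m j y \<^bold>\<longrightarrow> Act T f x y)
     \<^bold>\<and> (\<^bold>\<forall>n m x y a. m \<^bold>< n \<^bold>\<and> Mu T n m x \<^bold>\<and> Fld (Obj T n) y \<^bold>\<and> Supp T n y a \<^bold>\<longrightarrow>
          (Lt (Obj T n) y x \<^bold>\<longleftrightarrow> (\<^bold>\<forall>i. i \<^bold>\<epsilon> a \<^bold>\<longrightarrow> i \<^bold>< m))))"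

section \<open>The orders \<open>D\<^sup>T(X)\<close>\<close>

definition full_supp :: "praedil \<Rightarrow> term \<Rightarrow> term \<Rightarrow> form" where
  "full_supp T k s = (\<^bold>\<exists>b. Supp T k s b \<^bold>\<and> (\<^bold>\<forall>i. i \<^bold>\<epsilon> b \<^bold>\<longleftrightarrow> i \<^bold>< k))"

text \<open>\<open>T\<^bsub>|\<iota>|\<^esub>(s) < T\<^bsub>|\<iota>'|\<^esub>(t)\<close> in \<open>T\<^bsub>|c|\<^esub>\<close>, for \<open>c = a \<union> b\<close> and the inclusions \<open>\<iota>\<close> of \<open>a\<close> and \<open>\<iota>'\<close> of \<open>b\<close> into \<open>c\<close>.\<close>

definition D_less :: "praedil \<Rightarrow> order \<Rightarrow> term \<Rightarrow> term \<Rightarrow> term \<Rightarrow> term \<Rightarrow> form" where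
  "D_less T X a s b t =
    (\<^bold>\<exists>c k f g s' t'. is_fset c (\<lambda>x. x \<^bold>\<epsilon> a \<^bold>\<or> x \<^bold>\<epsilon> b) \<^bold>\<and> has_card c k
      \<^bold>\<and> incl X a c f \<^bold>\<and> incl X b c g \<^bold>\<and> Act T f s s' \<^bold>\<and> Act T g t t' \<^bold>\<and> Lt (Obj T k) s' t')"

definition D_fld :: "praedil \<Rightarrow> order \<Rightarrow> term \<Rightarrow> form" where
  "D_fld T X p =
    (\<^bold>\<exists>a s k. p \<^bold>= \<^bold>\<langle>a, s\<^bold>\<rangle> \<^bold>\<and> is_fin a \<^bold>\<and> (\<^bold>\<forall>x. x \<^bold>\<epsilon> a \<^bold>\<longrightarrow> Fld X x)
      \<^bold>\<and> has_card a k \<^bold>\<and> Fld (Obj T k) s \<^bold>\<and> full_supp T k s)"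

definition D_obj :: "praedil \<Rightarrow> order \<Rightarrow> order" where
  "D_obj T X =
    \<lparr>Fld = D_fld T X,
     Lt = (\<lambda>p q. D_fld T X p \<^bold>\<and> D_fld T X q
            \<^bold>\<and> (\<^bold>\<exists>a s b t. p \<^bold>= \<^bold>\<langle>a, s\<^bold>\<rangle> \<^bold>\<and> q \<^bold>= \<^bold>\<langle>b, t\<^bold>\<rangle> \<^bold>\<and> D_less T X a s b t))\<rparr>"

text \<open>The graph of \<open>D\<^sup>T(F) : D\<^sup>T(X) \<rightarrow> D\<^sup>T(Y)\<close>, where \<open>F\<close> is the graph of an embedding of \<open>X\<close> into \<open>Y\<close>.\<close>

definition D_map :: "praedil \<Rightarrow> order \<Rightarrow> (term \<Rightarrow> term \<Rightarrow> form) \<Rightarrow> term \<Rightarrow> term \<Rightarrow> form" where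
  "D_map T X F p q =
    (D_fld T X p
     \<^bold>\<and> (\<^bold>\<exists>a s b. p \<^bold>= \<^bold>\<langle>a, s\<^bold>\<rangle> \<^bold>\<and> q \<^bold>= \<^bold>\<langle>b, s\<^bold>\<rangle> \<^bold>\<and> is_fset b (\<lambda>y. \<^bold>\<exists>x. x \<^bold>\<epsilon> a \<^bold>\<and> F x y)))"

section \<open>Upper derivatives and derivatives\<close>

definition compose :: "praedil \<Rightarrow> praedil \<Rightarrow> praedil" where
  "compose T S =
    \<lparr>Obj = (\<lambda>n. D_obj T (Obj S n)),
     Act = (\<lambda>f p q. \<^bold>\<exists>n m. is_mor f n m \<^bold>\<and> D_map T (Obj S n) (Act S f) p q),
     Supp = (\<lambda>n p c. D_fld T (Obj S n) p
              \<^bold>\<and> (\<^bold>\<exists>a t. p \<^bold>= \<^bold>\<langle>a, t\<^bold>\<rangle> \<^bold>\<and> is_fset c (\<lambda>i. \<^bold>\<exists>s d. s \<^bold>\<epsilon> a \<^bold>\<and> Supp S n s d \<^bold>\<and> i \<^bold>\<epsilon> d))),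
     Mu = (\<lambda>n m p. \<^bold>\<exists>x y a. Mu S n m x \<^bold>\<and> Mu T \<^bold>1 \<^bold>0 y \<^bold>\<and> is_fset a (\<lambda>z. z \<^bold>= x) \<^bold>\<and> p \<^bold>= \<^bold>\<langle>a, y\<^bold>\<rangle>)\<rparr>"

text \<open>In the following, a family of functions \<open>\<nu>\<^sub>n\<close> is given by the ternary relation \<open>\<nu>\<^sub>n(x) = y\<close>.\<close>

definition nat_trans :: "praedil \<Rightarrow> praedil \<Rightarrow> (term \<Rightarrow> term \<Rightarrow> term \<Rightarrow> form) \<Rightarrow> form" where
  "nat_trans P Q N =
    ((\<^bold>\<forall>n. embeds (Obj P n) (Obj Q n) (N n))
     \<^bold>\<and> (\<^bold>\<forall>f n m x y u v. is_mor f n m \<^bold>\<and> Act P f x y \<^bold>\<and> N n x u \<^bold>\<and> Act Q f u v \<^bold>\<longrightarrow> N m y v))"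

definition normal_morphism ::
  "praedil \<Rightarrow> praedil \<Rightarrow> (term \<Rightarrow> term \<Rightarrow> term \<Rightarrow> form) \<Rightarrow> form" where
  "normal_morphism P Q N =
    (nat_trans P Q N \<^bold>\<and> (\<^bold>\<forall>n m x y. Mu P n m x \<^bold>\<and> N n x y \<^bold>\<longrightarrow> Mu Q n m y))"

definition upper_derivative ::
  "praedil \<Rightarrow> praedil \<Rightarrow> (term \<Rightarrow> term \<Rightarrow> term \<Rightarrow> form) \<Rightarrow> form" where
  "upper_derivative T S xi = (is_normal_praedilator S \<^bold>\<and> normal_morphism (compose T S) S xi)"

definition upper_morphism ::
  "praedil \<Rightarrow> praedil \<Rightarrow> (term \<Rightarrow> term \<Rightarrow> term \<Rightarrow> form) \<Rightarrow>
   praedil \<Rightarrow> (term \<Rightarrow> term \<Rightarrow> term \<Rightarrow> form) \<Rightarrow> (term \<Rightarrow> term \<Rightarrow> term \<Rightarrow> form) \<Rightarrow> form" where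
  "upper_morphism T S xi S' xi' N =
    (normal_morphism S S' N
     \<^bold>\<and> (\<^bold>\<forall>n p. D_fld T (Obj S n) p \<^bold>\<longrightarrow>
          (\<^bold>\<exists>x q y. xi n p x \<^bold>\<and> N n x y \<^bold>\<and> D_map T (Obj S n) (N n) p q \<^bold>\<and> xi' n q y)))"

text \<open>
  Quantification over prae-dilators and natural transformations is quantification over sets
  that code the data. Two families are identified if they have the same components.
\<close>

definition family :: "setvar \<Rightarrow> term \<Rightarrow> term \<Rightarrow> term \<Rightarrow> form" where
  "family X = (\<lambda>n x y. \<^bold>\<langle>n, \<^bold>\<langle>x, y\<^bold>\<rangle>\<^bold>\<rangle> \<^bold>\<in> X)"

definition coded :: "setvar \<Rightarrow> setvar \<Rightarrow> setvar \<Rightarrow> setvar \<Rightarrow> setvar \<Rightarrow> praedil" where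
  "coded A B C D E =
    \<lparr>Obj = (\<lambda>n. \<lparr>Fld = (\<lambda>x. \<^bold>\<langle>n, x\<^bold>\<rangle> \<^bold>\<in> A), Lt = family B n\<rparr>),
     Act = family C, Supp = family D, Mu = family E\<rparr>"

definition all_praedil :: "(praedil \<Rightarrow> form) \<Rightarrow> form" (binder "\<^bold>\<forall>\<^sub>P" 10) where
  "(\<^bold>\<forall>\<^sub>PT. F T) = (\<^bold>\<forall>\<^sub>SA B C D E. F (coded A B C D E))"
definition ex_praedil :: "(praedil \<Rightarrow> form) \<Rightarrow> form" (binder "\<^bold>\<exists>\<^sub>P" 10) where
  "(\<^bold>\<exists>\<^sub>PT. F T) = (\<^bold>\<exists>\<^sub>SA B C D E. F (coded A B C D E))"
definition all_family ::
  "((term \<Rightarrow> term \<Rightarrow> term \<Rightarrow> form) \<Rightarrow> form) \<Rightarrow> form" (binder "\<^bold>\<forall>\<^sub>F" 10) where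
  "(\<^bold>\<forall>\<^sub>FN. F N) = (\<^bold>\<forall>\<^sub>SX. F (family X))"
definition ex_family ::
  "((term \<Rightarrow> term \<Rightarrow> term \<Rightarrow> form) \<Rightarrow> form) \<Rightarrow> form" (binder "\<^bold>\<exists>\<^sub>F" 10) where
  "(\<^bold>\<exists>\<^sub>FN. F N) = (\<^bold>\<exists>\<^sub>SX. F (family X))"

definition is_derivative ::
  "praedil \<Rightarrow> praedil \<Rightarrow> (term \<Rightarrow> term \<Rightarrow> term \<Rightarrow> form) \<Rightarrow> form" where
  "is_derivative T S xi =
    (upper_derivative T S xi
     \<^bold>\<and> (\<^bold>\<forall>\<^sub>PS'. \<^bold>\<forall>\<^sub>Fxi'. upper_derivative T S' xi' \<^bold>\<longrightarrow>
          (\<^bold>\<exists>\<^sub>FN. upper_morphism T S xi S' xi' N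
            \<^bold>\<and> (\<^bold>\<forall>\<^sub>FN'. upper_morphism T S xi S' xi' N' \<^bold>\<longrightarrow>
                  (\<^bold>\<forall>n x y. N' n x y \<^bold>\<longleftrightarrow> N n x y)))))"

section \<open>The construction of \<open>(\<partial>T, \<xi>\<^sup>T)\<close>\<close>

definition mu_tm :: "term \<Rightarrow> term" where "mu_tm m = \<^bold>\<langle>\<^bold>0, m\<^bold>\<rangle>"
definition xi_tm :: "term \<Rightarrow> term \<Rightarrow> term" where "xi_tm a s = \<^bold>\<langle>\<^bold>1, \<^bold>\<langle>a, s\<^bold>\<rangle>\<^bold>\<rangle>"

text \<open>\<open>\<langle>a, s\<rangle> = \<langle>{\<mu>\<^sub>m}, \<mu>\<^sup>T\<^sub>1(0)\<rangle>\<close>\<close>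

definition is_mu_pair :: "praedil \<Rightarrow> term \<Rightarrow> term \<Rightarrow> term \<Rightarrow> form" where
  "is_mu_pair T m a s = (is_fset a (\<lambda>z. z \<^bold>= mu_tm m) \<^bold>\<and> Mu T \<^bold>1 \<^bold>0 s)"

text \<open>
  \<open>is_partial T P\<close> lists the recursive clauses for \<open>P = \<partial>T\<close>. They determine \<open>P\<close>: the elements of
  \<open>a\<close> have smaller codes than \<open>xi_tm a s\<close>, so that \<open>is_partial_fld\<close>, \<open>is_partial_act\<close> and
  \<open>is_partial_supp\<close> are course-of-values recursions; in \<open>is_partial_less\<close> the value at \<open>(s, t)\<close> depends
  only on values at pairs for which \<open>L\<^sub>n(s) + L\<^sub>n(t)\<close> is smaller. In \<open>is_partial_fld\<close>, the condition
  \<open>D_fld\<close> says that \<open>a\<close> is a finite set of terms, that \<open>s\<close> lies in \<open>T\<^bsub>|a|\<^esub>\<close> and that \<open>supp(s) = |a|\<close>;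
  its definition refers only to \<open>Fld (Obj P n)\<close>, not to the order.
\<close>

definition is_partial_fld :: "praedil \<Rightarrow> praedil \<Rightarrow> form" where
  "is_partial_fld T P =
    (\<^bold>\<forall>n t. Fld (Obj P n) t \<^bold>\<longleftrightarrow>
      (\<^bold>\<exists>m. m \<^bold>< n \<^bold>\<and> t \<^bold>= mu_tm m)
      \<^bold>\<or> (\<^bold>\<exists>a s. t \<^bold>= xi_tm a s \<^bold>\<and> D_fld T (Obj P n) \<^bold>\<langle>a, s\<^bold>\<rangle>
            \<^bold>\<and> \<^bold>\<not> (\<^bold>\<exists>m. m \<^bold>< n \<^bold>\<and> is_mu_pair T m a s)))"

definition is_partial_less :: "praedil \<Rightarrow> praedil \<Rightarrow> form" where
  "is_partial_less T P =
    (\<^bold>\<forall>n s t. Lt (Obj P n) s t \<^bold>\<longleftrightarrow>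
      Fld (Obj P n) s \<^bold>\<and> Fld (Obj P n) t \<^bold>\<and>
      ((\<^bold>\<exists>m k. s \<^bold>= mu_tm m \<^bold>\<and> t \<^bold>= mu_tm k \<^bold>\<and> m \<^bold>< k)
       \<^bold>\<or> (\<^bold>\<exists>m b v. s \<^bold>= mu_tm m \<^bold>\<and> t \<^bold>= xi_tm b v
             \<^bold>\<and> (\<^bold>\<exists>r. r \<^bold>\<epsilon> b \<^bold>\<and> (Lt (Obj P n) s r \<^bold>\<or> s \<^bold>= r)))
       \<^bold>\<or> (\<^bold>\<exists>a u k. s \<^bold>= xi_tm a u \<^bold>\<and> t \<^bold>= mu_tm k
             \<^bold>\<and> (\<^bold>\<forall>r. r \<^bold>\<epsilon> a \<^bold>\<longrightarrow> Lt (Obj P n) r t))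
       \<^bold>\<or> (\<^bold>\<exists>a u b v c. s \<^bold>= xi_tm a u \<^bold>\<and> t \<^bold>= xi_tm b v
             \<^bold>\<and> is_fset c (\<lambda>x. x \<^bold>\<epsilon> a \<^bold>\<or> x \<^bold>\<epsilon> b) \<^bold>\<and> linear (restrict (Obj P n) c)
             \<^bold>\<and> D_less T (Obj P n) a u b v)))"

definition is_partial_act :: "praedil \<Rightarrow> praedil \<Rightarrow> form" where
  "is_partial_act T P =
    (\<^bold>\<forall>f n l. is_mor f n l \<^bold>\<longrightarrow> (\<^bold>\<forall>s t. Act P f s t \<^bold>\<longleftrightarrow>
      Fld (Obj P n) s \<^bold>\<and>
      ((\<^bold>\<exists>m k. s \<^bold>= mu_tm m \<^bold>\<and> app f m k \<^bold>\<and> t \<^bold>= mu_tm k)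
       \<^bold>\<or> (\<^bold>\<exists>a u b. s \<^bold>= xi_tm a u \<^bold>\<and> is_fset b (\<lambda>y. \<^bold>\<exists>x. x \<^bold>\<epsilon> a \<^bold>\<and> Act P f x y) \<^bold>\<and> t \<^bold>= xi_tm b u))))"

definition is_partial_supp :: "praedil \<Rightarrow> praedil \<Rightarrow> form" where
  "is_partial_supp T P =
    (\<^bold>\<forall>n t c. Supp P n t c \<^bold>\<longleftrightarrow>
      Fld (Obj P n) t \<^bold>\<and>
      ((\<^bold>\<exists>m. t \<^bold>= mu_tm m \<^bold>\<and> is_fset c (\<lambda>i. i \<^bold>= m))
       \<^bold>\<or> (\<^bold>\<exists>a s. t \<^bold>= xi_tm a s \<^bold>\<and> is_fset c (\<lambda>i. \<^bold>\<exists>r d. r \<^bold>\<epsilon> a \<^bold>\<and> Supp P n r d \<^bold>\<and> i \<^bold>\<epsilon> d))))"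

definition is_partial_mu :: "praedil \<Rightarrow> praedil \<Rightarrow> form" where
  "is_partial_mu T P = (\<^bold>\<forall>n m t. Mu P n m t \<^bold>\<longleftrightarrow> m \<^bold>< n \<^bold>\<and> t \<^bold>= mu_tm m)"

definition is_partial :: "praedil \<Rightarrow> praedil \<Rightarrow> form" where
  "is_partial T P =
    (is_partial_fld T P \<^bold>\<and> is_partial_less T P \<^bold>\<and> is_partial_act T P
     \<^bold>\<and> is_partial_supp T P \<^bold>\<and> is_partial_mu T P)"

definition is_xi ::
  "praedil \<Rightarrow> praedil \<Rightarrow> (term \<Rightarrow> term \<Rightarrow> term \<Rightarrow> form) \<Rightarrow> form" where
  "is_xi T P xi =
    (\<^bold>\<forall>n p t. xi n p t \<^bold>\<longleftrightarrow>
      D_fld T (Obj P n) p \<^bold>\<and>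
      (\<^bold>\<exists>a s. p \<^bold>= \<^bold>\<langle>a, s\<^bold>\<rangle> \<^bold>\<and>
        ((\<^bold>\<exists>m. m \<^bold>< n \<^bold>\<and> is_mu_pair T m a s \<^bold>\<and> t \<^bold>= mu_tm m)
         \<^bold>\<or> (\<^bold>\<not> (\<^bold>\<exists>m. m \<^bold>< n \<^bold>\<and> is_mu_pair T m a s) \<^bold>\<and> t \<^bold>= xi_tm a s))))"

end

theory Submission
  imports Defs "HOL-Library.Countable"
begin

text \<open>
  By Henkin's completeness theorem it suffices to verify the statement in the term model of a
  complete theory that extends RCA0. In this model one can reason semantically about its numbers
  and sets, provided that comprehension is restricted to \<open>\<Delta>\<^sub>1\<close> predicates and induction to \<open>\<Sigma>\<^sub>1\<close>
  and \<open>\<Pi>\<^sub>1\<close> predicates. The term systems are then obtained by course-of-values recursion on codes.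

  Everything about \<open>D\<^sup>T(X)\<close> that is needed comes from normality: the element \<open>\<langle>{x}, \<mu>\<^sub>1(0)\<rangle>\<close> lies above
  \<open>\<langle>a, \<sigma>\<rangle>\<close> exactly if \<open>x\<close> lies above all elements of \<open>a\<close>. With this, transitivity and totality of
  \<open>\<partial>T\<^sub>n\<close> follow by simultaneous induction on the sum of the codes involved, and every map that is
  given on terms by an increasing map on the \<open>\<mu>\<^sub>m\<close> and an embedding in the case of \<open>\<xi>\<langle>a, \<sigma>\<rangle>\<close> is
  itself an embedding. This applies to \<open>\<partial>T\<^sub>f\<close> and to the map \<open>\<nu>(\<xi>\<langle>a, \<sigma>\<rangle>) = \<xi>'\<langle>\<nu>[a], \<sigma>\<rangle>\<close> into an upper
  derivative, which is the only one possible because a morphism is determined by these equations.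
\<close>

section \<open>Substitution\<close>

definition up :: "(nat \<Rightarrow> tm) \<Rightarrow> nat \<Rightarrow> tm" where
  "up s = case_nat (Var 0) (\<lambda>i. lift_tm (s i))"

definition up_set :: "(nat \<Rightarrow> nat) \<Rightarrow> nat \<Rightarrow> nat" where
  "up_set r = case_nat 0 (\<lambda>i. Suc (r i))"

lemma up_simps [simp]: "up s 0 = Var 0" "up s (Suc i) = lift_tm (s i)"
  by (simp_all add: up_def)

lemma up_set_simps [simp]: "up_set r 0 = 0" "up_set r (Suc i) = Suc (r i)"
  by (simp_all add: up_set_def)

lemma subst_quantifiers:
  "subst s r (AllN A) = AllN (subst (up s) r A)"
  "subst s r (AllS A) = AllS (subst s (up_set r) A)"
  by (simp_all add: up_def up_set_def)

declare subst.simps(6,7) [simp del]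
declare subst_quantifiers [simp]

lemma subst_tm_subst_tm: "subst_tm s (subst_tm s' t) = subst_tm (\<lambda>i. subst_tm s (s' i)) t"
  by (induction t) simp_all

lemma subst_tm_Var [simp]: "subst_tm Var t = t"
  by (induction t) simp_all

lemma lift_tm_Var [simp]: "lift_tm (Var i) = Var (Suc i)"
  by (simp add: lift_tm_def)

lemma subst_tm_up_lift [simp]: "subst_tm (up s) (lift_tm t) = lift_tm (subst_tm s t)"
  by (simp add: lift_tm_def subst_tm_subst_tm)

lemma up_comp: "(\<lambda>i. subst_tm (up s) (up s' i)) = up (\<lambda>i. subst_tm s (s' i))"
proof
  fix i show "subst_tm (up s) (up s' i) = up (\<lambda>i. subst_tm s (s' i)) i" by (cases i) simp_all
qed

lemma up_set_comp: "(\<lambda>i. up_set r (up_set r' i)) = up_set (\<lambda>i. r (r' i))"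
proof
  fix i show "up_set r (up_set r' i) = up_set (\<lambda>i. r (r' i)) i" by (cases i) simp_all
qed

lemma subst_subst:
  "subst s r (subst s' r' A) = subst (\<lambda>i. subst_tm s (s' i)) (\<lambda>j. r (r' j)) A"
  by (induction A arbitrary: s r s' r') (simp_all add: subst_tm_subst_tm up_comp up_set_comp)

lemma up_Var [simp]: "up Var = Var"
proof
  fix i show "up Var i = Var i" by (cases i) simp_all
qed

lemma up_set_id [simp]: "up_set (\<lambda>i. i) = (\<lambda>i. i)"
proof
  fix i show "up_set (\<lambda>i. i) i = i" by (cases i) simp_all
qed

lemma subst_id [simp]: "subst Var (\<lambda>i. i) A = A"
  by (induction A) simp_all

definition fresh_from_tm :: "nat \<Rightarrow> tm \<Rightarrow> bool" where
  "fresh_from_tm n t \<longleftrightarrow> (\<forall>s s'. (\<forall>i<n. s i = s' i) \<longrightarrow> subst_tm s t = subst_tm s' t)"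

lemma fresh_from_tm_mono: "fresh_from_tm n t \<Longrightarrow> n \<le> m \<Longrightarrow> fresh_from_tm m t"
  by (simp add: fresh_from_tm_def)

lemma fresh_from_tmD: "fresh_from_tm n t \<Longrightarrow> (\<And>i. i < n \<Longrightarrow> s i = s' i) \<Longrightarrow> subst_tm s t = subst_tm s' t"
  by (simp add: fresh_from_tm_def)

lemma fresh_from_tm_ex2: "\<exists>n. fresh_from_tm n t \<and> fresh_from_tm n u"
  if "\<exists>n. fresh_from_tm n t" "\<exists>n. fresh_from_tm n u"
proof -
  from that obtain n m where "fresh_from_tm n t" "fresh_from_tm m u" by auto
  then have "fresh_from_tm (max n m) t \<and> fresh_from_tm (max n m) u"
    by (metis fresh_from_tm_mono max.cobounded1 max.cobounded2)
  then show ?thesis ..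
qed

lemma fresh_from_tm_ex: "\<exists>n. fresh_from_tm n t"
proof (induction t)
  case (Var i)
  show ?case by (intro exI[of _ "Suc i"]) (simp add: fresh_from_tm_def)
next
  case (Add t u)
  from fresh_from_tm_ex2[OF this] obtain n where n: "fresh_from_tm n t" "fresh_from_tm n u" by blast
  show ?case
    by (rule exI[of _ n], simp only: fresh_from_tm_def subst_tm.simps tm.inject)
      (use n in \<open>auto intro: fresh_from_tmD\<close>)
next
  case (Mul t u)
  from fresh_from_tm_ex2[OF this] obtain n where n: "fresh_from_tm n t" "fresh_from_tm n u" by blast
  show ?case
    by (rule exI[of _ n], simp only: fresh_from_tm_def subst_tm.simps tm.inject)
      (use n in \<open>auto intro: fresh_from_tmD\<close>)
qed (simp_all add: fresh_from_tm_def)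

definition fresh_from :: "nat \<Rightarrow> fm \<Rightarrow> bool" where
  "fresh_from n A \<longleftrightarrow> (\<forall>s s' r r'. (\<forall>i<n. s i = s' i \<and> r i = r' i) \<longrightarrow> subst s r A = subst s' r' A)"

lemma fresh_from_mono: "fresh_from n A \<Longrightarrow> n \<le> m \<Longrightarrow> fresh_from m A"
  by (simp add: fresh_from_def)

lemma fresh_fromD:
  "fresh_from n A \<Longrightarrow> (\<And>i. i < n \<Longrightarrow> s i = s' i) \<Longrightarrow> (\<And>i. i < n \<Longrightarrow> r i = r' i) \<Longrightarrow>
    subst s r A = subst s' r' A"
  by (simp add: fresh_from_def)

lemma fresh_from_ex: "\<exists>n. fresh_from n A"
proof (induction A)
  case (Eq t u)
  from fresh_from_tm_ex2[OF fresh_from_tm_ex fresh_from_tm_ex] obtain n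
    where n: "fresh_from_tm n t" "fresh_from_tm n u" by blast
  show ?case
    by (rule exI[of _ n], simp only: fresh_from_def subst.simps fm.inject)
      (use n in \<open>auto intro: fresh_from_tmD\<close>)
next
  case (Less t u)
  from fresh_from_tm_ex2[OF fresh_from_tm_ex fresh_from_tm_ex] obtain n
    where n: "fresh_from_tm n t" "fresh_from_tm n u" by blast
  show ?case
    by (rule exI[of _ n], simp only: fresh_from_def subst.simps fm.inject)
      (use n in \<open>auto intro: fresh_from_tmD\<close>)
next
  case (Mem t j)
  obtain n where "fresh_from_tm n t" using fresh_from_tm_ex by blast
  then have "fresh_from_tm (max n (Suc j)) t" by (rule fresh_from_tm_mono) simp
  then have "fresh_from (max n (Suc j)) (Mem t j)"
    by (simp only: fresh_from_def subst.simps fm.inject) (auto intro: fresh_from_tmD)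
  then show ?case ..
next
  case Fls
  show ?case by (simp add: fresh_from_def)
next
  case (Imp A B)
  then obtain n m where "fresh_from n A" "fresh_from m B" by blast
  then have "fresh_from (max n m) A" "fresh_from (max n m) B"
    by (metis fresh_from_mono max.cobounded1 max.cobounded2)+
  then have "fresh_from (max n m) (Imp A B)"
    by (simp only: fresh_from_def[of _ "Imp A B"] subst.simps fm.inject) (auto intro: fresh_fromD)
  then show ?case ..
next
  case (AllN A)
  then obtain n where n: "fresh_from n A" by blast
  have "subst s r (AllN A) = subst s' r' (AllN A)"
    if "\<forall>i<n. s i = s' i \<and> r i = r' i" for s s' r r'
    using that by (auto intro!: fresh_fromD[OF n] simp: up_def split: nat.split)
  then show ?case unfolding fresh_from_def by blast
next
  case (AllS A)
  then obtain n where n: "fresh_from n A" by blast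
  have "subst s r (AllS A) = subst s' r' (AllS A)"
    if "\<forall>i<n. s i = s' i \<and> r i = r' i" for s s' r r'
    using that by (auto intro!: fresh_fromD[OF n] simp: up_set_def split: nat.split)
  then show ?case unfolding fresh_from_def by blast
qed

lemma fresh_from_list_ex: "\<exists>n. \<forall>A\<in>set L. fresh_from n A"
proof (induction L)
  case (Cons A L)
  then obtain n where "\<forall>A\<in>set L. fresh_from n A" by blast
  moreover obtain m where "fresh_from m A" using fresh_from_ex by blast
  ultimately have "\<forall>B\<in>set (A # L). fresh_from (max n m) B"
    by (metis fresh_from_mono max.cobounded1 max.cobounded2 set_ConsD)
  then show ?case by blast
qed simp

section \<open>Derivations\<close>

lemma derivable_weaken: "derivable Ax \<Gamma> A \<Longrightarrow> set \<Gamma> \<subseteq> set \<Delta> \<Longrightarrow> derivable Ax \<Delta> A"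
proof (induction arbitrary: \<Delta> rule: derivable.induct)
  case (ImpI A \<Gamma> B)
  then have "derivable Ax (A # \<Delta>) B" by (intro ImpI.IH) auto
  then show ?case by (rule derivable.ImpI)
next
  case (Classical A \<Gamma>)
  then have "derivable Ax (Neg A # \<Delta>) Fls" by (intro Classical.IH) auto
  then show ?case by (rule derivable.Classical)
next
  case (AllNI \<Gamma> A)
  then have "derivable Ax (map lift \<Delta>) A" by (intro AllNI.IH) auto
  then show ?case by (rule derivable.AllNI)
next
  case (AllSI \<Gamma> A)
  then have "derivable Ax (map lift_set \<Delta>) A" by (intro AllSI.IH) auto
  then show ?case by (rule derivable.AllSI)
next
  case (ImpE \<Gamma> A B)
  then show ?case by (blast intro: derivable.ImpE)
next
  case (EqSubst \<Gamma> t u A)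
  then show ?case by (blast intro: derivable.EqSubst)
qed (auto intro: derivable.intros)

lemma subst_inst: "subst s r (inst t A) = inst (subst_tm s t) (subst (up s) r A)"
  by (simp add: inst_def subst_subst) (rule arg_cong2[where f="\<lambda>f g. subst f g A"];
    auto simp: fun_eq_iff lift_tm_def subst_tm_subst_tm split: nat.split)

lemma subst_inst_set: "subst s r (inst_set j A) = inst_set (r j) (subst s (up_set r) A)"
  by (simp add: inst_set_def subst_subst) (rule arg_cong2[where f="\<lambda>f g. subst f g A"];
    auto simp: fun_eq_iff split: nat.split)

lemma subst_lift: "subst (up s) r (lift A) = lift (subst s r A)"
  by (simp add: lift_def subst_subst flip: lift_tm_def)

lemma subst_lift_set: "subst s (up_set r) (lift_set A) = lift_set (subst s r A)"
  by (simp add: lift_set_def subst_subst)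

text \<open>
  Axioms need not be closed under substitution: all free variables of the axiom are generalized
  and then instantiated one by one.
\<close>

lemma derivable_instances:
  assumes "A \<in> Ax" shows "derivable Ax \<Gamma> (subst s r A)"
proof -
  obtain n where n: "fresh_from n A" using fresh_from_ex by blast
  let ?valid = "\<lambda>A. \<forall>\<Gamma>. derivable Ax \<Gamma> A"
  define ups where "ups k = (up ^^ k)" for k
  define upss where "upss k = (up_set ^^ k)" for k
  have gen: "?valid ((AllN ^^ k) B)" if "?valid B" for B k
    using that by (induction k) (auto intro: derivable.intros)
  have gens: "?valid ((AllS ^^ k) B)" if "?valid B" for B k
    using that by (induction k) (auto intro: derivable.intros)
  have ups_Suc: "ups (Suc k) s = up (ups k s)" "upss (Suc k) r = up_set (upss k r)" for k s r
    by (simp_all add: ups_def upss_def)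
  have subst_All: "subst s r ((AllN ^^ k) B) = (AllN ^^ k) (subst (ups k s) r B)" for s r B k
    by (induction k arbitrary: B)
      (simp add: ups_def, simp add: funpow_Suc_right ups_Suc del: funpow.simps)
  have subst_Alls: "subst s r ((AllS ^^ k) B) = (AllS ^^ k) (subst s (upss k r) B)" for s r B k
    by (induction k arbitrary: B)
      (simp add: upss_def, simp add: funpow_Suc_right ups_Suc del: funpow.simps)
  have ups: "ups k s i = (if i < k then Var i else (lift_tm ^^ k) (s (i - k)))" for k s i
    unfolding ups_def
  proof (induction k arbitrary: i)
    case (Suc k)
    then show ?case by (cases i) auto
  qed simp
  have upss: "upss k r i = (if i < k then i else k + (r (i - k)))" for k r i
    unfolding upss_def
  proof (induction k arbitrary: i)
    case (Suc k)
    then show ?case by (cases i) auto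
  qed simp
  have ups_lift: "subst_tm (ups k s') ((lift_tm ^^ Suc k) t) = (lift_tm ^^ k) (subst_tm s' (lift_tm t))"
    for k s' t
    by (induction k) (simp_all add: ups_def)
  define \<theta> where "\<theta> k i = (if i < k then Var i else (lift_tm ^^ k) (s i))" for k i
  have N: "?valid ((AllN ^^ k) (subst (\<theta> k) (\<lambda>i. i) A))" if "k \<le> n" for k
    using that
  proof (induction k rule: inc_induct)
    case base
    have "subst (\<theta> n) (\<lambda>i. i) A = subst Var (\<lambda>i. i) A"
      by (rule fresh_fromD[OF n]) (simp_all add: \<theta>_def)
    then show ?case using assms by (intro gen) (simp add: derivable.Axiom)
  next
    case (step k)
    let ?s = "case_nat (s k) Var"
    have eq: "(\<lambda>i. subst_tm (ups k ?s) (\<theta> (Suc k) i)) = \<theta> k"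
    proof
      fix i
      have "subst_tm ?s (lift_tm t) = t" for t
        by (simp add: lift_tm_def subst_tm_subst_tm)
      then show "subst_tm (ups k ?s) (\<theta> (Suc k) i) = \<theta> k i"
        using ups_lift[of k ?s]
        by (auto simp: \<theta>_def ups less_Suc_eq simp del: funpow.simps)
    qed
    have "?valid (inst (s k) ((AllN ^^ k) (subst (\<theta> (Suc k)) (\<lambda>i. i) A)))"
      using step.IH by (auto intro: derivable.AllNE)
    then show ?case by (simp add: inst_def subst_All subst_subst eq)
  qed
  let ?B = "subst s (\<lambda>i. i) A"
  obtain m where m: "fresh_from m ?B" using fresh_from_ex by blast
  define \<eta> where "\<eta> k i = (if i < k then i else k + r i)" for k i :: nat
  have S: "?valid ((AllS ^^ k) (subst Var (\<eta> k) ?B))" if "k \<le> m" for k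
    using that
  proof (induction k rule: inc_induct)
    case base
    have "subst Var (\<eta> m) ?B = subst Var (\<lambda>i. i) ?B"
      by (rule fresh_fromD[OF m]) (simp_all add: \<eta>_def)
    moreover have "\<theta> 0 = s" by (simp add: \<theta>_def fun_eq_iff)
    ultimately show ?case using N[of 0] by (intro gens) simp
  next
    case (step k)
    let ?r = "case_nat (r k) (\<lambda>i. i)"
    have eq: "(\<lambda>i. upss k ?r (\<eta> (Suc k) i)) = \<eta> k"
      by (auto simp: \<eta>_def upss fun_eq_iff less_Suc_eq)
    have "?valid (inst_set (r k) ((AllS ^^ k) (subst Var (\<eta> (Suc k)) ?B)))"
      using step.IH by (auto intro: derivable.AllSE)
    then show ?case by (simp add: inst_set_def subst_Alls subst_subst eq)
  qed
  have "\<eta> 0 = r" by (simp add: \<eta>_def fun_eq_iff)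
  then show ?thesis using S[of 0] by (simp add: subst_subst)
qed

lemma derivable_subst:
  "derivable Ax \<Gamma> A \<Longrightarrow> derivable Ax (map (subst s r) \<Gamma>) (subst s r A)"
proof (induction arbitrary: s r rule: derivable.induct)
  case (Axiom A \<Gamma>)
  then show ?case by (rule derivable_instances)
next
  case (Hyp A \<Gamma>)
  then show ?case by (intro derivable.Hyp) auto
next
  case (ImpE \<Gamma> A B)
  then show ?case using derivable.ImpE by fastforce
next
  case (AllNI \<Gamma> A)
  from AllNI.IH[of "up s" r] show ?case
    by (auto intro!: derivable.AllNI simp: subst_lift o_def)
next
  case (AllNE \<Gamma> A t)
  then show ?case by (auto simp: subst_inst intro: derivable.AllNE)
next
  case (AllSI \<Gamma> A)
  from AllSI.IH[of s "up_set r"] show ?case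
    by (auto intro!: derivable.AllSI simp: subst_lift_set o_def)
next
  case (AllSE \<Gamma> A j)
  then show ?case by (auto simp: subst_inst_set intro: derivable.AllSE)
next
  case (EqSubst \<Gamma> t u A)
  from derivable.EqSubst[OF EqSubst.IH(1)[unfolded subst.simps], of s r "subst (up s) r A"]
  show ?case using EqSubst.IH(2) by (simp add: subst_inst)
qed (auto intro: derivable.intros simp: Neg_def)

lemma derivable_AllN_fresh:
  assumes d: "derivable Ax L (inst (Var y) A)" and L: "\<forall>B\<in>set L. fresh_from y B"
    and A: "fresh_from (Suc y) A"
  shows "derivable Ax L (AllN A)"
proof -
  let ?s = "\<lambda>i. if i = y then Var 0 else Var (Suc i)"
  have "subst ?s (\<lambda>i. i) B = lift B" if "B \<in> set L" for B
    unfolding lift_def using that L by (intro fresh_fromD[of y]) auto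
  then have "map (subst ?s (\<lambda>i. i)) L = map lift L" by simp
  moreover have "subst ?s (\<lambda>i. i) (inst (Var y) A) = subst Var (\<lambda>i. i) A"
    unfolding inst_def subst_subst by (rule fresh_fromD[OF A]) (auto split: nat.split)
  ultimately have "derivable Ax (map lift L) A"
    using derivable_subst[OF d, of ?s "\<lambda>i. i"] by (simp cong: map_cong)
  then show ?thesis by (rule derivable.AllNI)
qed

lemma derivable_AllS_fresh:
  assumes d: "derivable Ax L (inst_set y A)" and L: "\<forall>B\<in>set L. fresh_from y B"
    and A: "fresh_from (Suc y) A"
  shows "derivable Ax L (AllS A)"
proof -
  let ?r = "\<lambda>i. if i = y then 0 else Suc i"
  have "subst Var ?r B = lift_set B" if "B \<in> set L" for B
    unfolding lift_set_def using that L by (intro fresh_fromD[of y]) auto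
  then have "map (subst Var ?r) L = map lift_set L" by simp
  moreover have "subst Var ?r (inst_set y A) = subst Var (\<lambda>i. i) A"
    unfolding inst_set_def subst_subst by (rule fresh_fromD[OF A]) (auto split: nat.split)
  ultimately have "derivable Ax (map lift_set L) A"
    using derivable_subst[OF d, of Var ?r] by (simp cong: map_cong)
  then show ?thesis by (rule derivable.AllSI)
qed

section \<open>Semantics\<close>

primrec eval :: "(nat \<Rightarrow> 'a::{zero,one,plus,times}) \<Rightarrow> tm \<Rightarrow> 'a" where
  "eval \<eta> (Var i) = \<eta> i"
| "eval \<eta> Zero = 0"
| "eval \<eta> One = 1"
| "eval \<eta> (Add t u) = eval \<eta> t + eval \<eta> u"
| "eval \<eta> (Mul t u) = eval \<eta> t * eval \<eta> u"

primrec sat :: "'a set set \<Rightarrow> (nat \<Rightarrow> 'a::{zero,one,plus,times,ord}) \<Rightarrow> (nat \<Rightarrow> 'a set) \<Rightarrow> fm \<Rightarrow> bool"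
where
  "sat S \<eta> \<sigma> (Eq t u) \<longleftrightarrow> eval \<eta> t = eval \<eta> u"
| "sat S \<eta> \<sigma> (Less t u) \<longleftrightarrow> eval \<eta> t < eval \<eta> u"
| "sat S \<eta> \<sigma> (Mem t i) \<longleftrightarrow> eval \<eta> t \<in> \<sigma> i"
| "sat S \<eta> \<sigma> Fls \<longleftrightarrow> False"
| "sat S \<eta> \<sigma> (Imp A B) \<longleftrightarrow> (sat S \<eta> \<sigma> A \<longrightarrow> sat S \<eta> \<sigma> B)"
| "sat S \<eta> \<sigma> (AllN A) \<longleftrightarrow> (\<forall>v. sat S (case_nat v \<eta>) \<sigma> A)"
| "sat S \<eta> \<sigma> (AllS A) \<longleftrightarrow> (\<forall>X\<in>S. sat S \<eta> (case_nat X \<sigma>) A)"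

lemma sat_connectives [simp]:
  "sat S \<eta> \<sigma> (Neg A) \<longleftrightarrow> \<not> sat S \<eta> \<sigma> A"
  "sat S \<eta> \<sigma> (Conj A B) \<longleftrightarrow> sat S \<eta> \<sigma> A \<and> sat S \<eta> \<sigma> B"
  "sat S \<eta> \<sigma> (Disj A B) \<longleftrightarrow> sat S \<eta> \<sigma> A \<or> sat S \<eta> \<sigma> B"
  "sat S \<eta> \<sigma> (Iff A B) \<longleftrightarrow> (sat S \<eta> \<sigma> A \<longleftrightarrow> sat S \<eta> \<sigma> B)"
  "sat S \<eta> \<sigma> (ExN A) \<longleftrightarrow> (\<exists>v. sat S (case_nat v \<eta>) \<sigma> A)"
  "sat S \<eta> \<sigma> (ExS A) \<longleftrightarrow> (\<exists>X\<in>S. sat S \<eta> (case_nat X \<sigma>) A)"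
  by (auto simp: Neg_def Conj_def Disj_def Iff_def ExN_def ExS_def)

lemma eval_subst_tm [simp]: "eval \<eta> (subst_tm s t) = eval (\<lambda>i. eval \<eta> (s i)) t"
  by (induction t) simp_all

lemma eval_lift_tm [simp]: "eval (case_nat v \<eta>) (lift_tm t) = eval \<eta> t"
  by (simp add: lift_tm_def)

lemma sat_subst [simp]:
  "sat S \<eta> \<sigma> (subst s r A) \<longleftrightarrow> sat S (\<lambda>i. eval \<eta> (s i)) (\<lambda>i. \<sigma> (r i)) A"
proof (induction A arbitrary: \<eta> \<sigma> s r)
  case (AllN A)
  have "(\<lambda>i. eval (case_nat v \<eta>) (up s i)) = case_nat v (\<lambda>i. eval \<eta> (s i))" for v
    by (auto simp: fun_eq_iff split: nat.split)
  then show ?case using AllN by simp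
next
  case (AllS A)
  have "(\<lambda>i. case_nat X \<sigma> (up_set r i)) = case_nat X (\<lambda>i. \<sigma> (r i))" for X
    by (auto simp: fun_eq_iff split: nat.split)
  then show ?case using AllS by simp
qed simp_all

lemma eval_case_nat: "(\<lambda>i. eval \<eta> (case_nat t s i)) = case_nat (eval \<eta> t) (\<lambda>i. eval \<eta> (s i))"
  by (auto simp: fun_eq_iff split: nat.split)

lemma sat_inst [simp]: "sat S \<eta> \<sigma> (inst t A) \<longleftrightarrow> sat S (case_nat (eval \<eta> t) \<eta>) \<sigma> A"
  by (simp add: inst_def eval_case_nat)

lemma sat_inst_set [simp]: "sat S \<eta> \<sigma> (inst_set j A) \<longleftrightarrow> sat S \<eta> (case_nat (\<sigma> j) \<sigma>) A"
proof -
  have "(\<lambda>i. \<sigma> (case_nat j (\<lambda>i. i) i)) = case_nat (\<sigma> j) \<sigma>"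
    by (auto simp: fun_eq_iff split: nat.split)
  then show ?thesis by (simp add: inst_set_def)
qed

lemma sat_lift [simp]: "sat S (case_nat v \<eta>) \<sigma> (lift A) \<longleftrightarrow> sat S \<eta> \<sigma> A"
  by (simp add: lift_def)

lemma sat_lift_set [simp]: "sat S \<eta> (case_nat X \<sigma>) (lift_set A) \<longleftrightarrow> sat S \<eta> \<sigma> A"
  by (simp add: lift_set_def)

lemma soundness:
  assumes "derivable Ax \<Gamma> A"
    and Ax: "\<And>A \<eta> \<sigma>. A \<in> Ax \<Longrightarrow> range \<sigma> \<subseteq> S \<Longrightarrow> sat S \<eta> \<sigma> A"
    and "range \<sigma> \<subseteq> S" "\<forall>B\<in>set \<Gamma>. sat S \<eta> \<sigma> B"
  shows "sat S \<eta> \<sigma> A"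
  using assms(1,3,4)
proof (induction arbitrary: \<eta> \<sigma> rule: derivable.induct)
  case (AllSI \<Gamma> A)
  have "sat S \<eta> (case_nat X \<sigma>) A" if "X \<in> S" for X
    using that AllSI.prems by (intro AllSI.IH) (force split: nat.splits)+
  then show ?case by simp
next
  case (AllSE \<Gamma> A j)
  have "\<sigma> j \<in> S" using AllSE.prems by blast
  then show ?case using AllSE by simp
qed (auto intro: Ax)

section \<open>Completeness\<close>

instance tm :: countable by countable_datatype
instance fm :: countable by countable_datatype

definition henkin :: "fm set \<Rightarrow> fm set \<Rightarrow> bool" where
  "henkin Ax G \<longleftrightarrow>
    (\<forall>L A. set L \<subseteq> G \<and> derivable Ax L A \<longrightarrow> A \<in> G)
    \<and> (\<forall>A. Neg A \<in> G \<longleftrightarrow> A \<notin> G)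
    \<and> (\<forall>A. Neg (AllN A) \<in> G \<longrightarrow> (\<exists>t. Neg (inst t A) \<in> G))
    \<and> (\<forall>A. Neg (AllS A) \<in> G \<longrightarrow> (\<exists>j. Neg (inst_set j A) \<in> G))"

definition refutable :: "fm set \<Rightarrow> fm list \<Rightarrow> bool" where
  "refutable Ax L \<longleftrightarrow> derivable Ax L Fls"

lemma refutable_Neg: "refutable Ax (Neg A # L) \<longleftrightarrow> derivable Ax L A"
proof
  assume "derivable Ax L A"
  then have "derivable Ax (Neg A # L) A" by (rule derivable_weaken) auto
  moreover have "derivable Ax (Neg A # L) (Imp A Fls)"
    by (rule derivable.Hyp) (simp add: Neg_def)
  ultimately show "refutable Ax (Neg A # L)" unfolding refutable_def
    by (blast intro: derivable.ImpE)
qed (simp add: refutable_def derivable.Classical)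

lemma refutable_Cons: "refutable Ax (A # L) \<longleftrightarrow> derivable Ax L (Neg A)"
proof
  assume "derivable Ax L (Neg A)"
  then have "derivable Ax (A # L) (Imp A Fls)"
    unfolding Neg_def by (rule derivable_weaken) auto
  moreover have "derivable Ax (A # L) A" by (rule derivable.Hyp) simp
  ultimately show "refutable Ax (A # L)" unfolding refutable_def
    by (blast intro: derivable.ImpE)
qed (simp add: refutable_def Neg_def derivable.ImpI)

lemma refutable_Fls: "refutable Ax L \<Longrightarrow> derivable Ax L A"
  unfolding refutable_def by (rule derivable.Classical) (rule derivable_weaken, auto)

lemma refutable_cut: "derivable Ax L A \<Longrightarrow> refutable Ax (A # L) \<Longrightarrow> refutable Ax L"
  unfolding refutable_Cons unfolding Neg_def refutable_def by (rule derivable.ImpE)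

definition henkin_step :: "fm set \<Rightarrow> fm \<Rightarrow> fm list \<Rightarrow> fm list \<Rightarrow> bool" where
  "henkin_step Ax A L M \<longleftrightarrow>
    set L \<subseteq> set M \<and> \<not> refutable Ax M \<and> (A \<in> set M \<or> Neg A \<in> set M) \<and>
    (\<forall>B. A = Neg (AllN B) \<and> A \<in> set M \<longrightarrow> (\<exists>t. Neg (inst t B) \<in> set M)) \<and>
    (\<forall>B. A = Neg (AllS B) \<and> A \<in> set M \<longrightarrow> (\<exists>j. Neg (inst_set j B) \<in> set M))"

lemma refutable_Hyp: "A \<in> set L \<Longrightarrow> refutable Ax (A # L) \<longleftrightarrow> refutable Ax L"
  unfolding refutable_def by (auto elim!: derivable_weaken)

lemma Neg_inject [simp]: "Neg A = Neg B \<longleftrightarrow> A = B"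
  by (simp add: Neg_def)

lemma henkin_step_ex:
  assumes L: "\<not> refutable Ax L" shows "\<exists>M. henkin_step Ax A L M"
proof (cases "refutable Ax (A # L)")
  case True
  then have "\<not> refutable Ax (Neg A # L)"
    using L refutable_Neg refutable_cut by blast
  moreover have "A \<notin> set L" using True L refutable_Hyp by blast
  moreover have "size (Neg A) \<noteq> size A" by (simp add: Neg_def)
  then have "A \<noteq> Neg A" by metis
  ultimately have "henkin_step Ax A L (Neg A # L)" by (auto simp: henkin_step_def)
  then show ?thesis ..
next
  case cons: False
  obtain n where n: "\<forall>B\<in>set (A # L). fresh_from n B" using fresh_from_list_ex by blast
  consider B where "A = Neg (AllN B)" | B where "A = Neg (AllS B)"
    | "\<forall>B. A \<noteq> Neg (AllN B) \<and> A \<noteq> Neg (AllS B)" by blast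
  then show ?thesis
  proof cases
    case (1 B)
    obtain m where m: "fresh_from m B" using fresh_from_ex by blast
    let ?y = "max n m"
    let ?M = "Neg (inst (Var ?y) B) # A # L"
    have "\<not> refutable Ax ?M"
    proof
      assume "refutable Ax ?M"
      then have "derivable Ax (A # L) (AllN B)" unfolding refutable_Neg
        using n fresh_from_mono[OF m, of "Suc ?y"]
        by (intro derivable_AllN_fresh[of _ _ ?y]) (auto intro: fresh_from_mono[OF _ max.cobounded1])
      moreover have "derivable Ax (A # L) (Neg (AllN B))" by (rule derivable.Hyp) (simp add: 1)
      ultimately have "refutable Ax (A # L)"
        unfolding refutable_def Neg_def by (blast intro: derivable.ImpE)
      then show False using cons by simp
    qed
    then have "henkin_step Ax A L ?M" unfolding henkin_step_def 1
      by (auto simp: Neg_def)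
    then show ?thesis ..
  next
    case (2 B)
    obtain m where m: "fresh_from m B" using fresh_from_ex by blast
    let ?y = "max n m"
    let ?M = "Neg (inst_set ?y B) # A # L"
    have "\<not> refutable Ax ?M"
    proof
      assume "refutable Ax ?M"
      then have "derivable Ax (A # L) (AllS B)" unfolding refutable_Neg
        using n fresh_from_mono[OF m, of "Suc ?y"]
        by (intro derivable_AllS_fresh[of _ _ ?y]) (auto intro: fresh_from_mono[OF _ max.cobounded1])
      moreover have "derivable Ax (A # L) (Neg (AllS B))" by (rule derivable.Hyp) (simp add: 2)
      ultimately have "refutable Ax (A # L)"
        unfolding refutable_def Neg_def by (blast intro: derivable.ImpE)
      then show False using cons by simp
    qed
    then have "henkin_step Ax A L ?M" unfolding henkin_step_def 2
      by (auto simp: Neg_def)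
    then show ?thesis ..
  next
    case 3
    then have "henkin_step Ax A L (A # L)" using cons by (auto simp: henkin_step_def)
    then show ?thesis ..
  qed
qed

lemma henkin_ex:
  assumes L: "\<not> refutable Ax L"
  shows "\<exists>G. henkin Ax G \<and> set L \<subseteq> G"
proof -
  define f where "f = rec_nat L (\<lambda>k M. SOME M'. henkin_step Ax (from_nat k) M M')"
  have f0: "f 0 = L" by (simp add: f_def)
  have cons: "\<not> refutable Ax (f k)" and step: "henkin_step Ax (from_nat k) (f k) (f (Suc k))" for k
  proof (induction k)
    case 0
    show 1: "\<not> refutable Ax (f 0)" using L by (simp add: f0)
    show "henkin_step Ax (from_nat 0) (f 0) (f (Suc 0))"
      using someI_ex[OF henkin_step_ex[OF 1]] by (simp add: f_def)
  next
    case (Suc k)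
    show 1: "\<not> refutable Ax (f (Suc k))" using Suc(2) by (simp add: henkin_step_def)
    show "henkin_step Ax (from_nat (Suc k)) (f (Suc k)) (f (Suc (Suc k)))"
      using someI_ex[OF henkin_step_ex[OF 1]] by (simp add: f_def)
  qed
  define G where "G = (\<Union>k. set (f k))"
  have mono: "set (f k) \<subseteq> set (f l)" if "k \<le> l" for k l
    using that
  proof (induction rule: dec_induct)
    case (step m)
    then show ?case using \<open>henkin_step Ax (from_nat m) (f m) (f (Suc m))\<close>
      unfolding henkin_step_def by blast
  qed simp
  have bound: "\<exists>k. set M \<subseteq> set (f k)" if "set M \<subseteq> G" for M
    using that
  proof (induction M)
    case (Cons A M)
    then obtain k l where "set M \<subseteq> set (f k)" "A \<in> set (f l)" by (auto simp: G_def)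
    then have "set (A # M) \<subseteq> set (f (max k l))" using mono[of k "max k l"] mono[of l "max k l"] by auto
    then show ?case ..
  qed simp
  have consG: "\<not> refutable Ax M" if "set M \<subseteq> G" for M
    using bound[OF that] cons derivable_weaken unfolding refutable_def by blast
  have stepG: "\<exists>k. henkin_step Ax A (f k) (f (Suc k))" for A
    using step[of "to_nat A"] by auto
  have inG: "A \<in> G" if "A \<in> set (f k)" for A k using that by (auto simp: G_def)
  have not_both: "\<not> (A \<in> G \<and> Neg A \<in> G)" for A
    using consG[of "[A, Neg A]"] derivable.Hyp[of "Neg A" "[Neg A]" Ax] unfolding refutable_Cons
    by auto
  have either: "A \<in> G \<or> Neg A \<in> G" for A
    using stepG[of A] inG unfolding henkin_step_def by blast
  have "henkin Ax G"
    unfolding henkin_def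
  proof (intro conjI allI impI)
    fix M A assume "set M \<subseteq> G \<and> derivable Ax M A"
    then show "A \<in> G" using consG[of "Neg A # M"] either[of A] by (auto simp: refutable_Neg)
  next
    fix A show "Neg A \<in> G \<longleftrightarrow> A \<notin> G" using not_both either by blast
  next
    fix A assume A: "Neg (AllN A) \<in> G"
    obtain k where k: "henkin_step Ax (Neg (AllN A)) (f k) (f (Suc k))" using stepG by blast
    then have "Neg (AllN A) \<in> set (f (Suc k))"
      using A not_both inG unfolding henkin_step_def by blast
    then show "\<exists>t. Neg (inst t A) \<in> G" using k inG unfolding henkin_step_def by blast
  next
    fix A assume A: "Neg (AllS A) \<in> G"
    obtain k where k: "henkin_step Ax (Neg (AllS A)) (f k) (f (Suc k))" using stepG by blast
    then have "Neg (AllS A) \<in> set (f (Suc k))"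
      using A not_both inG unfolding henkin_step_def by blast
    then show "\<exists>t. Neg (inst_set t A) \<in> G" using k inG unfolding henkin_step_def by blast
  qed
  moreover have "set L \<subseteq> G" using f0 inG[of _ 0] by auto
  ultimately show ?thesis by blast
qed

section \<open>A model of RCA0 as a type\<close>

lemma sat_standard_RCA0:
  fixes \<eta> :: "nat \<Rightarrow> nat"
  assumes "A \<in> RCA0" shows "sat UNIV \<eta> \<sigma> A"
proof -
  consider "A \<in> basic_axioms" | B where "A = induction_axiom B"
    | B C where "A = comprehension_axiom B C"
    using assms by (auto simp: RCA0_def)
  then show ?thesis
  proof cases
    case 1
    then show ?thesis by (auto simp: basic_axioms_def)
  next
    case (2 B)
    have "sat UNIV (case_nat n \<eta>) \<sigma> B"
      if "sat UNIV (case_nat 0 \<eta>) \<sigma> B"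
        "\<And>n. sat UNIV (case_nat n \<eta>) \<sigma> B \<Longrightarrow> sat UNIV (case_nat (Suc n) \<eta>) \<sigma> B" for n
      using that by (induction n) auto
    then show ?thesis by (auto simp: 2 induction_axiom_def eval_case_nat)
  next
    case (3 B C)
    show ?thesis
      by (auto simp: 3 comprehension_axiom_def intro!: exI[of _ "{n. sat UNIV (case_nat n \<eta>) \<sigma> B}"])
  qed
qed

lemma RCA0_consistent: "\<not> refutable RCA0 []"
proof
  assume "refutable RCA0 []"
  then have "sat UNIV (\<lambda>_. 0::nat) (\<lambda>_. {}) Fls"
    unfolding refutable_def by (rule soundness) (auto intro: sat_standard_RCA0)
  then show False by simp
qed

definition goal :: fm where
  "goal = (\<^bold>\<forall>\<^sub>PT. is_normal_praedilator T \<^bold>\<longrightarrow>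
     (\<^bold>\<exists>\<^sub>PP. \<^bold>\<exists>\<^sub>Fxi. is_partial T P \<^bold>\<and> is_xi T P xi)
     \<^bold>\<and> (\<^bold>\<forall>\<^sub>PP. \<^bold>\<forall>\<^sub>Fxi. is_partial T P \<^bold>\<and> is_xi T P xi \<^bold>\<longrightarrow> is_derivative T P xi)) 0 0"

text \<open>
  Truth of the goal in the term model of the following theory implies that the goal is derivable.
  The model is made into a type, so that type classes become available for reasoning in it.
\<close>

definition Th :: "fm set" where
  "Th = (SOME G. henkin RCA0 G \<and> (goal \<in> G \<longrightarrow> derivable RCA0 [] goal))"

lemma Th: "henkin RCA0 Th" "goal \<in> Th \<Longrightarrow> derivable RCA0 [] goal"
proof -
  have "\<exists>G. henkin RCA0 G \<and> (goal \<in> G \<longrightarrow> derivable RCA0 [] goal)"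
  proof (cases "derivable RCA0 [] goal")
    case True
    then show ?thesis using henkin_ex[OF RCA0_consistent] by blast
  next
    case False
    then have "\<not> refutable RCA0 [Neg goal]" by (simp add: refutable_Neg)
    from henkin_ex[OF this] obtain G where "henkin RCA0 G" "Neg goal \<in> G" by auto
    then show ?thesis unfolding henkin_def by blast
  qed
  from someI_ex[OF this] show "henkin RCA0 Th" "goal \<in> Th \<Longrightarrow> derivable RCA0 [] goal"
    by (auto simp: Th_def)
qed

lemma Th_derivable: "derivable RCA0 L A \<Longrightarrow> set L \<subseteq> Th \<Longrightarrow> A \<in> Th"
  using Th(1) unfolding henkin_def by blast

lemma Th_Neg: "Neg A \<in> Th \<longleftrightarrow> A \<notin> Th"
  using Th(1) unfolding henkin_def by blast

lemma Th_Fls: "Fls \<notin> Th"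
proof -
  have "Neg Fls \<in> Th"
    by (rule Th_derivable[of "[]"]) (simp_all add: Neg_def derivable.ImpI derivable.Hyp)
  then show ?thesis by (simp add: Th_Neg)
qed

lemma Th_Imp: "Imp A B \<in> Th \<longleftrightarrow> (A \<in> Th \<longrightarrow> B \<in> Th)"
proof
  assume "Imp A B \<in> Th"
  moreover have "derivable RCA0 [Imp A B, A] B"
    by (rule derivable.ImpE[of _ _ A]) (auto intro: derivable.intros)
  ultimately show "A \<in> Th \<longrightarrow> B \<in> Th" using Th_derivable[of "[Imp A B, A]" B] by auto
next
  assume AB: "A \<in> Th \<longrightarrow> B \<in> Th"
  show "Imp A B \<in> Th"
  proof (cases "A \<in> Th")
    case True
    then show ?thesis using AB
      by (intro Th_derivable[of "[B]" "Imp A B"]) (simp_all add: derivable.ImpI derivable.Hyp)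
  next
    case False
    then have "Neg A \<in> Th" by (simp add: Th_Neg)
    moreover have "refutable RCA0 [A, Neg A]"
      unfolding refutable_Cons by (rule derivable.Hyp) simp
    then have "derivable RCA0 [Neg A] (Imp A B)"
      by (intro derivable.ImpI refutable_Fls)
    ultimately show ?thesis using Th_derivable[of "[Neg A]"] by auto
  qed
qed

lemma henkin_AllN: "henkin Ax G \<Longrightarrow> Neg (AllN A) \<in> G \<longrightarrow> (\<exists>t. Neg (inst t A) \<in> G)"
  unfolding henkin_def by (drule conjunct2, drule conjunct2, drule conjunct1, erule spec)

lemma henkin_AllS: "henkin Ax G \<Longrightarrow> Neg (AllS A) \<in> G \<longrightarrow> (\<exists>j. Neg (inst_set j A) \<in> G)"
  unfolding henkin_def by (drule conjunct2, drule conjunct2, drule conjunct2, erule spec)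

lemma Th_AllN: "AllN A \<in> Th \<longleftrightarrow> (\<forall>t. inst t A \<in> Th)"
proof
  assume A: "AllN A \<in> Th"
  have "derivable RCA0 [AllN A] (inst t A)" for t
    by (rule derivable.AllNE) (simp add: derivable.Hyp)
  from Th_derivable[OF this] A show "\<forall>t. inst t A \<in> Th" by simp
next
  assume "\<forall>t. inst t A \<in> Th"
  moreover have "Neg (AllN A) \<in> Th \<longrightarrow> (\<exists>t. Neg (inst t A) \<in> Th)"
    using Th(1) by (rule henkin_AllN)
  ultimately show "AllN A \<in> Th" by (auto simp: Th_Neg)
qed

lemma Th_AllS: "AllS A \<in> Th \<longleftrightarrow> (\<forall>j. inst_set j A \<in> Th)"
proof
  assume A: "AllS A \<in> Th"
  have "derivable RCA0 [AllS A] (inst_set j A)" for j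
    by (rule derivable.AllSE) (simp add: derivable.Hyp)
  from Th_derivable[OF this] A show "\<forall>j. inst_set j A \<in> Th" by simp
next
  assume "\<forall>j. inst_set j A \<in> Th"
  moreover have "Neg (AllS A) \<in> Th \<longrightarrow> (\<exists>t. Neg (inst_set t A) \<in> Th)"
    using Th(1) by (rule henkin_AllS)
  ultimately show "AllS A \<in> Th" by (auto simp: Th_Neg)
qed

definition eqv :: "tm \<Rightarrow> tm \<Rightarrow> bool" where
  "eqv t u \<longleftrightarrow> Eq t u \<in> Th"

lemma inst_lift_tm [simp]: "subst_tm (case_nat t Var) (lift_tm u) = u"
  by (simp add: lift_tm_def subst_tm_subst_tm)

lemma Th_replace: "inst u A \<in> Th" if "eqv t u" "inst t A \<in> Th"
proof -
  have "derivable RCA0 [Eq t u, inst t A] (inst u A)"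
    by (rule derivable.EqSubst[of _ _ t]) (auto intro: derivable.Hyp)
  then show ?thesis using that by (auto simp: eqv_def intro: Th_derivable)
qed

lemma Th_refl [simp]: "Eq t t \<in> Th"
  by (rule Th_derivable[of "[]"]) (simp_all add: derivable.EqRefl)

lemma eqv_refl [simp]: "eqv t t"
  by (simp add: eqv_def)

lemma eqv_sym: "eqv t u \<Longrightarrow> eqv u t"
  using Th_replace[of t u "Eq (Var 0) (lift_tm t)"] eqv_refl[of t] by (simp add: inst_def eqv_def)

lemma eqv_trans: "eqv t u \<Longrightarrow> eqv u v \<Longrightarrow> eqv t v"
  using Th_replace[of u v "Eq (lift_tm t) (Var 0)"] by (simp add: inst_def eqv_def)

quotient_type nn = tm / eqv
  by (rule equivpI) (auto intro!: reflpI sympI transpI intro: eqv_sym eqv_trans)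

lemma abs_nn_surj: "\<exists>t. x = abs_nn t"
  by (induction x rule: nn.abs_induct) blast

lemma all_nn: "(\<forall>x. P x) \<longleftrightarrow> (\<forall>t. P (abs_nn t))"
  using abs_nn_surj by metis

instantiation nn :: "{zero,one,plus,times,ord}"
begin

lift_definition zero_nn :: nn is Zero .
lift_definition one_nn :: nn is One .

lift_definition plus_nn :: "nn \<Rightarrow> nn \<Rightarrow> nn" is Add
proof -
  fix t t' u u' assume "eqv t t'" "eqv u u'"
  then show "eqv (Add t u) (Add t' u')"
    using Th_replace[of t t' "Eq (Add (lift_tm t) (lift_tm u)) (Add (Var 0) (lift_tm u))"]
      Th_replace[of u u' "Eq (Add (lift_tm t) (lift_tm u)) (Add (lift_tm t') (Var 0))"]
      eqv_refl[of "Add t u"]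
    by (simp add: inst_def eqv_def)
qed

lift_definition times_nn :: "nn \<Rightarrow> nn \<Rightarrow> nn" is Mul
proof -
  fix t t' u u' assume "eqv t t'" "eqv u u'"
  then show "eqv (Mul t u) (Mul t' u')"
    using Th_replace[of t t' "Eq (Mul (lift_tm t) (lift_tm u)) (Mul (Var 0) (lift_tm u))"]
      Th_replace[of u u' "Eq (Mul (lift_tm t) (lift_tm u)) (Mul (lift_tm t') (Var 0))"]
      eqv_refl[of "Mul t u"]
    by (simp add: inst_def eqv_def)
qed

lift_definition less_nn :: "nn \<Rightarrow> nn \<Rightarrow> bool" is "\<lambda>t u. Less t u \<in> Th"
proof -
  have "Less t' u' \<in> Th" if "eqv t t'" "eqv u u'" "Less t u \<in> Th" for t t' u u'
    using that Th_replace[of t t' "Less (Var 0) (lift_tm u)"]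
      Th_replace[of u u' "Less (lift_tm t') (Var 0)"] by (simp add: inst_def)
  then show "(Less t u \<in> Th) = (Less t' u' \<in> Th)" if "eqv t t'" "eqv u u'" for t t' u u'
    using that eqv_sym by blast
qed

definition less_eq_nn :: "nn \<Rightarrow> nn \<Rightarrow> bool" where
  "x \<le> y \<longleftrightarrow> x < y \<or> x = (y::nn)"

instance ..

end

definition set_of_var :: "nat \<Rightarrow> nn set" where
  "set_of_var j = {abs_nn t | t. Mem t j \<in> Th}"

definition Sets :: "nn set set" where "Sets = range set_of_var"

lemma Mem_set_of_var: "abs_nn t \<in> set_of_var j \<longleftrightarrow> Mem t j \<in> Th"
proof
  assume "abs_nn t \<in> set_of_var j"
  then obtain u where "eqv u t" "Mem u j \<in> Th"
    by (auto simp: set_of_var_def nn.abs_eq_iff intro: eqv_sym)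
  then show "Mem t j \<in> Th" using Th_replace[of u t "Mem (Var 0) j"] by (simp add: inst_def)
qed (auto simp: set_of_var_def)

lemma eval_abs: "eval (\<lambda>i. abs_nn (Var i)) t = abs_nn t"
  by (induction t) (simp_all add: zero_nn.abs_eq one_nn.abs_eq plus_nn.abs_eq times_nn.abs_eq)

primrec depth :: "fm \<Rightarrow> nat" where
  "depth (Eq t u) = 0"
| "depth (Less t u) = 0"
| "depth (Mem t j) = 0"
| "depth Fls = 0"
| "depth (Imp A B) = Suc (depth A + depth B)"
| "depth (AllN A) = Suc (depth A)"
| "depth (AllS A) = Suc (depth A)"

lemma depth_subst [simp]: "depth (subst s r A) = depth A"
  by (induction A arbitrary: s r) simp_all

lemma truth: "sat Sets (\<lambda>i. abs_nn (Var i)) set_of_var A \<longleftrightarrow> A \<in> Th"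
proof (induction "depth A" arbitrary: A rule: less_induct)
  case less
  let ?sat = "sat Sets (\<lambda>i. abs_nn (Var i)) set_of_var"
  show ?case
  proof (cases A)
    case (AllN B)
    have "?sat A \<longleftrightarrow> (\<forall>t. ?sat (inst t B))"
      by (simp add: AllN eval_abs all_nn)
    also have "\<dots> \<longleftrightarrow> (\<forall>t. inst t B \<in> Th)"
      using less[of "inst t B" for t] by (simp add: AllN inst_def)
    finally show ?thesis by (simp add: AllN Th_AllN)
  next
    case (AllS B)
    have "?sat A \<longleftrightarrow> (\<forall>j. ?sat (inst_set j B))"
      by (auto simp: AllS Sets_def)
    also have "\<dots> \<longleftrightarrow> (\<forall>j. inst_set j B \<in> Th)"
      using less[of "inst_set j B" for j] by (simp add: AllS inst_set_def)
    finally show ?thesis by (simp add: AllS Th_AllS)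
  qed (use less in \<open>simp_all add: eval_abs nn.abs_eq_iff eqv_def less_nn.abs_eq Mem_set_of_var
        Th_Fls Th_Imp\<close>)
qed

lemma sat_RCA0:
  assumes A: "A \<in> RCA0" and \<sigma>: "range \<sigma> \<subseteq> Sets"
  shows "sat Sets \<eta> \<sigma> A"
proof -
  have "\<exists>s. \<forall>i. \<eta> i = abs_nn (s i)" by (intro choice allI abs_nn_surj)
  then obtain s where s: "\<And>i. \<eta> i = abs_nn (s i)" by blast
  have "\<exists>r. \<forall>j. \<sigma> j = set_of_var (r j)" using \<sigma> by (intro choice) (auto simp: Sets_def)
  then obtain r where r: "\<And>j. \<sigma> j = set_of_var (r j)" by blast
  have "subst s r A \<in> Th" by (rule Th_derivable[of "[]"]) (simp_all add: derivable_instances[OF A])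
  then have "sat Sets (\<lambda>i. abs_nn (s i)) (\<lambda>j. set_of_var (r j)) A"
    unfolding truth[symmetric] by (simp add: eval_abs)
  moreover have "(\<lambda>i. abs_nn (s i)) = \<eta>" "(\<lambda>j. set_of_var (r j)) = \<sigma>" using s r by auto
  ultimately show ?thesis by simp
qed

section \<open>Arithmetic in the model\<close>

lemma Sets_nonempty: "\<exists>\<sigma> :: nat \<Rightarrow> nn set. range \<sigma> \<subseteq> Sets"
  by (auto simp: Sets_def)

lemma nn_basic:
  "x + 1 \<noteq> 0" "x + 1 = y + 1 \<longleftrightarrow> x = y" "x + 0 = x" "x + (y + 1) = (x + y) + 1" "x * 0 = 0"
  "x * (y + 1) = x * y + x" "\<not> x < 0" "x < y + 1 \<longleftrightarrow> x < y \<or> x = y"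
  for x y :: nn
proof -
  have "\<forall>A\<in>basic_axioms. sat Sets (case_nat x (\<lambda>_. y)) (SOME \<sigma>. range \<sigma> \<subseteq> Sets) A"
    using someI_ex[OF Sets_nonempty] by (intro ballI sat_RCA0) (simp_all add: RCA0_def)
  then show "x + 1 \<noteq> 0" "x + 1 = y + 1 \<longleftrightarrow> x = y" "x + 0 = x" "x + (y + 1) = (x + y) + 1"
    "x * 0 = 0" "x * (y + 1) = x * y + x" "\<not> x < 0" "x < y + 1 \<longleftrightarrow> x < y \<or> x = y"
    by (auto simp: basic_axioms_def)
qed

text \<open>The predicates on assignments that are defined by bounded formulas with set parameters.\<close>

inductive bdd :: "((nat \<Rightarrow> nn) \<Rightarrow> bool) \<Rightarrow> bool" where
  bdd_eq: "bdd (\<lambda>\<eta>. eval \<eta> t = eval \<eta> u)"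
| bdd_less: "bdd (\<lambda>\<eta>. eval \<eta> t < eval \<eta> u)"
| bdd_mem: "X \<in> Sets \<Longrightarrow> bdd (\<lambda>\<eta>. eval \<eta> t \<in> X)"
| bdd_Fls: "bdd (\<lambda>\<eta>. False)"
| bdd_imp: "bdd P \<Longrightarrow> bdd Q \<Longrightarrow> bdd (\<lambda>\<eta>. P \<eta> \<longrightarrow> Q \<eta>)"
| bdd_all: "bdd P \<Longrightarrow> bdd (\<lambda>\<eta>. \<forall>v. v < eval \<eta> t \<longrightarrow> P (case_nat v \<eta>))"

lemma bounded_subst: "bounded A \<Longrightarrow> bounded (subst s r A)"
proof (induction arbitrary: s r rule: bounded.induct)
  case (6 A t)
  then show ?case by (auto intro: bounded.intros)
qed (auto intro: bounded.intros)

lemma bdd_formula: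
  assumes "bdd P"
  shows "\<exists>A \<sigma>. bounded A \<and> range \<sigma> \<subseteq> Sets \<and> (\<forall>\<eta>. sat Sets \<eta> \<sigma> A \<longleftrightarrow> P \<eta>)"
  using assms
proof induction
  case (bdd_eq t u)
  obtain \<sigma> :: "nat \<Rightarrow> nn set" where "range \<sigma> \<subseteq> Sets" using Sets_nonempty by blast
  then show ?case by (intro exI[of _ "Eq t u"] exI[of _ \<sigma>]) (auto intro: bounded.intros)
next
  case (bdd_less t u)
  obtain \<sigma> :: "nat \<Rightarrow> nn set" where "range \<sigma> \<subseteq> Sets" using Sets_nonempty by blast
  then show ?case by (intro exI[of _ "Less t u"] exI[of _ \<sigma>]) (auto intro: bounded.intros)
next
  case (bdd_mem X t)
  then show ?case
    by (intro exI[of _ "Mem t 0"] exI[of _ "\<lambda>_. X"]) (auto intro: bounded.intros)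
next
  case bdd_Fls
  obtain \<sigma> :: "nat \<Rightarrow> nn set" where "range \<sigma> \<subseteq> Sets" using Sets_nonempty by blast
  then show ?case by (intro exI[of _ "Fls"] exI[of _ \<sigma>]) (auto intro: bounded.intros)
next
  case (bdd_imp P Q)
  then obtain A \<sigma> B \<tau> where A: "bounded A" "range \<sigma> \<subseteq> Sets" "\<And>\<eta>. sat Sets \<eta> \<sigma> A \<longleftrightarrow> P \<eta>"
    and B: "bounded B" "range \<tau> \<subseteq> Sets" "\<And>\<eta>. sat Sets \<eta> \<tau> B \<longleftrightarrow> Q \<eta>" by metis
  define \<rho> where "\<rho> j = (if even j then \<sigma> (j div 2) else \<tau> (j div 2))" for j
  let ?C = "Imp (subst Var (\<lambda>j. 2 * j) A) (subst Var (\<lambda>j. 2 * j + 1) B)"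
  have "bounded ?C" using A B by (auto intro: bounded.intros bounded_subst)
  moreover have "range \<rho> \<subseteq> Sets" using A B by (auto simp: \<rho>_def)
  moreover have "sat Sets \<eta> \<rho> ?C \<longleftrightarrow> (P \<eta> \<longrightarrow> Q \<eta>)" for \<eta>
    by (simp add: A B \<rho>_def)
  ultimately show ?case by blast
next
  case (bdd_all P t)
  then obtain A \<sigma> where A: "bounded A" "range \<sigma> \<subseteq> Sets" "\<And>\<eta>. sat Sets \<eta> \<sigma> A \<longleftrightarrow> P \<eta>" by metis
  let ?B = "AllN (Imp (Less (Var 0) (lift_tm t)) A)"
  have "bounded ?B" using A by (auto intro: bounded.intros)
  moreover have "sat Sets \<eta> \<sigma> ?B \<longleftrightarrow> (\<forall>v. v < eval \<eta> t \<longrightarrow> P (case_nat v \<eta>))" for \<eta>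
    by (simp add: A)
  ultimately show ?case using A(2) by blast
qed

lemma bdd_induct:
  assumes P: "bdd P"
    and base: "\<exists>y. P (case_nat y (case_nat 0 \<eta>))"
    and step: "\<And>x. \<exists>y. P (case_nat y (case_nat x \<eta>)) \<Longrightarrow> \<exists>y. P (case_nat y (case_nat (x + 1) \<eta>))"
  shows "\<exists>y. P (case_nat y (case_nat x \<eta>))"
proof -
  obtain A \<sigma> where A: "bounded A" "range \<sigma> \<subseteq> Sets" "\<And>\<eta>. sat Sets \<eta> \<sigma> A \<longleftrightarrow> P \<eta>"
    using bdd_formula[OF P] by metis
  have "sat Sets \<eta> \<sigma> (induction_axiom (ExN A))"
    using A by (intro sat_RCA0) (auto simp: RCA0_def Sigma1_def)
  then show ?thesis using base step by (simp add: induction_axiom_def A eval_case_nat)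
qed

lemma bdd_comprehension:
  assumes P: "bdd P" and Q: "bdd Q"
    and "\<And>x. (\<exists>y. P (case_nat y (case_nat x \<eta>))) \<longleftrightarrow> (\<forall>y. Q (case_nat y (case_nat x \<eta>)))"
  shows "{x. \<exists>y. P (case_nat y (case_nat x \<eta>))} \<in> Sets"
proof -
  obtain A \<sigma> where A: "bounded A" "range \<sigma> \<subseteq> Sets" "\<And>\<eta>. sat Sets \<eta> \<sigma> A \<longleftrightarrow> P \<eta>"
    using bdd_formula[OF P] by metis
  obtain B \<tau> where B: "bounded B" "range \<tau> \<subseteq> Sets" "\<And>\<eta>. sat Sets \<eta> \<tau> B \<longleftrightarrow> Q \<eta>"
    using bdd_formula[OF Q] by metis
  define \<rho> where "\<rho> j = (if even j then \<sigma> (j div 2) else \<tau> (j div 2))" for j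
  let ?A = "subst Var (\<lambda>j. 2 * j) A" and ?B = "subst Var (\<lambda>j. 2 * j + 1) B"
  have "range \<rho> \<subseteq> Sets" using A B by (auto simp: \<rho>_def)
  then have "sat Sets \<eta> \<rho> (comprehension_axiom (ExN ?A) (AllN ?B))"
  proof (rule sat_RCA0[rotated])
    have "ExN ?A \<in> Sigma1" "AllN ?B \<in> Pi1"
      using bounded_subst[OF A(1)] bounded_subst[OF B(1)] by (auto simp: Sigma1_def Pi1_def)
    then show "comprehension_axiom (ExN ?A) (AllN ?B) \<in> RCA0"
      unfolding RCA0_def by (intro UnI2 CollectI exI conjI) (rule refl)
  qed
  then have "(\<forall>x. (\<exists>y. P (case_nat y (case_nat x \<eta>))) \<longleftrightarrow> (\<forall>y. Q (case_nat y (case_nat x \<eta>)))) \<longrightarrow>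
    (\<exists>X\<in>Sets. \<forall>x. x \<in> X \<longleftrightarrow> (\<exists>y. P (case_nat y (case_nat x \<eta>))))"
    by (simp add: comprehension_axiom_def A B \<rho>_def)
  then have "\<exists>X\<in>Sets. \<forall>x. x \<in> X \<longleftrightarrow> (\<exists>y. P (case_nat y (case_nat x \<eta>)))"
    using assms(3) by blast
  then obtain X where "X \<in> Sets" "\<And>x. x \<in> X \<longleftrightarrow> (\<exists>y. P (case_nat y (case_nat x \<eta>)))"
    by blast
  moreover from this(2) have "X = {x. \<exists>y. P (case_nat y (case_nat x \<eta>))}" by blast
  ultimately show ?thesis by simp
qed

lemma open_induct:
  assumes P: "bdd P" and base: "P (case_nat 0 \<eta>)"
    and step: "\<And>x. P (case_nat x \<eta>) \<Longrightarrow> P (case_nat (x + 1) \<eta>)"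
  shows "P (case_nat x \<eta>)"
proof -
  obtain A \<sigma> where A: "bounded A" "range \<sigma> \<subseteq> Sets" "\<And>\<eta>. sat Sets \<eta> \<sigma> A \<longleftrightarrow> P \<eta>"
    using bdd_formula[OF P] by metis
  have "bounded (lift A)" using A(1) unfolding lift_def by (rule bounded_subst)
  then have "sat Sets \<eta> \<sigma> (induction_axiom (ExN (lift A)))"
    using A(2) by (intro sat_RCA0) (auto simp: RCA0_def Sigma1_def)
  then show ?thesis using base step by (simp add: induction_axiom_def A eval_case_nat)
qed

definition poly_fun :: "((nat \<Rightarrow> nn) \<Rightarrow> nn) \<Rightarrow> bool" where
  "poly_fun f \<longleftrightarrow> (\<exists>t. f = (\<lambda>\<eta>. eval \<eta> t))"

lemma poly_fun_intros:
  "poly_fun (\<lambda>\<eta>. \<eta> i)" "poly_fun (\<lambda>\<eta>. 0)" "poly_fun (\<lambda>\<eta>. 1)"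
  "poly_fun f \<Longrightarrow> poly_fun g \<Longrightarrow> poly_fun (\<lambda>\<eta>. f \<eta> + g \<eta>)"
  "poly_fun f \<Longrightarrow> poly_fun g \<Longrightarrow> poly_fun (\<lambda>\<eta>. f \<eta> * g \<eta>)"
  unfolding poly_fun_def by (metis eval.simps)+

lemma bdd_intros:
  "poly_fun f \<Longrightarrow> poly_fun g \<Longrightarrow> bdd (\<lambda>\<eta>. f \<eta> = g \<eta>)"
  "poly_fun f \<Longrightarrow> poly_fun g \<Longrightarrow> bdd (\<lambda>\<eta>. f \<eta> < g \<eta>)"
  "poly_fun f \<Longrightarrow> X \<in> Sets \<Longrightarrow> bdd (\<lambda>\<eta>. f \<eta> \<in> X)"
  "bdd P \<Longrightarrow> bdd Q \<Longrightarrow> bdd (\<lambda>\<eta>. P \<eta> \<longrightarrow> Q \<eta>)"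
  "bdd P \<Longrightarrow> bdd (\<lambda>\<eta>. \<not> P \<eta>)"
  "bdd P \<Longrightarrow> bdd Q \<Longrightarrow> bdd (\<lambda>\<eta>. P \<eta> \<and> Q \<eta>)"
  "bdd P \<Longrightarrow> bdd Q \<Longrightarrow> bdd (\<lambda>\<eta>. P \<eta> \<or> Q \<eta>)"
  "bdd P \<Longrightarrow> bdd Q \<Longrightarrow> bdd (\<lambda>\<eta>. P \<eta> \<longleftrightarrow> Q \<eta>)"
  "poly_fun f \<Longrightarrow> bdd P \<Longrightarrow> bdd (\<lambda>\<eta>. \<forall>v<f \<eta>. P (case_nat v \<eta>))"
  "poly_fun f \<Longrightarrow> bdd P \<Longrightarrow> bdd (\<lambda>\<eta>. \<exists>v<f \<eta>. P (case_nat v \<eta>))"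
proof -
  show "poly_fun f \<Longrightarrow> poly_fun g \<Longrightarrow> bdd (\<lambda>\<eta>. f \<eta> = g \<eta>)"
    "poly_fun f \<Longrightarrow> poly_fun g \<Longrightarrow> bdd (\<lambda>\<eta>. f \<eta> < g \<eta>)"
    "poly_fun f \<Longrightarrow> X \<in> Sets \<Longrightarrow> bdd (\<lambda>\<eta>. f \<eta> \<in> X)"
    by (auto simp: poly_fun_def intro: bdd.intros)
  show imp: "bdd P \<Longrightarrow> bdd Q \<Longrightarrow> bdd (\<lambda>\<eta>. P \<eta> \<longrightarrow> Q \<eta>)" for P Q
    by (rule bdd_imp)
  show neg: "bdd P \<Longrightarrow> bdd (\<lambda>\<eta>. \<not> P \<eta>)" for P
    using bdd_imp[OF _ bdd_Fls, of P] by simp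
  show con: "bdd P \<Longrightarrow> bdd Q \<Longrightarrow> bdd (\<lambda>\<eta>. P \<eta> \<and> Q \<eta>)" for P Q
    using neg[OF imp[OF _ neg, of P Q]] by simp
  show "bdd P \<Longrightarrow> bdd Q \<Longrightarrow> bdd (\<lambda>\<eta>. P \<eta> \<or> Q \<eta>)"
    using imp[OF neg, of P Q] by (simp add: disj_imp)
  show "bdd P \<Longrightarrow> bdd Q \<Longrightarrow> bdd (\<lambda>\<eta>. P \<eta> \<longleftrightarrow> Q \<eta>)"
    using con[OF imp[of P Q] imp[of Q P]] by (simp add: iff_conv_conj_imp)
  show all: "poly_fun f \<Longrightarrow> bdd P \<Longrightarrow> bdd (\<lambda>\<eta>. \<forall>v<f \<eta>. P (case_nat v \<eta>))" for f P
    by (auto simp: poly_fun_def intro: bdd_all)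
  show "poly_fun f \<Longrightarrow> bdd P \<Longrightarrow> bdd (\<lambda>\<eta>. \<exists>v<f \<eta>. P (case_nat v \<eta>))"
    using neg[OF all[OF _ neg, of f P]] by simp
qed

lemma zero_add_nn: "0 + x = (x::nn)"
proof -
  have "bdd (\<lambda>\<eta>. 0 + \<eta> 0 = \<eta> 0)" by (intro bdd_intros poly_fun_intros)
  from open_induct[OF this, of "\<lambda>_. 0" x] show ?thesis by (simp add: nn_basic)
qed

lemma succ_add_nn: "(x + 1) + y = (x + y) + (1::nn)"
proof -
  have "bdd (\<lambda>\<eta>. (\<eta> 1 + 1) + \<eta> 0 = (\<eta> 1 + \<eta> 0) + 1)" by (intro bdd_intros poly_fun_intros)
  from open_induct[OF this, of "\<lambda>_. x" y] show ?thesis by (simp add: nn_basic)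
qed

lemma add_comm_nn: "x + y = y + (x::nn)"
proof -
  have "bdd (\<lambda>\<eta>. \<eta> 1 + \<eta> 0 = \<eta> 0 + \<eta> 1)" by (intro bdd_intros poly_fun_intros)
  from open_induct[OF this, of "\<lambda>_. x" y] show ?thesis
    by (simp add: nn_basic zero_add_nn succ_add_nn)
qed

lemma add_assoc_nn: "(x + y) + z = x + (y + z)" for x y z :: nn
proof -
  have "bdd (\<lambda>\<eta>. (\<eta> 1 + \<eta> 2) + \<eta> 0 = \<eta> 1 + (\<eta> 2 + \<eta> 0))" by (intro bdd_intros poly_fun_intros)
  from open_induct[OF this, of "case_nat x (\<lambda>_. y)" z] show ?thesis
    by (simp add: nn_basic numeral_2_eq_2)
qed

lemma add_lcomm_nn: "x + (y + z) = y + (x + z)" for x y z :: nn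
  by (simp only: add_assoc_nn[symmetric] add_comm_nn[of x y])

lemmas add_ac_nn = add_assoc_nn add_comm_nn add_lcomm_nn

lemma zero_mult_nn: "0 * x = (0::nn)"
proof -
  have "bdd (\<lambda>\<eta>. 0 * \<eta> 0 = 0)" by (intro bdd_intros poly_fun_intros)
  from open_induct[OF this, of "\<lambda>_. 0" x] show ?thesis by (simp add: nn_basic)
qed

lemma succ_mult_nn: "(x + 1) * y = x * y + (y::nn)"
proof -
  have bdd: "bdd (\<lambda>\<eta>. (\<eta> 1 + 1) * \<eta> 0 = \<eta> 1 * \<eta> 0 + \<eta> 0)" by (intro bdd_intros poly_fun_intros)
  have "(x + 1) * (y + 1) = x * (y + 1) + (y + 1)" if "(x + 1) * y = x * y + y" for y
  proof -
    have "x * y + y + (x + 1) = x * y + x + (y + 1)" by (simp only: add_ac_nn)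
    then show ?thesis by (simp only: nn_basic that)
  qed
  with open_induct[OF bdd, of "\<lambda>_. x" y] show ?thesis by (simp add: nn_basic(3,5))
qed

lemma mult_comm_nn: "x * y = y * (x::nn)"
proof -
  have "bdd (\<lambda>\<eta>. \<eta> 1 * \<eta> 0 = \<eta> 0 * \<eta> 1)" by (intro bdd_intros poly_fun_intros)
  from open_induct[OF this, of "\<lambda>_. x" y] show ?thesis
    by (simp add: nn_basic zero_mult_nn succ_mult_nn)
qed

lemma distrib_nn: "(x + y) * z = x * z + y * z" for x y z :: nn
proof -
  have bdd: "bdd (\<lambda>\<eta>. (\<eta> 1 + \<eta> 2) * \<eta> 0 = \<eta> 1 * \<eta> 0 + \<eta> 2 * \<eta> 0)"
    by (intro bdd_intros poly_fun_intros)
  have "(x + y) * (z + 1) = x * (z + 1) + y * (z + 1)"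
    if "(x + y) * z = x * z + y * z" for z
  proof -
    have "x * z + y * z + (x + y) = x * z + x + (y * z + y)" by (simp only: add_ac_nn)
    then show ?thesis by (simp only: nn_basic that)
  qed
  with open_induct[OF bdd, of "case_nat x (\<lambda>_. y)" z] show ?thesis
    by (simp add: nn_basic(3,5) numeral_2_eq_2)
qed

lemma mult_assoc_nn: "(x * y) * z = x * (y * z)" for x y z :: nn
proof -
  have d: "x * (a + b) = x * a + x * b" for a b by (metis mult_comm_nn distrib_nn)
  have "bdd (\<lambda>\<eta>. (\<eta> 1 * \<eta> 2) * \<eta> 0 = \<eta> 1 * (\<eta> 2 * \<eta> 0))" by (intro bdd_intros poly_fun_intros)
  from open_induct[OF this, of "case_nat x (\<lambda>_. y)" z] show ?thesis
    by (simp add: nn_basic(3,5,6) numeral_2_eq_2 d)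
qed

lemma less_trans_nn: "x < y \<Longrightarrow> y < z \<Longrightarrow> x < z" for x y z :: nn
proof -
  have "bdd (\<lambda>\<eta>. \<eta> 1 < \<eta> 2 \<longrightarrow> \<eta> 2 < \<eta> 0 \<longrightarrow> \<eta> 1 < \<eta> 0)" by (intro bdd_intros poly_fun_intros)
  from open_induct[OF this, of "case_nat x (\<lambda>_. y)" z] show "x < y \<Longrightarrow> y < z \<Longrightarrow> x < z"
    by (auto simp: nn_basic numeral_2_eq_2)
qed

lemma succ_le_nn: "x < y \<Longrightarrow> x + 1 < y \<or> x + 1 = (y::nn)"
proof -
  have "bdd (\<lambda>\<eta>. \<eta> 1 < \<eta> 0 \<longrightarrow> \<eta> 1 + 1 < \<eta> 0 \<or> \<eta> 1 + 1 = \<eta> 0)" by (intro bdd_intros poly_fun_intros)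
  from open_induct[OF this, of "\<lambda>_. x" y] show "x < y \<Longrightarrow> x + 1 < y \<or> x + 1 = (y::nn)"
    by (auto simp: nn_basic)
qed

lemma irrefl_nn: "\<not> x < (x::nn)"
proof -
  have "bdd (\<lambda>\<eta>. \<not> \<eta> 0 < \<eta> 0)" by (intro bdd_intros poly_fun_intros)
  moreover have "\<not> x + 1 < x + 1" if "\<not> x < x" for x :: nn
    using that less_trans_nn nn_basic(8) by metis
  ultimately show ?thesis using open_induct[of _ "\<lambda>_. 0" x] nn_basic(7) by fastforce
qed

lemma zero_le_nn: "0 < x \<or> 0 = (x::nn)"
proof -
  have "bdd (\<lambda>\<eta>. 0 < \<eta> 0 \<or> 0 = \<eta> 0)" by (intro bdd_intros poly_fun_intros)
  from open_induct[OF this, of "\<lambda>_. 0" x] show ?thesis by (auto simp: nn_basic(8))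
qed

lemma linear_nn: "x < y \<or> x = y \<or> y < (x::nn)"
proof -
  have "bdd (\<lambda>\<eta>. \<eta> 0 < \<eta> 1 \<or> \<eta> 0 = \<eta> 1 \<or> \<eta> 1 < \<eta> 0)" by (intro bdd_intros poly_fun_intros)
  moreover have "x + 1 < y \<or> x + 1 = y \<or> y < x + 1" if "x < y \<or> x = y \<or> y < x" for x
    using that succ_le_nn by (auto simp: nn_basic(8))
  ultimately show ?thesis using open_induct[of _ "\<lambda>_. y" x] zero_le_nn by fastforce
qed

lemma add_less_nn: "x + z < y + z \<longleftrightarrow> x < (y::nn)"
proof -
  have succ: "x + 1 < y + 1 \<longleftrightarrow> x < y" for x y :: nn
    by (metis irrefl_nn less_trans_nn linear_nn nn_basic(8) succ_le_nn)
  have 1: "x + z < y + z" if "x < y" for x y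
  proof -
    have "bdd (\<lambda>\<eta>. \<eta> 1 < \<eta> 2 \<longrightarrow> \<eta> 1 + \<eta> 0 < \<eta> 2 + \<eta> 0)" by (intro bdd_intros poly_fun_intros)
    from open_induct[OF this, of "case_nat x (\<lambda>_. y)" z] show ?thesis
      using that by (simp add: nn_basic(3,4) succ numeral_2_eq_2)
  qed
  then show ?thesis by (metis irrefl_nn less_trans_nn linear_nn)
qed

lemma le_ex_nn: "\<exists>z. y = x + z" if "x \<le> y" for x y :: nn
proof -
  have "bdd (\<lambda>\<eta>. \<not> \<eta> 1 < \<eta> 2 \<longrightarrow> \<eta> 1 = \<eta> 2 + \<eta> 0)" by (intro bdd_intros poly_fun_intros)
  from bdd_induct[OF this, of "\<lambda>_. x" y]
  have "\<exists>z. \<not> 0 < x \<longrightarrow> 0 = x + z \<Longrightarrow>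
    (\<And>y. \<exists>z. \<not> y < x \<longrightarrow> y = x + z \<Longrightarrow> \<exists>z. \<not> y + 1 < x \<longrightarrow> y + 1 = x + z) \<Longrightarrow>
    \<exists>z. \<not> y < x \<longrightarrow> y = x + z" by (simp add: numeral_2_eq_2)
  moreover have "\<exists>z. \<not> 0 < x \<longrightarrow> 0 = x + z" using zero_le_nn nn_basic(3) by metis
  moreover have "\<exists>z. \<not> y + 1 < x \<longrightarrow> y + 1 = x + z" if "\<exists>z. \<not> y < x \<longrightarrow> y = x + z" for y
    using that by (metis nn_basic(3,4) succ_le_nn)
  moreover have "\<not> y < x" using \<open>x \<le> y\<close> irrefl_nn less_trans_nn less_eq_nn_def by metis
  ultimately show ?thesis by blast
qed

instantiation nn :: minus
begin

definition minus_nn :: "nn \<Rightarrow> nn \<Rightarrow> nn" where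
  "x - y = (if y \<le> x then THE z. x = y + z else (0::nn))"

instance ..

end

lemma add_cancel_nn: "x + z = y + z \<longleftrightarrow> x = (y::nn)"
  by (metis add_less_nn irrefl_nn linear_nn)

lemma diff_nn: "(x + y) - x = (y::nn)"
proof -
  have "x \<le> x + y" unfolding less_eq_nn_def
    using add_less_nn[of 0 x y] zero_le_nn[of y] by (metis add_comm_nn zero_add_nn)
  moreover have "(THE z. x + y = x + z) = y"
    by (rule the_equality) (metis add_cancel_nn add_comm_nn)+
  ultimately show ?thesis by (simp add: minus_nn_def)
qed

lemma le_ex_iff_nn: "x \<le> y \<longleftrightarrow> (\<exists>z. y = x + (z::nn))"
proof
  assume "\<exists>z. y = x + z"
  then show "x \<le> y" unfolding less_eq_nn_def
    by (metis add_comm_nn add_less_nn nn_basic(3) zero_le_nn)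
qed (rule le_ex_nn)

lemma diff_zero_nn: "x \<le> y \<Longrightarrow> x - y = (0::nn)"
  by (metis add_cancel_nn diff_nn irrefl_nn less_trans_nn less_eq_nn_def minus_nn_def nn_basic(3))

lemma mult_mono_nn: "x \<le> y \<Longrightarrow> z * x \<le> z * (y::nn)"
  unfolding le_ex_iff_nn by (metis distrib_nn mult_comm_nn)

lemma diff_mult_nn: "x * (y - z) = x * y - x * (z::nn)"
proof (cases "z \<le> y")
  case True
  then obtain w where "y = z + w" using le_ex_nn by blast
  then show ?thesis by (metis distrib_nn diff_nn mult_comm_nn)
next
  case False
  then have "y \<le> z" using linear_nn less_eq_nn_def by metis
  then show ?thesis using mult_mono_nn[of y z x] by (simp add: diff_zero_nn nn_basic)
qed

lemma pos_ex_succ: "\<exists>y. x = y + 1" if "0 < x" for x :: nn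
proof -
  have "1 \<le> x" using succ_le_nn[OF that] by (simp add: less_eq_nn_def zero_add_nn)
  then obtain y where "x = 1 + y" using le_ex_nn by blast
  then show ?thesis using add_comm_nn by blast
qed

lemma mult_pos_nn: "0 < x \<Longrightarrow> 0 < y \<Longrightarrow> 0 < x * (y::nn)"
proof -
  assume "0 < x" "0 < y"
  with \<open>0 < x\<close> \<open>0 < y\<close> obtain x' y' where "x = x' + 1" "y = y' + 1"
    using pos_ex_succ by blast
  then have "x * y = (x' + 1) * y' + x' + 1" by (simp only: nn_basic(4,6))
  then show "0 < x * y" using zero_le_nn nn_basic(8)[of 0] by metis
qed

lemma diff_diff_nn: "a - b - c = a - (b + (c::nn))"
proof (cases "b + c \<le> a")
  case True
  then obtain d where "a = b + (c + d)" using le_ex_nn add_assoc_nn by metis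
  then show ?thesis by (simp only: diff_nn flip: add_assoc_nn) (simp only: diff_nn add_assoc_nn)
next
  case False
  then have 0: "a - (b + c) = 0" by (simp add: minus_nn_def)
  show ?thesis
  proof (cases "b \<le> a")
    case True
    then obtain d where d: "a = b + d" using le_ex_nn by blast
    have "\<not> c \<le> d" using False by (metis d le_ex_iff_nn add_assoc_nn)
    then have "d \<le> c" using linear_nn[of d c] by (auto simp: less_eq_nn_def)
    then show ?thesis by (simp only: 0) (simp only: d diff_nn diff_zero_nn)
  next
    case False
    then have "a - b = 0" by (simp add: minus_nn_def)
    moreover have "0 \<le> c" using zero_le_nn[of c] by (auto simp: less_eq_nn_def)
    ultimately show ?thesis by (simp only: 0 diff_zero_nn)
  qed
qed

instance nn :: linordered_semidom
proof
  fix a b c :: nn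
  show "a + b + c = a + (b + c)" by (rule add_assoc_nn)
  show "a + b = b + a" by (rule add_comm_nn)
  show "a + b - a = b" by (rule diff_nn)
  show "a - b - c = a - (b + c)" by (rule diff_diff_nn)
  show "(a < b) = (a \<le> b \<and> \<not> b \<le> a)" "a \<le> a" "a \<le> b \<Longrightarrow> b \<le> c \<Longrightarrow> a \<le> c"
    "a \<le> b \<Longrightarrow> b \<le> a \<Longrightarrow> a = b" "a \<le> b \<or> b \<le> a"
    unfolding less_eq_nn_def using irrefl_nn less_trans_nn linear_nn by metis+
  show "a \<le> b \<Longrightarrow> c + a \<le> c + b"
    unfolding le_ex_iff_nn by (metis add_assoc_nn)
  show "0 + a = a" by (rule zero_add_nn)
  show "a * b * c = a * (b * c)" by (rule mult_assoc_nn)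
  show "a * b = b * a" by (rule mult_comm_nn)
  show "(a + b) * c = a * c + b * c" by (rule distrib_nn)
  then show "a * (b + c) = a * b + a * c" by (metis distrib_nn mult_comm_nn)
  show "0 * a = 0" by (rule zero_mult_nn)
  show "a * 0 = 0" by (rule nn_basic)
  show "1 * a = a" by (metis nn_basic(5,6) mult_comm_nn zero_add_nn)
  show "0 \<noteq> (1::nn)" by (metis nn_basic(1) zero_add_nn)
  show "a * (b - c) = a * b - a * c" by (rule diff_mult_nn)
  show "a \<noteq> 0 \<Longrightarrow> b \<noteq> 0 \<Longrightarrow> a * b \<noteq> 0"
    using mult_pos_nn[of a b] zero_le_nn irrefl_nn by metis
  show "0 < (1::nn)" using zero_le_nn[of 1] nn_basic(1)[of 0] zero_add_nn by metis
  show "b \<le> a \<Longrightarrow> a - b + b = a" unfolding le_ex_iff_nn by (metis diff_nn add_comm_nn)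
  show "c * a < c * b" if "a < b" "0 < c"
  proof -
    from that obtain d where d: "b = a + d" using le_ex_nn less_eq_nn_def by metis
    have "d \<noteq> 0" using that d nn_basic(3) irrefl_nn by metis
    then have "0 < c * d" using zero_le_nn mult_pos_nn that by metis
    then have "0 + c * a < c * d + c * a" by (simp only: add_less_nn)
    then show ?thesis by (metis d zero_add_nn distrib_nn mult_comm_nn add_comm_nn)
  qed
qed

lemma less_succ_iff [simp]: "x < y + 1 \<longleftrightarrow> x \<le> (y::nn)" "x < 1 + y \<longleftrightarrow> x \<le> (y::nn)"
  using nn_basic(8)[of x y] by (auto simp: le_less add.commute[of 1 y])

lemma succ_le_iff [simp]: "x + 1 \<le> y \<longleftrightarrow> x < (y::nn)" "1 + x \<le> y \<longleftrightarrow> x < (y::nn)"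
  by (metis less_succ_iff(1) not_le, metis less_succ_iff(2) not_le)

lemma zero_le [simp]: "0 \<le> (x::nn)" and not_less_zero [simp]: "\<not> x < (0::nn)"
  and le_zero_iff [simp]: "x \<le> 0 \<longleftrightarrow> x = (0::nn)" and zero_less_iff: "0 < x \<longleftrightarrow> x \<noteq> (0::nn)"
  using nn_basic(7) zero_le_nn[of x] by (auto simp: not_less[symmetric] le_less)

lemma less_one_iff [simp]: "x < 1 \<longleftrightarrow> x = (0::nn)"
  using less_succ_iff(1)[of x 0] by simp

lemma nn_cases [case_names zero succ]:
  obtains "x = 0" | y where "x = y + (1::nn)"
  using pos_ex_succ[of x] zero_less_iff[of x] by blast

lemma add_eq_zero_iff_nn [simp]: "x + y = 0 \<longleftrightarrow> x = 0 \<and> y = (0::nn)"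
  by (simp add: add_nonneg_eq_0_iff)

section \<open>Computability in the model\<close>

lemma bdd_quantifiers:
  "poly_fun f \<Longrightarrow> bdd (\<lambda>\<eta>. P (\<eta> 0) (\<lambda>i. \<eta> (Suc i))) \<Longrightarrow> bdd (\<lambda>\<eta>. \<forall>v<f \<eta>. P v \<eta>)"
  "poly_fun f \<Longrightarrow> bdd (\<lambda>\<eta>. P (\<eta> 0) (\<lambda>i. \<eta> (Suc i))) \<Longrightarrow> bdd (\<lambda>\<eta>. \<exists>v<f \<eta>. P v \<eta>)"
  using bdd_intros(9)[of f "\<lambda>\<eta>. P (\<eta> 0) (\<lambda>i. \<eta> (Suc i))"]
    bdd_intros(10)[of f "\<lambda>\<eta>. P (\<eta> 0) (\<lambda>i. \<eta> (Suc i))"] by simp_all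

lemmas bdd_rules = bdd_quantifiers bdd_intros(1-8) poly_fun_intros

lemma Sets_bdd: assumes "bdd P" shows "{x. P (case_nat x \<eta>)} \<in> Sets"
proof -
  obtain A \<sigma> where A: "bounded A" "range \<sigma> \<subseteq> Sets" "\<And>\<eta>. sat Sets \<eta> \<sigma> A \<longleftrightarrow> P \<eta>"
    using bdd_formula[OF assms] by metis
  have "bounded (lift A)" using A(1) unfolding lift_def by (rule bounded_subst)
  then have "ExN (lift A) \<in> Sigma1" "AllN (lift A) \<in> Pi1" by (auto simp: Sigma1_def Pi1_def)
  then have "comprehension_axiom (ExN (lift A)) (AllN (lift A)) \<in> RCA0"
    unfolding RCA0_def by (intro UnI2 CollectI exI conjI) (rule refl)
  then have "sat Sets \<eta> \<sigma> (comprehension_axiom (ExN (lift A)) (AllN (lift A)))"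
    using A(2) by (rule sat_RCA0)
  then obtain X where "X \<in> Sets" "\<forall>x. x \<in> X \<longleftrightarrow> P (case_nat x \<eta>)"
    by (auto simp: comprehension_axiom_def A)
  moreover from this(2) have "X = {x. P (case_nat x \<eta>)}" by blast
  ultimately show ?thesis by simp
qed

definition pr :: "nn \<Rightarrow> nn \<Rightarrow> nn" where "pr x y = (x + y) * (x + y) + x"

lemma pr_sum: "x + y \<le> pr x y"
proof (cases "x + y" rule: nn_cases)
  case (succ z)
  then have "(x + y) * 1 \<le> (x + y) * (x + y)" by (intro mult_left_mono) auto
  then show ?thesis by (simp add: pr_def add_increasing2)
qed (simp add: pr_def)

lemma pr_ge: "x \<le> pr x y" "y \<le> pr x y"
  by (rule order_trans[OF _ pr_sum[of x y]], simp add: add_increasing add_increasing2)+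

lemma pr_mono_sum: assumes "x + y < x' + y'" shows "pr x y < pr x' y'"
proof -
  have "pr x y < (x + y + 1) * (x + y + 1)"
    by (simp add: pr_def algebra_simps) (simp add: add_increasing flip: add.assoc)
  also have "\<dots> \<le> (x' + y') * (x' + y')" using assms by (intro mult_mono) auto
  also have "\<dots> \<le> pr x' y'" by (simp add: pr_def)
  finally show ?thesis .
qed

lemma pr_inject [simp]: "pr x y = pr x' y' \<longleftrightarrow> x = x' \<and> y = y'"
proof
  assume eq: "pr x y = pr x' y'"
  then have s: "x + y = x' + y'" using pr_mono_sum[of x y x' y'] pr_mono_sum[of x' y' x y]
    by (metis less_irrefl linorder_neqE)
  then have "x = x'" using eq by (simp add: pr_def)
  then show "x = x' \<and> y = y'" using s by simp
qed simp

lemma poly_fun_pr: "poly_fun f \<Longrightarrow> poly_fun g \<Longrightarrow> poly_fun (\<lambda>\<eta>. pr (f \<eta>) (g \<eta>))"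
  unfolding pr_def by (intro poly_fun_intros)

lemma bdd_pr:
  assumes f: "poly_fun f" and R: "bdd (\<lambda>\<eta>. R (\<eta> 1) (\<eta> 0) (\<lambda>i. \<eta> (Suc (Suc i))))"
  shows "bdd (\<lambda>\<eta>. \<exists>x y. f \<eta> = pr x y \<and> R x y \<eta>)"
proof -
  have f': "poly_fun (\<lambda>\<eta>. f (\<lambda>i. \<eta> (s i)))" for s
  proof -
    obtain t where "f = (\<lambda>\<eta>. eval \<eta> t)" using f by (auto simp: poly_fun_def)
    then show ?thesis unfolding poly_fun_def
      by (intro exI[of _ "subst_tm (\<lambda>i. Var (s i)) t"]) simp
  qed
  have "bdd (\<lambda>\<eta>. \<exists>x<f \<eta> + 1. \<exists>y<f \<eta> + 1. f \<eta> = pr x y \<and> R x y \<eta>)"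
    using R by (intro bdd_rules poly_fun_pr f f') simp
  moreover have "(\<exists>x<f \<eta> + 1. \<exists>y<f \<eta> + 1. f \<eta> = pr x y \<and> R x y \<eta>) \<longleftrightarrow> (\<exists>x y. f \<eta> = pr x y \<and> R x y \<eta>)" for \<eta>
    by (auto simp: pr_ge)
  ultimately show ?thesis by simp
qed

lemmas bdd_rules' = bdd_pr poly_fun_pr bdd_rules

class cod =
  fixes enc :: "'a \<Rightarrow> nn"
  assumes enc_inject [simp]: "enc x = enc y \<longleftrightarrow> x = y" and range_enc: "range enc \<in> Sets"

instantiation nn :: cod
begin

definition enc_nn :: "nn \<Rightarrow> nn" where [simp]: "enc_nn x = x"

instance
proof
  have "bdd (\<lambda>\<eta>. \<eta> 0 = \<eta> 0)" by (intro bdd_rules)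
  from Sets_bdd[OF this] show "range (enc :: nn \<Rightarrow> nn) \<in> Sets" by simp
qed simp

end

instantiation prod :: (cod, cod) cod
begin

definition enc_prod :: "'a \<times> 'b \<Rightarrow> nn" where [simp]: "enc_prod p = pr (enc (fst p)) (enc (snd p))"

instance
proof
  fix p q :: "'a \<times> 'b"
  show "enc p = enc q \<longleftrightarrow> p = q" by (auto simp: prod_eq_iff)
next
  let ?A = "range (enc :: 'a \<Rightarrow> nn)" and ?B = "range (enc :: 'b \<Rightarrow> nn)"
  have "bdd (\<lambda>\<eta>. \<exists>x y. \<eta> 0 = pr x y \<and> x \<in> ?A \<and> y \<in> ?B)"
    by (intro bdd_rules' range_enc)
  from Sets_bdd[OF this, of "\<lambda>_. 0"]
  have "{z. \<exists>x y. z = pr x y \<and> x \<in> ?A \<and> y \<in> ?B} \<in> Sets" by simp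
  moreover have "{z. \<exists>x y. z = pr x y \<and> x \<in> ?A \<and> y \<in> ?B} = range (enc :: 'a \<times> 'b \<Rightarrow> nn)"
    by (auto simp: pr_ge image_iff)
  ultimately show "range (enc :: 'a \<times> 'b \<Rightarrow> nn) \<in> Sets" by simp
qed

end

text \<open>
  \<open>D1\<close>, \<open>S1\<close> and \<open>F1\<close> single out the \<open>\<Delta>\<^sub>1\<close> predicates, the \<open>\<Sigma>\<^sub>1\<close> predicates and the \<open>\<Delta>\<^sub>1\<close>
  functions with parameters from \<open>Sets\<close>; by comprehension, the \<open>\<Delta>\<^sub>1\<close> predicates are the members
  of \<open>Sets\<close>.
\<close>

definition D1 :: "('a::cod \<Rightarrow> bool) \<Rightarrow> bool" where
  "D1 P \<longleftrightarrow> (\<exists>X\<in>Sets. \<forall>e. P e \<longleftrightarrow> enc e \<in> X)"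

definition S1 :: "('a::cod \<Rightarrow> bool) \<Rightarrow> bool" where
  "S1 P \<longleftrightarrow> (\<exists>X\<in>Sets. \<forall>e. P e \<longleftrightarrow> (\<exists>y. pr (enc e) y \<in> X))"

definition F1 :: "('a::cod \<Rightarrow> 'b::cod) \<Rightarrow> bool" where
  "F1 f \<longleftrightarrow> S1 (\<lambda>p. snd p = f (fst p))"

lemma D1_I: "{x. P x} \<in> Sets \<Longrightarrow> (\<And>e. Q e \<longleftrightarrow> P (enc e)) \<Longrightarrow> D1 Q"
  unfolding D1_def by (rule bexI[of _ "{x. P x}"]) auto

lemma S1_I: "{x. P x} \<in> Sets \<Longrightarrow> (\<And>e. Q e \<longleftrightarrow> (\<exists>y. P (pr (enc e) y))) \<Longrightarrow> S1 Q"
  unfolding S1_def by (rule bexI[of _ "{x. P x}"]) auto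

lemma D1_not: assumes "D1 P" shows "D1 (\<lambda>e. \<not> P e)"
proof -
  obtain X where X: "X \<in> Sets" "\<And>e. P e \<longleftrightarrow> enc e \<in> X" using assms by (auto simp: D1_def)
  have "bdd (\<lambda>\<eta>. \<not> \<eta> 0 \<in> X)" by (intro bdd_rules' X)
  from Sets_bdd[OF this] have "{x. x \<notin> X} \<in> Sets" by simp
  then show ?thesis by (rule D1_I) (simp add: X)
qed

lemma D1_conj: assumes "D1 P" "D1 Q" shows "D1 (\<lambda>e. P e \<and> Q e)"
proof -
  obtain X where X: "X \<in> Sets" "\<And>e. P e \<longleftrightarrow> enc e \<in> X" using assms by (auto simp: D1_def)
  obtain Y where Y: "Y \<in> Sets" "\<And>e. Q e \<longleftrightarrow> enc e \<in> Y" using assms by (auto simp: D1_def)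
  have "bdd (\<lambda>\<eta>. \<eta> 0 \<in> X \<and> \<eta> 0 \<in> Y)" by (intro bdd_rules' X Y)
  from Sets_bdd[OF this] have "{x. x \<in> X \<and> x \<in> Y} \<in> Sets" by simp
  then show ?thesis by (rule D1_I) (simp add: X Y)
qed

lemma D1_imp: "D1 P \<Longrightarrow> D1 Q \<Longrightarrow> D1 (\<lambda>e. P e \<longrightarrow> Q e)"
  using D1_not[OF D1_conj[OF _ D1_not, of P Q]] by simp

lemma D1_disj: "D1 P \<Longrightarrow> D1 Q \<Longrightarrow> D1 (\<lambda>e. P e \<or> Q e)"
  using D1_imp[OF D1_not, of P Q] by (simp add: disj_imp)

lemma D1_iff: "D1 P \<Longrightarrow> D1 Q \<Longrightarrow> D1 (\<lambda>e. P e \<longleftrightarrow> Q e)"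
  using D1_conj[OF D1_imp[of P Q] D1_imp[of Q P]] by (simp add: iff_conv_conj_imp)

lemma D1_S1: assumes "D1 P" shows "S1 P"
proof -
  obtain X where X: "X \<in> Sets" "\<And>e. P e \<longleftrightarrow> enc e \<in> X" using assms by (auto simp: D1_def)
  have "bdd (\<lambda>\<eta>. \<exists>e y. \<eta> 0 = pr e y \<and> e \<in> X)"
    by (intro bdd_rules' X)
  from Sets_bdd[OF this, of "\<lambda>_. 0"] have "{u. \<exists>e y. u = pr e y \<and> e \<in> X} \<in> Sets" by simp
  then show ?thesis by (rule S1_I) (auto simp: X pr_ge)
qed

lemma S1_conj: assumes "S1 P" "S1 Q" shows "S1 (\<lambda>e. P e \<and> Q e)"
proof -
  obtain X where X: "X \<in> Sets" "\<And>e. P e \<longleftrightarrow> (\<exists>y. pr (enc e) y \<in> X)"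
    using assms by (auto simp: S1_def)
  obtain Y where Y: "Y \<in> Sets" "\<And>e. Q e \<longleftrightarrow> (\<exists>y. pr (enc e) y \<in> Y)"
    using assms by (auto simp: S1_def)
  have "bdd (\<lambda>\<eta>. \<exists>e w. \<eta> 0 = pr e w \<and> (\<exists>y z. w = pr y z \<and> pr e y \<in> X \<and> pr e z \<in> Y))"
    by (intro bdd_rules' X Y)
  from Sets_bdd[OF this, of "\<lambda>_. 0"] have "{u. \<exists>e w. u = pr e w \<and> (\<exists>y z. w = pr y z \<and> pr e y \<in> X \<and> pr e z \<in> Y)} \<in> Sets" by simp
  then show ?thesis by (rule S1_I) (auto simp: X Y pr_ge)
qed

lemma S1_ex: fixes P :: "'a::cod \<times> 'b::cod \<Rightarrow> bool" assumes "S1 P" shows "S1 (\<lambda>e. \<exists>b. P (e, b))"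
proof -
  obtain X where X: "X \<in> Sets" "\<And>e. P e \<longleftrightarrow> (\<exists>y. pr (enc e) y \<in> X)"
    using assms by (auto simp: S1_def)
  have "bdd (\<lambda>\<eta>. \<exists>e w. \<eta> 0 = pr e w \<and>
     (\<exists>b y. w = pr b y \<and> pr (pr e b) y \<in> X \<and> b \<in> range (enc :: 'b \<Rightarrow> nn)))"
    by (intro bdd_rules' X range_enc)
  from Sets_bdd[OF this, of "\<lambda>_. 0"] have "{u. \<exists>e w. u = pr e w \<and>
     (\<exists>b y. w = pr b y \<and> pr (pr e b) y \<in> X \<and> b \<in> range (enc :: 'b \<Rightarrow> nn))} \<in> Sets" by simp
  then show ?thesis by (rule S1_I) (auto simp: X pr_ge)
qed

lemma S1_drop: assumes "S1 P"
  shows "S1 (\<lambda>q. P (fst q))" "S1 (\<lambda>q. P (snd q))"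
proof -
  obtain X where X: "X \<in> Sets" "\<And>e. P e \<longleftrightarrow> (\<exists>y. pr (enc e) y \<in> X)"
    using assms by (auto simp: S1_def)
  have "bdd (\<lambda>\<eta>. \<exists>p y. \<eta> 0 = pr p y \<and> (\<exists>e b. p = pr e b \<and> pr e y \<in> X))"
    by (intro bdd_rules' X)
  from Sets_bdd[OF this, of "\<lambda>_. 0"] have "{u. \<exists>p y. u = pr p y \<and> (\<exists>e b. p = pr e b \<and> pr e y \<in> X)} \<in> Sets" by simp
  then show "S1 (\<lambda>q. P (fst q))" by (rule S1_I) (auto simp: X pr_ge)
  have "bdd (\<lambda>\<eta>. \<exists>p y. \<eta> 0 = pr p y \<and> (\<exists>e b. p = pr e b \<and> pr b y \<in> X))"
    by (intro bdd_rules' X)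
  from Sets_bdd[OF this, of "\<lambda>_. 0"] have "{u. \<exists>p y. u = pr p y \<and> (\<exists>e b. p = pr e b \<and> pr b y \<in> X)} \<in> Sets" by simp
  then show "S1 (\<lambda>q. P (snd q))" by (rule S1_I) (auto simp: X pr_ge)
qed

lemma S1_drop_inner: assumes "S1 P"
  shows "S1 (\<lambda>q. P (fst q, fst (snd q)))" "S1 (\<lambda>q. P (fst q, snd (snd q)))"
proof -
  obtain X where X: "X \<in> Sets" "\<And>e. P e \<longleftrightarrow> (\<exists>y. pr (enc e) y \<in> X)"
    using assms by (auto simp: S1_def)
  have "bdd (\<lambda>\<eta>. \<exists>p y. \<eta> 0 = pr p y \<and>
     (\<exists>e q. p = pr e q \<and> (\<exists>a b. q = pr a b \<and> pr (pr e a) y \<in> X)))"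
    by (intro bdd_rules' X)
  from Sets_bdd[OF this, of "\<lambda>_. 0"] have "{u. \<exists>p y. u = pr p y \<and>
     (\<exists>e q. p = pr e q \<and> (\<exists>a b. q = pr a b \<and> pr (pr e a) y \<in> X))} \<in> Sets" by simp
  then show "S1 (\<lambda>q. P (fst q, fst (snd q)))" by (rule S1_I) (auto simp: X pr_ge)
  have "bdd (\<lambda>\<eta>. \<exists>p y. \<eta> 0 = pr p y \<and>
     (\<exists>e q. p = pr e q \<and> (\<exists>a b. q = pr a b \<and> pr (pr e b) y \<in> X)))"
    by (intro bdd_rules' X)
  from Sets_bdd[OF this, of "\<lambda>_. 0"] have "{u. \<exists>p y. u = pr p y \<and>
     (\<exists>e q. p = pr e q \<and> (\<exists>a b. q = pr a b \<and> pr (pr e b) y \<in> X))} \<in> Sets" by simp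
  then show "S1 (\<lambda>q. P (fst q, snd (snd q)))" by (rule S1_I) (auto simp: X pr_ge)
qed

lemma S1_comp: assumes "S1 P" "F1 f" shows "S1 (\<lambda>e. P (f e))"
  using S1_ex[OF S1_conj[OF assms(2)[unfolded F1_def] S1_drop(2)[OF assms(1)]]] by simp

lemma D1_CA: assumes "S1 P" "S1 (\<lambda>e. \<not> P e)" shows "D1 P"
proof -
  obtain X where X: "X \<in> Sets" "\<And>e. P e \<longleftrightarrow> (\<exists>y. pr (enc e) y \<in> X)"
    using assms by (auto simp: S1_def)
  obtain Y where Y: "Y \<in> Sets" "\<And>e. \<not> P e \<longleftrightarrow> (\<exists>y. pr (enc e) y \<in> Y)"
    using assms by (auto simp: S1_def)
  let ?R = "range (enc :: 'a \<Rightarrow> nn)"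
  have "{x. \<exists>y. x \<in> ?R \<and> pr x y \<in> X} \<in> Sets"
  proof -
    have "bdd (\<lambda>\<eta>. \<eta> 1 \<in> ?R \<and> pr (\<eta> 1) (\<eta> 0) \<in> X)"
      and "bdd (\<lambda>\<eta>. \<eta> 1 \<in> ?R \<and> \<not> pr (\<eta> 1) (\<eta> 0) \<in> Y)"
      by (intro bdd_rules' X Y range_enc)+
    from bdd_comprehension[OF this, of "\<lambda>_. 0"] show ?thesis
      using X(2) Y(2) by (fastforce simp: image_iff)
  qed
  then show ?thesis by (rule D1_I) (simp add: X)
qed

lemma S1_not_graph: assumes "F1 f" "D1 P" shows "S1 (\<lambda>e. \<not> P (f e))"
  using S1_comp[OF D1_S1[OF D1_not[OF assms(2)]] assms(1)] .

lemma D1_comp: assumes "D1 P" "F1 f" shows "D1 (\<lambda>e. P (f e))"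
  by (rule D1_CA[OF S1_comp[OF D1_S1[OF assms(1)] assms(2)] S1_not_graph[OF assms(2,1)]])

lemma F1_Pair: assumes "F1 f" "F1 g" shows "F1 (\<lambda>e. (f e, g e))"
  using S1_conj[OF S1_drop_inner(1)[OF assms(1)[unfolded F1_def]]
      S1_drop_inner(2)[OF assms(2)[unfolded F1_def]]]
  unfolding F1_def by (simp add: prod_eq_iff)

lemma F1_id: "F1 (\<lambda>e. e)"
proof -
  have "bdd (\<lambda>\<eta>. \<exists>x y. \<eta> 0 = pr x y \<and> x = y)" by (intro bdd_rules')
  from Sets_bdd[OF this, of "\<lambda>_. 0"] have "{u. \<exists>x y. u = pr x y \<and> x = y} \<in> Sets" by simp
  then have "D1 (\<lambda>p :: 'a \<times> 'a. snd p = fst p)" by (rule D1_I) (auto simp: pr_ge)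
  then show ?thesis unfolding F1_def by (rule D1_S1)
qed

lemma F1_const: fixes c :: "'a::cod" shows "F1 (\<lambda>e :: 'b::cod. c)"
proof -
  have "bdd (\<lambda>\<eta>. \<exists>x y. \<eta> 0 = pr x y \<and> y = \<eta> 1)" by (intro bdd_rules')
  from Sets_bdd[OF this, of "\<lambda>_. enc c"] have "{u. \<exists>x y. u = pr x y \<and> y = enc c} \<in> Sets" by simp
  then have "D1 (\<lambda>p :: 'b \<times> 'a. snd p = c)" by (rule D1_I) (auto simp: pr_ge)
  then show ?thesis unfolding F1_def by (rule D1_S1)
qed

lemma F1_fst0: "F1 fst"
proof -
  have "bdd (\<lambda>\<eta>. \<exists>p z. \<eta> 0 = pr p z \<and> (\<exists>x y. p = pr x y \<and> z = x))"
    by (intro bdd_rules')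
  from Sets_bdd[OF this, of "\<lambda>_. 0"] have "{u. \<exists>p z. u = pr p z \<and> (\<exists>x y. p = pr x y \<and> z = x)} \<in> Sets" by simp
  then have "D1 (\<lambda>p :: ('a \<times> 'b) \<times> 'a. snd p = fst (fst p))"
    by (rule D1_I) auto
  then show ?thesis unfolding F1_def by (rule D1_S1)
qed

lemma F1_snd0: "F1 snd"
proof -
  have "bdd (\<lambda>\<eta>. \<exists>p z. \<eta> 0 = pr p z \<and> (\<exists>x y. p = pr x y \<and> z = y))"
    by (intro bdd_rules')
  from Sets_bdd[OF this, of "\<lambda>_. 0"] have "{u. \<exists>p z. u = pr p z \<and> (\<exists>x y. p = pr x y \<and> z = y)} \<in> Sets" by simp
  then have "D1 (\<lambda>p :: ('a \<times> 'b) \<times> 'b. snd p = snd (fst p))"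
    by (rule D1_I) auto
  then show ?thesis unfolding F1_def by (rule D1_S1)
qed

lemma S1_drop_mid: assumes "S1 P" shows "S1 (\<lambda>q. P (fst (fst q), snd q))"
proof -
  obtain X where X: "X \<in> Sets" "\<And>e. P e \<longleftrightarrow> (\<exists>y. pr (enc e) y \<in> X)"
    using assms by (auto simp: S1_def)
  have "bdd (\<lambda>\<eta>. \<exists>p y. \<eta> 0 = pr p y \<and>
     (\<exists>q c. p = pr q c \<and> (\<exists>a b. q = pr a b \<and> pr (pr a c) y \<in> X)))"
    by (intro bdd_rules' X)
  from Sets_bdd[OF this, of "\<lambda>_. 0"] have "{u. \<exists>p y. u = pr p y \<and>
     (\<exists>q c. p = pr q c \<and> (\<exists>a b. q = pr a b \<and> pr (pr a c) y \<in> X))} \<in> Sets" by simp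
  then show ?thesis by (rule S1_I) (auto simp: X pr_ge)
qed

lemma F1_comp:
  fixes g :: "'a::cod \<Rightarrow> 'b::cod" and f :: "'c::cod \<Rightarrow> 'a"
  assumes "F1 g" "F1 f" shows "F1 (\<lambda>e. g (f e))"
proof -
  have "F1 (\<lambda>p :: 'c \<times> 'b. f (fst p))"
    using S1_drop_mid[OF assms(2)[unfolded F1_def]] unfolding F1_def by simp
  from S1_comp[OF assms(1)[unfolded F1_def] F1_Pair[OF this F1_snd0]]
  show ?thesis unfolding F1_def by simp
qed

lemma F1_fst: "F1 f \<Longrightarrow> F1 (\<lambda>e. fst (f e))" and F1_snd: "F1 f \<Longrightarrow> F1 (\<lambda>e. snd (f e))"
  by (rule F1_comp[OF F1_fst0], assumption) (rule F1_comp[OF F1_snd0], assumption)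

lemma D1_comp2:
  assumes "D1 (\<lambda>p. R (fst p) (snd p))" "F1 f" "F1 g"
  shows "D1 (\<lambda>e. R (f e) (g e))"
  using D1_comp[OF assms(1) F1_Pair[OF assms(2) assms(3)]] by (simp only: fst_conv snd_conv)

lemma D1_comp3:
  assumes "D1 (\<lambda>p. R (fst p) (fst (snd p)) (snd (snd p)))" "F1 f" "F1 g" "F1 h"
  shows "D1 (\<lambda>e. R (f e) (g e) (h e))"
  using D1_comp[OF assms(1) F1_Pair[OF assms(2) F1_Pair[OF assms(3) assms(4)]]] by (simp only: fst_conv snd_conv)

lemma S1_comp3:
  assumes "S1 (\<lambda>p. R (fst p) (fst (snd p)) (snd (snd p)))" "F1 f" "F1 g" "F1 h"
  shows "S1 (\<lambda>e. R (f e) (g e) (h e))"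
  using S1_comp[OF assms(1) F1_Pair[OF assms(2) F1_Pair[OF assms(3) assms(4)]]] by (simp only: fst_conv snd_conv)

lemma F1_comp2:
  assumes "F1 (\<lambda>p. R (fst p) (snd p))" "F1 f" "F1 g"
  shows "F1 (\<lambda>e. R (f e) (g e))"
  using F1_comp[OF assms(1) F1_Pair[OF assms(2) assms(3)]] by (simp only: fst_conv snd_conv)

lemma F1_comp3:
  assumes "F1 (\<lambda>p. R (fst p) (fst (snd p)) (snd (snd p)))" "F1 f" "F1 g" "F1 h"
  shows "F1 (\<lambda>e. R (f e) (g e) (h e))"
  using F1_comp[OF assms(1) F1_Pair[OF assms(2) F1_Pair[OF assms(3) assms(4)]]] by (simp only: fst_conv snd_conv)

lemma D1_graph: "F1 f \<Longrightarrow> D1 (\<lambda>p. snd p = f (fst p))" for f :: "'a::cod \<Rightarrow> 'b::cod"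
proof -
  assume f: "F1 f"
  have "bdd (\<lambda>\<eta>. \<exists>x y. \<eta> 0 = pr x y \<and> x = y)" by (intro bdd_rules')
  from Sets_bdd[OF this, of "\<lambda>_. 0"] have "{u. \<exists>x y. u = pr x y \<and> x = y} \<in> Sets" by simp
  then have eq: "D1 (\<lambda>p :: 'b \<times> 'b. snd p = fst p)" by (rule D1_I) (auto simp: pr_ge)
  from D1_comp[OF this F1_Pair[OF F1_comp[OF f F1_fst[OF F1_id]] F1_snd[OF F1_id]]]
  show ?thesis by simp
qed

lemma D1_eq: "F1 f \<Longrightarrow> F1 g \<Longrightarrow> D1 (\<lambda>e. f e = g e)"
  using D1_comp[OF D1_graph[of f] F1_Pair[OF F1_id, of g]]
  by (simp only: fst_conv snd_conv eq_commute[of "f _"])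

lemma D1_less: assumes "F1 f" "F1 g" shows "D1 (\<lambda>e. f e < (g e :: nn))"
proof -
  have "bdd (\<lambda>\<eta>. \<exists>x y. \<eta> 0 = pr x y \<and> x < y)"
    by (intro bdd_rules')
  from Sets_bdd[OF this, of "\<lambda>_. 0"] have "{u. \<exists>x y. u = pr x y \<and> x < y} \<in> Sets" by simp
  then have "D1 (\<lambda>p. fst p < (snd p :: nn))" by (rule D1_I) (auto simp: pr_ge)
  then show ?thesis by (rule D1_comp2) fact+
qed

lemma D1_le: "F1 f \<Longrightarrow> F1 g \<Longrightarrow> D1 (\<lambda>e. f e \<le> (g e :: nn))"
  using D1_not[OF D1_less, of g f] by (simp add: not_less)

lemma D1_mem: "F1 f \<Longrightarrow> X \<in> Sets \<Longrightarrow> D1 (\<lambda>e. f e \<in> X)" for f :: "_ \<Rightarrow> nn"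
  by (rule D1_comp[of "\<lambda>x. x \<in> X"]) (auto simp: D1_def)

lemma D1_const: "D1 (\<lambda>e. b)"
proof (cases b)
  case True
  then show ?thesis using D1_eq[OF F1_id F1_id] by simp
next
  case False
  then show ?thesis using D1_not[OF D1_eq[OF F1_id F1_id]] by simp
qed

lemma D1_Sets: "D1 P \<Longrightarrow> {x. P x} \<in> Sets" for P :: "nn \<Rightarrow> bool"
  by (auto simp: D1_def)

lemma F1_poly:
  assumes "F1 f" "F1 g"
  shows "F1 (\<lambda>e. f e + g e :: nn)" "F1 (\<lambda>e. f e * g e :: nn)" "F1 (\<lambda>e. pr (f e) (g e))"
proof -
  have "bdd (\<lambda>\<eta>. \<exists>p z. \<eta> 0 = pr p z \<and> (\<exists>x y. p = pr x y \<and> z = x + y))"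
    by (intro bdd_rules')
  from Sets_bdd[OF this, of "\<lambda>_. 0"] have "{u. \<exists>p z. u = pr p z \<and> (\<exists>x y. p = pr x y \<and> z = x + y)} \<in> Sets"
    by simp
  then have "D1 (\<lambda>p. snd p = fst (fst p) + (snd (fst p) :: nn))" by (rule D1_I) (auto simp: pr_ge)
  then have "F1 (\<lambda>p. fst p + snd p :: nn)" unfolding F1_def by (rule D1_S1)
  then show add: "F1 (\<lambda>e. f e + g e)" by (rule F1_comp2) fact+
  have "bdd (\<lambda>\<eta>. \<exists>p z. \<eta> 0 = pr p z \<and> (\<exists>x y. p = pr x y \<and> z = x * y))"
    by (intro bdd_rules')
  from Sets_bdd[OF this, of "\<lambda>_. 0"] have "{u. \<exists>p z. u = pr p z \<and> (\<exists>x y. p = pr x y \<and> z = x * y)} \<in> Sets"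
    by simp
  then have "D1 (\<lambda>p. snd p = fst (fst p) * (snd (fst p) :: nn))" by (rule D1_I) (auto simp: pr_ge)
  then have "F1 (\<lambda>p. fst p * snd p :: nn)" unfolding F1_def by (rule D1_S1)
  then show "F1 (\<lambda>e. f e * g e)" by (rule F1_comp2) fact+
  have "bdd (\<lambda>\<eta>. \<exists>p z. \<eta> 0 = pr p z \<and> (\<exists>x y. p = pr x y \<and> z = pr x y))"
    by (intro bdd_rules')
  from Sets_bdd[OF this, of "\<lambda>_. 0"] have "{u. \<exists>p z. u = pr p z \<and> (\<exists>x y. p = pr x y \<and> z = pr x y)} \<in> Sets"
    by simp
  then have "D1 (\<lambda>p. snd p = pr (fst (fst p)) (snd (fst p)))" by (rule D1_I) (auto simp: pr_ge)
  then have "F1 (\<lambda>p. pr (fst p) (snd p))" unfolding F1_def by (rule D1_S1)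
  then show "F1 (\<lambda>e. pr (f e) (g e))" by (rule F1_comp2) fact+
qed

lemma D1_all_less:
  assumes "F1 b" "D1 (\<lambda>p. P (fst p) (snd p))" shows "D1 (\<lambda>e. \<forall>y<b e. P e (y::nn))"
proof -
  obtain X where X: "X \<in> Sets" "\<And>e y. P e y \<longleftrightarrow> pr (enc e) y \<in> X" using assms(2) by (auto simp: D1_def)
  have "bdd (\<lambda>\<eta>. \<exists>e b. \<eta> 0 = pr e b \<and> (\<forall>y<b. pr e y \<in> X))"
    by (intro bdd_rules' X)
  from Sets_bdd[OF this, of "\<lambda>_. 0"]
  have "{u. \<exists>e b. u = pr e b \<and> (\<forall>y<b. pr e y \<in> X)} \<in> Sets" by simp
  then have "D1 (\<lambda>p. \<forall>y<snd p. P (fst p) y)" by (rule D1_I) (auto simp: pr_ge X)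
  from D1_comp2[of "\<lambda>e b. \<forall>y<b. P e y", OF this F1_id assms(1)] show ?thesis .
qed

lemma D1_ex_less: "F1 b \<Longrightarrow> D1 (\<lambda>p. P (fst p) (snd p)) \<Longrightarrow> D1 (\<lambda>e. \<exists>y<b e. P e (y::nn))"
  using D1_not[OF D1_all_less[OF _ D1_not, of b P]] by simp

lemma D1_all_le: "F1 b \<Longrightarrow> D1 (\<lambda>p. P (fst p) (snd p)) \<Longrightarrow> D1 (\<lambda>e. \<forall>y\<le>b e. P e (y::nn))"
  using D1_all_less[OF F1_poly(1)[OF _ F1_const[of 1]], of b P] by simp

lemma D1_ex_le: "F1 b \<Longrightarrow> D1 (\<lambda>p. P (fst p) (snd p)) \<Longrightarrow> D1 (\<lambda>e. \<exists>y\<le>b e. P e (y::nn))"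
  using D1_ex_less[OF F1_poly(1)[OF _ F1_const[of 1]], of b P] by simp

lemma S1_exI: "S1 (\<lambda>p. P (fst p) (snd p)) \<Longrightarrow> S1 (\<lambda>e. \<exists>y. P e y)"
  using S1_ex[of "\<lambda>p. P (fst p) (snd p)"] by (simp only: fst_conv snd_conv)

lemma S1_normal_form:
  fixes P :: "'a::cod \<Rightarrow> bool"
  assumes "S1 P"
  obtains Q :: "'a \<Rightarrow> nn \<Rightarrow> bool" where "D1 (\<lambda>p. Q (fst p) (snd p))" "\<And>e. P e \<longleftrightarrow> (\<exists>y. Q e y)"
proof -
  obtain X where X: "X \<in> Sets" "\<And>e. P e \<longleftrightarrow> (\<exists>y. pr (enc e) y \<in> X)"
    using assms by (auto simp: S1_def)
  have "D1 (\<lambda>p. pr (enc (fst p)) (snd p) \<in> X)"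
    unfolding D1_def by (rule bexI[OF _ X(1)]) simp
  with X(2) that[of "\<lambda>e y. pr (enc e) y \<in> X"] show ?thesis by blast
qed

lemma S1_disj: assumes "S1 P" "S1 Q" shows "S1 (\<lambda>e. P e \<or> Q e)"
proof -
  obtain P' where P: "D1 (\<lambda>p. P' (fst p) (snd p))" "\<And>e. P e \<longleftrightarrow> (\<exists>y::nn. P' e y)"
    by (rule S1_normal_form[OF assms(1)]) blast
  obtain Q' where Q: "D1 (\<lambda>p. Q' (fst p) (snd p))" "\<And>e. Q e \<longleftrightarrow> (\<exists>y::nn. Q' e y)"
    by (rule S1_normal_form[OF assms(2)]) blast
  have "S1 (\<lambda>e. \<exists>y. P' e y \<or> Q' e y)"
    by (rule S1_exI, rule D1_S1, rule D1_disj) (rule P Q)+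
  then show ?thesis by (simp add: P Q ex_disj_distrib)
qed

lemmas D1_logic = D1_not D1_conj D1_disj D1_imp D1_iff D1_all_less D1_ex_less D1_all_le D1_ex_le
  D1_less D1_le D1_eq
lemmas S1_logic = S1_conj S1_disj S1_exI
lemmas F1_rules = F1_id F1_const F1_fst F1_snd F1_Pair F1_poly

section \<open>Induction in the model\<close>

lemma S1_induct [consumes 1, case_names zero succ]:
  assumes P: "S1 P" and "P 0" "\<And>x. P x \<Longrightarrow> P (x + 1)" shows "P (x :: nn)"
proof -
  obtain X where X: "X \<in> Sets" "\<And>e. P e \<longleftrightarrow> (\<exists>y. pr e y \<in> X)"
    using assms(1) by (auto simp: S1_def)
  have "bdd (\<lambda>\<eta>. pr (\<eta> 1) (\<eta> 0) \<in> X)" by (intro bdd_rules' X)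
  from bdd_induct[OF this, of "\<lambda>_. 0" x] show ?thesis using assms(2,3) by (simp add: X)
qed

lemma collection:
  assumes P: "D1 (\<lambda>p. P (fst p) (snd p))" and ex: "\<And>x. x < n \<Longrightarrow> \<exists>y. P x y"
  shows "\<exists>b. \<forall>x<n. \<exists>y<b::nn. P (x::nn) y"
proof -
  have "S1 (\<lambda>k. \<exists>b. \<forall>x<k. x < n \<longrightarrow> (\<exists>y<b. P x y))"
    by (intro S1_logic D1_S1 D1_logic F1_rules D1_comp2[OF P])
  then have "\<exists>b. \<forall>x<n. x < n \<longrightarrow> (\<exists>y<b. P x y)"
  proof (induction n rule: S1_induct)
    case (succ k)
    then obtain b where b: "\<forall>x<k. x < n \<longrightarrow> (\<exists>y<b. P x y)" by blast
    show ?case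
    proof (cases "k < n")
      case True
      then obtain y where "P k y" using ex by blast
      have "\<exists>y'<b + y + 1. P x y'" if x: "x < k + 1" "x < n" for x
      proof (cases "x < k")
        case True
        then obtain y' where "y' < b" "P x y'" using b x(2) by blast
        then show ?thesis by (intro exI[of _ y']) (simp add: add_increasing2 less_imp_le)
      next
        case False
        then have "x = k" using x by (simp add: le_less)
        then show ?thesis using \<open>P k y\<close> by (intro exI[of _ y]) (simp add: add_increasing)
      qed
      then have "\<forall>x<k + 1. x < n \<longrightarrow> (\<exists>y'<b + y + 1. P x y')" by blast
      then show ?thesis ..
    next
      case False
      then show ?thesis using b by (auto simp: le_less)
    qed
  qed simp
  then show ?thesis by blast
qed

lemma S1_all_less:
  assumes "F1 b" "S1 (\<lambda>p. P (fst p) (snd p))" shows "S1 (\<lambda>e. \<forall>y<b e. P e (y::nn))"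
proof -
  obtain Q where Q: "D1 (\<lambda>p. Q (fst p) (snd p))" and PQ: "\<And>e. P (fst e) (snd e) \<longleftrightarrow> (\<exists>y::nn. Q e y)"
    by (rule S1_normal_form[OF assms(2)]) blast
  have "S1 (\<lambda>e. \<exists>c. \<forall>y<b e. \<exists>z<c. Q (e, y) z)"
    by (intro S1_logic D1_S1 D1_logic F1_rules D1_comp2[OF Q] F1_comp[OF assms(1)])
  moreover have "(\<forall>y<b e. P e y) \<longleftrightarrow> (\<exists>c. \<forall>y<b e. \<exists>z<c. Q (e, y) z)" for e
  proof
    assume "\<forall>y<b e. P e y"
    then have "\<exists>z. Q (e, y) z" if "y < b e" for y using that PQ[of "(e, y)"] by auto
    moreover have "D1 (\<lambda>p. Q (e, fst p) (snd p))" by (intro D1_comp2[OF Q] F1_rules)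
    ultimately show "\<exists>c. \<forall>y<b e. \<exists>z<c. Q (e, y) z" using collection[of "\<lambda>y z. Q (e, y) z"] by blast
  next
    assume "\<exists>c. \<forall>y<b e. \<exists>z<c. Q (e, y) z"
    then show "\<forall>y<b e. P e y" using PQ[of "(e, y)" for y] by auto
  qed
  ultimately show ?thesis by simp
qed

lemma S1_less_induct [consumes 1, case_names less]:
  assumes P: "S1 P" and step: "\<And>x. (\<And>y. y < x \<Longrightarrow> P y) \<Longrightarrow> P x" shows "P (x :: nn)"
proof -
  have "S1 (\<lambda>x. \<forall>y<x. P y)"
    by (intro S1_all_less F1_rules S1_comp[OF P])
  then have "\<forall>y<z. P y" for z
  proof (induction z rule: S1_induct)
    case (succ x)
    then show ?case using step by (auto simp: le_less)
  qed simp
  from this[of "x + 1"] show ?thesis by simp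
qed

lemmas D1_less_induct [consumes 1, case_names less] = S1_less_induct[OF D1_S1]
lemmas D1_induct [consumes 1, case_names zero succ] = S1_induct[OF D1_S1]

lemma D1_LeastI:
  assumes P: "D1 P" and ex: "P x" shows "P (LEAST x::nn. P x)" "(LEAST x. P x) \<le> x"
proof -
  have "\<exists>x. P x \<and> (\<forall>y<x. \<not> P y)"
  proof (rule ccontr)
    assume *: "\<nexists>x. P x \<and> (\<forall>y<x. \<not> P y)"
    have "D1 (\<lambda>x. \<not> P x)" by (intro D1_logic P)
    then have "\<not> P x" by (induction x rule: D1_less_induct) (use * in blast)
    then show False using ex by simp
  qed
  then obtain m where m: "P m" "\<And>y. y < m \<Longrightarrow> \<not> P y" by blast
  then have "(LEAST x. P x) = m" by (intro Least_equality) (auto simp: not_less[symmetric])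
  then show "P (LEAST x::nn. P x)" "(LEAST x. P x) \<le> x" using m ex by (auto simp: not_less[symmetric])
qed

lemma F1_Least:
  assumes P: "D1 (\<lambda>p. P (fst p) (snd p))" and ex: "\<And>e. \<exists>y. P e y"
  shows "F1 (\<lambda>e. LEAST y::nn. P e y)"
proof -
  have "D1 (\<lambda>y. P e y)" for e by (intro D1_comp2[OF P] F1_rules)
  then have "y = (LEAST y. P e y) \<longleftrightarrow> P e y \<and> (\<forall>z<y. \<not> P e z)" for e y
    using D1_LeastI ex[of e] Least_equality[of "P e"] not_less by metis
  moreover have "D1 (\<lambda>p. P (fst p) (snd p) \<and> (\<forall>z<snd p. \<not> P (fst p) z))"
    by (intro D1_logic F1_rules D1_comp2[OF P])
  ultimately show ?thesis unfolding F1_def by (intro D1_S1) simp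
qed

lemma F1_if: assumes "D1 P" "F1 f" "F1 g" shows "F1 (\<lambda>e. if P e then f e else g e)"
proof -
  have "S1 (\<lambda>p. P (fst p) \<and> snd p = f (fst p) \<or> \<not> P (fst p) \<and> snd p = g (fst p))"
    by (intro D1_S1 D1_logic F1_rules D1_comp[OF assms(1)] F1_comp[OF assms(2)] F1_comp[OF assms(3)])
  then show ?thesis unfolding F1_def by (rule back_subst[of S1]) auto
qed

lemma F1_by_graph:
  assumes "S1 (\<lambda>p. R (fst p) (snd p))" "\<And>e y. R e y \<longleftrightarrow> y = f e" shows "F1 f"
  using assms unfolding F1_def by simp

section \<open>Coded finite sets\<close>

definition fs :: "nn \<Rightarrow> nn set" where
  "fs a = {x. \<exists>k m q. a = pr k (pr m q) \<and> x < k \<and> (m * (x + 1) + 1) dvd q}"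

lemma fs_bound: "x \<in> fs a \<Longrightarrow> x < a"
  using pr_ge by (auto simp: fs_def intro: less_le_trans)

lemma dvd_bound: "x * y = q \<Longrightarrow> 0 < x \<Longrightarrow> y \<le> (q::nn)"
  using mult_right_mono[of 1 x y] by (auto simp: zero_less_iff) (metis nn_cases add.commute less_one_iff not_less)

lemma D1_dvd: assumes "F1 f" "F1 g" shows "D1 (\<lambda>e. f e + 1 dvd (g e :: nn))"
proof -
  have "D1 (\<lambda>e. \<exists>r\<le>g e. (f e + 1) * r = g e)"
    by (intro D1_logic F1_rules F1_comp[OF assms(1)] F1_comp[OF assms(2)] assms)
  moreover have "(\<exists>r\<le>g e. (f e + 1) * r = g e) \<longleftrightarrow> f e + 1 dvd g e" for e
  proof
    assume "f e + 1 dvd g e"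
    then obtain r where "(f e + 1) * r = g e" by (auto simp: dvd_def)
    moreover from this have "r \<le> g e" by (rule dvd_bound) (simp add: zero_less_iff)
    ultimately show "\<exists>r\<le>g e. (f e + 1) * r = g e" by blast
  qed (metis dvd_triv_left)
  ultimately show ?thesis by simp
qed

lemma D1_fs: assumes "F1 f" "F1 g" shows "D1 (\<lambda>e. f e \<in> fs (g e))"
proof -
  have "D1 (\<lambda>p. \<exists>k\<le>snd p. \<exists>m\<le>snd p. \<exists>q\<le>snd p.
      snd p = pr k (pr m q) \<and> fst p < k \<and> m * (fst p + 1) + 1 dvd q)"
    by (intro D1_logic F1_rules D1_dvd)
  moreover have "(\<exists>k\<le>a. \<exists>m\<le>a. \<exists>q\<le>a. a = pr k (pr m q) \<and> x < k \<and> m * (x + 1) + 1 dvd q)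
    \<longleftrightarrow> x \<in> fs a" for a x
  proof
    assume "x \<in> fs a"
    then obtain k m q where *: "a = pr k (pr m q)" "x < k" "m * (x + 1) + 1 dvd q"
      by (auto simp: fs_def)
    have "k \<le> a" "m \<le> a" "q \<le> a"
      unfolding *(1) using pr_ge order_trans[OF pr_ge(1) pr_ge(2)] order_trans[OF pr_ge(2) pr_ge(2)]
      by auto
    with * show "\<exists>k\<le>a. \<exists>m\<le>a. \<exists>q\<le>a. a = pr k (pr m q) \<and> x < k \<and> m * (x + 1) + 1 dvd q"
      by blast
  qed (auto simp: fs_def)
  ultimately have "D1 (\<lambda>p. fst p \<in> fs (snd p))" by simp
  then show ?thesis by (rule D1_comp2) fact+
qed

lemma fs_Sets: "fs a \<in> Sets"
  using D1_Sets[OF D1_fs[OF F1_id F1_const], of a] by simp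

lemma D1_ball_fs: assumes "F1 a" "D1 (\<lambda>p. P (fst p) (snd p))" shows "D1 (\<lambda>e. \<forall>x\<in>fs (a e). P e x)"
proof -
  have "D1 (\<lambda>e. \<forall>x<a e. x \<in> fs (a e) \<longrightarrow> P e x)"
    by (intro D1_logic F1_rules D1_fs F1_comp[OF assms(1)] assms)
  moreover have "(\<forall>x<a e. x \<in> fs (a e) \<longrightarrow> P e x) \<longleftrightarrow> (\<forall>x\<in>fs (a e). P e x)" for e
    using fs_bound by blast
  ultimately show ?thesis by simp
qed

lemma D1_bex_fs: "F1 a \<Longrightarrow> D1 (\<lambda>p. P (fst p) (snd p)) \<Longrightarrow> D1 (\<lambda>e. \<exists>x\<in>fs (a e). P e x)"
  using D1_not[OF D1_ball_fs[OF _ D1_not, of a P]] by simp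

lemmas D1_rules = D1_ball_fs D1_bex_fs D1_logic D1_fs D1_const

lemma common_multiple: "\<exists>m. 0 < m \<and> (\<forall>i<k. i + 1 dvd (m::nn))"
proof -
  have "S1 (\<lambda>k. \<exists>m. 0 < m \<and> (\<forall>i<k. i + 1 dvd (m::nn)))"
    by (intro S1_exI D1_S1 D1_logic F1_rules D1_dvd)
  then show ?thesis
  proof (induction k rule: S1_induct)
    case zero
    show ?case by (rule exI[of _ 1]) simp
  next
    case (succ k)
    then obtain m where m: "0 < m" "\<forall>i<k. i + 1 dvd m" by blast
    have "0 < m * (k + 1)" using m by (simp add: zero_less_iff)
    moreover have "\<forall>i<k + 1. i + 1 dvd m * (k + 1)" using m by (auto simp: le_less)
    ultimately show ?case by blast
  qed
qed

lemma less_ex_nn: "x < y \<Longrightarrow> \<exists>d. y = x + (d + 1)" for x y :: nn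
  using le_ex_nn[of "x + 1" y] by (auto simp: ac_simps)

lemma beta_coprime:
  assumes xy: "x \<noteq> y" "x < k" "y < k" and m: "\<forall>i<k. i + 1 dvd (m::nn)"
    and dvd: "m * (x + 1) + 1 dvd w * (m * (y + 1) + 1)"
  shows "m * (x + 1) + 1 dvd w"
proof -
  define u v where "u = m * (x + 1) + 1" and "v = m * (y + 1) + 1"
  have "\<exists>d. d dvd m \<and> u dvd w * m * d"
  proof (cases "x < y")
    case True
    then obtain d where d: "y = x + (d + 1)" using less_ex_nn by blast
    have "w * v = w * u + w * m * (d + 1)" by (simp add: u_def v_def d algebra_simps)
    then have "u dvd w * m * (d + 1)"
      using dvd dvd_add_right_iff[of u "w * u"] by (simp add: u_def v_def)
    moreover have "d < x + (d + 1)" "d < y + (d + 1)"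
      by (simp_all add: add_increasing flip: add.assoc)
    then have "d < k" using d xy by (metis less_trans)
    ultimately show ?thesis using m by blast
  next
    case False
    then have "y < x" using xy by simp
    then obtain d where d: "x = y + (d + 1)" using less_ex_nn by blast
    have "w * u = w * v + w * m * (d + 1)" by (simp add: u_def v_def d algebra_simps)
    then have "u dvd w * v + w * m * (d + 1)" by (metis dvd_triv_right)
    then have "u dvd w * m * (d + 1)"
      using dvd dvd_add_right_iff[of u "w * v"] by (simp add: u_def v_def)
    moreover have "d < x + (d + 1)" "d < y + (d + 1)"
      by (simp_all add: add_increasing flip: add.assoc)
    then have "d < k" using d xy by (metis less_trans)
    ultimately show ?thesis using m by blast
  qed
  then obtain d c where "m = d * c" and d: "u dvd w * m * d" by (auto simp: dvd_def)
  define t where "t = m * (x + 1)"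
  have "u dvd (w * m * d) * (c * (x + 1) * (x + 1))" using d by (rule dvd_mult2)
  also have "\<dots> = w * t * t" by (simp add: t_def \<open>m = d * c\<close> ac_simps)
  finally have "u dvd w * t * t" .
  moreover have "u dvd w * t * t + w * t"
  proof -
    have "w * t * t + w * t = u * (w * t)" by (simp add: u_def t_def algebra_simps)
    then show ?thesis by simp
  qed
  ultimately have "u dvd w * t" by (simp add: dvd_add_right_iff)
  moreover have "u dvd w * t + w"
  proof -
    have "w * t + w = u * w" by (simp add: u_def t_def algebra_simps)
    then show ?thesis by simp
  qed
  ultimately show ?thesis by (simp add: dvd_add_right_iff u_def)
qed

lemma fs_ex: assumes X: "X \<in> Sets" and bound: "\<And>x. x \<in> X \<Longrightarrow> x < k" shows "\<exists>a. fs a = X"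
proof -
  obtain m where m: "0 < m" "\<forall>i<k. i + 1 dvd m" using common_multiple by blast
  have "S1 (\<lambda>j. \<exists>q. \<forall>x<k. m * (x + 1) + 1 dvd q \<longleftrightarrow> x < j \<and> x \<in> X)"
    by (intro S1_exI D1_S1 D1_logic F1_rules D1_dvd D1_mem X)
  then have "\<exists>q. \<forall>x<k. m * (x + 1) + 1 dvd q \<longleftrightarrow> x < j \<and> x \<in> X" for j
  proof (induction j rule: S1_induct)
    case zero
    have "\<not> m * (x + 1) + 1 dvd 1" for x
    proof
      assume "m * (x + 1) + 1 dvd 1"
      then obtain r where r: "1 = (m * (x + 1) + 1) * r" by (auto simp: dvd_def)
      then have "r \<noteq> 0" by auto
      then have "1 \<le> r" using not_less less_one_iff by metis
      then have "(m * (x + 1) + 1) * 1 \<le> (m * (x + 1) + 1) * r" by (intro mult_left_mono) auto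
      then have "m * (x + 1) = 0" using r by simp
      then show False using m by simp
    qed
    then show ?case by (intro exI[of _ 1]) simp
  next
    case (succ j)
    then obtain q where q: "\<forall>x<k. m * (x + 1) + 1 dvd q \<longleftrightarrow> x < j \<and> x \<in> X" by blast
    show ?case
    proof (cases "j \<in> X")
      case True
      have "m * (x + 1) + 1 dvd q * (m * (j + 1) + 1) \<longleftrightarrow> x < j + 1 \<and> x \<in> X" if "x < k" for x
      proof (cases "x = j")
        case True
        then show ?thesis using \<open>j \<in> X\<close> by simp
      next
        case False
        have "m * (x + 1) + 1 dvd q * (m * (j + 1) + 1) \<longleftrightarrow> m * (x + 1) + 1 dvd q"
          by (rule iffI[OF beta_coprime[OF False that bound[OF \<open>j \<in> X\<close>] m(2)] dvd_mult2])
        moreover have "x < j + 1 \<longleftrightarrow> x < j" using False by (simp add: le_less)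
        ultimately show ?thesis using q that by blast
      qed
      then show ?thesis by blast
    next
      case False
      then have "x < j + 1 \<and> x \<in> X \<longleftrightarrow> x < j \<and> x \<in> X" for x by (auto simp: le_less)
      then show ?thesis using q by blast
    qed
  qed
  from this[of k] obtain q where "\<forall>x<k. m * (x + 1) + 1 dvd q \<longleftrightarrow> x < k \<and> x \<in> X" by blast
  moreover have "fs (pr k (pr m q)) = {x. x < k \<and> m * (x + 1) + 1 dvd q}"
    unfolding fs_def pr_inject by blast
  ultimately have "fs (pr k (pr m q)) = X" using bound by blast
  then show ?thesis ..
qed

definition fin :: "nn set \<Rightarrow> bool" where "fin X \<longleftrightarrow> (\<exists>a. X = fs a)"

definition code :: "nn set \<Rightarrow> nn" where "code X = (LEAST a. fs a = X)"

definition isf :: "nn \<Rightarrow> bool" where "isf a \<longleftrightarrow> (\<forall>b<a. fs b \<noteq> fs a)"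

lemma finI: "D1 P \<Longrightarrow> (\<And>x. P x \<Longrightarrow> x < k) \<Longrightarrow> fin {x. P x}"
  unfolding fin_def using fs_ex[OF D1_Sets, of P k] by blast

lemma fin_fs [simp]: "fin (fs a)" by (auto simp: fin_def)

lemma fin_Sets: "fin X \<Longrightarrow> X \<in> Sets" using fs_Sets by (auto simp: fin_def)

lemma fin_bound: "fin X \<Longrightarrow> \<exists>k. \<forall>x\<in>X. x < k" using fs_bound by (auto simp: fin_def)

lemma fs_eq_iff: "fs a = fs b \<longleftrightarrow> (\<forall>x\<in>fs a. x \<in> fs b) \<and> (\<forall>x\<in>fs b. x \<in> fs a)"
  by blast

lemma D1_fs_eq: assumes "F1 f" "F1 g" shows "D1 (\<lambda>e. fs (f e) = fs (g e))"
  unfolding fs_eq_iff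
  by (intro D1_rules F1_rules F1_comp[OF assms(1)] F1_comp[OF assms(2)])

lemma D1_isf: assumes "F1 f" shows "D1 (\<lambda>e. isf (f e))"
proof -
  have "D1 isf" unfolding isf_def by (intro D1_rules F1_rules D1_fs_eq)
  then show ?thesis by (rule D1_comp) fact
qed

lemma code_Least: assumes "fin X" shows fs_code [simp]: "fs (code X) = X" and "fs b = X \<Longrightarrow> code X \<le> b"
proof -
  obtain a where a: "X = fs a" using assms by (auto simp: fin_def)
  have D: "D1 (\<lambda>b. fs b = X)" unfolding a by (intro D1_fs_eq F1_rules)
  show "fs (code X) = X" using D1_LeastI(1)[OF D a[symmetric]] by (simp add: code_def)
  show "fs b = X \<Longrightarrow> code X \<le> b" using D1_LeastI(2)[OF D] by (simp add: code_def)
qed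

lemma isf_code [simp]: "fin X \<Longrightarrow> isf (code X)"
  using code_Least(2) by (auto simp: isf_def not_less[symmetric])

lemma isf_unique: "isf a \<Longrightarrow> isf b \<Longrightarrow> fs a = fs b \<Longrightarrow> a = b"
  unfolding isf_def by (metis linorder_neqE)

lemma code_fs [simp]: "isf a \<Longrightarrow> code (fs a) = a"
  by (rule isf_unique) auto

lemma code_inject: "fin X \<Longrightarrow> fin Y \<Longrightarrow> code X = code Y \<longleftrightarrow> X = Y"
  by (metis fs_code)

lemma code_eq_iff: "fin X \<Longrightarrow> a = code X \<longleftrightarrow> isf a \<and> fs a = X"
  using code_fs fs_code isf_code by metis

lemma F1_code:
  assumes P: "D1 (\<lambda>p. P (fst p) (snd p))" and fin: "\<And>e. fin {x. P e x}" and b: "F1 b"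
    and bound: "\<And>e x. P e x \<Longrightarrow> x < b e"
  shows "F1 (\<lambda>e. code {x. P e x})"
proof (rule F1_by_graph)
  show "S1 (\<lambda>p. isf (snd p) \<and> (\<forall>x\<in>fs (snd p). P (fst p) x) \<and>
    (\<forall>x<b (fst p). P (fst p) x \<longrightarrow> x \<in> fs (snd p)))"
    by (intro D1_S1 D1_rules D1_isf F1_rules D1_comp2[OF P] F1_comp[OF b])
  show "isf y \<and> (\<forall>x\<in>fs y. P e x) \<and> (\<forall>x<b e. P e x \<longrightarrow> x \<in> fs y) \<longleftrightarrow> y = code {x. P e x}" for e y
    unfolding code_eq_iff[OF fin] using bound by blast
qed

lemma fs_0 [simp]: "fs 0 = {}"
  using fs_bound by fastforce

lemma fin_empty [simp]: "fin {}"
  using fin_fs[of 0] by simp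

lemma fin_D1_subset: assumes "fin A" "D1 P" shows "fin {x \<in> A. P x}"
proof -
  obtain k where "\<forall>x\<in>A. x < k" using fin_bound[OF assms(1)] by blast
  then show ?thesis
    by (intro finI[of _ k] D1_rules D1_mem F1_rules fin_Sets assms) auto
qed

lemma fin_lessThan [simp]: "fin {..<k}"
  unfolding lessThan_def by (intro finI[of _ k] D1_rules F1_rules)

lemma fin_Un [simp]: assumes "fin A" "fin B" shows "fin (A \<union> B)"
proof -
  obtain k l where "\<forall>x\<in>A. x < k" "\<forall>x\<in>B. x < l" using assms fin_bound by metis
  then have "fin {x. x \<in> A \<or> x \<in> B}"
    using assms by (intro finI[of _ "max k l"] D1_rules D1_mem F1_rules fin_Sets) (auto simp: less_max_iff_disj)
  then show ?thesis by (simp add: Un_def)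
qed

lemma fin_insert [simp]: assumes "fin A" shows "fin (insert x A)"
proof -
  have "fin {y. y = x}" by (intro finI[of _ "x + 1"] D1_rules F1_rules) simp
  from fin_Un[OF this assms] show ?thesis by simp
qed

lemma fin_Diff [simp]: "fin A \<Longrightarrow> fin B \<Longrightarrow> fin (A - B)"
  using fin_D1_subset[of A "\<lambda>x. x \<notin> B"] by (simp add: set_diff_eq D1_not D1_mem F1_id fin_Sets)

lemma fin_collection:
  assumes "fin A" "F1 f" shows "\<exists>b. \<forall>x\<in>A. f x < (b::nn)"
proof -
  obtain k where k: "\<forall>x\<in>A. x < k" using assms fin_bound by metis
  have "D1 (\<lambda>p. snd p = f (fst p))" by (intro D1_rules F1_rules F1_comp[OF assms(2)])
  from collection[OF this, of k] k show ?thesis by blast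
qed

lemma fin_image: assumes "fin A" "F1 f" shows "fin (f ` A)"
proof -
  obtain b where b: "\<forall>x\<in>A. f x < b" using fin_collection[OF assms] by blast
  have "fin {y. \<exists>x\<in>fs (code A). y = f x}"
    using assms b by (intro finI[of _ b] D1_rules F1_rules F1_comp[OF assms(2)]) auto
  moreover have "{y. \<exists>x\<in>fs (code A). y = f x} = f ` A" using assms by auto
  ultimately show ?thesis by simp
qed

lemma fin_UN: assumes "fin A" "F1 g" shows "fin (\<Union>x\<in>A. fs (g x))"
proof -
  obtain b where b: "\<forall>x\<in>A. g x < b" using fin_collection[OF assms] by blast
  have "fin {y. \<exists>x\<in>fs (code A). y \<in> fs (g x)}"
    using assms b fs_bound less_trans
    by (intro finI[of _ b] D1_rules F1_rules F1_comp[OF assms(2)]) (auto dest!: fs_bound)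
  moreover have "{y. \<exists>x\<in>fs (code A). y \<in> fs (g x)} = (\<Union>x\<in>A. fs (g x))" using assms by auto
  ultimately show ?thesis by simp
qed

lemma F1_code_image:
  assumes f: "F1 (\<lambda>p. f (fst p) (snd p))" and a: "F1 a"
  shows "F1 (\<lambda>e. code (f e ` fs (a e)))"
proof (rule F1_by_graph)
  show "S1 (\<lambda>p. isf (snd p) \<and> (\<forall>y\<in>fs (snd p). \<exists>x\<in>fs (a (fst p)). y = f (fst p) x) \<and>
    (\<forall>x\<in>fs (a (fst p)). f (fst p) x \<in> fs (snd p)))"
    by (intro D1_S1 D1_rules D1_isf F1_rules F1_comp2[OF f] F1_comp[OF a])
  have "F1 (f e)" for e using F1_comp2[OF f F1_const F1_id] .
  then have "fin (f e ` fs (a e))" for e by (intro fin_image) auto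
  then show "isf y \<and> (\<forall>y\<in>fs y. \<exists>x\<in>fs (a e). y = f e x) \<and> (\<forall>x\<in>fs (a e). f e x \<in> fs y) \<longleftrightarrow>
    y = code (f e ` fs (a e))" for e y
    by (subst code_eq_iff) auto
qed

lemma F1_code_UN:
  assumes f: "F1 (\<lambda>p. f (fst p) (snd p))" and a: "F1 a"
  shows "F1 (\<lambda>e. code (\<Union>x\<in>fs (a e). fs (f e x)))"
proof (rule F1_by_graph)
  show "S1 (\<lambda>p. isf (snd p) \<and> (\<forall>y\<in>fs (snd p). \<exists>x\<in>fs (a (fst p)). y \<in> fs (f (fst p) x)) \<and>
    (\<forall>x\<in>fs (a (fst p)). \<forall>y\<in>fs (f (fst p) x). y \<in> fs (snd p)))"
    by (intro D1_S1 D1_rules D1_isf F1_rules F1_comp2[OF f] F1_comp[OF a])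
  have "F1 (f e)" for e using F1_comp2[OF f F1_const F1_id] .
  then have "fin (\<Union>x\<in>fs (a e). fs (f e x))" for e by (intro fin_UN) auto
  then show "isf y \<and> (\<forall>y\<in>fs y. \<exists>x\<in>fs (a e). y \<in> fs (f e x)) \<and>
      (\<forall>x\<in>fs (a e). \<forall>y'\<in>fs (f e x). y' \<in> fs y) \<longleftrightarrow>
    y = code (\<Union>x\<in>fs (a e). fs (f e x))" for e y
    by (subst code_eq_iff) auto
qed

lemma F1_code_Un:
  assumes "F1 f" "F1 g" shows "F1 (\<lambda>e. code (fs (f e) \<union> fs (g e)))"
proof -
  have "fin {x. x \<in> fs (f e) \<or> x \<in> fs (g e)}" for e
    using fin_Un[OF fin_fs fin_fs, of "f e" "g e"] by (simp add: Un_def)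
  then have "F1 (\<lambda>e. code {x. x \<in> fs (f e) \<or> x \<in> fs (g e)})"
    by (intro F1_code[where b="\<lambda>e. f e + g e"] D1_rules F1_rules assms F1_comp[OF assms(1)] F1_comp[OF assms(2)])
      (auto dest!: fs_bound intro: less_le_trans)
  then show ?thesis by (simp add: Un_def)
qed

lemma F1_code_insert:
  assumes "F1 f" "F1 g" shows "F1 (\<lambda>e. code (insert (f e) (fs (g e))))"
proof -
  have eq: "{x. x = f e \<or> x \<in> fs (g e)} = insert (f e) (fs (g e))" for e by auto
  have "fin {x. x = f e \<or> x \<in> fs (g e)}" for e by (simp only: eq fin_insert fin_fs)
  then have "F1 (\<lambda>e. code {x. x = f e \<or> x \<in> fs (g e)})"
    by (intro F1_code[where b="\<lambda>e. f e + g e + 1"] D1_rules F1_rules assms F1_comp[OF assms(1)] F1_comp[OF assms(2)])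
      (auto dest!: fs_bound simp: add_increasing less_imp_le)
  then show ?thesis by (simp only: eq)
qed

lemma F1_code_filter:
  assumes a: "F1 a" and P: "D1 (\<lambda>p. P (fst p) (snd p))" shows "F1 (\<lambda>e. code {x \<in> fs (a e). P e x})"
proof -
  have "D1 (P e)" for e using D1_comp2[OF P F1_const F1_id] .
  then have "fin {x. x \<in> fs (a e) \<and> P e x}" for e by (intro fin_D1_subset) auto
  then show ?thesis
    by (intro F1_code[where b=a] D1_rules F1_rules D1_comp2[OF P] F1_comp[OF a] a) (auto dest!: fs_bound)
qed

lemma fin_induct [consumes 2, case_names empty insert]:
  assumes A: "fin A" and P: "S1 (\<lambda>a. P (fs a))" and "P {}"
    and insert: "\<And>x B. fin B \<Longrightarrow> x \<in> A \<Longrightarrow> B \<subseteq> A \<Longrightarrow> x \<notin> B \<Longrightarrow> P B \<Longrightarrow> P (insert x B)"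
  shows "P A"
proof -
  have fin: "fin {x \<in> A. x < z}" for z using A by (intro fin_D1_subset D1_rules F1_rules)
  have "F1 (\<lambda>z. code {x \<in> fs (code A). x < z})"
    by (intro F1_code_filter F1_rules D1_rules)
  from S1_comp[OF P this] have "S1 (\<lambda>z. P {x \<in> A. x < z})" using fin A by simp
  then have "P {x \<in> A. x < z}" for z
  proof (induction z rule: S1_induct)
    case (succ z)
    have "{x \<in> A. x < z + 1} = (if z \<in> A then insert z {x \<in> A. x < z} else {x \<in> A. x < z})"
      by (auto simp: le_less)
    then show ?case using succ insert[OF fin, of z z] by auto
  qed (simp add: \<open>P {}\<close>)
  moreover obtain k where "\<forall>x\<in>A. x < k" using fin_bound[OF A] by blast
  then have "{x \<in> A. x < k} = A" by blast
  ultimately show ?thesis by metis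
qed

section \<open>Recursion in the model\<close>

lemma prim_rec:
  fixes g :: "'a::cod \<Rightarrow> nn"
  assumes g: "F1 g" and h: "F1 (\<lambda>p. h (fst p) (fst (snd p)) (snd (snd p)))"
  obtains f :: "'a \<Rightarrow> nn \<Rightarrow> nn" where "F1 (\<lambda>p. f (fst p) (snd p))"
    "\<And>e. f e 0 = g e" "\<And>e x. f e (x + 1) = h e x (f e x)"
proof -
  define J where "J e G \<longleftrightarrow> (\<forall>z\<in>fs G. z = pr 0 (g e) \<or>
    (\<exists>x<G. \<exists>y<G. pr x y \<in> fs G \<and> z = pr (x + 1) (h e x y)))" for e G
  have J: "D1 (\<lambda>p. J (fst p) (snd p))"
    unfolding J_def by (intro D1_rules F1_rules F1_comp[OF g] F1_comp3[OF h])
  define R where "R e n y \<longleftrightarrow> (\<exists>G. J e G \<and> pr n y \<in> fs G)" for e n y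
  have R: "S1 (\<lambda>p. R (fst p) (fst (snd p)) (snd (snd p)))"
    unfolding R_def by (intro S1_exI D1_S1 D1_rules F1_rules D1_comp2[OF J])
  have el: "pr x y \<in> fs G \<Longrightarrow> x < G \<and> y < G" for x y G
    using fs_bound pr_ge le_less_trans by blast
  have J0: "pr 0 y \<in> fs G \<Longrightarrow> J e G \<Longrightarrow> y = g e" for y G e by (fastforce simp: J_def)
  have Js: "pr (x + 1) y \<in> fs G \<Longrightarrow> J e G \<Longrightarrow> \<exists>z. pr x z \<in> fs G \<and> y = h e x z" for x y G e
    by (fastforce simp: J_def)
  have unique: "y = y'" if "R e n y" "R e n y'" for e n y y'
  proof -
    obtain G G' where G: "J e G" "pr n y \<in> fs G" "J e G'" "pr n y' \<in> fs G'"
      using \<open>R e n y\<close> \<open>R e n y'\<close> unfolding R_def by blast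
    have "D1 (\<lambda>n. \<forall>y<G. \<forall>y'<G'. pr n y \<in> fs G \<longrightarrow> pr n y' \<in> fs G' \<longrightarrow> y = y')"
      by (intro D1_rules F1_rules)
    then have "\<forall>y<G. \<forall>y'<G'. pr n y \<in> fs G \<longrightarrow> pr n y' \<in> fs G' \<longrightarrow> y = y'"
    proof (induction n rule: D1_induct)
      case zero
      then show ?case using J0 G by metis
    next
      case (succ x)
      then show ?case using Js G el by metis
    qed
    then show ?thesis using G el by blast
  qed
  have R0: "R e 0 (g e)" for e
    unfolding R_def J_def by (intro exI[of _ "code {pr 0 (g e)}"]) simp
  have Rs: "R e (n + 1) (h e n y)" if Rn: "R e n y" for e n y
  proof -
    obtain G where G: "J e G" "pr n y \<in> fs G" using Rn unfolding R_def by blast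
    let ?G = "code (insert (pr (n + 1) (h e n y)) (fs G))"
    have fs: "fs ?G = insert (pr (n + 1) (h e n y)) (fs G)" by simp
    have "J e ?G"
      unfolding J_def
    proof
      fix z assume "z \<in> fs ?G"
      then consider "z = pr (n + 1) (h e n y)" | "z \<in> fs G" by (auto simp: fs)
      then show "z = pr 0 (g e) \<or> (\<exists>x<?G. \<exists>y<?G. pr x y \<in> fs ?G \<and> z = pr (x + 1) (h e x y))"
      proof cases
        case 1
        have "pr n y \<in> fs ?G" using G fs by simp
        then show ?thesis using el 1 by blast
      next
        case 2
        then show ?thesis using G(1) unfolding J_def using el fs by (metis insertCI)
      qed
    qed
    then show ?thesis unfolding R_def using fs by blast
  qed
  have ex: "\<exists>y. R e n y" for e n
  proof -
    have "S1 (\<lambda>n. \<exists>y. R e n y)" by (intro S1_exI S1_comp3[OF R] F1_rules)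
    then show ?thesis by (induction n rule: S1_induct) (use R0 Rs in blast)+
  qed
  define f where "f e n = (THE y. R e n y)" for e n
  have f: "R e n y \<longleftrightarrow> y = f e n" for e n y
    unfolding f_def using ex unique by (metis theI')
  show thesis
  proof
    have "S1 (\<lambda>q. R (fst (fst q)) (snd (fst q)) (snd q))" by (intro S1_comp3[OF R] F1_rules)
    then show "F1 (\<lambda>p. f (fst p) (snd p))" by (rule F1_by_graph) (rule f)
    show "f e 0 = g e" for e using R0 f by metis
    show "f e (x + 1) = h e x (f e x)" for e x using Rs f by metis
  qed
qed

definition lookup :: "nn \<Rightarrow> nn \<Rightarrow> nn" where
  "lookup c y = (LEAST v. pr y v \<in> fs c \<or> (\<forall>w<c. pr y w \<notin> fs c))"

lemma F1_lookup: assumes "F1 f" "F1 g" shows "F1 (\<lambda>e. lookup (f e) (g e))"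
proof -
  have "\<exists>v. pr y v \<in> fs c \<or> (\<forall>w<c. pr y w \<notin> fs c)" for c y by blast
  then have "F1 (\<lambda>p. lookup (fst p) (snd p))"
    unfolding lookup_def by (intro F1_Least D1_rules F1_rules)
  then show ?thesis by (rule F1_comp2) fact+
qed

lemma lookup_eq: assumes "pr y v \<in> fs c" "\<And>w. pr y w \<in> fs c \<Longrightarrow> w = v" shows "lookup c y = v"
proof -
  have D: "D1 (\<lambda>v. pr y v \<in> fs c \<or> (\<forall>w<c. pr y w \<notin> fs c))" by (intro D1_rules F1_rules)
  have "pr y (lookup c y) \<in> fs c \<or> (\<forall>w<c. pr y w \<notin> fs c)"
    unfolding lookup_def by (rule D1_LeastI(1)[OF D disjI1[OF assms(1)]])
  moreover have "v < c" using assms(1) fs_bound pr_ge le_less_trans by blast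
  ultimately show ?thesis using assms by blast
qed

lemma cov_rec:
  assumes H: "F1 (\<lambda>p. H (fst p) (lookup (fst (snd p))) (snd (snd p)))"
    and cong: "\<And>e g g' x. (\<And>y. y < x \<Longrightarrow> g y = g' y) \<Longrightarrow> H e g x = H e g' x"
  obtains f where "F1 (\<lambda>p. f (fst p) (snd p))" "\<And>e x. f e x = H e (f e) x"
proof -
  let ?h = "\<lambda>e x c. code (insert (pr x (H e (lookup c) x)) (fs c))"
  have "F1 (\<lambda>p. ?h (fst p) (fst (snd p)) (snd (snd p)))"
    by (intro F1_code_insert F1_rules F1_comp3[of "\<lambda>e c. H e (lookup c)", OF H])
  from prim_rec[OF F1_const[of 0] this] obtain t where t: "F1 (\<lambda>p. t (fst p) (snd p))"
    "\<And>e. t e 0 = 0" "\<And>e x. t e (x + 1) = ?h e x (t e x)" by blast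
  define f where "f e x = H e (lookup (t e x)) x" for e x
  have f: "F1 (\<lambda>p. f (fst p) (snd p))"
    unfolding f_def by (intro F1_comp3[of "\<lambda>e c. H e (lookup c)", OF H] F1_rules F1_comp2[OF t(1)])
  have fs_t: "fs (t e (x + 1)) = insert (pr x (f e x)) (fs (t e x))" for e x
    by (simp add: t f_def)
  have t_eq: "(\<forall>y<x. pr y (f e y) \<in> fs (t e x)) \<and> (\<forall>z\<in>fs (t e x). \<exists>y<x. z = pr y (f e y))" for e x
  proof -
    have "D1 (\<lambda>x. (\<forall>y<x. pr y (f e y) \<in> fs (t e x)) \<and> (\<forall>z\<in>fs (t e x). \<exists>y<x. z = pr y (f e y)))"
      by (intro D1_rules F1_rules F1_comp2[OF f] F1_comp2[OF t(1)])
    then show ?thesis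
    proof (induction x rule: D1_induct)
      case zero
      then show ?case by (simp add: t)
    next
      case (succ x)
      then show ?case unfolding fs_t by (auto simp: le_less)
    qed
  qed
  have "lookup (t e x) y = f e y" if "y < x" for e x y
    using t_eq[of x e] that by (intro lookup_eq) auto
  then have "f e x = H e (f e) x" for e x
    unfolding f_def[of e x] by (rule cong)
  with f show thesis by (rule that)
qed

lemma cov_rec_pred:
  assumes H: "D1 (\<lambda>p. H (fst p) (\<lambda>y. lookup (fst (snd p)) y = 1) (snd (snd p)))"
    and cong: "\<And>e g g' x. (\<And>y. y < x \<Longrightarrow> g y = g' y) \<Longrightarrow> H e g x = H e g' x"
  obtains R where "D1 (\<lambda>p. R (fst p) (snd p))" "\<And>e x. R e x \<longleftrightarrow> H e (R e) x"
proof -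
  let ?H = "\<lambda>e g x. if H e (\<lambda>y. g y = 1) x then 1 else 0 :: nn"
  have 1: "F1 (\<lambda>p. ?H (fst p) (lookup (fst (snd p))) (snd (snd p)))"
    by (intro F1_if H F1_rules)
  have 2: "?H e g x = ?H e g' x" if "\<And>y. y < x \<Longrightarrow> g y = g' y" for e g g' x
    using cong[of x "\<lambda>y. g y = 1" "\<lambda>y. g' y = 1" e] that by simp
  show thesis
  proof (rule cov_rec[of ?H, OF 1 2])
    fix f assume f: "F1 (\<lambda>p. f (fst p) (snd p))" "\<And>e x. f e x = ?H e (f e) x"
    have "D1 (\<lambda>p. f (fst p) (snd p) = 1)" by (intro D1_rules f F1_rules)
    moreover have "f e x = 1 \<longleftrightarrow> H e (\<lambda>y. f e y = 1) x" for e x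
      by (subst f(2)) simp
    ultimately show thesis by (rule that[of "\<lambda>e x. f e x = 1"])
  qed
qed

section \<open>The notions of the statement in the model\<close>

text \<open>
  Each formula constructor \<open>c\<close> of the statement has a counterpart \<open>s_c\<close> that is its truth value in
  the model; \<open>fs a\<close> and \<open>isf a\<close> are the counterparts of \<open>\<^bold>\<epsilon>\<close> and \<open>is_fin\<close>.
\<close>

definition s_is_fset :: "nn \<Rightarrow> (nn \<Rightarrow> bool) \<Rightarrow> bool" where
  "s_is_fset a P = (isf a \<and> (\<forall>x. x \<in> fs a \<longleftrightarrow> P x))"

record s_order =
  sFld :: "nn \<Rightarrow> bool"
  sLt :: "nn \<Rightarrow> nn \<Rightarrow> bool"

definition s_linear :: "s_order \<Rightarrow> bool" where
  "s_linear X =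
    ((\<forall>x y. sLt X x y \<longrightarrow> sFld X x \<and> sFld X y)
     \<and> (\<forall>x. \<not> sLt X x x)
     \<and> (\<forall>x y z. sLt X x y \<and> sLt X y z \<longrightarrow> sLt X x z)
     \<and> (\<forall>x y. sFld X x \<and> sFld X y \<longrightarrow> sLt X x y \<or> x = y \<or> sLt X y x))"

definition s_below :: "nn \<Rightarrow> s_order" where
  "s_below n = \<lparr>sFld = (\<lambda>x. x < n), sLt = (\<lambda>x y. x < y \<and> y < n)\<rparr>"

definition s_restrict :: "s_order \<Rightarrow> nn \<Rightarrow> s_order" where
  "s_restrict X a = \<lparr>sFld = (\<lambda>x. x \<in> fs a), sLt = (\<lambda>x y. x \<in> fs a \<and> y \<in> fs a \<and> sLt X x y)\<rparr>"

definition s_maps ::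
  "(nn \<Rightarrow> bool) \<Rightarrow> (nn \<Rightarrow> bool) \<Rightarrow> (nn \<Rightarrow> nn \<Rightarrow> bool) \<Rightarrow> bool" where
  "s_maps A B G =
    ((\<forall>x y. G x y \<longrightarrow> A x \<and> B y)
     \<and> (\<forall>x. A x \<longrightarrow> (\<exists>y. G x y \<and> (\<forall>z. G x z \<longrightarrow> z = y))))"

definition s_embeds :: "s_order \<Rightarrow> s_order \<Rightarrow> (nn \<Rightarrow> nn \<Rightarrow> bool) \<Rightarrow> bool" where
  "s_embeds X Y G =
    (s_maps (sFld X) (sFld Y) G
     \<and> (\<forall>x y x' y'. G x y \<and> G x' y' \<and> sLt X x x' \<longrightarrow> sLt Y y y'))"

definition s_enum :: "s_order \<Rightarrow> nn \<Rightarrow> nn \<Rightarrow> nn \<Rightarrow> bool" where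
  "s_enum X a k g =
    (isf g \<and> (\<forall>z. z \<in> fs g \<longrightarrow> (\<exists>i x. z = pr i x))
     \<and> s_embeds (s_below k) (s_restrict X a) (\<lambda>i x. pr i x \<in> fs g)
     \<and> (\<forall>x. x \<in> fs a \<longrightarrow> (\<exists>i. pr i x \<in> fs g)))"

definition s_has_card :: "nn \<Rightarrow> nn \<Rightarrow> bool" where
  "s_has_card a k =
    (\<exists>g. s_maps (\<lambda>i. i < k) (\<lambda>x. x \<in> fs a) (\<lambda>i x. pr i x \<in> fs g)
     \<and> (\<forall>x. x \<in> fs a \<longrightarrow> (\<exists>i. pr i x \<in> fs g \<and> (\<forall>j. pr j x \<in> fs g \<longrightarrow> j = i))))"

definition s_app :: "nn \<Rightarrow> nn \<Rightarrow> nn \<Rightarrow> bool" where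
  "s_app f i j = (\<exists>n m g. f = pr n (pr m g) \<and> pr i j \<in> fs g)"

definition s_is_mor :: "nn \<Rightarrow> nn \<Rightarrow> nn \<Rightarrow> bool" where
  "s_is_mor f n m =
    ((\<exists>g. f = pr n (pr m g) \<and> isf g \<and> (\<forall>z. z \<in> fs g \<longrightarrow> (\<exists>i j. z = pr i j)))
     \<and> s_embeds (s_below n) (s_below m) (s_app f))"

definition s_incl :: "s_order \<Rightarrow> nn \<Rightarrow> nn \<Rightarrow> nn \<Rightarrow> bool" where
  "s_incl X a c f =
    (\<exists>k l u v. s_enum X a k u \<and> s_enum X c l v \<and> s_is_mor f k l
      \<and> (\<forall>i j. s_app f i j \<longrightarrow> (\<exists>x. pr i x \<in> fs u \<and> pr j x \<in> fs v)))"

record s_praedil =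
  sObj :: "nn \<Rightarrow> s_order"
  sAct :: "nn \<Rightarrow> nn \<Rightarrow> nn \<Rightarrow> bool"
  sSupp :: "nn \<Rightarrow> nn \<Rightarrow> nn \<Rightarrow> bool"
  sMu :: "nn \<Rightarrow> nn \<Rightarrow> nn \<Rightarrow> bool"

definition s_is_functor :: "s_praedil \<Rightarrow> bool" where
  "s_is_functor T =
    ((\<forall>n. s_linear (sObj T n))
     \<and> (\<forall>f n m. s_is_mor f n m \<longrightarrow> s_embeds (sObj T n) (sObj T m) (sAct T f))
     \<and> (\<forall>f n. s_is_mor f n n \<and> (\<forall>i. i < n \<longrightarrow> s_app f i i) \<longrightarrow>
          (\<forall>x. sFld (sObj T n) x \<longrightarrow> sAct T f x x))
     \<and> (\<forall>f g h n m l. s_is_mor f n m \<and> s_is_mor g m l \<and> s_is_mor h n l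
            \<and> (\<forall>i j k. s_app f i j \<and> s_app g j k \<longrightarrow> s_app h i k) \<longrightarrow>
          (\<forall>x y z. sAct T f x y \<and> sAct T g y z \<longrightarrow> sAct T h x z)))"

definition s_is_praedilator :: "s_praedil \<Rightarrow> bool" where
  "s_is_praedilator T =
    (s_is_functor T
     \<and> (\<forall>n. s_maps (sFld (sObj T n)) (\<lambda>a. isf a \<and> (\<forall>i. i \<in> fs a \<longrightarrow> i < n)) (sSupp T n))
     \<and> (\<forall>f n m x y a b. s_is_mor f n m \<and> sAct T f x y \<and> sSupp T n x a \<and> sSupp T m y b \<longrightarrow>
          (\<forall>j. j \<in> fs b \<longleftrightarrow> (\<exists>i. i \<in> fs a \<and> s_app f i j)))
     \<and> (\<forall>n x a. sSupp T n x a \<longrightarrow>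
          (\<exists>k u f y. s_enum (s_below n) a k u \<and> s_is_mor f k n \<and> (\<forall>i j. s_app f i j \<longleftrightarrow> pr i j \<in> fs u)
            \<and> sFld (sObj T k) y \<and> sAct T f y x)))"

definition s_is_normal_praedilator :: "s_praedil \<Rightarrow> bool" where
  "s_is_normal_praedilator T =
    (s_is_praedilator T
     \<and> (\<forall>n. s_embeds (s_below n) (sObj T n) (sMu T n))
     \<and> (\<forall>f n m i j x y. s_is_mor f n m \<and> s_app f i j \<and> sMu T n i x \<and> sMu T m j y \<longrightarrow> sAct T f x y)
     \<and> (\<forall>n m x y a. m < n \<and> sMu T n m x \<and> sFld (sObj T n) y \<and> sSupp T n y a \<longrightarrow>
          (sLt (sObj T n) y x \<longleftrightarrow> (\<forall>i. i \<in> fs a \<longrightarrow> i < m))))"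

definition s_full_supp :: "s_praedil \<Rightarrow> nn \<Rightarrow> nn \<Rightarrow> bool" where
  "s_full_supp T k s = (\<exists>b. sSupp T k s b \<and> (\<forall>i. i \<in> fs b \<longleftrightarrow> i < k))"

definition s_D_less :: "s_praedil \<Rightarrow> s_order \<Rightarrow> nn \<Rightarrow> nn \<Rightarrow> nn \<Rightarrow> nn \<Rightarrow> bool" where
  "s_D_less T X a s b t =
    (\<exists>c k f g s' t'. s_is_fset c (\<lambda>x. x \<in> fs a \<or> x \<in> fs b) \<and> s_has_card c k
      \<and> s_incl X a c f \<and> s_incl X b c g \<and> sAct T f s s' \<and> sAct T g t t' \<and> sLt (sObj T k) s' t')"

definition s_D_fld :: "s_praedil \<Rightarrow> s_order \<Rightarrow> nn \<Rightarrow> bool" where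
  "s_D_fld T X p =
    (\<exists>a s k. p = pr a s \<and> isf a \<and> (\<forall>x. x \<in> fs a \<longrightarrow> sFld X x)
      \<and> s_has_card a k \<and> sFld (sObj T k) s \<and> s_full_supp T k s)"

definition s_D_obj :: "s_praedil \<Rightarrow> s_order \<Rightarrow> s_order" where
  "s_D_obj T X =
    \<lparr>sFld = s_D_fld T X,
     sLt = (\<lambda>p q. s_D_fld T X p \<and> s_D_fld T X q
            \<and> (\<exists>a s b t. p = pr a s \<and> q = pr b t \<and> s_D_less T X a s b t))\<rparr>"

definition s_D_map :: "s_praedil \<Rightarrow> s_order \<Rightarrow> (nn \<Rightarrow> nn \<Rightarrow> bool) \<Rightarrow> nn \<Rightarrow> nn \<Rightarrow> bool" where
  "s_D_map T X F p q =
    (s_D_fld T X p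
     \<and> (\<exists>a s b. p = pr a s \<and> q = pr b s \<and> s_is_fset b (\<lambda>y. \<exists>x. x \<in> fs a \<and> F x y)))"

definition s_compose :: "s_praedil \<Rightarrow> s_praedil \<Rightarrow> s_praedil" where
  "s_compose T S =
    \<lparr>sObj = (\<lambda>n. s_D_obj T (sObj S n)),
     sAct = (\<lambda>f p q. \<exists>n m. s_is_mor f n m \<and> s_D_map T (sObj S n) (sAct S f) p q),
     sSupp = (\<lambda>n p c. s_D_fld T (sObj S n) p
              \<and> (\<exists>a t. p = pr a t \<and> s_is_fset c (\<lambda>i. \<exists>s d. s \<in> fs a \<and> sSupp S n s d \<and> i \<in> fs d))),
     sMu = (\<lambda>n m p. \<exists>x y a. sMu S n m x \<and> sMu T 1 0 y \<and> s_is_fset a (\<lambda>z. z = x) \<and> p = pr a y)\<rparr>"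

definition s_nat_trans :: "s_praedil \<Rightarrow> s_praedil \<Rightarrow> (nn \<Rightarrow> nn \<Rightarrow> nn \<Rightarrow> bool) \<Rightarrow> bool" where
  "s_nat_trans P Q N =
    ((\<forall>n. s_embeds (sObj P n) (sObj Q n) (N n))
     \<and> (\<forall>f n m x y u v. s_is_mor f n m \<and> sAct P f x y \<and> N n x u \<and> sAct Q f u v \<longrightarrow> N m y v))"

definition s_normal_morphism ::
  "s_praedil \<Rightarrow> s_praedil \<Rightarrow> (nn \<Rightarrow> nn \<Rightarrow> nn \<Rightarrow> bool) \<Rightarrow> bool" where
  "s_normal_morphism P Q N =
    (s_nat_trans P Q N \<and> (\<forall>n m x y. sMu P n m x \<and> N n x y \<longrightarrow> sMu Q n m y))"

definition s_upper_derivative ::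
  "s_praedil \<Rightarrow> s_praedil \<Rightarrow> (nn \<Rightarrow> nn \<Rightarrow> nn \<Rightarrow> bool) \<Rightarrow> bool" where
  "s_upper_derivative T S xi = (s_is_normal_praedilator S \<and> s_normal_morphism (s_compose T S) S xi)"

definition s_upper_morphism ::
  "s_praedil \<Rightarrow> s_praedil \<Rightarrow> (nn \<Rightarrow> nn \<Rightarrow> nn \<Rightarrow> bool) \<Rightarrow>
   s_praedil \<Rightarrow> (nn \<Rightarrow> nn \<Rightarrow> nn \<Rightarrow> bool) \<Rightarrow> (nn \<Rightarrow> nn \<Rightarrow> nn \<Rightarrow> bool) \<Rightarrow> bool" where
  "s_upper_morphism T S xi S' xi' N =
    (s_normal_morphism S S' N
     \<and> (\<forall>n p. s_D_fld T (sObj S n) p \<longrightarrow>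
          (\<exists>x q y. xi n p x \<and> N n x y \<and> s_D_map T (sObj S n) (N n) p q \<and> xi' n q y)))"

definition s_family :: "nn set \<Rightarrow> nn \<Rightarrow> nn \<Rightarrow> nn \<Rightarrow> bool" where
  "s_family X = (\<lambda>n x y. pr n (pr x y) \<in> X)"

definition s_coded :: "nn set \<Rightarrow> nn set \<Rightarrow> nn set \<Rightarrow> nn set \<Rightarrow> nn set \<Rightarrow> s_praedil" where
  "s_coded A B C D E =
    \<lparr>sObj = (\<lambda>n. \<lparr>sFld = (\<lambda>x. pr n x \<in> A), sLt = s_family B n\<rparr>),
     sAct = s_family C, sSupp = s_family D, sMu = s_family E\<rparr>"

definition s_is_derivative ::
  "s_praedil \<Rightarrow> s_praedil \<Rightarrow> (nn \<Rightarrow> nn \<Rightarrow> nn \<Rightarrow> bool) \<Rightarrow> bool" where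
  "s_is_derivative T S xi =
    (s_upper_derivative T S xi
     \<and> (\<forall>A\<in>Sets. \<forall>B\<in>Sets. \<forall>C\<in>Sets. \<forall>D\<in>Sets. \<forall>E\<in>Sets. \<forall>X\<in>Sets.
          s_upper_derivative T (s_coded A B C D E) (s_family X) \<longrightarrow>
          (\<exists>N\<in>Sets. s_upper_morphism T S xi (s_coded A B C D E) (s_family X) (s_family N)
            \<and> (\<forall>N'\<in>Sets. s_upper_morphism T S xi (s_coded A B C D E) (s_family X) (s_family N') \<longrightarrow>
                  (\<forall>n x y. s_family N' n x y \<longleftrightarrow> s_family N n x y)))))"

definition s_mu_tm :: "nn \<Rightarrow> nn" where "s_mu_tm m = pr 0 m"
definition s_xi_tm :: "nn \<Rightarrow> nn \<Rightarrow> nn" where "s_xi_tm a s = pr 1 (pr a s)"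

definition s_is_mu_pair :: "s_praedil \<Rightarrow> nn \<Rightarrow> nn \<Rightarrow> nn \<Rightarrow> bool" where
  "s_is_mu_pair T m a s = (s_is_fset a (\<lambda>z. z = s_mu_tm m) \<and> sMu T 1 0 s)"

definition s_is_partial_fld :: "s_praedil \<Rightarrow> s_praedil \<Rightarrow> bool" where
  "s_is_partial_fld T P =
    (\<forall>n t. sFld (sObj P n) t \<longleftrightarrow>
      (\<exists>m. m < n \<and> t = s_mu_tm m)
      \<or> (\<exists>a s. t = s_xi_tm a s \<and> s_D_fld T (sObj P n) (pr a s)
            \<and> \<not> (\<exists>m. m < n \<and> s_is_mu_pair T m a s)))"

definition s_is_partial_less :: "s_praedil \<Rightarrow> s_praedil \<Rightarrow> bool" where
  "s_is_partial_less T P =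
    (\<forall>n s t. sLt (sObj P n) s t \<longleftrightarrow>
      sFld (sObj P n) s \<and> sFld (sObj P n) t \<and>
      ((\<exists>m k. s = s_mu_tm m \<and> t = s_mu_tm k \<and> m < k)
       \<or> (\<exists>m b v. s = s_mu_tm m \<and> t = s_xi_tm b v
             \<and> (\<exists>r. r \<in> fs b \<and> (sLt (sObj P n) s r \<or> s = r)))
       \<or> (\<exists>a u k. s = s_xi_tm a u \<and> t = s_mu_tm k
             \<and> (\<forall>r. r \<in> fs a \<longrightarrow> sLt (sObj P n) r t))
       \<or> (\<exists>a u b v c. s = s_xi_tm a u \<and> t = s_xi_tm b v
             \<and> s_is_fset c (\<lambda>x. x \<in> fs a \<or> x \<in> fs b) \<and> s_linear (s_restrict (sObj P n) c)
             \<and> s_D_less T (sObj P n) a u b v)))"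

definition s_is_partial_act :: "s_praedil \<Rightarrow> s_praedil \<Rightarrow> bool" where
  "s_is_partial_act T P =
    (\<forall>f n l. s_is_mor f n l \<longrightarrow> (\<forall>s t. sAct P f s t \<longleftrightarrow>
      sFld (sObj P n) s \<and>
      ((\<exists>m k. s = s_mu_tm m \<and> s_app f m k \<and> t = s_mu_tm k)
       \<or> (\<exists>a u b. s = s_xi_tm a u \<and> s_is_fset b (\<lambda>y. \<exists>x. x \<in> fs a \<and> sAct P f x y) \<and> t = s_xi_tm b u))))"

definition s_is_partial_supp :: "s_praedil \<Rightarrow> s_praedil \<Rightarrow> bool" where
  "s_is_partial_supp T P =
    (\<forall>n t c. sSupp P n t c \<longleftrightarrow>
      sFld (sObj P n) t \<and>
      ((\<exists>m. t = s_mu_tm m \<and> s_is_fset c (\<lambda>i. i = m))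
       \<or> (\<exists>a s. t = s_xi_tm a s \<and> s_is_fset c (\<lambda>i. \<exists>r d. r \<in> fs a \<and> sSupp P n r d \<and> i \<in> fs d))))"

definition s_is_partial_mu :: "s_praedil \<Rightarrow> s_praedil \<Rightarrow> bool" where
  "s_is_partial_mu T P = (\<forall>n m t. sMu P n m t \<longleftrightarrow> m < n \<and> t = s_mu_tm m)"

definition s_is_partial :: "s_praedil \<Rightarrow> s_praedil \<Rightarrow> bool" where
  "s_is_partial T P =
    (s_is_partial_fld T P \<and> s_is_partial_less T P \<and> s_is_partial_act T P
     \<and> s_is_partial_supp T P \<and> s_is_partial_mu T P)"

definition s_is_xi ::
  "s_praedil \<Rightarrow> s_praedil \<Rightarrow> (nn \<Rightarrow> nn \<Rightarrow> nn \<Rightarrow> bool) \<Rightarrow> bool" where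
  "s_is_xi T P xi =
    (\<forall>n p t. xi n p t \<longleftrightarrow>
      s_D_fld T (sObj P n) p \<and>
      (\<exists>a s. p = pr a s \<and>
        ((\<exists>m. m < n \<and> s_is_mu_pair T m a s \<and> t = s_mu_tm m)
         \<or> (\<not> (\<exists>m. m < n \<and> s_is_mu_pair T m a s) \<and> t = s_xi_tm a s))))"

section \<open>Evaluation of formulas in the model\<close>

text \<open>
  A world consists of the values of the bound number and set variables, innermost first. A term
  or class represents an object of the model at a world if it has this value at all worlds that
  extend it, i.e. inside further quantifiers.
\<close>

type_synonym world = "nn list \<times> nn set list"

definition ext :: "world \<Rightarrow> world \<Rightarrow> bool" (infix "\<preceq>" 50) where
  "w \<preceq> w' \<longleftrightarrow> (\<exists>\<rho> \<sigma>. fst w' = \<rho> @ fst w \<and> snd w' = \<sigma> @ snd w)"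

definition push :: "nn \<Rightarrow> world \<Rightarrow> world" where "push v w = (v # fst w, snd w)"
definition push_set :: "nn set \<Rightarrow> world \<Rightarrow> world" where "push_set X w = (fst w, X # snd w)"
definition var :: "world \<Rightarrow> term" where "var w = (\<lambda>d. Var (d - Suc (length (fst w))))"
definition var_set :: "world \<Rightarrow> setvar" where "var_set w = (\<lambda>e. e - Suc (length (snd w)))"

definition num_env :: "world \<Rightarrow> nat \<Rightarrow> nn" where
  "num_env w i = (if i < length (fst w) then fst w ! i else abs_nn (Var (i - length (fst w))))"
definition set_env :: "world \<Rightarrow> nat \<Rightarrow> nn set" where
  "set_env w i = (if i < length (snd w) then snd w ! i else set_of_var (i - length (snd w)))"

definition RF :: "world \<Rightarrow> form \<Rightarrow> bool \<Rightarrow> bool" where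
  "RF w A P \<longleftrightarrow> (sat Sets (num_env w) (set_env w) (A (length (fst w)) (length (snd w))) \<longleftrightarrow> P)"
definition RT :: "world \<Rightarrow> term \<Rightarrow> nn \<Rightarrow> bool" where
  "RT w x v \<longleftrightarrow> (\<forall>w'. w \<preceq> w' \<longrightarrow> eval (num_env w') (x (length (fst w'))) = v)"
definition RS :: "world \<Rightarrow> setvar \<Rightarrow> nn set \<Rightarrow> bool" where
  "RS w X V \<longleftrightarrow> (\<forall>w'. w \<preceq> w' \<longrightarrow> set_env w' (X (length (snd w'))) = V)"

lemma ext_refl: "w \<preceq> w" by (simp add: ext_def)
lemma ext_push: "w \<preceq> w' \<Longrightarrow> w \<preceq> push v w'" by (auto simp: ext_def push_def)
lemma ext_push_set: "w \<preceq> w' \<Longrightarrow> w \<preceq> push_set X w'" by (auto simp: ext_def push_set_def)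
lemma ext_step: "w' \<preceq> w'' \<Longrightarrow> w \<preceq> w' \<Longrightarrow> w \<preceq> w''" by (auto simp: ext_def)

lemma RT_mono: "RT w x v \<Longrightarrow> w \<preceq> w' \<Longrightarrow> RT w' x v" unfolding RT_def by (blast intro: ext_step)
lemma RS_mono: "RS w x v \<Longrightarrow> w \<preceq> w' \<Longrightarrow> RS w' x v" unfolding RS_def by (blast intro: ext_step)

lemma RT_var: "push v w \<preceq> w' \<Longrightarrow> RT w' (var w) v"
  unfolding RT_def by (auto simp: ext_def push_def var_def num_env_def nth_append)

lemma RS_var: "push_set X w \<preceq> w' \<Longrightarrow> RS w' (var_set w) X"
  unfolding RS_def by (auto simp: ext_def push_set_def var_set_def set_env_def nth_append)

lemma RT_terms:
  "RT w \<^bold>0 0" "RT w \<^bold>1 1"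
  "RT w x u \<Longrightarrow> RT w y v \<Longrightarrow> RT w (x \<^bold>+ y) (u + v)"
  "RT w x u \<Longrightarrow> RT w y v \<Longrightarrow> RT w (x \<^bold>* y) (u * v)"
  "RT w x u \<Longrightarrow> RT w y v \<Longrightarrow> RT w (\<^bold>\<langle>x, y\<^bold>\<rangle>) (pr u v)"
  by (simp_all add: RT_def b_zero_def b_one_def b_add_def b_mul_def pair_def pr_def)

lemma RT_D: "RT w x u \<Longrightarrow> eval (num_env w) (x (length (fst w))) = u"
  unfolding RT_def using ext_refl by blast

lemma RS_D: "RS w X V \<Longrightarrow> set_env w (X (length (snd w))) = V"
  unfolding RS_def using ext_refl by blast

lemma num_env_push: "case_nat v (num_env w) = num_env (push v w)"
  by (auto simp: num_env_def push_def fun_eq_iff split: nat.split)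

lemma set_env_push: "case_nat X (set_env w) = set_env (push_set X w)"
  by (auto simp: set_env_def push_set_def fun_eq_iff split: nat.split)

lemma push_simps: "set_env (push v w) = set_env w" "num_env (push_set X w) = num_env w"
  "length (fst (push v w)) = Suc (length (fst w))" "length (snd (push v w)) = length (snd w)"
  "length (fst (push_set X w)) = length (fst w)" "length (snd (push_set X w)) = Suc (length (snd w))"
  by (auto simp: set_env_def num_env_def push_def push_set_def fun_eq_iff)

lemma RF_logic:
  "RT w x u \<Longrightarrow> RT w y v \<Longrightarrow> RF w (x \<^bold>= y) (u = v)"
  "RT w x u \<Longrightarrow> RT w y v \<Longrightarrow> RF w (x \<^bold>< y) (u < v)"
  "RT w x u \<Longrightarrow> RS w X V \<Longrightarrow> RF w (x \<^bold>\<in> X) (u \<in> V)"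
  "RF w A P \<Longrightarrow> RF w (\<^bold>\<not> A) (\<not> P)"
  "RF w A P \<Longrightarrow> RF w B Q \<Longrightarrow> RF w (A \<^bold>\<and> B) (P \<and> Q)"
  "RF w A P \<Longrightarrow> RF w B Q \<Longrightarrow> RF w (A \<^bold>\<or> B) (P \<or> Q)"
  "RF w A P \<Longrightarrow> RF w B Q \<Longrightarrow> RF w (A \<^bold>\<longrightarrow> B) (P \<longrightarrow> Q)"
  "RF w A P \<Longrightarrow> RF w B Q \<Longrightarrow> RF w (A \<^bold>\<longleftrightarrow> B) (P \<longleftrightarrow> Q)"
  by (simp_all add: RF_def b_eq_def b_less_def b_mem_def b_not_def b_and_def b_or_def b_imp_def
      b_iff_def RT_D RS_D)

lemma RF_quantifiers:
  "(\<And>v. RF (push v w) (F (var w)) (P v)) \<Longrightarrow> RF w (\<^bold>\<forall>x. F x) (\<forall>v. P v)"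
  "(\<And>v. RF (push v w) (F (var w)) (P v)) \<Longrightarrow> RF w (\<^bold>\<exists>x. F x) (\<exists>v. P v)"
  "(\<And>X. RF (push_set X w) (G (var_set w)) (Q X)) \<Longrightarrow> RF w (\<^bold>\<forall>\<^sub>SX. G X) (\<forall>X\<in>Sets. Q X)"
  "(\<And>X. RF (push_set X w) (G (var_set w)) (Q X)) \<Longrightarrow> RF w (\<^bold>\<exists>\<^sub>SX. G X) (\<exists>X\<in>Sets. Q X)"
  by (simp_all add: RF_def b_all_def b_ex_def b_all_set_def b_ex_set_def var_def var_set_def
      num_env_push set_env_push push_simps)

named_theorems bridge

lemmas [bridge] = ext_refl ext_push ext_push_set RT_var RS_var RF_logic RF_quantifiers RT_terms

definition RO :: "world \<Rightarrow> order \<Rightarrow> s_order \<Rightarrow> bool" where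
  "RO w X Y \<longleftrightarrow> (\<forall>w' x u. w \<preceq> w' \<longrightarrow> RT w' x u \<longrightarrow> RF w' (Fld X x) (sFld Y u))
    \<and> (\<forall>w' x u y v. w \<preceq> w' \<longrightarrow> RT w' x u \<longrightarrow> RT w' y v \<longrightarrow> RF w' (Lt X x y) (sLt Y u v))"

lemma RO_mono: "RO w X Y \<Longrightarrow> w \<preceq> w' \<Longrightarrow> RO w' X Y"
  unfolding RO_def by (blast intro: ext_step)

lemma RO_D:
  "RO w X Y \<Longrightarrow> RT w x u \<Longrightarrow> RF w (Fld X x) (sFld Y u)"
  "RO w X Y \<Longrightarrow> RT w x u \<Longrightarrow> RT w y v \<Longrightarrow> RF w (Lt X x y) (sLt Y u v)"
  unfolding RO_def using ext_refl by blast+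

lemma RO_I:
  assumes "\<And>w' x u. w \<preceq> w' \<Longrightarrow> RT w' x u \<Longrightarrow> RF w' (F x) (P u)"
    "\<And>w' x u y v. w \<preceq> w' \<Longrightarrow> RT w' x u \<Longrightarrow> RT w' y v \<Longrightarrow> RF w' (L x y) (Q u v)"
  shows "RO w \<lparr>Fld = F, Lt = L\<rparr> \<lparr>sFld = P, sLt = Q\<rparr>"
  using assms by (simp add: RO_def)

definition RD :: "world \<Rightarrow> praedil \<Rightarrow> s_praedil \<Rightarrow> bool" where
  "RD w T S \<longleftrightarrow> (\<forall>w' n u. w \<preceq> w' \<longrightarrow> RT w' n u \<longrightarrow> RO w' (Obj T n) (sObj S u))
    \<and> (\<forall>w' n u x v y z. w \<preceq> w' \<longrightarrow> RT w' n u \<longrightarrow> RT w' x v \<longrightarrow> RT w' y z \<longrightarrow>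
        RF w' (Act T n x y) (sAct S u v z) \<and> RF w' (Supp T n x y) (sSupp S u v z)
        \<and> RF w' (Mu T n x y) (sMu S u v z))"

lemma RD_mono: "RD w X Y \<Longrightarrow> w \<preceq> w' \<Longrightarrow> RD w' X Y"
  unfolding RD_def by (blast intro: ext_step)

lemma RD_D:
  "RD w T S \<Longrightarrow> RT w n u \<Longrightarrow> RO w (Obj T n) (sObj S u)"
  "RD w T S \<Longrightarrow> RT w n u \<Longrightarrow> RT w x v \<Longrightarrow> RT w y z \<Longrightarrow> RF w (Act T n x y) (sAct S u v z)"
  "RD w T S \<Longrightarrow> RT w n u \<Longrightarrow> RT w x v \<Longrightarrow> RT w y z \<Longrightarrow> RF w (Supp T n x y) (sSupp S u v z)"
  "RD w T S \<Longrightarrow> RT w n u \<Longrightarrow> RT w x v \<Longrightarrow> RT w y z \<Longrightarrow> RF w (Mu T n x y) (sMu S u v z)"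
  unfolding RD_def using ext_refl by blast+

lemma RD_I:
  assumes "\<And>w' n u. w \<preceq> w' \<Longrightarrow> RT w' n u \<Longrightarrow> RO w' (O1 n) (O2 u)"
    "\<And>w' n u x v y z. w \<preceq> w' \<Longrightarrow> RT w' n u \<Longrightarrow> RT w' x v \<Longrightarrow> RT w' y z \<Longrightarrow> RF w' (A1 n x y) (A2 u v z)"
    "\<And>w' n u x v y z. w \<preceq> w' \<Longrightarrow> RT w' n u \<Longrightarrow> RT w' x v \<Longrightarrow> RT w' y z \<Longrightarrow> RF w' (Su1 n x y) (Su2 u v z)"
    "\<And>w' n u x v y z. w \<preceq> w' \<Longrightarrow> RT w' n u \<Longrightarrow> RT w' x v \<Longrightarrow> RT w' y z \<Longrightarrow> RF w' (M1 n x y) (M2 u v z)"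
  shows "RD w \<lparr>Obj = O1, Act = A1, Supp = Su1, Mu = M1\<rparr> \<lparr>sObj = O2, sAct = A2, sSupp = Su2, sMu = M2\<rparr>"
  using assms by (simp add: RD_def)

lemmas [bridge] = RO_D RD_D RO_I RD_I
lemmas bridge_mono = RT_mono RS_mono RO_mono RD_mono ext_step

lemma RF_elem [bridge]: "RT w x u \<Longrightarrow> RT w a v \<Longrightarrow> RF w (x \<^bold>\<epsilon> a) (u \<in> fs v)"
proof -
  have eq: "u \<in> fs v \<longleftrightarrow> (\<exists>k m q. v = pr k (pr m q) \<and> u < k \<and> (\<exists>r. (m * (u + 1) + 1) * r = q))"
    unfolding fs_def dvd_def mem_Collect_eq by (simp only: eq_commute[of "(_ * _ :: nn)"])
  assume "RT w x u" "RT w a v"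
  then show ?thesis unfolding elem_def eq
    by - ((assumption | rule bridge | erule bridge_mono)+)
qed

lemma RF_is_fin [bridge]: "RT w a v \<Longrightarrow> RF w (is_fin a) (isf v)"
proof -
  have eq: "isf v \<longleftrightarrow> (\<forall>b. b < v \<longrightarrow> \<not> (\<forall>x. x \<in> fs b \<longleftrightarrow> x \<in> fs v))"
    unfolding isf_def by auto
  assume "RT w a v"
  then show ?thesis unfolding is_fin_def eq
    by - ((assumption | rule bridge | erule bridge_mono)+)
qed

lemma RF_is_fset [bridge]:
  assumes "RT w a v" and P: "\<And>w' x u. w \<preceq> w' \<Longrightarrow> RT w' x u \<Longrightarrow> RF w' (P x) (Q u)"
  shows "RF w (is_fset a P) (s_is_fset v Q)"
  using assms(1) unfolding is_fset_def s_is_fset_def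
  by - ((assumption | rule bridge P | erule bridge_mono)+)

lemma RF_linear [bridge]:
  assumes "RO w X Y"
  shows "RF w (linear X) (s_linear Y)"
  using assms unfolding linear_def s_linear_def
  by - ((assumption | rule bridge | erule bridge_mono)+)

lemma RF_below [bridge]:
  assumes "RT w n i"
  shows "RO w (below n) (s_below i)"
  using assms unfolding below_def s_below_def
  by - ((assumption | rule bridge | erule bridge_mono)+)

lemma RF_restrict [bridge]:
  assumes "RO w X Y"
    and "RT w a i"
  shows "RO w (restrict X a) (s_restrict Y i)"
  using assms unfolding restrict_def s_restrict_def
  by - ((assumption | rule bridge | erule bridge_mono)+)

lemma RF_maps [bridge]:
  assumes A: "\<And>w' x u. w \<preceq> w' \<Longrightarrow> RT w' x u \<Longrightarrow> RF w' (A x) (A' u)"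
    and B: "\<And>w' x u. w \<preceq> w' \<Longrightarrow> RT w' x u \<Longrightarrow> RF w' (B x) (B' u)"
    and G: "\<And>w' x u y v. w \<preceq> w' \<Longrightarrow> RT w' x u \<Longrightarrow> RT w' y v \<Longrightarrow> RF w' (G x y) (G' u v)"
  shows "RF w (maps A B G) (s_maps A' B' G')"
  using assms unfolding maps_def s_maps_def
  by - ((assumption | rule bridge A B G | erule bridge_mono)+)

lemma RF_embeds [bridge]:
  assumes "RO w X X'" "RO w Y Y'"
    and G: "\<And>w' x u y v. w \<preceq> w' \<Longrightarrow> RT w' x u \<Longrightarrow> RT w' y v \<Longrightarrow> RF w' (G x y) (G' u v)"
  shows "RF w (embeds X Y G) (s_embeds X' Y' G')"
  using assms unfolding embeds_def s_embeds_def
  by - ((assumption | rule bridge G | erule bridge_mono)+)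

lemma RF_enum [bridge]:
  assumes "RO w X Y"
    and "RT w a a'" "RT w k k'" "RT w g g'"
  shows "RF w (enum X a k g) (s_enum Y a' k' g')"
  using assms unfolding enum_def s_enum_def
  by - ((assumption | rule bridge | erule bridge_mono)+)

lemma RF_has_card [bridge]:
  assumes "RT w a a'" "RT w k k'"
  shows "RF w (has_card a k) (s_has_card a' k')"
  using assms unfolding has_card_def s_has_card_def
  by - ((assumption | rule bridge | erule bridge_mono)+)

lemma RF_app [bridge]:
  assumes "RT w f f'" "RT w i i'" "RT w j j'"
  shows "RF w (app f i j) (s_app f' i' j')"
  using assms unfolding app_def s_app_def
  by - ((assumption | rule bridge | erule bridge_mono)+)

lemma RF_is_mor [bridge]:
  assumes "RT w f f'" "RT w n n'" "RT w m m'"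
  shows "RF w (is_mor f n m) (s_is_mor f' n' m')"
  using assms unfolding is_mor_def s_is_mor_def
  by - ((assumption | rule bridge | erule bridge_mono)+)

lemma RF_incl [bridge]:
  assumes "RO w X Y"
    and "RT w a a'" "RT w c c'" "RT w f f'"
  shows "RF w (incl X a c f) (s_incl Y a' c' f')"
  using assms unfolding incl_def s_incl_def
  by - ((assumption | rule bridge | erule bridge_mono)+)

lemma RF_is_functor [bridge]:
  assumes "RD w T S"
  shows "RF w (is_functor T) (s_is_functor S)"
  using assms unfolding is_functor_def s_is_functor_def
  by - ((assumption | rule bridge | erule bridge_mono)+)

lemma RF_is_praedilator [bridge]:
  assumes "RD w T S"
  shows "RF w (is_praedilator T) (s_is_praedilator S)"
  using assms unfolding is_praedilator_def s_is_praedilator_def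
  by - ((assumption | rule bridge | erule bridge_mono)+)

lemma RF_is_normal_praedilator [bridge]:
  assumes "RD w T S"
  shows "RF w (is_normal_praedilator T) (s_is_normal_praedilator S)"
  using assms unfolding is_normal_praedilator_def s_is_normal_praedilator_def
  by - ((assumption | rule bridge | erule bridge_mono)+)

lemma RF_full_supp [bridge]:
  assumes "RD w T S"
    and "RT w k k'" "RT w s s'"
  shows "RF w (full_supp T k s) (s_full_supp S k' s')"
  using assms unfolding full_supp_def s_full_supp_def
  by - ((assumption | rule bridge | erule bridge_mono)+)

lemma RF_D_less [bridge]:
  assumes "RD w T S"
    and "RO w X Y"
    and "RT w a a'" "RT w s s'" "RT w b b'" "RT w t t'"
  shows "RF w (D_less T X a s b t) (s_D_less S Y a' s' b' t')"
  using assms unfolding D_less_def s_D_less_def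
  by - ((assumption | rule bridge | erule bridge_mono)+)

lemma RF_D_fld [bridge]:
  assumes "RD w T S"
    and "RO w X Y"
    and "RT w p p'"
  shows "RF w (D_fld T X p) (s_D_fld S Y p')"
  using assms unfolding D_fld_def s_D_fld_def
  by - ((assumption | rule bridge | erule bridge_mono)+)

lemma RF_D_obj [bridge]:
  assumes "RD w T S"
    and "RO w X Y"
  shows "RO w (D_obj T X) (s_D_obj S Y)"
  using assms unfolding D_obj_def s_D_obj_def
  by - ((assumption | rule bridge | erule bridge_mono)+)

lemma RF_D_map [bridge]:
  assumes "RD w T S"
    and "RO w X Y"
    and F: "\<And>w' x u y v. w \<preceq> w' \<Longrightarrow> RT w' x u \<Longrightarrow> RT w' y v \<Longrightarrow> RF w' (F x y) (F' u v)"
    and "RT w p p'" "RT w q q'"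
  shows "RF w (D_map T X F p q) (s_D_map S Y F' p' q')"
  using assms unfolding D_map_def s_D_map_def
  by - ((assumption | rule bridge F | erule bridge_mono)+)

lemma RF_compose [bridge]:
  assumes "RD w T T'"
    and "RD w S S'"
  shows "RD w (compose T S) (s_compose T' S')"
  using assms unfolding compose_def s_compose_def
  by - ((assumption | rule bridge | erule bridge_mono)+)

lemma RF_nat_trans [bridge]:
  assumes "RD w T T'"
    and "RD w S S'"
    and N: "\<And>w' n i x u y v. w \<preceq> w' \<Longrightarrow> RT w' n i \<Longrightarrow> RT w' x u \<Longrightarrow> RT w' y v \<Longrightarrow> RF w' (N n x y) (N' i u v)"
  shows "RF w (nat_trans T S N) (s_nat_trans T' S' N')"
  using assms unfolding nat_trans_def s_nat_trans_def
  by - ((assumption | rule bridge N | erule bridge_mono)+)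

lemma RF_normal_morphism [bridge]:
  assumes "RD w T T'"
    and "RD w S S'"
    and N: "\<And>w' n i x u y v. w \<preceq> w' \<Longrightarrow> RT w' n i \<Longrightarrow> RT w' x u \<Longrightarrow> RT w' y v \<Longrightarrow> RF w' (N n x y) (N' i u v)"
  shows "RF w (normal_morphism T S N) (s_normal_morphism T' S' N')"
  using assms unfolding normal_morphism_def s_normal_morphism_def
  by - ((assumption | rule bridge N | erule bridge_mono)+)

lemma RF_upper_derivative [bridge]:
  assumes "RD w T T'"
    and "RD w S S'"
    and N: "\<And>w' n i x u y v. w \<preceq> w' \<Longrightarrow> RT w' n i \<Longrightarrow> RT w' x u \<Longrightarrow> RT w' y v \<Longrightarrow> RF w' (N n x y) (N' i u v)"
  shows "RF w (upper_derivative T S N) (s_upper_derivative T' S' N')"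
  using assms unfolding upper_derivative_def s_upper_derivative_def
  by - ((assumption | rule bridge N | erule bridge_mono)+)

lemma RF_upper_morphism [bridge]:
  assumes "RD w T T'"
    and "RD w S S'"
    and X: "\<And>w' n i x u y v. w \<preceq> w' \<Longrightarrow> RT w' n i \<Longrightarrow> RT w' x u \<Longrightarrow> RT w' y v \<Longrightarrow> RF w' (X n x y) (X' i u v)"
    and "RD w R R'"
    and Y: "\<And>w' n i x u y v. w \<preceq> w' \<Longrightarrow> RT w' n i \<Longrightarrow> RT w' x u \<Longrightarrow> RT w' y v \<Longrightarrow> RF w' (Y n x y) (Y' i u v)"
    and N: "\<And>w' n i x u y v. w \<preceq> w' \<Longrightarrow> RT w' n i \<Longrightarrow> RT w' x u \<Longrightarrow> RT w' y v \<Longrightarrow> RF w' (N n x y) (N' i u v)"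
  shows "RF w (upper_morphism T S X R Y N) (s_upper_morphism T' S' X' R' Y' N')"
  using assms unfolding upper_morphism_def s_upper_morphism_def
  by - ((assumption | rule bridge X Y N | erule bridge_mono)+)

lemma RF_family [bridge]:
  assumes "RS w X V"
    and "RT w n i" "RT w x u" "RT w y v"
  shows "RF w (family X n x y) (s_family V i u v)"
  using assms unfolding family_def s_family_def
  by - ((assumption | rule bridge | erule bridge_mono)+)

lemma RF_coded [bridge]:
  assumes "RS w A A'" "RS w B B'" "RS w C C'" "RS w D D'" "RS w E E'"
  shows "RD w (coded A B C D E) (s_coded A' B' C' D' E')"
  using assms unfolding coded_def s_coded_def
  by - ((assumption | rule bridge | erule bridge_mono)+)

lemma RF_is_derivative [bridge]:
  assumes "RD w T T'"
    and "RD w S S'"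
    and X: "\<And>w' n i x u y v. w \<preceq> w' \<Longrightarrow> RT w' n i \<Longrightarrow> RT w' x u \<Longrightarrow> RT w' y v \<Longrightarrow> RF w' (X n x y) (X' i u v)"
  shows "RF w (is_derivative T S X) (s_is_derivative T' S' X')"
  using assms unfolding is_derivative_def s_is_derivative_def all_praedil_def all_family_def ex_family_def
  by - ((assumption | rule bridge X | erule bridge_mono)+)

lemma RT_tms [bridge]:
  "RT w m i \<Longrightarrow> RT w (mu_tm m) (s_mu_tm i)"
  "RT w m i \<Longrightarrow> RT w s u \<Longrightarrow> RT w (xi_tm m s) (s_xi_tm i u)"
  unfolding mu_tm_def s_mu_tm_def xi_tm_def s_xi_tm_def by (intro RT_terms; assumption)+

lemma RF_is_mu_pair [bridge]:
  assumes "RD w T T'"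
    and "RT w m m'" "RT w a a'" "RT w s s'"
  shows "RF w (is_mu_pair T m a s) (s_is_mu_pair T' m' a' s')"
  using assms unfolding is_mu_pair_def s_is_mu_pair_def
  by - ((assumption | rule bridge | erule bridge_mono)+)

lemma RF_is_partial_fld [bridge]:
  assumes "RD w T T'"
    and "RD w P P'"
  shows "RF w (is_partial_fld T P) (s_is_partial_fld T' P')"
  using assms unfolding is_partial_fld_def s_is_partial_fld_def
  by - ((assumption | rule bridge | erule bridge_mono)+)

lemma RF_is_partial_less [bridge]:
  assumes "RD w T T'"
    and "RD w P P'"
  shows "RF w (is_partial_less T P) (s_is_partial_less T' P')"
  using assms unfolding is_partial_less_def s_is_partial_less_def
  by - ((assumption | rule bridge | erule bridge_mono)+)

lemma RF_is_partial_act [bridge]: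
  assumes "RD w T T'"
    and "RD w P P'"
  shows "RF w (is_partial_act T P) (s_is_partial_act T' P')"
  using assms unfolding is_partial_act_def s_is_partial_act_def
  by - ((assumption | rule bridge | erule bridge_mono)+)

lemma RF_is_partial_supp [bridge]:
  assumes "RD w T T'"
    and "RD w P P'"
  shows "RF w (is_partial_supp T P) (s_is_partial_supp T' P')"
  using assms unfolding is_partial_supp_def s_is_partial_supp_def
  by - ((assumption | rule bridge | erule bridge_mono)+)

lemma RF_is_partial_mu [bridge]:
  assumes "RD w T T'"
    and "RD w P P'"
  shows "RF w (is_partial_mu T P) (s_is_partial_mu T' P')"
  using assms unfolding is_partial_mu_def s_is_partial_mu_def
  by - ((assumption | rule bridge | erule bridge_mono)+)

lemma RF_is_partial [bridge]:
  assumes "RD w T T'"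
    and "RD w P P'"
  shows "RF w (is_partial T P) (s_is_partial T' P')"
  using assms unfolding is_partial_def s_is_partial_def
  by - ((assumption | rule bridge | erule bridge_mono)+)

lemma RF_is_xi [bridge]:
  assumes "RD w T T'"
    and "RD w P P'"
    and X: "\<And>w' n i x u y v. w \<preceq> w' \<Longrightarrow> RT w' n i \<Longrightarrow> RT w' x u \<Longrightarrow> RT w' y v \<Longrightarrow> RF w' (X n x y) (X' i u v)"
  shows "RF w (is_xi T P X) (s_is_xi T' P' X')"
  using assms unfolding is_xi_def s_is_xi_def
  by - ((assumption | rule bridge X | erule bridge_mono)+)

lemma sat_goal:
  assumes "\<And>A B C D E. A \<in> Sets \<Longrightarrow> B \<in> Sets \<Longrightarrow> C \<in> Sets \<Longrightarrow> D \<in> Sets \<Longrightarrow> E \<in> Sets \<Longrightarrow>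
    s_is_normal_praedilator (s_coded A B C D E) \<Longrightarrow>
    (\<exists>A'\<in>Sets. \<exists>B'\<in>Sets. \<exists>C'\<in>Sets. \<exists>D'\<in>Sets. \<exists>E'\<in>Sets. \<exists>X\<in>Sets.
      s_is_partial (s_coded A B C D E) (s_coded A' B' C' D' E')
      \<and> s_is_xi (s_coded A B C D E) (s_coded A' B' C' D' E') (s_family X))
    \<and> (\<forall>A'\<in>Sets. \<forall>B'\<in>Sets. \<forall>C'\<in>Sets. \<forall>D'\<in>Sets. \<forall>E'\<in>Sets. \<forall>X\<in>Sets.
      s_is_partial (s_coded A B C D E) (s_coded A' B' C' D' E')
      \<and> s_is_xi (s_coded A B C D E) (s_coded A' B' C' D' E') (s_family X)
      \<longrightarrow> s_is_derivative (s_coded A B C D E) (s_coded A' B' C' D' E') (s_family X))"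
  shows "derivable RCA0 [] goal"
proof -
  let ?G = "\<^bold>\<forall>\<^sub>PT. is_normal_praedilator T \<^bold>\<longrightarrow>
     (\<^bold>\<exists>\<^sub>PP. \<^bold>\<exists>\<^sub>Fxi. is_partial T P \<^bold>\<and> is_xi T P xi)
     \<^bold>\<and> (\<^bold>\<forall>\<^sub>PP. \<^bold>\<forall>\<^sub>Fxi. is_partial T P \<^bold>\<and> is_xi T P xi \<^bold>\<longrightarrow> is_derivative T P xi)"
  have "RF ([], []) ?G
    (\<forall>A\<in>Sets. \<forall>B\<in>Sets. \<forall>C\<in>Sets. \<forall>D\<in>Sets. \<forall>E\<in>Sets. s_is_normal_praedilator (s_coded A B C D E) \<longrightarrow>
    (\<exists>A'\<in>Sets. \<exists>B'\<in>Sets. \<exists>C'\<in>Sets. \<exists>D'\<in>Sets. \<exists>E'\<in>Sets. \<exists>X\<in>Sets.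
      s_is_partial (s_coded A B C D E) (s_coded A' B' C' D' E')
      \<and> s_is_xi (s_coded A B C D E) (s_coded A' B' C' D' E') (s_family X))
    \<and> (\<forall>A'\<in>Sets. \<forall>B'\<in>Sets. \<forall>C'\<in>Sets. \<forall>D'\<in>Sets. \<forall>E'\<in>Sets. \<forall>X\<in>Sets.
      s_is_partial (s_coded A B C D E) (s_coded A' B' C' D' E')
      \<and> s_is_xi (s_coded A B C D E) (s_coded A' B' C' D' E') (s_family X)
      \<longrightarrow> s_is_derivative (s_coded A B C D E) (s_coded A' B' C' D' E') (s_family X)))"
    unfolding all_praedil_def ex_praedil_def all_family_def ex_family_def
    by - ((assumption | rule bridge | erule bridge_mono)+)
  then have "sat Sets (num_env ([], [])) (set_env ([], [])) goal"
    using assms by (simp add: RF_def goal_def)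
  moreover have "num_env ([], []) = (\<lambda>i. abs_nn (Var i))" "set_env ([], []) = set_of_var"
    by (auto simp: num_env_def set_env_def)
  ultimately show ?thesis using truth Th(2) by simp
qed

section \<open>Computable families of finite sets\<close>

lemma P1_induct [consumes 1, case_names zero succ]:
  assumes P: "S1 (\<lambda>x. \<not> P x)" and "P 0" and step: "\<And>x. P x \<Longrightarrow> P (x + 1)" shows "P (a :: nn)"
proof (rule ccontr)
  assume a: "\<not> P a"
  have "S1 (\<lambda>z. \<exists>x. x + z = a \<and> \<not> P x \<or> a < z)"
    by (intro S1_exI S1_disj S1_conj D1_S1[OF D1_eq] D1_S1[OF D1_less] F1_rules S1_comp[OF P])
  then have "\<exists>x. x + z = a \<and> \<not> P x \<or> a < z" for z
  proof (induction z rule: S1_induct)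
    case zero
    show ?case using a by auto
  next
    case (succ z)
    then obtain x where "x + z = a \<and> \<not> P x \<or> a < z" by blast
    then show ?case
    proof
      assume x: "x + z = a \<and> \<not> P x"
      show ?thesis
      proof (cases x rule: nn_cases)
        case zero
        then show ?thesis using x \<open>P 0\<close> by simp
      next
        case (succ y)
        then have "\<not> P y" using x step by blast
        then show ?thesis using succ x by (intro exI[of _ y]) (simp add: ac_simps)
      qed
    next
      assume "a < z"
      then show ?thesis by (auto intro: less_imp_le)
    qed
  qed
  from this[of a] obtain x where "x + a = a" "\<not> P x" by auto
  then show False using \<open>P 0\<close> by simp
qed

lemma P1_less_induct [consumes 1, case_names less]:
  assumes P: "S1 (\<lambda>x. \<not> P x)" and step: "\<And>x. (\<And>y. y < x \<Longrightarrow> P y) \<Longrightarrow> P x" shows "P (x :: nn)"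
proof -
  have "S1 (\<lambda>x. \<exists>y. y < x \<and> \<not> P y)"
    by (intro S1_exI S1_conj D1_S1[OF D1_less] F1_rules S1_comp[OF P])
  then have "S1 (\<lambda>x. \<not> (\<forall>y<x. P y))" by simp
  then have "\<forall>y<z. P y" for z
    by (induction z rule: P1_induct) (use step in \<open>auto simp: le_less\<close>)
  from this[of "x + 1"] show ?thesis by simp
qed

definition FS :: "('a::cod \<Rightarrow> nn set) \<Rightarrow> bool" where
  "FS A \<longleftrightarrow> (\<forall>e. fin (A e)) \<and> F1 (\<lambda>e. code (A e))"

lemma FS_fin: "FS A \<Longrightarrow> fin (A e)" and FS_code: "FS A \<Longrightarrow> F1 (\<lambda>e. code (A e))"
  by (auto simp: FS_def)

lemma FS_comp: "FS A \<Longrightarrow> F1 g \<Longrightarrow> FS (\<lambda>e. A (g e))"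
  unfolding FS_def using F1_comp[of "\<lambda>e. code (A e)" g] by blast

lemma D1_memFS: "F1 f \<Longrightarrow> FS A \<Longrightarrow> D1 (\<lambda>e. f e \<in> A e)"
  using D1_fs[OF _ FS_code, of f A] by (simp add: FS_fin)

lemma D1_ballFS: "FS A \<Longrightarrow> D1 (\<lambda>p. P (fst p) (snd p)) \<Longrightarrow> D1 (\<lambda>e. \<forall>x\<in>A e. P e x)"
  using D1_ball_fs[OF FS_code, of A P] by (simp add: FS_fin)

lemma D1_bexFS: "FS A \<Longrightarrow> D1 (\<lambda>p. P (fst p) (snd p)) \<Longrightarrow> D1 (\<lambda>e. \<exists>x\<in>A e. P e x)"
  using D1_bex_fs[OF FS_code, of A P] by (simp add: FS_fin)

lemma D1_eqFS: assumes "FS A" "FS B" shows "D1 (\<lambda>e. A e = B e)"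
  using D1_eq[OF FS_code[OF assms(1)] FS_code[OF assms(2)]]
  by (simp add: code_inject FS_fin[OF assms(1)] FS_fin[OF assms(2)])

lemma FS_filter: assumes "FS A" "D1 (\<lambda>p. P (fst p) (snd p))" shows "FS (\<lambda>e. {x \<in> A e. P e x})"
proof -
  have "D1 (P e)" for e using D1_comp2[OF assms(2) F1_const F1_id] .
  then show ?thesis
    using F1_code_filter[OF FS_code[OF assms(1)] assms(2)]
    unfolding FS_def by (auto simp: FS_fin[OF assms(1)] intro: fin_D1_subset)
qed

lemma FS_fs: assumes "F1 f" shows "FS (\<lambda>e. fs (f e))"
  using F1_code_filter[OF assms D1_const[of True]] by (simp add: FS_def)

lemma FS_const: "fin A \<Longrightarrow> FS (\<lambda>e. A)"
  using FS_fs[OF F1_const, of "code A"] by simp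

lemma FS_Un: assumes "FS A" "FS B" shows "FS (\<lambda>e. A e \<union> B e)"
  using F1_code_Un[OF FS_code[OF assms(1)] FS_code[OF assms(2)]]
  by (simp add: FS_def FS_fin[OF assms(1)] FS_fin[OF assms(2)])

lemma FS_insert: assumes "F1 f" "FS B" shows "FS (\<lambda>e. insert (f e) (B e))"
  using F1_code_insert[OF assms(1) FS_code[OF assms(2)]]
  by (simp add: FS_def FS_fin[OF assms(2)])

lemma FS_empty: "FS (\<lambda>e. {})" by (simp add: FS_def F1_const)

lemma FS_image: assumes "F1 (\<lambda>p. f (fst p) (snd p))" "FS A" shows "FS (\<lambda>e. f e ` A e)"
proof -
  have "F1 (f e)" for e using F1_comp2[OF assms(1) F1_const F1_id] .
  then show ?thesis
    using F1_code_image[OF assms(1) FS_code[OF assms(2)]] fin_image[OF FS_fin[OF assms(2)]]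
    by (simp add: FS_def FS_fin[OF assms(2)])
qed

lemma FS_UN: assumes "F1 (\<lambda>p. f (fst p) (snd p))" "FS A" shows "FS (\<lambda>e. \<Union>x\<in>A e. fs (f e x))"
proof -
  have "F1 (f e)" for e using F1_comp2[OF assms(1) F1_const F1_id] .
  then show ?thesis
    using F1_code_UN[OF assms(1) FS_code[OF assms(2)]] fin_UN[OF FS_fin[OF assms(2)]]
    by (simp add: FS_def FS_fin[OF assms(2)])
qed

lemma FS_lessThan: assumes "F1 f" shows "FS (\<lambda>e. {..<f e})"
proof -
  have "F1 (\<lambda>k. code {x. x < k})" using fin_lessThan unfolding lessThan_def
    by (intro F1_code[where b="\<lambda>k. k"] D1_rules F1_rules)
  then have "FS (\<lambda>k. {..<k})" by (simp add: FS_def lessThan_def[symmetric])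
  then show ?thesis by (rule FS_comp) fact
qed

lemmas FS_rules = FS_filter FS_fs FS_Un FS_insert FS_empty FS_lessThan FS_image FS_UN
lemmas comp_rules = D1_ballFS D1_bexFS D1_eqFS D1_logic D1_memFS D1_const F1_rules FS_rules

section \<open>Cardinality\<close>

lemma cnt_ex: "\<exists>f :: nn \<Rightarrow> nn \<Rightarrow> nn. F1 (\<lambda>p. f (fst p) (snd p)) \<and>
  (\<forall>a. f a 0 = 0 \<and> (\<forall>z. f a (z + 1) = f a z + (if z \<in> fs a then 1 else 0)))"
proof -
  let ?h = "\<lambda>a z c. c + (if z \<in> fs a then 1 else 0) :: nn"
  have "F1 (\<lambda>p. ?h (fst p) (fst (snd p)) (snd (snd p)))"
    by (intro F1_rules F1_if D1_fs)
  from prim_rec[OF F1_const[of 0] this] show ?thesis by metis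
qed

definition cnt :: "nn \<Rightarrow> nn \<Rightarrow> nn" where
  "cnt = (SOME f. F1 (\<lambda>p. f (fst p) (snd p)) \<and>
    (\<forall>a. f a 0 = 0 \<and> (\<forall>z. f a (z + 1) = f a z + (if z \<in> fs a then 1 else 0))))"

lemma cnt: "F1 (\<lambda>p. cnt (fst p) (snd p))" "cnt a 0 = 0"
  "cnt a (z + 1) = cnt a z + (if z \<in> fs a then 1 else 0)"
  using someI_ex[OF cnt_ex] unfolding cnt_def by blast+

definition crd :: "nn set \<Rightarrow> nn" where "crd A = cnt (code A) (code A)"

lemma F1_crd: "FS A \<Longrightarrow> F1 (\<lambda>e. crd (A e))"
  unfolding crd_def by (intro F1_comp2[OF cnt(1)] FS_code)

lemma crd_cnt: assumes A: "fin A" and b: "\<And>x. x \<in> A \<Longrightarrow> x < b" shows "crd A = cnt (code A) b"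
proof -
  have stable: "cnt (code A) (b + d) = cnt (code A) b" if b: "\<And>x. x \<in> A \<Longrightarrow> x < b" for b d
  proof -
    have "D1 (\<lambda>d. cnt (code A) (b + d) = cnt (code A) b)"
      by (intro comp_rules F1_comp2[OF cnt(1)])
    then show ?thesis
    proof (induction d rule: D1_induct)
      case (succ d)
      have "b + d \<notin> A" using b[of "b + d"] by (auto simp: not_less)
      then show ?case using succ A cnt(3)[of "code A" "b + d"] by (simp add: add.assoc)
    qed simp
  qed
  have a: "x < code A" if "x \<in> A" for x using fs_bound[of x "code A"] that A by simp
  have "cnt (code A) b = cnt (code A) (b + code A)" using stable[OF b] by simp
  also have "\<dots> = cnt (code A) (code A)" using stable[OF a, of b] by (simp add: add.commute)
  finally show ?thesis by (simp add: crd_def)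
qed

lemma crd_empty [simp]: "crd {} = 0"
  using crd_cnt[of "{}" 0] by (simp add: cnt)

lemma crd_insert: assumes A: "fin A" and x: "x \<notin> A" shows "crd (insert x A) = crd A + 1"
proof -
  obtain b where b: "\<And>y. y \<in> insert x A \<Longrightarrow> y < b" using fin_bound[of "insert x A"] A by auto
  have "D1 (\<lambda>z. cnt (code (insert x A)) z = cnt (code A) z + (if x < z then 1 else 0))"
    by (intro comp_rules F1_comp2[OF cnt(1)] F1_if)
  then have "cnt (code (insert x A)) z = cnt (code A) z + (if x < z then 1 else 0)" for z
  proof (induction z rule: D1_induct)
    case zero
    show ?case by (simp add: cnt)
  next
    case (succ z)
    then show ?case using A x cnt(3)[of "code (insert x A)" z] cnt(3)[of "code A" z]
      by (auto simp: ac_simps le_less)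
  qed
  from this[of b] show ?thesis
    using crd_cnt[of A b] crd_cnt[of "insert x A" b] A b by auto
qed

lemma crd_Un:
  assumes A: "fin A" and B: "fin B" and "A \<inter> B = {}" shows "crd (A \<union> B) = crd A + crd B"
proof -
  have "S1 (\<lambda>a. crd (fs a \<union> B) = crd (fs a) + crd B)"
    by (intro D1_S1 comp_rules F1_crd FS_const B)
  with A show ?thesis
  proof (induction rule: fin_induct)
    case (insert x A')
    then have "x \<notin> A' \<union> B" using assms(3) by blast
    then show ?case using insert B by (simp add: crd_insert ac_simps)
  qed simp
qed

lemma crd_mono: assumes "fin B" "fin A" "A \<subseteq> B" shows "crd A \<le> crd B"
  using crd_Un[of A "B - A"] assms by (simp add: Un_absorb1)

lemma crd_0: assumes "fin A" "crd A = 0" shows "A = {}"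
proof (rule ccontr)
  assume "A \<noteq> {}"
  then obtain x where "x \<in> A" by blast
  then have "crd {x} \<le> crd A" using assms by (intro crd_mono) auto
  then show False using assms crd_insert[of "{}" x] by simp
qed

lemma crd_subset_eq: assumes "fin B" "fin A" "A \<subseteq> B" "crd A = crd B" shows "A = B"
proof -
  have "crd (B - A) = 0" using crd_Un[of A "B - A"] assms by (simp add: Un_absorb1)
  then show ?thesis using crd_0[of "B - A"] assms by auto
qed

lemma crd_strict: assumes "fin B" "fin A" "A \<subset> B" shows "crd A < crd B"
  using crd_mono[of B A] crd_subset_eq[of B A] assms by (auto simp: order.strict_iff_order)

lemma crd_image: assumes A: "fin A" and f: "F1 f" "inj_on f A" shows "crd (f ` A) = crd A"
proof -
  have "S1 (\<lambda>a. crd (f ` fs a) = crd (fs a))"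
    by (intro D1_S1 comp_rules F1_crd F1_comp[OF f(1)])
  with A show ?thesis
  proof (induction rule: fin_induct)
    case (insert x A')
    then have "f x \<notin> f ` A'" using f(2) by (auto simp: inj_on_def)
    then show ?case using insert f(1) by (simp add: crd_insert fin_image)
  qed simp
qed

lemma lessThan_zero [simp]: "{..<0::nn} = {}" by auto

lemma lessThan_succ: "{..<k + 1} = insert k {..<k::nn}"
  by (auto simp: le_less)

lemma crd_lessThan [simp]: "crd {..<k} = k"
proof -
  have "D1 (\<lambda>k. crd {..<k} = k)" by (intro comp_rules F1_crd)
  then show ?thesis
  proof (induction k rule: D1_induct)
    case (succ k)
    then show ?case using crd_insert[of "{..<k}" k] by (simp add: lessThan_succ)
  qed simp
qed

section \<open>Ranks in finite linear orders\<close>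

definition lin :: "(nn \<Rightarrow> nn \<Rightarrow> bool) \<Rightarrow> nn set \<Rightarrow> bool" where
  "lin lt A \<longleftrightarrow> (\<forall>x\<in>A. \<not> lt x x) \<and> (\<forall>x\<in>A. \<forall>y\<in>A. \<forall>z\<in>A. lt x y \<longrightarrow> lt y z \<longrightarrow> lt x z)
    \<and> (\<forall>x\<in>A. \<forall>y\<in>A. lt x y \<or> x = y \<or> lt y x)"

definition rank :: "(nn \<Rightarrow> nn \<Rightarrow> bool) \<Rightarrow> nn set \<Rightarrow> nn \<Rightarrow> nn" where
  "rank lt A x = crd {y \<in> A. lt y x}"

text \<open>The morphism \<open>|\<iota>|\<close> for the inclusion \<open>\<iota>\<close> of \<open>A\<close> into \<open>C\<close>.\<close>

definition inc :: "(nn \<Rightarrow> nn \<Rightarrow> bool) \<Rightarrow> nn set \<Rightarrow> nn set \<Rightarrow> nn" where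
  "inc lt A C = pr (crd A) (pr (crd C) (code ((\<lambda>x. pr (rank lt A x) (rank lt C x)) ` A)))"

lemma linD:
  "lin lt A \<Longrightarrow> x \<in> A \<Longrightarrow> \<not> lt x x"
  "lin lt A \<Longrightarrow> lt x y \<Longrightarrow> lt y z \<Longrightarrow> x \<in> A \<Longrightarrow> y \<in> A \<Longrightarrow> z \<in> A \<Longrightarrow> lt x z"
  "lin lt A \<Longrightarrow> x \<in> A \<Longrightarrow> y \<in> A \<Longrightarrow> lt x y \<or> x = y \<or> lt y x"
  unfolding lin_def by blast+

lemma lin_asym: "lin lt A \<Longrightarrow> lt x y \<Longrightarrow> x \<in> A \<Longrightarrow> y \<in> A \<Longrightarrow> \<not> lt y x"
  using linD by metis

lemma lin_subset: "lin lt A \<Longrightarrow> B \<subseteq> A \<Longrightarrow> lin lt B"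
  unfolding lin_def by blast

lemma D1_lin:
  assumes "D1 (\<lambda>p. lt (fst p) (fst (snd p)) (snd (snd p)))" "FS A"
  shows "D1 (\<lambda>e. lin (lt e) (A e))"
  unfolding lin_def by (intro comp_rules D1_comp3[OF assms(1)] FS_comp[OF assms(2)] assms(2))

lemma F1_rank:
  assumes "D1 (\<lambda>p. lt (fst p) (fst (snd p)) (snd (snd p)))" "FS A" "F1 x"
  shows "F1 (\<lambda>e. rank (lt e) (A e) (x e))"
  unfolding rank_def
  by (intro F1_crd comp_rules D1_comp3[OF assms(1)] FS_comp[OF assms(2)] F1_comp[OF assms(3)] assms(2))

lemma F1_inc:
  assumes "D1 (\<lambda>p. lt (fst p) (fst (snd p)) (snd (snd p)))" "FS A" "FS C"
  shows "F1 (\<lambda>e. inc (lt e) (A e) (C e))"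
  unfolding inc_def
  by (intro F1_crd FS_code FS_image F1_rank F1_rules D1_comp3[OF assms(1)] FS_comp[OF assms(2)]
      FS_comp[OF assms(3)] assms(2,3))

lemma rank_cong: "(\<And>y. y \<in> A \<Longrightarrow> lt y x = lt' y x) \<Longrightarrow> rank lt A x = rank lt' A x"
  unfolding rank_def by (metis (mono_tags, lifting) Collect_cong)

lemma inc_cong:
  assumes "A \<subseteq> C" "\<And>x y. x \<in> C \<Longrightarrow> y \<in> C \<Longrightarrow> lt x y = lt' x y"
  shows "inc lt A C = inc lt' A C"
proof -
  have "rank lt B x = rank lt' B x" if "B \<subseteq> C" "x \<in> A" for B x
    using that assms by (intro rank_cong) auto
  then show ?thesis using assms(1) unfolding inc_def by (metis (no_types, lifting) image_cong order_refl)
qed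

lemma lin_cong:
  assumes "\<And>x y. x \<in> C \<Longrightarrow> y \<in> C \<Longrightarrow> lt x y = lt' x y" shows "lin lt C = lin lt' C"
  using assms by (simp add: lin_def cong: ball_cong)

context
  fixes lt :: "nn \<Rightarrow> nn \<Rightarrow> bool"
  assumes D1_lt: "D1 (\<lambda>p. lt (fst p) (snd p))"
begin

lemma fin_below: "fin A \<Longrightarrow> fin {y \<in> A. lt y x}"
  by (intro fin_D1_subset D1_comp2[OF D1_lt] F1_rules)

lemma F1_rank': "fin A \<Longrightarrow> F1 (rank lt A)"
  by (rule F1_rank[where lt="\<lambda>_. lt"]) (intro F1_rules D1_comp2[OF D1_lt] FS_const; assumption)+

lemma rank_less:
  assumes "lin lt A" "fin A" "lt x y" "x \<in> A" "y \<in> A" shows "rank lt A x < rank lt A y"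
  unfolding rank_def
proof (rule crd_strict)
  show "{z \<in> A. lt z x} \<subset> {z \<in> A. lt z y}" using assms linD(1,2)[OF assms(1)] by blast
qed (use assms fin_below in auto)

lemma rank_less_iff:
  assumes "lin lt A" "fin A" "x \<in> A" "y \<in> A"
  shows "rank lt A x < rank lt A y \<longleftrightarrow> lt x y" "rank lt A x = rank lt A y \<longleftrightarrow> x = y"
  using rank_less[OF assms(1,2)] linD(3)[OF assms(1,3,4)] assms(3,4) by (metis less_asym less_irrefl)+

lemma rank_bound: assumes "lin lt A" "fin A" "x \<in> A" shows "rank lt A x < crd A"
  unfolding rank_def
  by (rule crd_strict) (use assms fin_below linD(1)[OF assms(1)] in auto)

lemma inj_rank: "lin lt A \<Longrightarrow> fin A \<Longrightarrow> inj_on (rank lt A) A"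
  by (auto simp: inj_on_def rank_less_iff)

lemma rank_image: assumes "lin lt A" "fin A" shows "rank lt A ` A = {..<crd A}"
proof (rule crd_subset_eq)
  show "rank lt A ` A \<subseteq> {..<crd A}" using rank_bound assms by auto
  show "crd (rank lt A ` A) = crd {..<crd A}" using assms by (simp add: crd_image F1_rank' inj_rank)
qed (simp_all add: assms fin_image F1_rank')

lemma rank_surj: assumes "lin lt A" "fin A" "i < crd A" shows "\<exists>x\<in>A. rank lt A x = i"
  using rank_image[OF assms(1,2)] assms(3) by (metis imageE lessThan_iff)

lemma rank_unique:
  assumes lin: "lin lt A" and A: "fin A" and f: "F1 f" "f ` {..<k} = A"
    and mono: "\<And>i j. i < j \<Longrightarrow> j < k \<Longrightarrow> lt (f i) (f j)" and i: "i < k"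
  shows "rank lt A (f i) = i" "crd A = k"
proof -
  have memb: "f i \<in> A" if "i < k" for i using f that by blast
  have inj: "inj_on f {..<k}"
    unfolding inj_on_def using mono linD(1)[OF lin memb] by (metis lessThan_iff linorder_neqE)
  have less: "lt (f j) (f i) \<longleftrightarrow> j < i" if "j < k" "i < k" for i j
    using mono lin_asym[OF lin] linD(1)[OF lin] memb that by (metis linorder_neqE)
  have "{y \<in> A. lt y (f i)} = f ` {..<i}" using f(2) less i by (fastforce dest: less_trans[OF _ i])
  moreover have "inj_on f {..<i}" using inj i by (rule_tac inj_on_subset) (auto dest: less_trans)
  ultimately show "rank lt A (f i) = i" by (simp add: rank_def crd_image f(1))
  show "crd A = k" using crd_image[OF _ f(1) inj] f(2) by simp
qed

end

section \<open>Morphisms of the category of natural numbers\<close>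

lemma s_embedsI:
  assumes "\<And>x y. G x y \<Longrightarrow> sFld X x \<and> sFld Y y"
    and "\<And>x. sFld X x \<Longrightarrow> \<exists>y. G x y \<and> (\<forall>z. G x z \<longrightarrow> z = y)"
    and "\<And>x y x' y'. G x y \<Longrightarrow> G x' y' \<Longrightarrow> sLt X x x' \<Longrightarrow> sLt Y y y'"
  shows "s_embeds X Y G"
  unfolding s_embeds_def s_maps_def using assms by (intro conjI) blast+

lemma s_embedsD:
  assumes "s_embeds X Y G"
  shows "G x y \<Longrightarrow> sFld X x \<and> sFld Y y" "sFld X x \<Longrightarrow> \<exists>y. G x y \<and> (\<forall>z. G x z \<longrightarrow> z = y)"
    "G x y \<Longrightarrow> G x' y' \<Longrightarrow> sLt X x x' \<Longrightarrow> sLt Y y y'"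
  using assms unfolding s_embeds_def s_maps_def by blast+

lemma s_below_simps [simp]:
  "sFld (s_below n) i \<longleftrightarrow> i < n" "sLt (s_below n) i j \<longleftrightarrow> i < j \<and> j < n"
  by (simp_all add: s_below_def)

lemma s_restrict_simps [simp]:
  "sFld (s_restrict X a) x \<longleftrightarrow> x \<in> fs a" "sLt (s_restrict X a) x y \<longleftrightarrow> x \<in> fs a \<and> y \<in> fs a \<and> sLt X x y"
  by (simp_all add: s_restrict_def)

definition p1 :: "nn \<Rightarrow> nn" where "p1 z = (LEAST x. (\<exists>y\<le>z. z = pr x y) \<or> (\<forall>x\<le>z. \<forall>y\<le>z. z \<noteq> pr x y))"
definition p2 :: "nn \<Rightarrow> nn" where "p2 z = (LEAST y. (\<exists>x\<le>z. z = pr x y) \<or> (\<forall>x\<le>z. \<forall>y\<le>z. z \<noteq> pr x y))"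

lemma pr_decode: "\<not> (\<forall>a\<le>pr x y. \<forall>b\<le>pr x y. x = a \<longrightarrow> y \<noteq> b)"
proof
  assume *: "\<forall>a\<le>pr x y. \<forall>b\<le>pr x y. x = a \<longrightarrow> y \<noteq> b"
  show False using *[rule_format, of x y, OF pr_ge] by simp
qed

lemma p1_pr [simp]: "p1 (pr x y) = x"
  unfolding p1_def by (rule Least_equality) (auto simp: pr_ge pr_decode)

lemma p2_pr [simp]: "p2 (pr x y) = y"
  unfolding p2_def by (rule Least_equality) (auto simp: pr_ge pr_decode)

lemma F1_p1: assumes "F1 f" shows "F1 (\<lambda>e. p1 (f e))"
proof -
  have "\<exists>x. (\<exists>y\<le>z. z = pr x y) \<or> (\<forall>x\<le>z. \<forall>y\<le>z. z \<noteq> pr x y)" for z by blast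
  then have "F1 p1" unfolding p1_def by (intro F1_Least comp_rules)
  then show ?thesis by (rule F1_comp) fact
qed

lemma F1_p2: assumes "F1 f" shows "F1 (\<lambda>e. p2 (f e))"
proof -
  have "\<exists>y. (\<exists>x\<le>z. z = pr x y) \<or> (\<forall>x\<le>z. \<forall>y\<le>z. z \<noteq> pr x y)" for z by blast
  then have "F1 p2" unfolding p2_def by (intro F1_Least comp_rules)
  then show ?thesis by (rule F1_comp) fact
qed

definition ap :: "nn \<Rightarrow> nn \<Rightarrow> nn" where "ap f i = lookup (p2 (p2 f)) i"

lemma F1_ap: "F1 f \<Longrightarrow> F1 g \<Longrightarrow> F1 (\<lambda>e. ap (f e) (g e))"
  unfolding ap_def by (intro F1_lookup F1_p2)

definition mor_graph :: "nn \<Rightarrow> nn \<Rightarrow> nn \<Rightarrow> bool" where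
  "mor_graph g n m \<longleftrightarrow> isf g \<and> (\<forall>z\<in>fs g. \<exists>i<n. \<exists>j<m. z = pr i j)
    \<and> (\<forall>i<n. \<exists>j<m. pr i j \<in> fs g \<and> (\<forall>j'<m. pr i j' \<in> fs g \<longrightarrow> j' = j))
    \<and> (\<forall>i<n. \<forall>i'<i. \<forall>j<m. \<forall>j'<m. pr i j \<in> fs g \<and> pr i' j' \<in> fs g \<longrightarrow> j' < j)"

lemma mor_graphD:
  assumes "mor_graph g n m"
  shows "isf g" "z \<in> fs g \<Longrightarrow> \<exists>i j. z = pr i j" "pr i j \<in> fs g \<Longrightarrow> i < n \<and> j < m"
    "i < n \<Longrightarrow> \<exists>j. pr i j \<in> fs g \<and> (\<forall>j'. pr i j' \<in> fs g \<longrightarrow> j' = j)"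
    "pr i j \<in> fs g \<Longrightarrow> pr i' j' \<in> fs g \<Longrightarrow> i < i' \<Longrightarrow> j < j'"
proof -
  note * = assms[unfolded mor_graph_def]
  show "isf g" using * by (rule conjunct1)
  have z: "\<forall>z\<in>fs g. \<exists>i<n. \<exists>j<m. z = pr i j" using * by (elim conjE)
  then show "z \<in> fs g \<Longrightarrow> \<exists>i j. z = pr i j" by blast
  have ij: "i < n \<and> j < m" if "pr i j \<in> fs g" for i j using bspec[OF z that] by auto
  then show "pr i j \<in> fs g \<Longrightarrow> i < n \<and> j < m" .
  have "\<forall>i<n. \<exists>j<m. pr i j \<in> fs g \<and> (\<forall>j'<m. pr i j' \<in> fs g \<longrightarrow> j' = j)" using * by (elim conjE)
  then show "i < n \<Longrightarrow> \<exists>j. pr i j \<in> fs g \<and> (\<forall>j'. pr i j' \<in> fs g \<longrightarrow> j' = j)" using ij by metis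
  have "\<forall>i<n. \<forall>i'<i. \<forall>j<m. \<forall>j'<m. pr i j \<in> fs g \<and> pr i' j' \<in> fs g \<longrightarrow> j' < j" using * by (elim conjE)
  then show "pr i j \<in> fs g \<Longrightarrow> pr i' j' \<in> fs g \<Longrightarrow> i < i' \<Longrightarrow> j < j'" using ij by metis
qed

lemma mor_app_graph: "s_app (pr n (pr m g)) i j \<longleftrightarrow> pr i j \<in> fs g"
  by (auto simp: s_app_def)

lemma mor_iff: "s_is_mor f n m \<longleftrightarrow> (\<exists>g\<le>f. f = pr n (pr m g) \<and> mor_graph g n m)"
  (is "?L \<longleftrightarrow> ?R")
proof
  assume L: ?L
  then obtain g where g: "f = pr n (pr m g)" "isf g" "\<And>z. z \<in> fs g \<Longrightarrow> \<exists>i j. z = pr i j"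
    unfolding s_is_mor_def by blast
  have "s_embeds (s_below n) (s_below m) (s_app f)" using L unfolding s_is_mor_def by blast
  then have E: "(\<forall>i j. pr i j \<in> fs g \<longrightarrow> i < n \<and> j < m) \<and>
      (\<forall>i. i < n \<longrightarrow> (\<exists>j. pr i j \<in> fs g \<and> (\<forall>j'. pr i j' \<in> fs g \<longrightarrow> j' = j))) \<and>
      (\<forall>i j i' j'. pr i j \<in> fs g \<and> pr i' j' \<in> fs g \<and> i < i' \<and> i' < n \<longrightarrow> j < j' \<and> j' < m)"
    unfolding s_embeds_def s_maps_def s_below_def s_order.select_convs g(1) mor_app_graph conj_assoc .
  then have e: "\<forall>i j. pr i j \<in> fs g \<longrightarrow> i < n \<and> j < m" by (rule conjunct1)
  have "\<exists>i<n. \<exists>j<m. z = pr i j" if "z \<in> fs g" for z using g(3)[OF that] that e by auto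
  moreover have "\<exists>j<m. pr i j \<in> fs g \<and> (\<forall>j'<m. pr i j' \<in> fs g \<longrightarrow> j' = j)" if "i < n" for i
    using E e that by metis
  moreover have "j < j'" if "pr i j \<in> fs g" "pr i' j' \<in> fs g" "i < i'" "i' < n" for i j i' j'
    using E that by metis
  ultimately have "mor_graph g n m" using g(2) unfolding mor_graph_def by simp metis
  moreover have "g \<le> f" unfolding g(1) using pr_ge(2) order_trans by blast
  ultimately show ?R using g(1) by blast
next
  assume ?R
  then obtain g where g: "f = pr n (pr m g)" "mor_graph g n m" by blast
  note G = mor_graphD[OF g(2)]
  have "\<forall>i j. pr i j \<in> fs g \<longrightarrow> i < n \<and> j < m" using G(3) by blast
  moreover have "\<forall>i. i < n \<longrightarrow> (\<exists>j. pr i j \<in> fs g \<and> (\<forall>j'. pr i j' \<in> fs g \<longrightarrow> j' = j))"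
    using G(4) by blast
  moreover have "\<forall>i j i' j'. pr i j \<in> fs g \<and> pr i' j' \<in> fs g \<and> i < i' \<and> i' < n \<longrightarrow> j < j' \<and> j' < m"
    using G(3,5) by blast
  ultimately have "s_embeds (s_below n) (s_below m) (s_app f)"
    unfolding s_embeds_def s_maps_def s_below_def s_order.select_convs g(1) mor_app_graph
    by (intro conjI)
  then show ?L unfolding s_is_mor_def using g(1) G(1,2) by blast
qed

lemma D1_mor: assumes "F1 f" "F1 n" "F1 m" shows "D1 (\<lambda>e. s_is_mor (f e) (n e) (m e))"
proof -
  have "D1 (\<lambda>p. s_is_mor (fst p) (fst (snd p)) (snd (snd p)))"
    unfolding mor_iff mor_graph_def by (intro comp_rules D1_isf)
  then show ?thesis by (rule D1_comp3) fact+
qed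

lemma mor: assumes "s_is_mor f n m" shows mor_app: "s_app f i j \<longleftrightarrow> i < n \<and> j = ap f i"
  and mor_bound: "i < n \<Longrightarrow> ap f i < m" and mor_mono: "i < j \<Longrightarrow> j < n \<Longrightarrow> ap f i < ap f j"
proof -
  from assms obtain g where g: "f = pr n (pr m g)" "mor_graph g n m" unfolding mor_iff by blast
  note G = mor_graphD[OF g(2)]
  have look: "pr i (ap f i) \<in> fs g \<and> (\<forall>j. pr i j \<in> fs g \<longrightarrow> j = ap f i)" if i: "i < n" for i
  proof -
    obtain j where j: "pr i j \<in> fs g" "\<And>j'. pr i j' \<in> fs g \<Longrightarrow> j' = j" using G(4)[OF i] by blast
    then have "lookup g i = j" by (rule lookup_eq)
    then have "ap f i = j" by (simp add: ap_def g(1))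
    then show ?thesis using j by blast
  qed
  show "s_app f i j \<longleftrightarrow> i < n \<and> j = ap f i"
    unfolding g(1) mor_app_graph using look[unfolded g(1)] G(3) by blast
  show "i < n \<Longrightarrow> ap f i < m" using look G(3) by blast
  show "ap f i < ap f j" if "i < j" "j < n"
    by (rule G(5)[OF conjunct1[OF look] conjunct1[OF look]]) (use that less_trans in auto)
qed

lemma mor_pr: assumes "s_is_mor f n m" shows "p1 f = n" "p1 (p2 f) = m"
  using assms unfolding s_is_mor_def by auto

lemma mor_ext:
  assumes "s_is_mor f n m" "s_is_mor f' n m" "\<And>i. i < n \<Longrightarrow> ap f i = ap f' i" shows "f = f'"
proof -
  obtain g g' where g: "f = pr n (pr m g)" "isf g" "\<forall>z. z \<in> fs g \<longrightarrow> (\<exists>i j. z = pr i j)"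
    "f' = pr n (pr m g')" "isf g'" "\<forall>z. z \<in> fs g' \<longrightarrow> (\<exists>i j. z = pr i j)"
    using assms(1,2) unfolding s_is_mor_def by blast
  have "s_app f i j \<longleftrightarrow> s_app f' i j" for i j
    using mor_app[OF assms(1)] mor_app[OF assms(2)] assms(3) by metis
  then have "pr i j \<in> fs g \<longleftrightarrow> pr i j \<in> fs g'" for i j by (simp add: s_app_def g(1,4))
  then have "fs g = fs g'" using g(3,6) by blast
  then show ?thesis using g isf_unique by metis
qed

lemma has_card_iff: "s_has_card a k \<longleftrightarrow> k = crd (fs a)"
proof
  assume "s_has_card a k"
  then obtain g where g: "s_maps (\<lambda>i. i < k) (\<lambda>x. x \<in> fs a) (\<lambda>i x. pr i x \<in> fs g)"
    "\<And>x. x \<in> fs a \<Longrightarrow> \<exists>i. pr i x \<in> fs g \<and> (\<forall>j. pr j x \<in> fs g \<longrightarrow> j = i)"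
    unfolding s_has_card_def by blast
  have look: "pr i (lookup g i) \<in> fs g" "\<forall>x. pr i x \<in> fs g \<longrightarrow> x = lookup g i" if "i < k" for i
  proof -
    obtain y where "pr i y \<in> fs g" "\<And>z. pr i z \<in> fs g \<Longrightarrow> z = y"
      using g(1) \<open>i < k\<close> unfolding s_maps_def by blast
    moreover from this have "lookup g i = y" by (rule lookup_eq)
    ultimately show "pr i (lookup g i) \<in> fs g" "\<forall>x. pr i x \<in> fs g \<longrightarrow> x = lookup g i" by blast+
  qed
  have e: "pr i x \<in> fs g \<Longrightarrow> i < k \<and> x \<in> fs a" for i x using g(1) unfolding s_maps_def by blast
  have "x \<in> lookup g ` {..<k}" if x: "x \<in> fs a" for x
  proof -
    obtain i where i: "pr i x \<in> fs g" using g(2)[OF x] by blast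
    then have "i < k" using e by blast
    then show ?thesis using look(2) i by blast
  qed
  then have "lookup g ` {..<k} = fs a" using look(1) e by blast
  moreover have "inj_on (lookup g) {..<k}"
    unfolding inj_on_def using look e g(2) by (metis lessThan_iff)
  moreover have "F1 (lookup g)" using F1_lookup[OF F1_const F1_id] .
  ultimately show "k = crd (fs a)" using crd_image[of "{..<k}" "lookup g"] by simp
next
  assume k: "k = crd (fs a)"
  let ?A = "fs a" and ?r = "rank (<) (fs a)"
  have D: "D1 (\<lambda>p. fst p < (snd p :: nn))" by (intro comp_rules)
  have l: "lin (<) ?A" unfolding lin_def by auto
  have r: "F1 ?r" by (rule F1_rank'[OF D]) simp
  let ?G = "(\<lambda>x. pr (?r x) x) ` ?A"
  have fin: "fin ?G" by (intro fin_image F1_rules r fin_fs)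
  have mem: "pr i x \<in> fs (code ?G) \<longleftrightarrow> x \<in> ?A \<and> i = ?r x" for i x
    unfolding fs_code[OF fin] by auto
  have "\<exists>x. (x \<in> ?A \<and> i = ?r x) \<and> (\<forall>y. y \<in> ?A \<and> i = ?r y \<longrightarrow> y = x)" if i: "i < k" for i
  proof -
    obtain x where "x \<in> ?A" "?r x = i" using rank_surj[OF D l fin_fs] i k by blast
    then show ?thesis using rank_less_iff(2)[OF D l fin_fs] by blast
  qed
  then have "s_maps (\<lambda>i. i < k) (\<lambda>x. x \<in> ?A) (\<lambda>i x. pr i x \<in> fs (code ?G))"
    unfolding s_maps_def mem using rank_bound[OF D l fin_fs] k by blast
  moreover have "\<forall>x. x \<in> ?A \<longrightarrow> (\<exists>i. pr i x \<in> fs (code ?G) \<and> (\<forall>j. pr j x \<in> fs (code ?G) \<longrightarrow> j = i))"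
    unfolding mem by blast
  ultimately show "s_has_card a k" unfolding s_has_card_def by blast
qed

context
  fixes lt :: "nn \<Rightarrow> nn \<Rightarrow> bool"
  assumes D1_lt: "D1 (\<lambda>p. lt (fst p) (snd p))"
begin

lemma fin_rank_graph: assumes "fin A" shows "fin ((\<lambda>x. pr (rank lt A x) x) ` A)"
  by (intro fin_image F1_rules F1_rank'[OF D1_lt] assms)

lemma fin_inc_graph: assumes "fin A" "fin C" shows "fin ((\<lambda>x. pr (rank lt A x) (rank lt C x)) ` A)"
  by (intro fin_image F1_rules F1_rank'[OF D1_lt] assms)

lemma inc:
  assumes l: "lin lt C" and fin: "fin A" "fin C" and AC: "A \<subseteq> C"
  shows mor_inc: "s_is_mor (inc lt A C) (crd A) (crd C)"
    and ap_inc: "x \<in> A \<Longrightarrow> ap (inc lt A C) (rank lt A x) = rank lt C x"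
proof -
  note lA = lin_subset[OF l AC]
  let ?G = "(\<lambda>x. pr (rank lt A x) (rank lt C x)) ` A"
  have fs: "fs (code ?G) = ?G" "isf (code ?G)" using fin_inc_graph[OF fin] by simp_all
  have app: "s_app (inc lt A C) i j \<longleftrightarrow> (\<exists>x\<in>A. i = rank lt A x \<and> j = rank lt C x)" for i j
    unfolding s_app_def inc_def pr_inject by (auto simp: fs)
  show mor: "s_is_mor (inc lt A C) (crd A) (crd C)"
    unfolding s_is_mor_def
  proof (intro conjI exI)
    show "inc lt A C = pr (crd A) (pr (crd C) (code ?G))" by (simp add: inc_def)
    show "isf (code ?G)" by (rule fs)
    show "\<forall>z. z \<in> fs (code ?G) \<longrightarrow> (\<exists>i j. z = pr i j)" by (auto simp: fs)
    show "s_embeds (s_below (crd A)) (s_below (crd C)) (s_app (inc lt A C))"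
    proof (rule s_embedsI)
      show "sFld (s_below (crd A)) i \<and> sFld (s_below (crd C)) j" if "s_app (inc lt A C) i j" for i j
        using that rank_bound[OF D1_lt lA fin(1)] rank_bound[OF D1_lt l fin(2)] AC
        unfolding app by auto
    next
      fix i assume "sFld (s_below (crd A)) i"
      then obtain x where "x \<in> A" "rank lt A x = i" using rank_surj[OF D1_lt lA fin(1)] by auto
      then show "\<exists>j. s_app (inc lt A C) i j \<and> (\<forall>j'. s_app (inc lt A C) i j' \<longrightarrow> j' = j)"
        unfolding app using rank_less_iff(2)[OF D1_lt lA fin(1)] by metis
    next
      fix i j i' j'
      assume ij: "s_app (inc lt A C) i j" "s_app (inc lt A C) i' j'" "sLt (s_below (crd A)) i i'"
      then obtain x x' where x: "x \<in> A" "x' \<in> A" "rank lt A x < rank lt A x'" "j = rank lt C x"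
        "j' = rank lt C x'" unfolding app by auto
      then have "lt x x'" using rank_less_iff(1)[OF D1_lt lA fin(1)] by blast
      moreover have "x \<in> C" "x' \<in> C" using x AC by blast+
      ultimately show "sLt (s_below (crd C)) j j'"
        using x rank_less_iff(1)[OF D1_lt l fin(2)] rank_bound[OF D1_lt l fin(2)] by auto
    qed
  qed
  show "ap (inc lt A C) (rank lt A x) = rank lt C x" if "x \<in> A"
    using mor_app[OF mor, of "rank lt A x" "rank lt C x"] that unfolding app by metis
qed

lemma inc_unique:
  assumes l: "lin lt C" and fin: "fin A" "fin C" and AC: "A \<subseteq> C"
    and f: "s_is_mor f (crd A) (crd C)" "\<And>x. x \<in> A \<Longrightarrow> ap f (rank lt A x) = rank lt C x"
  shows "f = inc lt A C"
  using f mor_inc[OF l fin AC] ap_inc[OF l fin AC] rank_surj[OF D1_lt lin_subset[OF l AC] fin(1)]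
  by (intro mor_ext[of f "crd A" "crd C"]) metis+

end

lemma enum_iff:
  assumes D: "D1 (\<lambda>p. sLt X (fst p) (snd p))" and l: "lin (sLt X) (fs a)"
  shows "s_enum X a k u \<longleftrightarrow> k = crd (fs a) \<and> u = code ((\<lambda>x. pr (rank (sLt X) (fs a) x) x) ` fs a)"
    (is "_ \<longleftrightarrow> _ \<and> u = code ?G")
proof
  assume e: "s_enum X a k u"
  have e1: "isf u" "\<And>z. z \<in> fs u \<Longrightarrow> \<exists>i x. z = pr i x" "\<And>x. x \<in> fs a \<Longrightarrow> \<exists>i. pr i x \<in> fs u"
    and e2: "\<And>i x. pr i x \<in> fs u \<Longrightarrow> i < k \<and> x \<in> fs a"
      "\<And>i. i < k \<Longrightarrow> \<exists>x. pr i x \<in> fs u \<and> (\<forall>y. pr i y \<in> fs u \<longrightarrow> y = x)"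
      "\<And>i x j y. pr i x \<in> fs u \<Longrightarrow> pr j y \<in> fs u \<Longrightarrow> i < j \<Longrightarrow> j < k \<Longrightarrow> sLt X x y"
    using e unfolding s_enum_def s_embeds_def s_maps_def s_below_def s_restrict_def by simp_all blast+
  have look: "pr i (lookup u i) \<in> fs u" "\<forall>x. pr i x \<in> fs u \<longrightarrow> x = lookup u i" if "i < k" for i
  proof -
    obtain y where "pr i y \<in> fs u" "\<And>z. pr i z \<in> fs u \<Longrightarrow> z = y" using e2(2)[OF \<open>i < k\<close>] by blast
    moreover from this have "lookup u i = y" by (rule lookup_eq)
    ultimately show "pr i (lookup u i) \<in> fs u" "\<forall>x. pr i x \<in> fs u \<longrightarrow> x = lookup u i" by blast+
  qed
  have F: "F1 (lookup u)" using F1_lookup[OF F1_const F1_id] .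
  have "x \<in> lookup u ` {..<k}" if x: "x \<in> fs a" for x
  proof -
    obtain i where i: "pr i x \<in> fs u" using e1(3)[OF x] by blast
    then have "i < k" using e2(1) by blast
    then show ?thesis using look(2) i by blast
  qed
  then have im: "lookup u ` {..<k} = fs a" using look(1) e2(1) by blast
  have mono: "sLt X (lookup u i) (lookup u j)" if "i < j" "j < k" for i j
    using look(1) e2(3) that by (meson less_trans)
  note ru = rank_unique[OF D l fin_fs F im mono]
  have "crd (fs a) = k"
  proof (cases "k = 0")
    case True
    then show ?thesis using im by simp
  next
    case False
    then show ?thesis using ru(2)[of 0] by (simp add: zero_less_iff)
  qed
  have "z \<in> fs u \<longleftrightarrow> z \<in> ?G" for z
  proof
    assume z: "z \<in> fs u"
    then obtain i x where ix: "z = pr i x" using e1(2) by blast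
    then have "i < k" "x \<in> fs a" "x = lookup u i" using z e2(1) look(2) by blast+
    then have "z = pr (rank (sLt X) (fs a) x) x" using ru(1) ix by simp
    then show "z \<in> ?G" using \<open>x \<in> fs a\<close> by blast
  next
    assume "z \<in> ?G"
    then obtain x where x: "x \<in> fs a" "z = pr (rank (sLt X) (fs a) x) x" by blast
    then obtain i where "i < k" "x = lookup u i" using im by blast
    then show "z \<in> fs u" using x ru(1) look(1) by metis
  qed
  then have "fs u = ?G" by blast
  then have "u = code ?G" using e1(1) code_fs by metis
  with \<open>crd (fs a) = k\<close> show "k = crd (fs a) \<and> u = code ?G" by simp
next
  assume u: "k = crd (fs a) \<and> u = code ?G"
  have fs: "fs (code ?G) = ?G" "isf (code ?G)" using fin_rank_graph[OF D fin_fs] by simp_all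
  have mem: "pr i x \<in> fs u \<longleftrightarrow> x \<in> fs a \<and> i = rank (sLt X) (fs a) x" for i x
    using u fs(1) by auto
  have "s_embeds (s_below k) (s_restrict X a) (\<lambda>i x. pr i x \<in> fs u)"
  proof (rule s_embedsI)
    fix i assume "sFld (s_below k) i"
    then obtain x where "x \<in> fs a" "rank (sLt X) (fs a) x = i" using rank_surj[OF D l fin_fs] u by auto
    then show "\<exists>x. pr i x \<in> fs u \<and> (\<forall>y. pr i y \<in> fs u \<longrightarrow> y = x)"
      unfolding mem using rank_less_iff(2)[OF D l fin_fs] by metis
  next
    show "sFld (s_below k) i \<and> sFld (s_restrict X a) x" if "pr i x \<in> fs u" for i x
      using that rank_bound[OF D l fin_fs] u unfolding mem by simp
    show "sLt (s_restrict X a) x y" if "pr i x \<in> fs u" "pr j y \<in> fs u" "sLt (s_below k) i j" for i x j y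
      using that rank_less_iff(1)[OF D l fin_fs] unfolding mem by simp
  qed
  then show "s_enum X a k u"
    unfolding s_enum_def using u fs by (auto simp: mem)
qed

lemma incl_iff:
  assumes D: "D1 (\<lambda>p. sLt X (fst p) (snd p))" and l: "lin (sLt X) (fs c)" and ac: "fs a \<subseteq> fs c"
  shows "s_incl X a c f \<longleftrightarrow> f = inc (sLt X) (fs a) (fs c)"
proof -
  let ?r = "\<lambda>a x. rank (sLt X) (fs a) x"
  note la = lin_subset[OF l ac]
  note mor = mor_inc[OF D l fin_fs fin_fs ac] and api = ap_inc[OF D l fin_fs fin_fs ac]
  have mem: "pr i x \<in> fs (code ((\<lambda>x. pr (?r a x) x) ` fs a)) \<longleftrightarrow> x \<in> fs a \<and> i = ?r a x" for a i x
    using fin_rank_graph[OF D fin_fs] by auto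
  have "s_incl X a c f \<longleftrightarrow> s_is_mor f (crd (fs a)) (crd (fs c)) \<and>
    (\<forall>i j. s_app f i j \<longrightarrow> (\<exists>x. (x \<in> fs a \<and> i = ?r a x) \<and> x \<in> fs c \<and> j = ?r c x))"
    unfolding s_incl_def enum_iff[OF D l] enum_iff[OF D la] by (auto simp: mem)
  also have "\<dots> \<longleftrightarrow> f = inc (sLt X) (fs a) (fs c)"
  proof
    assume R: "s_is_mor f (crd (fs a)) (crd (fs c)) \<and>
      (\<forall>i j. s_app f i j \<longrightarrow> (\<exists>x. (x \<in> fs a \<and> i = ?r a x) \<and> x \<in> fs c \<and> j = ?r c x))"
    then have f: "s_is_mor f (crd (fs a)) (crd (fs c))" ..
    have "ap f (?r a x) = ?r c x" if "x \<in> fs a" for x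
    proof -
      have "s_app f (?r a x) (ap f (?r a x))"
        using mor_app[OF f] rank_bound[OF D la fin_fs that] by blast
      then obtain y where "y \<in> fs a" "?r a x = ?r a y" "ap f (?r a x) = ?r c y" using R by blast
      then show ?thesis using rank_less_iff(2)[OF D la fin_fs that] by simp
    qed
    then show "f = inc (sLt X) (fs a) (fs c)" by (rule inc_unique[OF D l fin_fs fin_fs ac f])
  next
    assume f: "f = inc (sLt X) (fs a) (fs c)"
    show "s_is_mor f (crd (fs a)) (crd (fs c)) \<and>
      (\<forall>i j. s_app f i j \<longrightarrow> (\<exists>x. (x \<in> fs a \<and> i = ?r a x) \<and> x \<in> fs c \<and> j = ?r c x))"
    proof (intro conjI allI impI)
      fix i j assume "s_app f i j"
      then have ij: "i < crd (fs a)" "j = ap f i" using mor_app[OF mor] by (simp_all add: f)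
      then obtain x where "x \<in> fs a" "?r a x = i" using rank_surj[OF D la fin_fs] by blast
      then show "\<exists>x. (x \<in> fs a \<and> i = ?r a x) \<and> x \<in> fs c \<and> j = ?r c x"
        using ij api ac f by blast
    qed (simp add: f mor)
  qed
  finally show ?thesis .
qed

section \<open>Normal prae-dilators in the model\<close>

definition comp_dil :: "s_praedil \<Rightarrow> bool" where
  "comp_dil T \<longleftrightarrow> D1 (\<lambda>p. sFld (sObj T (fst p)) (snd p))
    \<and> D1 (\<lambda>p. sLt (sObj T (fst p)) (fst (snd p)) (snd (snd p)))
    \<and> D1 (\<lambda>p. sAct T (fst p) (fst (snd p)) (snd (snd p)))
    \<and> D1 (\<lambda>p. sSupp T (fst p) (fst (snd p)) (snd (snd p)))
    \<and> D1 (\<lambda>p. sMu T (fst p) (fst (snd p)) (snd (snd p)))"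

lemma D1_family: "X \<in> Sets \<Longrightarrow> D1 (\<lambda>p. s_family X (fst p) (fst (snd p)) (snd (snd p)))"
  unfolding s_family_def by (intro D1_mem F1_rules)

lemma comp_dil_coded:
  "A \<in> Sets \<Longrightarrow> B \<in> Sets \<Longrightarrow> C \<in> Sets \<Longrightarrow> D \<in> Sets \<Longrightarrow> E \<in> Sets \<Longrightarrow> comp_dil (s_coded A B C D E)"
  unfolding comp_dil_def s_coded_def s_praedil.select_convs s_order.select_convs
  by (intro conjI D1_family D1_mem F1_rules)

lemma Sets_family:
  assumes "D1 (\<lambda>p. R (fst p) (fst (snd p)) (snd (snd p)))" shows "\<exists>X\<in>Sets. s_family X = R"
proof -
  obtain X where X: "X \<in> Sets" "\<And>n x y. R n x y \<longleftrightarrow> pr n (pr x y) \<in> X"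
    using assms by (auto simp: D1_def)
  show ?thesis by (rule bexI[OF _ X(1)]) (simp add: s_family_def X(2) fun_eq_iff)
qed

lemma Sets_binary:
  assumes "D1 (\<lambda>p. R (fst p) (snd p))" shows "\<exists>X\<in>Sets. (\<lambda>n x. pr n x \<in> X) = R"
proof -
  obtain X where X: "X \<in> Sets" "\<And>n x. R n x \<longleftrightarrow> pr n x \<in> X" using assms by (auto simp: D1_def)
  show ?thesis by (rule bexI[OF _ X(1)]) (simp add: X(2) fun_eq_iff)
qed

locale normal_dil =
  fixes T :: s_praedil
  assumes comp: "comp_dil T" and normal: "s_is_normal_praedilator T"
begin

abbreviation "TF n \<equiv> sFld (sObj T n)"
abbreviation "tlt n \<equiv> sLt (sObj T n)"

definition act :: "nn \<Rightarrow> nn \<Rightarrow> nn" where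
  "act f s = (LEAST y. sAct T f s y \<or> \<not> (s_is_mor f (p1 f) (p1 (p2 f)) \<and> TF (p1 f) s))"
definition supc :: "nn \<Rightarrow> nn \<Rightarrow> nn" where "supc n s = (LEAST a. sSupp T n s a \<or> \<not> TF n s)"
definition mu :: "nn \<Rightarrow> nn \<Rightarrow> nn" where "mu n m = (LEAST x. sMu T n m x \<or> \<not> m < n)"
abbreviation "supp n s \<equiv> fs (supc n s)"

lemma D1_TF: "F1 n \<Longrightarrow> F1 x \<Longrightarrow> D1 (\<lambda>e. TF (n e) (x e))"
  using comp unfolding comp_dil_def by (auto intro: D1_comp2[of "\<lambda>n x. TF n x"])

lemma D1_tlt: "F1 n \<Longrightarrow> F1 x \<Longrightarrow> F1 y \<Longrightarrow> D1 (\<lambda>e. tlt (n e) (x e) (y e))"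
  using comp unfolding comp_dil_def by (auto intro: D1_comp3[of "\<lambda>n x y. tlt n x y"])

lemma D1_rels:
  "F1 n \<Longrightarrow> F1 x \<Longrightarrow> F1 y \<Longrightarrow> D1 (\<lambda>e. sAct T (n e) (x e) (y e))"
  "F1 n \<Longrightarrow> F1 x \<Longrightarrow> F1 y \<Longrightarrow> D1 (\<lambda>e. sSupp T (n e) (x e) (y e))"
  "F1 n \<Longrightarrow> F1 x \<Longrightarrow> F1 y \<Longrightarrow> D1 (\<lambda>e. sMu T (n e) (x e) (y e))"
  using comp unfolding comp_dil_def
  by (auto intro: D1_comp3[of "\<lambda>n x y. sAct T n x y"] D1_comp3[of "\<lambda>n x y. sSupp T n x y"]
      D1_comp3[of "\<lambda>n x y. sMu T n x y"])

lemma T_functor: "s_is_functor T" and T_praedil: "s_is_praedilator T"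
  using normal unfolding s_is_normal_praedilator_def by (simp_all add: s_is_praedilator_def)

lemma linear: "s_linear (sObj T n)"
  using T_functor unfolding s_is_functor_def by blast

lemma tlt_TF: "tlt n x y \<Longrightarrow> TF n x \<and> TF n y"
  and tlt_irrefl: "\<not> tlt n x x"
  and tlt_trans: "tlt n x y \<Longrightarrow> tlt n y z \<Longrightarrow> tlt n x z"
  and tlt_total: "TF n x \<Longrightarrow> TF n y \<Longrightarrow> tlt n x y \<or> x = y \<or> tlt n y x"
  using linear[of n] unfolding s_linear_def by blast+

lemma tlt_asym: "tlt n x y \<Longrightarrow> \<not> tlt n y x"
  using tlt_irrefl tlt_trans by blast

lemma act_embeds: "s_is_mor f n m \<Longrightarrow> s_embeds (sObj T n) (sObj T m) (sAct T f)"
  using T_functor unfolding s_is_functor_def by blast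

lemma act_iff: assumes f: "s_is_mor f n m" shows "sAct T f x y \<longleftrightarrow> TF n x \<and> y = act f x"
proof -
  note E = s_embedsD[OF act_embeds[OF f]]
  have eq: "act f x = (LEAST y. sAct T f x y \<or> \<not> TF n x)"
    using f mor_pr[OF f] by (simp add: act_def)
  have D: "D1 (\<lambda>y. sAct T f x y \<or> \<not> TF n x)" by (intro comp_rules D1_rels D1_TF)
  have "sAct T f x (act f x)" if x: "TF n x"
  proof -
    obtain y where "sAct T f x y" using E(2)[OF x] by blast
    then show ?thesis using D1_LeastI(1)[OF D, of y] x unfolding eq by blast
  qed
  then show ?thesis using E(1,2) by metis
qed

lemma act_TF: "s_is_mor f n m \<Longrightarrow> TF n x \<Longrightarrow> TF m (act f x)"
  using act_iff s_embedsD(1)[OF act_embeds] by blast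

lemma act_less: assumes f: "s_is_mor f n m" and x: "TF n x" "TF n y"
  shows "tlt m (act f x) (act f y) \<longleftrightarrow> tlt n x y" and act_inject: "act f x = act f y \<longleftrightarrow> x = y"
proof -
  have mono: "tlt m (act f x) (act f y)" if "tlt n x y" for x y
    using s_embedsD(3)[OF act_embeds[OF f]] that act_iff[OF f] tlt_TF[OF that] by blast
  then show "tlt m (act f x) (act f y) \<longleftrightarrow> tlt n x y" "act f x = act f y \<longleftrightarrow> x = y"
    using tlt_total[OF x] tlt_asym tlt_irrefl by metis+
qed

lemma act_act:
  assumes f: "s_is_mor f n m" and g: "s_is_mor g m l" and h: "s_is_mor h n l"
    and eq: "\<And>i. i < n \<Longrightarrow> ap g (ap f i) = ap h i" and x: "TF n x"
  shows "act g (act f x) = act h x"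
proof -
  have "\<forall>i j k. s_app f i j \<and> s_app g j k \<longrightarrow> s_app h i k"
    using mor_app[OF f] mor_app[OF g] mor_app[OF h] eq by metis
  moreover have "sAct T f x (act f x)" "sAct T g (act f x) (act g (act f x))"
    using act_iff[OF f] act_iff[OF g] act_TF[OF f x] x by blast+
  ultimately have "sAct T h x (act g (act f x))"
    using T_functor f g h unfolding s_is_functor_def by blast
  then show ?thesis using act_iff[OF h] by blast
qed

lemma supp_iff: "sSupp T n x a \<longleftrightarrow> TF n x \<and> a = supc n x"
  and supp_bound: "TF n x \<Longrightarrow> i \<in> supp n x \<Longrightarrow> i < n"
proof -
  have m: "s_maps (TF n) (\<lambda>a. isf a \<and> (\<forall>i. i \<in> fs a \<longrightarrow> i < n)) (sSupp T n)"
    using T_praedil unfolding s_is_praedilator_def by blast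
  then have E: "sSupp T n x y \<Longrightarrow> TF n x \<and> isf y \<and> (\<forall>i. i \<in> fs y \<longrightarrow> i < n)"
    "TF n x \<Longrightarrow> \<exists>y. sSupp T n x y \<and> (\<forall>z. sSupp T n x z \<longrightarrow> z = y)" for x y
    unfolding s_maps_def by blast+
  have D: "D1 (\<lambda>y. sSupp T n x y \<or> \<not> TF n x)" by (intro comp_rules D1_rels D1_TF)
  have *: "sSupp T n x (supc n x)" if x: "TF n x"
  proof -
    obtain y where "sSupp T n x y" using E(2)[OF x] by blast
    then show ?thesis using D1_LeastI(1)[OF D, of y] x unfolding supc_def by blast
  qed
  then show "sSupp T n x a \<longleftrightarrow> TF n x \<and> a = supc n x" using E by metis
  show "TF n x \<Longrightarrow> i \<in> supp n x \<Longrightarrow> i < n" using * E(1) by blast+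
qed

lemma supp_act: assumes f: "s_is_mor f n m" and x: "TF n x" shows "supp m (act f x) = ap f ` supp n x"
proof -
  have "sAct T f x (act f x)" "sSupp T n x (supc n x)" "sSupp T m (act f x) (supc m (act f x))"
    using act_iff[OF f] x supp_iff act_TF[OF f x] by blast+
  then have "\<forall>j. j \<in> supp m (act f x) \<longleftrightarrow> (\<exists>i. i \<in> supp n x \<and> s_app f i j)"
    using T_praedil f unfolding s_is_praedilator_def by blast
  then show ?thesis using mor_app[OF f] supp_bound[OF x] by blast
qed

lemma mu_iff: "sMu T n m x \<longleftrightarrow> m < n \<and> x = mu n m" and mu_TF: "m < n \<Longrightarrow> TF n (mu n m)"
  and mu_less: "i < j \<Longrightarrow> j < n \<Longrightarrow> tlt n (mu n i) (mu n j)"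
proof -
  have "s_embeds (s_below n) (sObj T n) (sMu T n)"
    using normal unfolding s_is_normal_praedilator_def by blast
  note E = s_embedsD[OF this, unfolded s_below_simps]
  have D: "D1 (\<lambda>x. sMu T n m x \<or> \<not> m < n)" for m by (intro comp_rules D1_rels)
  have *: "sMu T n m (mu n m)" if m: "m < n" for m
  proof -
    obtain y where "sMu T n m y" using E(2)[OF m] by blast
    then show ?thesis using D1_LeastI(1)[OF D[of m], of y] m unfolding mu_def by blast
  qed
  then show "sMu T n m x \<longleftrightarrow> m < n \<and> x = mu n m" using E(1,2) by metis
  show "m < n \<Longrightarrow> TF n (mu n m)" using * E(1) by blast
  show "i < j \<Longrightarrow> j < n \<Longrightarrow> tlt n (mu n i) (mu n j)" using * E(3) less_trans by blast
qed

lemma act_mu: assumes f: "s_is_mor f n m" and i: "i < n" shows "act f (mu n i) = mu m (ap f i)"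
proof -
  have "s_app f i (ap f i)" "sMu T n i (mu n i)" "sMu T m (ap f i) (mu m (ap f i))"
    using mor_app[OF f] mu_iff i mor_bound[OF f i] by blast+
  then have "sAct T f (mu n i) (mu m (ap f i))"
    using normal f unfolding s_is_normal_praedilator_def by blast
  then show ?thesis using act_iff[OF f] by simp
qed

lemma less_mu: assumes m: "m < n" and x: "TF n x" shows "tlt n x (mu n m) \<longleftrightarrow> (\<forall>i\<in>supp n x. i < m)"
proof -
  have "sMu T n m (mu n m)" "sSupp T n x (supc n x)" using mu_iff supp_iff m x by blast+
  then show ?thesis using normal m x unfolding s_is_normal_praedilator_def by blast
qed

lemma supp_mu0: "supp 1 (mu 1 0) = {0}"
proof -
  have "0 < (1::nn)" by simp
  then have "\<not> (\<forall>i\<in>supp 1 (mu 1 0). i < 0)"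
    using less_mu[of 0 1 "mu 1 0"] mu_TF[of 0 1] tlt_irrefl by blast
  moreover have "i = 0" if "i \<in> supp 1 (mu 1 0)" for i
    using supp_bound[OF mu_TF[of 0 1] that] by simp
  ultimately show ?thesis by blast
qed

lemma F1_act: "F1 f \<Longrightarrow> F1 g \<Longrightarrow> F1 (\<lambda>e. act (f e) (g e))"
proof -
  have "\<exists>y. sAct T f s y \<or> \<not> (s_is_mor f (p1 f) (p1 (p2 f)) \<and> TF (p1 f) s)" for f s
    using act_iff[of f "p1 f" "p1 (p2 f)"] by blast
  then have "F1 (\<lambda>p. act (fst p) (snd p))"
    unfolding act_def by (intro F1_Least comp_rules D1_rels D1_mor F1_p1 F1_p2 D1_TF)
  then show "F1 f \<Longrightarrow> F1 g \<Longrightarrow> F1 (\<lambda>e. act (f e) (g e))" by (rule F1_comp2)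
qed

lemma F1_supc: "F1 f \<Longrightarrow> F1 g \<Longrightarrow> F1 (\<lambda>e. supc (f e) (g e))"
proof -
  have "\<exists>a. sSupp T n s a \<or> \<not> TF n s" for n s using supp_iff by blast
  then have "F1 (\<lambda>p. supc (fst p) (snd p))"
    unfolding supc_def by (intro F1_Least comp_rules D1_rels D1_TF)
  then show "F1 f \<Longrightarrow> F1 g \<Longrightarrow> F1 (\<lambda>e. supc (f e) (g e))" by (rule F1_comp2)
qed

lemma F1_mu: "F1 f \<Longrightarrow> F1 g \<Longrightarrow> F1 (\<lambda>e. mu (f e) (g e))"
proof -
  have "\<exists>x. sMu T n m x \<or> \<not> m < n" for n m using mu_iff by blast
  then have "F1 (\<lambda>p. mu (fst p) (snd p))"
    unfolding mu_def by (intro F1_Least comp_rules D1_rels)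
  then show "F1 f \<Longrightarrow> F1 g \<Longrightarrow> F1 (\<lambda>e. mu (f e) (g e))" by (rule F1_comp2)
qed

section \<open>The orders \<open>D\<^sup>T(X)\<close> in the model\<close>

definition De :: "nn set \<Rightarrow> nn \<Rightarrow> bool" where
  "De A s \<longleftrightarrow> TF (crd A) s \<and> supp (crd A) s = {..<crd A}"

definition tr :: "(nn \<Rightarrow> nn \<Rightarrow> bool) \<Rightarrow> nn set \<Rightarrow> nn set \<Rightarrow> nn \<Rightarrow> nn" where
  "tr lt A C s = act (inc lt A C) s"

definition Dl :: "(nn \<Rightarrow> nn \<Rightarrow> bool) \<Rightarrow> nn set \<Rightarrow> nn \<Rightarrow> nn set \<Rightarrow> nn \<Rightarrow> bool" where
  "Dl lt A s B t \<longleftrightarrow> tlt (crd (A \<union> B)) (tr lt A (A \<union> B) s) (tr lt B (A \<union> B) t)"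

lemma De_mu: "De {x} (mu 1 0)"
proof -
  have "crd {x} = 1" using crd_insert[of "{}" x] by simp
  moreover have "{..<1} = {0::nn}" by auto
  ultimately show ?thesis using supp_mu0 mu_TF[of 0 1] by (simp only: De_def zero_less_one simp_thms)
qed

lemma full_supp_iff: "s_full_supp T k s \<longleftrightarrow> TF k s \<and> supp k s = {..<k}"
  unfolding s_full_supp_def supp_iff by auto

lemma D_fld_iff: "s_D_fld T X p \<longleftrightarrow> (\<exists>a s. p = pr a s \<and> isf a \<and> (\<forall>x\<in>fs a. sFld X x) \<and> De (fs a) s)"
  unfolding s_D_fld_def has_card_iff full_supp_iff De_def by blast

lemma D_fld_pr: "s_D_fld T X (pr a s) \<longleftrightarrow> isf a \<and> (\<forall>x\<in>fs a. sFld X x) \<and> De (fs a) s"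
  unfolding D_fld_iff by auto

context
  fixes lt :: "nn \<Rightarrow> nn \<Rightarrow> bool" and C :: "nn set"
  assumes D1_lt: "D1 (\<lambda>p. lt (fst p) (snd p))" and lin: "lin lt C" and fin: "fin C"
begin

lemma tr_TF: "fin A \<Longrightarrow> A \<subseteq> C \<Longrightarrow> De A s \<Longrightarrow> TF (crd C) (tr lt A C s)"
  unfolding tr_def De_def using act_TF mor_inc[OF D1_lt lin _ fin] by blast

lemma tr_less:
  assumes "fin A" "A \<subseteq> C" "TF (crd A) s" "TF (crd A) t"
  shows "tlt (crd C) (tr lt A C s) (tr lt A C t) \<longleftrightarrow> tlt (crd A) s t" "tr lt A C s = tr lt A C t \<longleftrightarrow> s = t"
  unfolding tr_def using act_less[OF mor_inc[OF D1_lt lin _ fin]] act_inject[OF mor_inc[OF D1_lt lin _ fin]]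
    assms by blast+

lemma supp_tr: assumes A: "fin A" "A \<subseteq> C" "De A s" shows "supp (crd C) (tr lt A C s) = rank lt C ` A"
proof -
  note mor = mor_inc[OF D1_lt lin A(1) fin A(2)] and api = ap_inc[OF D1_lt lin A(1) fin A(2)]
  have "supp (crd C) (tr lt A C s) = ap (inc lt A C) ` rank lt A ` A"
    unfolding tr_def using supp_act[OF mor] A rank_image[OF D1_lt lin_subset[OF lin A(2)] A(1)]
    by (simp add: De_def)
  also have "\<dots> = rank lt C ` A" using api by (force simp: image_image)
  finally show ?thesis .
qed

lemma tr_mu: assumes x: "x \<in> C" shows "tr lt {x} C (mu 1 0) = mu (crd C) (rank lt C x)"
proof -
  have c: "crd {x} = 1" using crd_insert[of "{}" x] by simp
  have sub: "{x} \<subseteq> C" and f: "fin {x}" using x by simp_all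
  note mor = mor_inc[OF D1_lt lin f fin sub] and api = ap_inc[OF D1_lt lin f fin sub]
  have "rank lt {x} x = 0"
    using rank_bound[OF D1_lt lin_subset[OF lin sub] f, of x] c by simp
  then have "ap (inc lt {x} C) 0 = rank lt C x" using api[of x] by simp
  then show ?thesis unfolding tr_def using act_mu[OF mor[unfolded c], of 0] by simp
qed

lemma tr_inject:
  assumes A: "fin A" "A \<subseteq> C" "De A s" and B: "fin B" "B \<subseteq> C" "De B t"
  shows "tr lt A C s = tr lt B C t \<longleftrightarrow> A = B \<and> s = t"
proof
  assume eq: "tr lt A C s = tr lt B C t"
  then have "rank lt C ` A = rank lt C ` B" using supp_tr[OF A] supp_tr[OF B] by simp
  then have "A = B" using inj_on_image_eq_iff[OF inj_rank[OF D1_lt lin fin]] A B by blast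
  then show "A = B \<and> s = t" using eq tr_less(2)[OF A(1,2)] A B by (simp add: De_def)
qed simp

lemma tr_tr:
  assumes "fin A" "fin B" "A \<subseteq> B" "B \<subseteq> C" "De A s" shows "tr lt B C (tr lt A B s) = tr lt A C s"
proof -
  have lB: "lin lt B" using lin_subset[OF lin] assms by blast
  have AC: "A \<subseteq> C" using assms by blast
  note incs = mor_inc[OF D1_lt lB assms(1,2,3)] mor_inc[OF D1_lt lin assms(2) fin assms(4)]
    mor_inc[OF D1_lt lin assms(1) fin AC]
  have "ap (inc lt B C) (ap (inc lt A B) i) = ap (inc lt A C) i" if i: "i < crd A" for i
  proof -
    obtain x where "x \<in> A" "rank lt A x = i"
      using rank_surj[OF D1_lt lin_subset[OF lin AC] assms(1) i] by blast
    then show ?thesis using ap_inc[OF D1_lt lB assms(1,2,3)] ap_inc[OF D1_lt lin assms(2) fin assms(4)]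
      ap_inc[OF D1_lt lin assms(1) fin AC] assms(3) by auto
  qed
  then show ?thesis unfolding tr_def using act_act[OF incs] assms(5) by (simp add: De_def)
qed

end

context
  fixes lt :: "nn \<Rightarrow> nn \<Rightarrow> bool" and C :: "nn set"
  assumes D1_lt: "D1 (\<lambda>p. lt (fst p) (snd p))" and lin: "lin lt C" and fin: "fin C"
begin

lemma Dl_iff:
  assumes A: "fin A" "A \<subseteq> C" "De A s" and B: "fin B" "B \<subseteq> C" "De B t"
  shows "Dl lt A s B t \<longleftrightarrow> tlt (crd C) (tr lt A C s) (tr lt B C t)"
proof -
  let ?D = "A \<union> B"
  have D: "fin ?D" "?D \<subseteq> C" using A B by auto
  note lD = lin_subset[OF lin D(2)]
  have "TF (crd ?D) (tr lt A ?D s)" "TF (crd ?D) (tr lt B ?D t)"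
    using tr_TF[OF D1_lt lD D(1)] A B by auto
  from tr_less(1)[OF D1_lt lin fin D this] show ?thesis
    using tr_tr[OF D1_lt lin fin A(1) D(1) _ D(2) A(3)] tr_tr[OF D1_lt lin fin B(1) D(1) _ D(2) B(3)]
    by (simp add: Dl_def)
qed

lemma Dl_irrefl: "fin A \<Longrightarrow> A \<subseteq> C \<Longrightarrow> De A s \<Longrightarrow> \<not> Dl lt A s A s"
  using Dl_iff tlt_irrefl by blast

lemma Dl_trans:
  assumes "fin A" "A \<subseteq> C" "De A s" "fin B" "B \<subseteq> C" "De B t" "fin E" "E \<subseteq> C" "De E u"
    and "Dl lt A s B t" "Dl lt B t E u"
  shows "Dl lt A s E u"
  using assms(10,11) tlt_trans unfolding Dl_iff[OF assms(1-6)] Dl_iff[OF assms(4-9)]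
    Dl_iff[OF assms(1-3,7-9)] by blast

lemma Dl_total:
  assumes "fin A" "A \<subseteq> C" "De A s" "fin B" "B \<subseteq> C" "De B t"
  shows "Dl lt A s B t \<or> A = B \<and> s = t \<or> Dl lt B t A s"
  using tlt_total[OF tr_TF[OF D1_lt lin fin assms(1-3)] tr_TF[OF D1_lt lin fin assms(4-6)]] assms
  by (simp add: Dl_iff tr_inject[OF D1_lt lin fin])

lemma Dl_mu:
  assumes A: "fin A" "A \<subseteq> C" "De A s" and x: "x \<in> C"
  shows "Dl lt A s {x} (mu 1 0) \<longleftrightarrow> (\<forall>y\<in>A. lt y x)"
proof -
  have "Dl lt A s {x} (mu 1 0) \<longleftrightarrow> tlt (crd C) (tr lt A C s) (mu (crd C) (rank lt C x))"
    using Dl_iff[OF A _ _ De_mu, of x] x tr_mu[OF D1_lt lin fin x] by simp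
  also have "\<dots> \<longleftrightarrow> (\<forall>y\<in>A. rank lt C y < rank lt C x)"
    using less_mu[OF rank_bound[OF D1_lt lin fin x] tr_TF[OF D1_lt lin fin A]]
      supp_tr[OF D1_lt lin fin A] by simp
  also have "\<dots> \<longleftrightarrow> (\<forall>y\<in>A. lt y x)"
    using rank_less_iff(1)[OF D1_lt lin fin _ x] A(2) by blast
  finally show ?thesis .
qed

lemma Dl_mu_le:
  assumes A: "fin A" "A \<subseteq> C" "De A s" and x: "x \<in> C" and y: "y \<in> A" "lt x y \<or> x = y"
  shows "Dl lt {x} (mu 1 0) A s \<or> A = {x} \<and> s = mu 1 0"
proof -
  have "\<not> Dl lt A s {x} (mu 1 0)"
    using Dl_mu[OF A x] y linD(1)[OF lin x] lin_asym[OF lin] A(2) x by blast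
  then show ?thesis using Dl_total[OF A _ _ De_mu, of x] x by auto
qed

lemma Dl_cofinal:
  assumes A: "fin A" "A \<subseteq> C" "De A s" and B: "fin B" "B \<subseteq> C" "De B t"
    and less: "Dl lt A s B t" and r: "r \<in> A"
  shows "\<exists>r'\<in>B. lt r r' \<or> r = r'"
proof (rule ccontr)
  assume no: "\<not> (\<exists>r'\<in>B. lt r r' \<or> r = r')"
  have rC: "r \<in> C" using r A by blast
  have "\<forall>y\<in>B. lt y r" using no linD(3)[OF lin rC] B(2) by blast
  then have Br: "Dl lt B t {r} (mu 1 0)" using Dl_mu[OF B rC] by blast
  have rs: "fin {r}" "{r} \<subseteq> C" using rC by simp_all
  from Dl_mu_le[OF A rC r disjI2[OF refl]] have "Dl lt B t A s"
  proof
    assume "Dl lt {r} (mu 1 0) A s"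
    with Br show ?thesis by (rule Dl_trans[OF B rs De_mu A])
  qed (use Br in simp)
  then show False using Dl_trans[OF A B A less] Dl_irrefl[OF A] by blast
qed

end

text \<open>Functoriality of \<open>D\<^sup>T\<close>: ranks and hence the morphisms \<open>|\<iota>|\<close> are invariant under embeddings.\<close>

context
  fixes lt lt' :: "nn \<Rightarrow> nn \<Rightarrow> bool" and C :: "nn set" and G :: "nn \<Rightarrow> nn"
  assumes D1_lt: "D1 (\<lambda>p. lt (fst p) (snd p))" and D1_lt': "D1 (\<lambda>p. lt' (fst p) (snd p))"
    and lin: "lin lt C" and lin': "lin lt' (G ` C)" and fin: "fin C" and G: "F1 G"
    and mono: "\<And>x y. x \<in> C \<Longrightarrow> y \<in> C \<Longrightarrow> lt x y \<Longrightarrow> lt' (G x) (G y)"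
begin

lemma G_iff: assumes "x \<in> C" "y \<in> C" shows "lt' (G x) (G y) \<longleftrightarrow> lt x y" "G x = G y \<longleftrightarrow> x = y"
proof -
  have *: "lt' (G x) (G y)" "\<not> lt' (G y) (G x)" "G x \<noteq> G y" if xy: "x \<in> C" "y \<in> C" "lt x y" for x y
  proof -
    have GC: "G x \<in> G ` C" "G y \<in> G ` C" using xy by auto
    show l: "lt' (G x) (G y)" using mono xy by blast
    show "\<not> lt' (G y) (G x)" using lin_asym[OF lin' l GC] .
    show "G x \<noteq> G y" using l linD(1)[OF lin' GC(1)] by auto
  qed
  have "\<not> lt' (G x) (G x)" using linD(1)[OF lin', of "G x"] assms by blast
  then show "lt' (G x) (G y) \<longleftrightarrow> lt x y" "G x = G y \<longleftrightarrow> x = y"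
    using linD(3)[OF lin assms] *[OF assms] *[OF assms(2,1)] linD(1)[OF lin assms(1)] by auto
qed

lemma inj_G: "A \<subseteq> C \<Longrightarrow> inj_on G A"
  unfolding inj_on_def using G_iff(2) by blast

lemma crd_G: "fin A \<Longrightarrow> A \<subseteq> C \<Longrightarrow> crd (G ` A) = crd A"
  using crd_image[OF _ G inj_G] by blast

lemma De_G: "fin A \<Longrightarrow> A \<subseteq> C \<Longrightarrow> De (G ` A) s \<longleftrightarrow> De A s"
  by (simp add: De_def crd_G)

lemma rank_G: assumes A: "fin A" "A \<subseteq> C" and x: "x \<in> C" shows "rank lt' (G ` A) (G x) = rank lt A x"
proof -
  have "{z \<in> G ` A. lt' z (G x)} = G ` {y \<in> A. lt y x}" using G_iff(1) A x by blast
  moreover have "fin {y \<in> A. lt y x}" by (rule fin_below[OF D1_lt A(1)])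
  ultimately show ?thesis unfolding rank_def using crd_G[of "{y \<in> A. lt y x}"] A(2) by auto
qed

lemma inc_G: assumes "fin A" "A \<subseteq> B" "fin B" "B \<subseteq> C" shows "inc lt' (G ` A) (G ` B) = inc lt A B"
proof -
  have "A \<subseteq> C" using assms by blast
  then have "(\<lambda>x. pr (rank lt' (G ` A) x) (rank lt' (G ` B) x)) ` G ` A
      = (\<lambda>x. pr (rank lt A x) (rank lt B x)) ` A"
    unfolding image_image using rank_G[OF assms(1) \<open>A \<subseteq> C\<close>] rank_G[OF assms(3,4)]
    by (intro image_cong) auto
  then show ?thesis unfolding inc_def using crd_G assms \<open>A \<subseteq> C\<close> by simp
qed

lemma Dl_G:
  assumes "fin A" "A \<subseteq> C" "fin B" "B \<subseteq> C"
  shows "Dl lt' (G ` A) s (G ` B) t \<longleftrightarrow> Dl lt A s B t"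
proof -
  have AB: "fin (A \<union> B)" "A \<union> B \<subseteq> C" using assms by auto
  show ?thesis
    unfolding Dl_def tr_def image_Un[symmetric]
    using inc_G[OF assms(1) _ AB] inc_G[OF assms(3) _ AB] crd_G[OF AB] by simp
qed

end

lemma D_less_iff:
  assumes D: "D1 (\<lambda>p. sLt X (fst p) (snd p))" and l: "lin (sLt X) (fs a \<union> fs b)"
    and a: "De (fs a) s" and b: "De (fs b) t"
  shows "s_D_less T X a s b t \<longleftrightarrow> Dl (sLt X) (fs a) s (fs b) t"
proof -
  let ?c = "code (fs a \<union> fs b)"
  have c: "fs ?c = fs a \<union> fs b" "isf ?c" by simp_all
  have lc: "lin (sLt X) (fs ?c)" using l by (simp add: c)
  have sub: "fs a \<subseteq> fs ?c" "fs b \<subseteq> fs ?c" by (simp_all add: c)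
  have mors: "s_is_mor (inc (sLt X) (fs a) (fs ?c)) (crd (fs a)) (crd (fs ?c))"
    "s_is_mor (inc (sLt X) (fs b) (fs ?c)) (crd (fs b)) (crd (fs ?c))"
    using mor_inc[OF D lc] sub by simp_all
  have "s_is_fset c (\<lambda>x. x \<in> fs a \<or> x \<in> fs b) \<longleftrightarrow> c = ?c" for c
    unfolding s_is_fset_def using code_eq_iff[of "fs a \<union> fs b" c] by auto
  then show ?thesis
    unfolding s_D_less_def Dl_def tr_def has_card_iff
    using incl_iff[OF D lc sub(1)] incl_iff[OF D lc sub(2)] act_iff[OF mors(1)] act_iff[OF mors(2)] a b
    by (auto simp: c De_def)
qed

end

lemma linear_restrict_iff: "s_linear (s_restrict X c) \<longleftrightarrow> lin (sLt X) (fs c)"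
proof
  assume "s_linear (s_restrict X c)"
  then have "\<forall>x. \<not> (x \<in> fs c \<and> x \<in> fs c \<and> sLt X x x)"
    and trans: "\<forall>x y z. (x \<in> fs c \<and> y \<in> fs c \<and> sLt X x y) \<and> y \<in> fs c \<and> z \<in> fs c \<and> sLt X y z
      \<longrightarrow> x \<in> fs c \<and> z \<in> fs c \<and> sLt X x z"
    and "\<forall>x y. x \<in> fs c \<and> y \<in> fs c \<longrightarrow> (x \<in> fs c \<and> y \<in> fs c \<and> sLt X x y) \<or> x = y \<or>
      (y \<in> fs c \<and> x \<in> fs c \<and> sLt X y x)"
    unfolding s_linear_def s_restrict_simps by - (elim conjE; assumption)+
  then show "lin (sLt X) (fs c)" unfolding lin_def by meson
next
  assume l: "lin (sLt X) (fs c)"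
  show "s_linear (s_restrict X c)"
    unfolding s_linear_def s_restrict_simps
    using linD(1)[OF l] linD(2)[OF l] linD(3)[OF l] by (intro conjI) blast+
qed

section \<open>Existence of the term systems\<close>

abbreviation "mt \<equiv> s_mu_tm"
abbreviation "xt \<equiv> s_xi_tm"

lemma tm_inject [simp]: "mt m = mt k \<longleftrightarrow> m = k" "xt a s = xt b t \<longleftrightarrow> a = b \<and> s = t" "mt m \<noteq> xt a s" "xt a s \<noteq> mt m"
  by (simp_all add: s_mu_tm_def s_xi_tm_def)

text \<open>
  Pairing is quadratic. Hence the code of a \<open>\<xi>\<close>-term exceeds the sum of any three elements of its
  argument, and recursion and induction on sums of codes can replace the measure \<open>L\<^sub>n\<close>.
\<close>

lemma xt_triple: "a + a + a \<le> xt a s"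
proof -
  let ?P = "pr a s"
  have sq: "?P \<le> ?P * ?P"
  proof (cases ?P rule: nn_cases)
    case (succ z)
    have "?P * 1 \<le> ?P * ?P" unfolding succ by (intro mult_left_mono) simp_all
    then show ?thesis by simp
  qed simp
  have "a + a + a \<le> ?P + ?P + ?P * ?P"
    using pr_ge(1)[of a s] sq by (intro add_mono) auto
  also have "\<dots> \<le> xt a s" by (simp add: s_xi_tm_def pr_def[of 1] algebra_simps add_increasing)
  finally show ?thesis .
qed

lemma xt_ge: "a \<le> xt a s" "s \<le> xt a s" "m \<le> mt m"
proof -
  show "a \<le> xt a s" unfolding s_xi_tm_def by (rule order_trans[OF pr_ge(1) pr_ge(2)])
  show "s \<le> xt a s" unfolding s_xi_tm_def by (rule order_trans[OF pr_ge(2) pr_ge(2)])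
  show "m \<le> mt m" unfolding s_mu_tm_def by (rule pr_ge)
qed

lemma fs_xt: "r \<in> fs a \<Longrightarrow> r < xt a s"
  using fs_bound xt_ge(1) less_le_trans by blast

lemma fs_xt3:
  assumes "r \<in> fs a" "r' \<in> fs a" "r'' \<in> fs a" shows "r + r' + r'' < xt a s"
proof -
  have "r + r' + r'' < a + a + a" using assms[THEN fs_bound] by (intro add_strict_mono)
  then show ?thesis using xt_triple less_le_trans by blast
qed

lemma fs_xt_Un:
  assumes "r \<in> fs a \<union> fs b" "r' \<in> fs a \<union> fs b" "r'' \<in> fs a \<union> fs b"
  shows "r + r' + r'' < xt a s + xt b t"
proof -
  let ?m = "max a b"
  have "x < ?m" if "x \<in> fs a \<union> fs b" for x
    using that fs_bound by (auto simp: less_max_iff_disj)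
  then have "r + r' + r'' < ?m + ?m + ?m" using assms by (intro add_strict_mono) auto
  also have "\<dots> \<le> xt a s + xt b t"
    using xt_triple[of a s] xt_triple[of b t] by (auto simp: max_def add_increasing add_increasing2)
  finally show ?thesis .
qed

lemma p_le: "p1 z \<le> z" "p2 z \<le> z"
proof -
  have "p1 z \<le> z \<and> p2 z \<le> z"
  proof (cases "\<exists>x y. z = pr x y")
    case True
    then show ?thesis using pr_ge by auto
  next
    case False
    then have "p1 z = (LEAST x::nn. True)" "p2 z = (LEAST x::nn. True)" by (simp_all add: p1_def p2_def)
    moreover have "(LEAST x::nn. True) = 0" by (rule Least_equality) auto
    ultimately show ?thesis by simp
  qed
  then show "p1 z \<le> z" "p2 z \<le> z" by auto
qed

lemma pact_ex: "\<exists>f. F1 (\<lambda>p. f (fst p) (snd p)) \<and> (\<forall>e m. f e (mt m) = mt (ap e m))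
  \<and> (\<forall>e a u. f e (xt a u) = xt (code (f e ` fs a)) u)"
proof -
  let ?H = "\<lambda>e g t. if p1 t = 0 then pr 0 (ap e (p2 t))
    else pr 1 (pr (code (g ` fs (p1 (p2 t)))) (p2 (p2 t)))"
  have 1: "F1 (\<lambda>p. ?H (fst p) (lookup (fst (snd p))) (snd (snd p)))"
    by (intro F1_if comp_rules F1_p1 F1_p2 F1_ap F1_code_image F1_lookup)
  have 2: "?H e g t = ?H e g' t" if "\<And>y. y < t \<Longrightarrow> g y = g' y" for e g g' t
  proof -
    have "y < t" if "y \<in> fs (p1 (p2 t))" for y
      using fs_bound[OF that] p_le(1)[of "p2 t"] p_le(2)[of t] by simp
    then have "g ` fs (p1 (p2 t)) = g' ` fs (p1 (p2 t))" using that by (intro image_cong) auto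
    then show ?thesis by (simp only:)
  qed
  show ?thesis
  proof (rule cov_rec[of ?H, OF 1 2], assumption, intro exI conjI allI)
    fix f assume f: "F1 (\<lambda>p. f (fst p) (snd p))" "\<And>e x. f e x = ?H e (f e) x"
    show "F1 (\<lambda>p. f (fst p) (snd p))" by (rule f)
    show "f e (mt m) = mt (ap e m)" for e m by (subst f(2)) (simp add: s_mu_tm_def)
    show "f e (xt a u) = xt (code (f e ` fs a)) u" for e a u
      by (subst f(2)) (simp add: s_xi_tm_def)
  qed
qed

definition pact :: "nn \<Rightarrow> nn \<Rightarrow> nn" where
  "pact = (SOME f. F1 (\<lambda>p. f (fst p) (snd p)) \<and> (\<forall>e m. f e (mt m) = mt (ap e m))
  \<and> (\<forall>e a u. f e (xt a u) = xt (code (f e ` fs a)) u))"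

lemma F1_pact0: "F1 (\<lambda>p. pact (fst p) (snd p))"
  and pact_mt [simp]: "pact f (mt m) = mt (ap f m)"
  and pact_xt [simp]: "pact f (xt a u) = xt (code (pact f ` fs a)) u"
  using someI_ex[OF pact_ex] unfolding pact_def by blast+

lemmas F1_pact = F1_comp2[OF F1_pact0]

lemma psup_ex: "\<exists>f. F1 f \<and> (\<forall>m. f (mt m) = code {m}) \<and> (\<forall>a u. f (xt a u) = code (\<Union>r\<in>fs a. fs (f r)))"
proof -
  let ?H = "\<lambda>e g t. if p1 t = 0 then code {p2 t} else code (\<Union>r\<in>fs (p1 (p2 t)). fs (g r))"
  have 1: "F1 (\<lambda>p :: nn \<times> nn \<times> nn. ?H (fst p) (lookup (fst (snd p))) (snd (snd p)))"
    by (intro F1_if comp_rules F1_p1 F1_p2 FS_code F1_code_UN F1_lookup)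
  have 2: "?H e g t = ?H e g' t" if "\<And>y. y < t \<Longrightarrow> g y = g' y" for e :: nn and g g' t
  proof -
    have "y < t" if "y \<in> fs (p1 (p2 t))" for y
      using fs_bound[OF that] p_le(1)[of "p2 t"] p_le(2)[of t] by simp
    then have "(\<Union>r\<in>fs (p1 (p2 t)). fs (g r)) = (\<Union>r\<in>fs (p1 (p2 t)). fs (g' r))" using that by auto
    then show ?thesis by (simp only:)
  qed
  show ?thesis
  proof (rule cov_rec[of ?H, OF 1 2], assumption, intro exI conjI allI)
    fix f assume f: "F1 (\<lambda>p :: nn \<times> nn. f (fst p) (snd p))" "\<And>e x. f e x = ?H e (f e) x"
    show "F1 (f 0)" using F1_comp2[OF f(1) F1_const F1_id] .
    show "f 0 (mt m) = code {m}" for m by (subst f(2)) (simp add: s_mu_tm_def)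
    show "f 0 (xt a u) = code (\<Union>r\<in>fs a. fs (f 0 r))" for a u
      by (subst f(2)) (simp add: s_xi_tm_def)
  qed
qed

definition psup :: "nn \<Rightarrow> nn" where
  "psup = (SOME f. F1 f \<and> (\<forall>m. f (mt m) = code {m}) \<and> (\<forall>a u. f (xt a u) = code (\<Union>r\<in>fs a. fs (f r))))"

lemma F1_psup0: "F1 psup" and psup_mt0: "psup (mt m) = code {m}"
  and psup_xt0: "psup (xt a u) = code (\<Union>r\<in>fs a. fs (psup r))"
  using someI_ex[OF psup_ex] unfolding psup_def by blast+

lemmas F1_psup = F1_comp[OF F1_psup0]

lemma fs_psup [simp]: "fs (psup (mt m)) = {m}" "fs (psup (xt a u)) = (\<Union>r\<in>fs a. fs (psup r))"
  unfolding psup_mt0 psup_xt0 by (simp_all add: fin_UN F1_psup0)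

lemma isf_psup: "isf (psup (mt m))" "isf (psup (xt a u))"
  unfolding psup_mt0 psup_xt0 by (simp_all add: fin_UN F1_psup0)

lemma fs_code_pact [simp]: "fs (code (pact f ` fs a)) = pact f ` fs a" "isf (code (pact f ` fs a))"
proof -
  have "F1 (pact f)" using F1_pact[OF F1_const F1_id] .
  then have "fin (pact f ` fs a)" by (simp add: fin_image)
  then show "fs (code (pact f ` fs a)) = pact f ` fs a" "isf (code (pact f ` fs a))" by simp_all
qed

lemma ex_decode:
  "(\<exists>m\<le>s. s = pr 0 m \<and> Q m) \<longleftrightarrow> (\<exists>m. s = mt m \<and> Q m)"
  "(\<exists>a\<le>s. \<exists>u\<le>s. s = pr 1 (pr a u) \<and> R a u) \<longleftrightarrow> (\<exists>a u. s = xt a u \<and> R a u)"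
  "(\<exists>x\<le>pr s t. \<exists>y\<le>pr s t. pr s t = pr x y \<and> R x y) \<longleftrightarrow> R s t"
  using xt_ge by (auto simp: s_mu_tm_def s_xi_tm_def pr_ge)

context normal_dil
begin

lemma D1_De: "FS A \<Longrightarrow> F1 s \<Longrightarrow> D1 (\<lambda>e. De (A e) (s e))"
  unfolding De_def
  by (intro comp_rules D1_TF F1_crd F1_supc; assumption)

lemma D1_Dl:
  assumes lt: "D1 (\<lambda>p. lt (fst p) (fst (snd p)) (snd (snd p)))"
    and "FS A" "F1 s" "FS B" "F1 t"
  shows "D1 (\<lambda>e. Dl (lt e) (A e) (s e) (B e) (t e))"
  unfolding Dl_def tr_def
  by (intro D1_tlt F1_crd F1_act F1_inc FS_Un D1_comp3[OF lt] F1_rules assms)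

lemma Dl_cong:
  assumes "\<And>x y. x \<in> A \<union> B \<Longrightarrow> y \<in> A \<union> B \<Longrightarrow> lt x y = lt' x y"
  shows "Dl lt A s B t = Dl lt' A s B t"
  unfolding Dl_def tr_def using inc_cong[of A "A \<union> B" lt lt'] inc_cong[of B "A \<union> B" lt lt'] assms by simp

lemma mu_pair_iff: "s_is_mu_pair T m a s \<longleftrightarrow> isf a \<and> fs a = {mt m} \<and> s = mu 1 0"
  unfolding s_is_mu_pair_def s_is_fset_def mu_iff by auto

lemma fld_ex:
  obtains F where "D1 (\<lambda>p. F (fst p) (snd p))"
    "\<And>n t. F n t \<longleftrightarrow> (\<exists>m. m < n \<and> t = mt m) \<or>
      (\<exists>a s. t = xt a s \<and> isf a \<and> (\<forall>x\<in>fs a. F n x) \<and> De (fs a) s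
        \<and> \<not> (\<exists>m. m < n \<and> fs a = {mt m} \<and> s = mu 1 0))"
proof -
  let ?H = "\<lambda>n g t. (\<exists>m<n. t = pr 0 m) \<or>
    (\<exists>a\<le>t. \<exists>s\<le>t. t = pr 1 (pr a s) \<and> isf a \<and> (\<forall>x\<in>fs a. g x) \<and> De (fs a) s
        \<and> \<not> (\<exists>m<n. fs a = {pr 0 m} \<and> s = mu 1 0))"
  have 1: "D1 (\<lambda>p. ?H (fst p) (\<lambda>y. lookup (fst (snd p)) y = 1) (snd (snd p)))"
    by (intro comp_rules D1_isf D1_De F1_lookup F1_mu)
  have 2: "?H n g t = ?H n g' t" if "\<And>y. y < t \<Longrightarrow> g y = g' y" for n g g' t
  proof -
    have "(\<forall>x\<in>fs a. g x) \<longleftrightarrow> (\<forall>x\<in>fs a. g' x)" if "a \<le> t" for a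
      using \<open>\<And>y. y < t \<Longrightarrow> g y = g' y\<close> fs_bound that less_le_trans by blast
    then show ?thesis by (simp cong: conj_cong)
  qed
  show thesis
  proof (rule cov_rec_pred[of ?H, OF 1 2])
    fix F assume F: "D1 (\<lambda>p. F (fst p) (snd p))" "\<And>n t. F n t \<longleftrightarrow> ?H n (F n) t"
    show thesis
    proof (rule that[OF F(1)])
      fix n t
      show "F n t \<longleftrightarrow> (\<exists>m. m < n \<and> t = mt m) \<or>
        (\<exists>a s. t = xt a s \<and> isf a \<and> (\<forall>x\<in>fs a. F n x) \<and> De (fs a) s
          \<and> \<not> (\<exists>m. m < n \<and> fs a = {mt m} \<and> s = mu 1 0))"
        unfolding F(2)[of n t] using xt_ge by (auto simp: s_mu_tm_def s_xi_tm_def)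
    qed
  qed
qed

lemma less_ex:
  assumes F: "D1 (\<lambda>p. F (fst p) (snd p))"
  obtains L where "D1 (\<lambda>p. L (fst p) (fst (snd p)) (snd (snd p)))"
    "\<And>n s t. L n s t \<longleftrightarrow> F n s \<and> F n t \<and>
      ((\<exists>m k. s = mt m \<and> t = mt k \<and> m < k)
      \<or> (\<exists>m b v. s = mt m \<and> t = xt b v \<and> (\<exists>r\<in>fs b. L n s r \<or> s = r))
      \<or> (\<exists>a u k. s = xt a u \<and> t = mt k \<and> (\<forall>r\<in>fs a. L n r t))
      \<or> (\<exists>a u b v. s = xt a u \<and> t = xt b v \<and> lin (L n) (fs a \<union> fs b) \<and> Dl (L n) (fs a) u (fs b) v))"
proof -
  let ?C = "\<lambda>n g s t. F n s \<and> F n t \<and>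
      ((\<exists>m\<le>s. s = pr 0 m \<and> (\<exists>k\<le>t. t = pr 0 k \<and> m < k))
      \<or> (\<exists>m\<le>s. s = pr 0 m \<and> (\<exists>b\<le>t. \<exists>v\<le>t. t = pr 1 (pr b v) \<and> (\<exists>r\<in>fs b. g s r \<or> s = r)))
      \<or> (\<exists>a\<le>s. \<exists>u\<le>s. s = pr 1 (pr a u) \<and> (\<exists>k\<le>t. t = pr 0 k \<and> (\<forall>r\<in>fs a. g r t)))
      \<or> (\<exists>a\<le>s. \<exists>u\<le>s. s = pr 1 (pr a u) \<and> (\<exists>b\<le>t. \<exists>v\<le>t. t = pr 1 (pr b v)
          \<and> lin g (fs a \<union> fs b) \<and> Dl g (fs a) u (fs b) v)))"
  let ?H = "\<lambda>n g z. \<exists>s\<le>z. \<exists>t\<le>z. z = pr s t \<and> ?C n (\<lambda>x y. g (pr x y)) s t"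
  have 1: "D1 (\<lambda>p. ?H (fst p) (\<lambda>y. lookup (fst (snd p)) y = 1) (snd (snd p)))"
    by (intro comp_rules D1_comp2[OF F] F1_lookup D1_lin D1_Dl)
  have C: "?C n g s t \<longleftrightarrow> F n s \<and> F n t \<and>
      ((\<exists>m k. s = mt m \<and> t = mt k \<and> m < k)
      \<or> (\<exists>m b v. s = mt m \<and> t = xt b v \<and> (\<exists>r\<in>fs b. g s r \<or> s = r))
      \<or> (\<exists>a u k. s = xt a u \<and> t = mt k \<and> (\<forall>r\<in>fs a. g r t))
      \<or> (\<exists>a u b v. s = xt a u \<and> t = xt b v \<and> lin g (fs a \<union> fs b) \<and> Dl g (fs a) u (fs b) v))"
    for n s t and g :: "nn \<Rightarrow> nn \<Rightarrow> bool"
    unfolding ex_decode by (intro arg_cong2[of _ _ _ _ "(\<and>)"] arg_cong2[of _ _ _ _ "(\<or>)"] refl; blast)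
  have 2: "?H n g z = ?H n g' z" if g: "\<And>y. y < z \<Longrightarrow> g y = g' y" for n g g' z
  proof -
    have C': "?C n (\<lambda>x y. g (pr x y)) s t = ?C n (\<lambda>x y. g' (pr x y)) s t" if z: "z = pr s t" for s t
    proof -
      have eq: "g (pr x y) = g' (pr x y)" if "x + y < s + t" for x y
        using g pr_mono_sum[OF that] z by blast
      have 2: "(\<exists>r\<in>fs b. g (pr s r) \<or> s = r) \<longleftrightarrow> (\<exists>r\<in>fs b. g' (pr s r) \<or> s = r)"
        if "t = xt b v" for b v
        using eq fs_xt that by (metis add_less_cancel_left)
      have 3: "(\<forall>r\<in>fs a. g (pr r t)) \<longleftrightarrow> (\<forall>r\<in>fs a. g' (pr r t))" if "s = xt a u" for a u
        using eq fs_xt that by (metis add_less_cancel_right)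
      have 4: "lin (\<lambda>x y. g (pr x y)) (fs a \<union> fs b) = lin (\<lambda>x y. g' (pr x y)) (fs a \<union> fs b)"
        "Dl (\<lambda>x y. g (pr x y)) (fs a) u (fs b) v = Dl (\<lambda>x y. g' (pr x y)) (fs a) u (fs b) v"
        if "s = xt a u" "t = xt b v" for a u b v
      proof -
        have eq2: "g (pr x y) = g' (pr x y)" if "x \<in> fs a \<union> fs b" "y \<in> fs a \<union> fs b" for x y
        proof (rule eq)
          have "x + y \<le> x + y + y" by (simp add: add_increasing2)
          also have "\<dots> < s + t" using fs_xt_Un[OF that that(2)] \<open>s = xt a u\<close> \<open>t = xt b v\<close> by simp
          finally show "x + y < s + t" .
        qed
        show "lin (\<lambda>x y. g (pr x y)) (fs a \<union> fs b) = lin (\<lambda>x y. g' (pr x y)) (fs a \<union> fs b)"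
          "Dl (\<lambda>x y. g (pr x y)) (fs a) u (fs b) v = Dl (\<lambda>x y. g' (pr x y)) (fs a) u (fs b) v"
          by (rule lin_cong, rule eq2; assumption) (rule Dl_cong, rule eq2; assumption)
      qed
      show ?thesis
        unfolding ex_decode by (intro conj_cong disj_cong ex_cong1 refl 2 3 4; assumption)
    qed
    show ?thesis
      by (rule ex_cong1, rule conj_cong[OF refl], rule ex_cong1, rule conj_cong[OF refl], rule conj_cong[OF refl])
        (rule C')
  qed
  show thesis
  proof (rule cov_rec_pred[of ?H, OF 1 2])
    fix R assume R: "D1 (\<lambda>p. R (fst p) (snd p))" "\<And>n z. R n z \<longleftrightarrow> ?H n (R n) z"
    show thesis
    proof (rule that[of "\<lambda>n s t. R n (pr s t)"])
      show "D1 (\<lambda>p. R (fst p) (pr (fst (snd p)) (snd (snd p))))"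
        by (intro D1_comp2[OF R(1)] comp_rules)
      show "R n (pr s t) \<longleftrightarrow> F n s \<and> F n t \<and>
      ((\<exists>m k. s = mt m \<and> t = mt k \<and> m < k)
      \<or> (\<exists>m b v. s = mt m \<and> t = xt b v \<and> (\<exists>r\<in>fs b. R n (pr s r) \<or> s = r))
      \<or> (\<exists>a u k. s = xt a u \<and> t = mt k \<and> (\<forall>r\<in>fs a. R n (pr r t)))
      \<or> (\<exists>a u b v. s = xt a u \<and> t = xt b v \<and> lin (\<lambda>x y. R n (pr x y)) (fs a \<union> fs b)
          \<and> Dl (\<lambda>x y. R n (pr x y)) (fs a) u (fs b) v))" for n s t
      proof -
        have "R n (pr s t) \<longleftrightarrow> ?C n (\<lambda>x y. R n (pr x y)) s t"
          by (subst R(2)) (rule ex_decode(3))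
        then show ?thesis using C[of n s t "\<lambda>x y. R n (pr x y)"] by (rule trans)
      qed
    qed
  qed
qed

context
  fixes P :: s_praedil
  assumes comp_P: "comp_dil P"
begin

lemma D1_P:
  "F1 n \<Longrightarrow> F1 x \<Longrightarrow> D1 (\<lambda>e. sFld (sObj P (n e)) (x e))"
  "F1 n \<Longrightarrow> F1 x \<Longrightarrow> F1 y \<Longrightarrow> D1 (\<lambda>e. sLt (sObj P (n e)) (x e) (y e))"
  "F1 n \<Longrightarrow> F1 x \<Longrightarrow> F1 y \<Longrightarrow> D1 (\<lambda>e. sAct P (n e) (x e) (y e))"
  "F1 n \<Longrightarrow> F1 x \<Longrightarrow> F1 y \<Longrightarrow> D1 (\<lambda>e. sSupp P (n e) (x e) (y e))"
  using comp_P unfolding comp_dil_def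
  by (auto intro: D1_comp3[of "\<lambda>n x y. sLt (sObj P n) x y"] D1_comp2[of "\<lambda>n x. sFld (sObj P n) x"]
     D1_comp3[of "\<lambda>n x y. sAct P n x y"] D1_comp3[of "\<lambda>n x y. sSupp P n x y"]
      D1_comp3[of "\<lambda>n x y. sMu P n x y"])

lemma partial_fld_iff:
  "s_is_partial_fld T P \<longleftrightarrow> (\<forall>n t. sFld (sObj P n) t \<longleftrightarrow> (\<exists>m. m < n \<and> t = mt m) \<or>
    (\<exists>a s. t = xt a s \<and> isf a \<and> (\<forall>x\<in>fs a. sFld (sObj P n) x) \<and> De (fs a) s
      \<and> \<not> (\<exists>m. m < n \<and> fs a = {mt m} \<and> s = mu 1 0)))"
proof -
  have "(s_D_fld T (sObj P n) (pr a s) \<and> \<not> (\<exists>m. m < n \<and> s_is_mu_pair T m a s)) \<longleftrightarrow>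
    (isf a \<and> (\<forall>x\<in>fs a. sFld (sObj P n) x) \<and> De (fs a) s \<and> \<not> (\<exists>m. m < n \<and> fs a = {mt m} \<and> s = mu 1 0))"
    for n a s
    unfolding D_fld_pr mu_pair_iff by blast
  then show ?thesis unfolding s_is_partial_fld_def by (simp only:)
qed

context
  assumes fld: "s_is_partial_fld T P"
begin

lemma PF_mt: "sFld (sObj P n) (mt m) \<longleftrightarrow> m < n"
  and PF_xt: "sFld (sObj P n) (xt a s) \<longleftrightarrow> isf a \<and> (\<forall>x\<in>fs a. sFld (sObj P n) x) \<and> De (fs a) s
      \<and> \<not> (\<exists>m. m < n \<and> fs a = {mt m} \<and> s = mu 1 0)"
  using fld[unfolded partial_fld_iff, rule_format, of n "mt m"]
    fld[unfolded partial_fld_iff, rule_format, of n "xt a s"] by simp_all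

lemma PF_cases:
  assumes "sFld (sObj P n) t"
  obtains (mt) m where "t = mt m" "m < n"
  | (xt) a s where "t = xt a s" "isf a" "\<And>x. x \<in> fs a \<Longrightarrow> sFld (sObj P n) x" "De (fs a) s"
      "\<And>m. m < n \<Longrightarrow> fs a = {mt m} \<Longrightarrow> s \<noteq> mu 1 0"
  using fld[unfolded partial_fld_iff, rule_format, THEN iffD1, OF assms] by blast

lemma partial_less_iff:
  "s_is_partial_less T P \<longleftrightarrow> (\<forall>n s t. sLt (sObj P n) s t \<longleftrightarrow> sFld (sObj P n) s \<and> sFld (sObj P n) t \<and>
      ((\<exists>m k. s = mt m \<and> t = mt k \<and> m < k)
      \<or> (\<exists>m b v. s = mt m \<and> t = xt b v \<and> (\<exists>r\<in>fs b. sLt (sObj P n) s r \<or> s = r))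
      \<or> (\<exists>a u k. s = xt a u \<and> t = mt k \<and> (\<forall>r\<in>fs a. sLt (sObj P n) r t))
      \<or> (\<exists>a u b v. s = xt a u \<and> t = xt b v \<and> lin (sLt (sObj P n)) (fs a \<union> fs b)
          \<and> Dl (sLt (sObj P n)) (fs a) u (fs b) v)))"
proof -
  have key: "(\<exists>c. s_is_fset c (\<lambda>x. x \<in> fs a \<or> x \<in> fs b) \<and> s_linear (s_restrict (sObj P n) c)
      \<and> s_D_less T (sObj P n) a u b v) \<longleftrightarrow>
    lin (sLt (sObj P n)) (fs a \<union> fs b) \<and> Dl (sLt (sObj P n)) (fs a) u (fs b) v"
    if "sFld (sObj P n) (xt a u)" "sFld (sObj P n) (xt b v)" for n a u b v
  proof -
    have De: "De (fs a) u" "De (fs b) v" using that by (simp_all add: PF_xt)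
    have "s_is_fset c (\<lambda>x. x \<in> fs a \<or> x \<in> fs b) \<longleftrightarrow> c = code (fs a \<union> fs b)" for c
      unfolding s_is_fset_def using code_eq_iff[of "fs a \<union> fs b" c] by auto
    moreover have "D1 (\<lambda>p. sLt (sObj P n) (fst p) (snd p))" by (intro D1_P F1_rules)
    ultimately show ?thesis using D_less_iff[of "sObj P n" a b u v] De by (auto simp: linear_restrict_iff)
  qed
  have "(\<exists>a u b v c. s = xt a u \<and> t = xt b v
         \<and> s_is_fset c (\<lambda>x. x \<in> fs a \<or> x \<in> fs b) \<and> s_linear (s_restrict (sObj P n) c)
         \<and> s_D_less T (sObj P n) a u b v) \<longleftrightarrow>
      (\<exists>a u b v. s = xt a u \<and> t = xt b v \<and> lin (sLt (sObj P n)) (fs a \<union> fs b)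
        \<and> Dl (sLt (sObj P n)) (fs a) u (fs b) v)"
    if F: "sFld (sObj P n) s" "sFld (sObj P n) t" for n s t
    unfolding ex_simps
  proof (rule ex_cong1, rule ex_cong1, rule conj_cong[OF refl], rule ex_cong1, rule ex_cong1, rule conj_cong[OF refl])
    fix a u b v assume "s = xt a u" "t = xt b v"
    then show "(\<exists>c. s_is_fset c (\<lambda>x. x \<in> fs a \<or> x \<in> fs b) \<and> s_linear (s_restrict (sObj P n) c)
      \<and> s_D_less T (sObj P n) a u b v) \<longleftrightarrow>
      lin (sLt (sObj P n)) (fs a \<union> fs b) \<and> Dl (sLt (sObj P n)) (fs a) u (fs b) v"
      using key[of n a u b v] F by simp
  qed
  then show ?thesis unfolding s_is_partial_less_def Bex_def Ball_def by (simp cong: conj_cong)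
qed

lemma fset_image_iff: "s_is_fset b (\<lambda>y. \<exists>x. x \<in> fs a \<and> y = pact f x) \<longleftrightarrow> b = code (pact f ` fs a)"
proof -
  have "F1 (pact f)" using F1_pact[OF F1_const F1_id] .
  then have "fin (pact f ` fs a)" by (simp add: fin_image)
  from code_eq_iff[OF this, of b] show ?thesis unfolding s_is_fset_def by blast
qed

lemma fset_UN_iff:
  "s_is_fset c (\<lambda>i. \<exists>r d. r \<in> fs a \<and> d = psup r \<and> i \<in> fs d) \<longleftrightarrow> c = code (\<Union>r\<in>fs a. fs (psup r))"
proof -
  have "fin (\<Union>r\<in>fs a. fs (psup r))" by (simp add: fin_UN F1_psup0)
  from code_eq_iff[OF this, of c] show ?thesis unfolding s_is_fset_def by blast
qed

lemma partial_act_iff: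
  "s_is_partial_act T P \<longleftrightarrow>
    (\<forall>f n l. s_is_mor f n l \<longrightarrow> (\<forall>s t. sAct P f s t \<longleftrightarrow> sFld (sObj P n) s \<and> t = pact f s))"
proof -
  have step: "sFld (sObj P n) s \<and> ((\<exists>m k. s = mt m \<and> s_app f m k \<and> t = mt k)
       \<or> (\<exists>a u b. s = xt a u \<and> s_is_fset b (\<lambda>y. \<exists>x. x \<in> fs a \<and> sAct P f x y) \<and> t = xt b u))
    \<longleftrightarrow> sFld (sObj P n) s \<and> t = pact f s"
    if f: "s_is_mor f n l" and IH: "\<And>r t. r < s \<Longrightarrow> sAct P f r t \<longleftrightarrow> sFld (sObj P n) r \<and> t = pact f r"
    for f n l s t
  proof (cases "sFld (sObj P n) s")
    case True
    then show ?thesis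
    proof (cases rule: PF_cases)
      case (mt m)
      then show ?thesis using mor_app[OF f] by (auto simp: PF_mt)
    next
      case (xt a u)
      have "sAct P f x y \<longleftrightarrow> y = pact f x" if x: "x \<in> fs a" for x y
        using IH[of x y] xt(3)[OF x] fs_xt[OF x, of u] xt(1) by simp
      then have "s_is_fset b (\<lambda>y. \<exists>x. x \<in> fs a \<and> sAct P f x y) \<longleftrightarrow> b = code (pact f ` fs a)" for b
        unfolding fset_image_iff[symmetric] s_is_fset_def by blast
      then show ?thesis using True xt(1) by auto
    qed
  qed simp
  show ?thesis
  proof
    assume P: "s_is_partial_act T P"
    have "\<forall>t. sAct P f s t \<longleftrightarrow> sFld (sObj P n) s \<and> t = pact f s" if f: "s_is_mor f n l" for f n l s
    proof -
      have "S1 (\<lambda>s. \<exists>t. \<not> (sAct P f s t \<longleftrightarrow> sFld (sObj P n) s \<and> t = pact f s))"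
        by (intro S1_exI D1_S1 comp_rules D1_P F1_pact)
      then have "S1 (\<lambda>s. \<not> (\<forall>t. sAct P f s t \<longleftrightarrow> sFld (sObj P n) s \<and> t = pact f s))" by simp
      then show ?thesis
      proof (induction s rule: P1_less_induct)
        case (less s)
        show ?case
          by (rule allI, rule trans[OF P[unfolded s_is_partial_act_def, rule_format, OF f] step[OF f]])
            (use less in blast)
      qed
    qed
    then show "\<forall>f n l. s_is_mor f n l \<longrightarrow> (\<forall>s t. sAct P f s t \<longleftrightarrow> sFld (sObj P n) s \<and> t = pact f s)"
      by blast
  next
    assume P: "\<forall>f n l. s_is_mor f n l \<longrightarrow> (\<forall>s t. sAct P f s t \<longleftrightarrow> sFld (sObj P n) s \<and> t = pact f s)"
    show "s_is_partial_act T P"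
      unfolding s_is_partial_act_def
    proof (intro allI impI)
      fix f n l s t assume f: "s_is_mor f n l"
      note P = P[rule_format, OF f]
      show "sAct P f s t \<longleftrightarrow> sFld (sObj P n) s \<and> ((\<exists>m k. s = mt m \<and> s_app f m k \<and> t = mt k)
       \<or> (\<exists>a u b. s = xt a u \<and> s_is_fset b (\<lambda>y. \<exists>x. x \<in> fs a \<and> sAct P f x y) \<and> t = xt b u))"
        by (rule trans[OF P step[OF f P, symmetric]])
    qed
  qed
qed

lemma partial_supp_iff:
  "s_is_partial_supp T P \<longleftrightarrow> (\<forall>n t c. sSupp P n t c \<longleftrightarrow> sFld (sObj P n) t \<and> c = psup t)"
proof -
  have step: "sFld (sObj P n) t \<and> ((\<exists>m. t = mt m \<and> s_is_fset c (\<lambda>i. i = m))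
       \<or> (\<exists>a s. t = xt a s \<and> s_is_fset c (\<lambda>i. \<exists>r d. r \<in> fs a \<and> sSupp P n r d \<and> i \<in> fs d)))
    \<longleftrightarrow> sFld (sObj P n) t \<and> c = psup t"
    if IH: "\<And>r c. r < t \<Longrightarrow> sSupp P n r c \<longleftrightarrow> sFld (sObj P n) r \<and> c = psup r" for n t c
  proof (cases "sFld (sObj P n) t")
    case True
    then show ?thesis
    proof (cases rule: PF_cases)
      case (mt m)
      have "s_is_fset c (\<lambda>i. i = m) \<longleftrightarrow> c = code {m}"
        unfolding s_is_fset_def using code_eq_iff[of "{m}" c] by auto
      then show ?thesis using mt by (simp add: psup_mt0)
    next
      case (xt a u)
      have "sSupp P n r d \<longleftrightarrow> d = psup r" if r: "r \<in> fs a" for r d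
        using IH[of r d] xt(3)[OF r] fs_xt[OF r, of u] xt(1) by simp
      then have "s_is_fset c (\<lambda>i. \<exists>r d. r \<in> fs a \<and> sSupp P n r d \<and> i \<in> fs d) \<longleftrightarrow>
          c = code (\<Union>r\<in>fs a. fs (psup r))" for c
        unfolding fset_UN_iff[symmetric] s_is_fset_def by blast
      then show ?thesis using True xt(1) by (auto simp: psup_xt0)
    qed
  qed simp
  show ?thesis
  proof
    assume P: "s_is_partial_supp T P"
    have "\<forall>c. sSupp P n t c \<longleftrightarrow> sFld (sObj P n) t \<and> c = psup t" for n t
    proof -
      have "S1 (\<lambda>t. \<exists>c. \<not> (sSupp P n t c \<longleftrightarrow> sFld (sObj P n) t \<and> c = psup t))"
        by (intro S1_exI D1_S1 comp_rules D1_P F1_psup)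
      then have "S1 (\<lambda>t. \<not> (\<forall>c. sSupp P n t c \<longleftrightarrow> sFld (sObj P n) t \<and> c = psup t))" by simp
      then show ?thesis
      proof (induction t rule: P1_less_induct)
        case (less t)
        show ?case
          by (rule allI, rule trans[OF P[unfolded s_is_partial_supp_def, rule_format] step])
            (use less in blast)
      qed
    qed
    then show "\<forall>n t c. sSupp P n t c \<longleftrightarrow> sFld (sObj P n) t \<and> c = psup t" by blast
  next
    assume "\<forall>n t c. sSupp P n t c \<longleftrightarrow> sFld (sObj P n) t \<and> c = psup t"
    then show "s_is_partial_supp T P"
      unfolding s_is_partial_supp_def using step by (intro allI) blast
  qed
qed

end

end

lemma partial_ex:
  "\<exists>A\<in>Sets. \<exists>B\<in>Sets. \<exists>C\<in>Sets. \<exists>D\<in>Sets. \<exists>E\<in>Sets. \<exists>X\<in>Sets.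
    s_is_partial T (s_coded A B C D E) \<and> s_is_xi T (s_coded A B C D E) (s_family X)"
proof -
  obtain F where F: "D1 (\<lambda>p. F (fst p) (snd p))"
    "\<And>n t. F n t \<longleftrightarrow> (\<exists>m. m < n \<and> t = mt m) \<or>
      (\<exists>a s. t = xt a s \<and> isf a \<and> (\<forall>x\<in>fs a. F n x) \<and> De (fs a) s
        \<and> \<not> (\<exists>m. m < n \<and> fs a = {mt m} \<and> s = mu 1 0))"
    using fld_ex by blast
  note D1_F = D1_comp2[OF F(1)]
  obtain L where L: "D1 (\<lambda>p. L (fst p) (fst (snd p)) (snd (snd p)))"
    "\<And>n s t. L n s t \<longleftrightarrow> F n s \<and> F n t \<and>
      ((\<exists>m k. s = mt m \<and> t = mt k \<and> m < k)
      \<or> (\<exists>m b v. s = mt m \<and> t = xt b v \<and> (\<exists>r\<in>fs b. L n s r \<or> s = r))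
      \<or> (\<exists>a u k. s = xt a u \<and> t = mt k \<and> (\<forall>r\<in>fs a. L n r t))
      \<or> (\<exists>a u b v. s = xt a u \<and> t = xt b v \<and> lin (L n) (fs a \<union> fs b) \<and> Dl (L n) (fs a) u (fs b) v))"
    by (rule less_ex[OF F(1)]) (rule that; assumption)
  obtain A where A: "A \<in> Sets" "(\<lambda>n x. pr n x \<in> A) = F" using Sets_binary[OF F(1)] by blast
  obtain B where B: "B \<in> Sets" "s_family B = L" using Sets_family[OF L(1)] by blast
  let ?act = "\<lambda>f s t. F (p1 f) s \<and> t = pact f s"
  have "D1 (\<lambda>p. ?act (fst p) (fst (snd p)) (snd (snd p)))"
    by (intro comp_rules D1_F F1_p1 F1_pact)
  then obtain C where C: "C \<in> Sets" "s_family C = ?act" using Sets_family[of ?act] by blast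
  let ?supp = "\<lambda>n t c. F n t \<and> c = psup t"
  have "D1 (\<lambda>p. ?supp (fst p) (fst (snd p)) (snd (snd p)))"
    by (intro comp_rules D1_F F1_psup)
  then obtain D where D: "D \<in> Sets" "s_family D = ?supp" using Sets_family[of ?supp] by blast
  let ?mu = "\<lambda>n m t. m < n \<and> t = mt m"
  have "D1 (\<lambda>p. ?mu (fst p) (fst (snd p)) (snd (snd p)))"
    unfolding s_mu_tm_def by (intro comp_rules)
  then obtain E where E: "E \<in> Sets" "s_family E = ?mu" using Sets_family[of ?mu] by blast
  let ?xi = "\<lambda>n p t. \<exists>a\<le>p. \<exists>s\<le>p. p = pr a s \<and> (isf a \<and> (\<forall>x\<in>fs a. F n x) \<and> De (fs a) s) \<and>
        ((\<exists>m<n. (isf a \<and> fs a = {pr 0 m} \<and> s = mu 1 0) \<and> t = pr 0 m)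
         \<or> (\<not> (\<exists>m<n. isf a \<and> fs a = {pr 0 m} \<and> s = mu 1 0) \<and> t = pr 1 (pr a s)))"
  have "D1 (\<lambda>p. ?xi (fst p) (fst (snd p)) (snd (snd p)))"
    by (intro comp_rules D1_F D1_isf D1_De F1_mu)
  then obtain X where X: "X \<in> Sets" "s_family X = ?xi" using Sets_family[of ?xi] by blast
  let ?P = "s_coded A B C D E"
  have P: "sFld (sObj ?P n) = F n" "sLt (sObj ?P n) = L n" "sAct ?P = ?act" "sSupp ?P = ?supp" "sMu ?P = ?mu" for n
    using A(2) B(2) C(2) D(2) E(2) by (simp_all add: s_coded_def fun_eq_iff)
  have comp_P: "comp_dil ?P" using A(1) B(1) C(1) D(1) E(1) by (rule comp_dil_coded)
  have fld: "s_is_partial_fld T ?P" unfolding partial_fld_iff[OF comp_P] P using F(2) by blast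
  have "s_is_partial_less T ?P" unfolding partial_less_iff[OF comp_P fld] P using L(2) by (intro allI)
  moreover have "s_is_partial_act T ?P" unfolding partial_act_iff[OF comp_P fld] P using mor_pr(1) by blast
  moreover have "s_is_partial_supp T ?P" unfolding partial_supp_iff[OF comp_P fld] P by blast
  moreover have "s_is_partial_mu T ?P" unfolding s_is_partial_mu_def P by blast
  ultimately have "s_is_partial T ?P" unfolding s_is_partial_def using fld by blast
  moreover have "s_is_xi T ?P (s_family X)"
    unfolding s_is_xi_def X(2)
  proof (intro allI)
    fix n p t
    show "?xi n p t \<longleftrightarrow> s_D_fld T (sObj ?P n) p \<and> (\<exists>a s. p = pr a s \<and>
        ((\<exists>m. m < n \<and> s_is_mu_pair T m a s \<and> t = mt m)
         \<or> (\<not> (\<exists>m. m < n \<and> s_is_mu_pair T m a s) \<and> t = xt a s)))"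
    proof (cases "\<exists>a s. p = pr a s")
      case True
      then obtain a s where p: "p = pr a s" by blast
      have 1: "(\<exists>a s. p = pr a s \<and> R a s) \<longleftrightarrow> R a s" for R unfolding p by simp
      show ?thesis unfolding p ex_decode(3) 1[unfolded p] D_fld_pr P mu_pair_iff s_mu_tm_def s_xi_tm_def
        by (simp only: conj_assoc)
    qed blast
  qed
  ultimately show ?thesis using A(1) B(1) C(1) D(1) E(1) X(1) by blast
qed

end

section \<open>Linearity of the term systems\<close>

lemma linear_lin: "s_linear X \<Longrightarrow> (\<And>x. x \<in> C \<Longrightarrow> sFld X x) \<Longrightarrow> lin (sLt X) C"
  unfolding s_linear_def lin_def by meson

lemma fs_xt_Un3:
  assumes "r \<in> fs a \<union> fs b \<union> fs c" "r' \<in> fs a \<union> fs b \<union> fs c" "r'' \<in> fs a \<union> fs b \<union> fs c"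
  shows "r + r' + r'' < xt a s + xt b t + xt c u"
proof -
  let ?m = "max (max a b) c"
  have "x < ?m" if "x \<in> fs a \<union> fs b \<union> fs c" for x
    using that fs_bound by (auto simp: less_max_iff_disj)
  then have "r + r' + r'' < ?m + ?m + ?m" using assms by (intro add_strict_mono) auto
  also have "\<dots> \<le> xt a s + xt b t + xt c u"
    using xt_triple[of a s] xt_triple[of b t] xt_triple[of c u]
    by (auto simp: max_def add_increasing add_increasing2)
  finally show ?thesis .
qed

locale term_system = normal_dil T for T +
  fixes P :: s_praedil and xi :: "nn \<Rightarrow> nn \<Rightarrow> nn \<Rightarrow> bool"
  assumes comp_P: "comp_dil P" and partial: "s_is_partial T P" and xi: "s_is_xi T P xi"
begin

abbreviation "PF n \<equiv> sFld (sObj P n)"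
abbreviation "pl n \<equiv> sLt (sObj P n)"

lemma partials:
  shows fld: "s_is_partial_fld T P" and "s_is_partial_less T P" "s_is_partial_act T P"
    "s_is_partial_supp T P" "s_is_partial_mu T P"
  using partial unfolding s_is_partial_def by blast+

lemmas PF_mt = PF_mt[OF comp_P fld]
lemmas PF_xt = PF_xt[OF comp_P fld]
lemmas PF_cases = PF_cases[OF comp_P fld, consumes 1, case_names mt xt]
lemmas pl_iff = partials(2)[unfolded partial_less_iff[OF comp_P fld], rule_format]
lemmas D1_P = D1_P[OF comp_P]

lemma P_act_iff: "s_is_mor f n l \<Longrightarrow> sAct P f s t \<longleftrightarrow> PF n s \<and> t = pact f s"
  using partials(3)[unfolded partial_act_iff[OF comp_P fld]] by blast

lemma P_supp_iff: "sSupp P n t c \<longleftrightarrow> PF n t \<and> c = psup t"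
  using partials(4)[unfolded partial_supp_iff[OF comp_P fld]] by blast

lemma P_mu_iff: "sMu P n m t \<longleftrightarrow> m < n \<and> t = mt m"
  using partials(5) unfolding s_is_partial_mu_def by blast

lemma PF_fs: "PF n (xt a s) \<Longrightarrow> r \<in> fs a \<Longrightarrow> PF n r"
  by (simp add: PF_xt)

lemma pl_PF: "pl n s t \<Longrightarrow> PF n s \<and> PF n t"
  using pl_iff[THEN iffD1, of n s t] by blast

lemma pl_simps:
  "pl n (mt m) (mt k) \<longleftrightarrow> m < k \<and> k < n"
  "pl n (mt m) (xt b v) \<longleftrightarrow> m < n \<and> PF n (xt b v) \<and> (\<exists>r\<in>fs b. pl n (mt m) r \<or> mt m = r)"
  "pl n (xt a u) (mt k) \<longleftrightarrow> PF n (xt a u) \<and> k < n \<and> (\<forall>r\<in>fs a. pl n r (mt k))"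
  "pl n (xt a u) (xt b v) \<longleftrightarrow> PF n (xt a u) \<and> PF n (xt b v) \<and> lin (pl n) (fs a \<union> fs b)
    \<and> Dl (pl n) (fs a) u (fs b) v"
proof -
  show "pl n (mt m) (mt k) \<longleftrightarrow> m < k \<and> k < n" by (subst pl_iff) (auto simp: PF_mt)
qed ((subst pl_iff, simp add: PF_mt)+)

lemma D1_pl: "D1 (\<lambda>p. pl n (fst p) (snd p))"
  by (intro D1_P F1_rules)

lemma sum_le: "x \<le> x + y + z" "x + y \<le> x + y + (z :: nn)"
  by (simp_all add: add_increasing add_increasing2)

lemma lin_step:
  assumes trans: "\<And>s t u. s + t + u < N \<Longrightarrow> pl n s t \<Longrightarrow> pl n t u \<Longrightarrow> pl n s u"
    and irrefl: "\<And>s. s < N \<Longrightarrow> \<not> pl n s s"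
    and total: "\<And>s t. s + t < N \<Longrightarrow> PF n s \<Longrightarrow> PF n t \<Longrightarrow> pl n s t \<or> s = t \<or> pl n t s"
    and C: "\<And>x. x \<in> C \<Longrightarrow> PF n x" "\<And>x y z. x \<in> C \<Longrightarrow> y \<in> C \<Longrightarrow> z \<in> C \<Longrightarrow> x + y + z < N"
  shows "lin (pl n) C"
  unfolding lin_def
proof (intro conjI ballI impI)
  show "\<not> pl n x x" if "x \<in> C" for x
    using irrefl[of x] le_less_trans[OF sum_le(1) C(2)[OF that that that]] by blast
  show "pl n x y \<or> x = y \<or> pl n y x" if "x \<in> C" "y \<in> C" for x y
    using total[of x y] le_less_trans[OF sum_le(2) C(2)[OF that that(2)]] C(1) that by blast
  show "pl n x z" if "x \<in> C" "y \<in> C" "z \<in> C" "pl n x y" "pl n y z" for x y z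
    using trans C(2) that by blast
qed

lemma trans_step:
  assumes trans: "\<And>s t u. s + t + u < r + s' + t' \<Longrightarrow> pl n s t \<Longrightarrow> pl n t u \<Longrightarrow> pl n s u"
    and irrefl: "\<And>s. s < r + s' + t' \<Longrightarrow> \<not> pl n s s"
    and total: "\<And>s t. s + t < r + s' + t' \<Longrightarrow> PF n s \<Longrightarrow> PF n t \<Longrightarrow> pl n s t \<or> s = t \<or> pl n t s"
    and less: "pl n r s'" "pl n s' t'"
  shows "pl n r t'"
proof -
  note lin = lin_step[OF trans irrefl total]
  have PF: "PF n r" "PF n s'" "PF n t'" using pl_PF less by blast+
  from PF(1) show ?thesis
  proof (cases rule: PF_cases)
    case r: (mt m)
    from PF(2) show ?thesis
    proof (cases rule: PF_cases)
      case s: (mt k)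
      from PF(3) show ?thesis
      proof (cases rule: PF_cases)
        case t: (mt l)
        show ?thesis using less less_trans unfolding r s t pl_simps by blast
      next
        case t: (xt c w)
        obtain x where x: "x \<in> fs c" "pl n (mt k) x \<or> mt k = x"
          using less(2) unfolding s t pl_simps by blast
        have "mt m + mt k + x < mt m + mt k + xt c w" using fs_xt[OF x(1)] by simp
        then have "pl n (mt m) x" using x(2) trans[of "mt m" "mt k" x] less(1) unfolding r s t by blast
        then show ?thesis using x PF r t unfolding r t pl_simps by blast
      qed
    next
      case s: (xt b v)
      obtain x where x: "x \<in> fs b" "pl n (mt m) x \<or> mt m = x"
        using less(1) unfolding r s pl_simps by blast
      from PF(3) show ?thesis
      proof (cases rule: PF_cases)
        case t: (mt l)
        have "pl n x (mt l)" using less(2) x(1) unfolding s t pl_simps by blast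
        moreover have "mt m + x + mt l < mt m + xt b v + mt l" using fs_xt[OF x(1)] by simp
        ultimately show ?thesis using x(2) trans[of "mt m" x "mt l"] unfolding r s t by blast
      next
        case t: (xt c w)
        have l: "lin (pl n) (fs b \<union> fs c)" "Dl (pl n) (fs b) v (fs c) w"
          using less(2) unfolding s t pl_simps by blast+
        obtain y where y: "y \<in> fs c" "pl n x y \<or> x = y"
          using Dl_cofinal[OF D1_pl l(1) _ _ _ s(4) _ _ t(4) l(2) x(1)] by auto
        have "mt m + x + y < mt m + xt b v + xt c w"
          by (rule add_strict_mono[OF add_strict_left_mono[OF fs_xt[OF x(1)]] fs_xt[OF y(1)]])
        then have "pl n (mt m) y \<or> mt m = y"
          using x(2) y(2) trans[of "mt m" x y] unfolding r s t by blast
        then show ?thesis using y(1) PF r t unfolding r t pl_simps by blast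
      qed
    qed
  next
    case r: (xt a u)
    from PF(2) show ?thesis
    proof (cases rule: PF_cases)
      case s: (mt k)
      have a: "pl n x (mt k)" if "x \<in> fs a" for x using less(1) that unfolding r s pl_simps by blast
      from PF(3) show ?thesis
      proof (cases rule: PF_cases)
        case t: (mt l)
        have "pl n x (mt l)" if x: "x \<in> fs a" for x
        proof -
          have "x + mt k + mt l < xt a u + mt k + mt l" using fs_xt[OF x] by simp
          then show ?thesis using trans[of x "mt k" "mt l"] a[OF x] less(2) unfolding r s t by blast
        qed
        then show ?thesis using PF t unfolding r t pl_simps by blast
      next
        case t: (xt c w)
        obtain y where y: "y \<in> fs c" "pl n (mt k) y \<or> mt k = y"
          using less(2) unfolding s t pl_simps by blast
        have ay: "pl n x y" if x: "x \<in> fs a" for x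
        proof -
          have "x + mt k + y < xt a u + mt k + xt c w"
            by (rule add_strict_mono[OF add_strict_right_mono[OF fs_xt[OF x]] fs_xt[OF y(1)]])
          then show ?thesis using trans[of x "mt k" y] a[OF x] y(2) unfolding r s t by blast
        qed
        have l: "lin (pl n) (fs a \<union> fs c)"
        proof (rule lin)
          show "PF n x" if "x \<in> fs a \<union> fs c" for x using r(3) t(3) that by blast
          show "x + y + z < r + s' + t'"
            if "x \<in> fs a \<union> fs c" "y \<in> fs a \<union> fs c" "z \<in> fs a \<union> fs c" for x y z
          proof -
            have "x + y + z < xt a u + xt c w" using fs_xt_Un[OF that] .
            also have "\<dots> \<le> xt a u + mt k + xt c w" by (intro add_right_mono) simp
            finally show ?thesis by (simp only: r(1) s(1) t(1))
          qed
        qed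
        note dl = D1_pl l fin_Un[OF fin_fs fin_fs]
        have sub: "fs a \<subseteq> fs a \<union> fs c" "fs c \<subseteq> fs a \<union> fs c" "{y} \<subseteq> fs a \<union> fs c" "y \<in> fs a \<union> fs c"
          using y by auto
        have f: "fin {y}" by simp
        have 1: "Dl (pl n) (fs a) u {y} (mu 1 0)"
          using Dl_mu[OF dl fin_fs sub(1) r(4) sub(4)] ay by blast
        have "Dl (pl n) (fs a) u (fs c) w"
          using Dl_mu_le[OF dl fin_fs sub(2) t(4) sub(4) y(1) disjI2[OF refl]]
        proof
          assume "Dl (pl n) {y} (mu 1 0) (fs c) w"
          then show ?thesis by (rule Dl_trans[OF dl fin_fs sub(1) r(4) f sub(3) De_mu fin_fs sub(2) t(4) 1])
        qed (use 1 in simp)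
        then show ?thesis using PF l unfolding r t pl_simps by blast
      qed
    next
      case s: (xt b v)
      have l: "lin (pl n) (fs a \<union> fs b)" "Dl (pl n) (fs a) u (fs b) v"
        using less(1) unfolding r s pl_simps by blast+
      from PF(3) show ?thesis
      proof (cases rule: PF_cases)
        case t: (mt k)
        have "pl n x (mt k)" if x: "x \<in> fs a" for x
        proof -
          obtain y where y: "y \<in> fs b" "pl n x y \<or> x = y"
            using Dl_cofinal[OF D1_pl l(1) _ _ _ r(4) _ _ s(4) l(2) x] by auto
          have "pl n y (mt k)" using less(2) y(1) unfolding s t pl_simps by blast
          moreover have "x + y + mt k < xt a u + xt b v + mt k"
            by (rule add_strict_right_mono[OF add_strict_mono[OF fs_xt[OF x] fs_xt[OF y(1)]]])
          ultimately show ?thesis using trans[of x y "mt k"] y(2) unfolding r s t by blast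
        qed
        then show ?thesis using PF t unfolding r t pl_simps by blast
      next
        case t: (xt c w)
        have bc: "Dl (pl n) (fs b) v (fs c) w" using less(2) unfolding s t pl_simps by blast
        let ?C = "fs a \<union> fs b \<union> fs c"
        have lC: "lin (pl n) ?C"
        proof (rule lin)
          show "PF n x" if "x \<in> ?C" for x using r(3) s(3) t(3) that by blast
          show "x + y + z < r + s' + t'" if "x \<in> ?C" "y \<in> ?C" "z \<in> ?C" for x y z
            using fs_xt_Un3[OF that] by (simp only: r(1) s(1) t(1))
        qed
        have "Dl (pl n) (fs a) u (fs c) w"
          by (rule Dl_trans[OF D1_pl lC _ fin_fs _ r(4) fin_fs _ s(4) fin_fs _ t(4) l(2) bc]) auto
        moreover have "lin (pl n) (fs a \<union> fs c)" by (rule lin_subset[OF lC]) blast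
        ultimately show ?thesis using PF unfolding r t pl_simps by blast
      qed
    qed
  qed
qed

lemma pl_order: "(\<forall>s\<le>N. \<forall>t\<le>N. \<forall>u\<le>N. s + t + u = N \<and> pl n s t \<and> pl n t u \<longrightarrow> pl n s u)
  \<and> \<not> pl n N N
  \<and> (\<forall>s\<le>N. \<forall>t\<le>N. s + t = N \<and> PF n s \<and> PF n t \<longrightarrow> pl n s t \<or> s = t \<or> pl n t s)"
  (is "?Q N")
proof -
  have "D1 ?Q" by (intro comp_rules D1_P)
  then show ?thesis
  proof (induction N rule: D1_less_induct)
    case (less N)
    have trans: "pl n s u" if "s + t + u < N" "pl n s t" "pl n t u" for s t u
      using less[OF that(1), THEN conjunct1, rule_format, of s t u] that
      by (simp add: add_increasing add_increasing2)
    have irrefl: "\<not> pl n s s" if "s < N" for s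
      using less[OF that, THEN conjunct2, THEN conjunct1] .
    have total: "pl n s t \<or> s = t \<or> pl n t s" if "s + t < N" "PF n s" "PF n t" for s t
      using less[OF that(1), THEN conjunct2, THEN conjunct2, rule_format, of s t] that
      by (simp add: add_increasing add_increasing2)
    show ?case
    proof (intro conjI allI impI; (elim conjE)?)
      fix s t u assume N: "s + t + u = N" and l: "pl n s t" "pl n t u"
      show "pl n s u" by (rule trans_step[OF trans[folded N] irrefl[folded N] total[folded N] l])
    next
      show "\<not> pl n N N"
      proof
        assume N: "pl n N N"
        then have "PF n N" using pl_PF by blast
        then show False
        proof (cases rule: PF_cases)
          case (mt m)
          then show ?thesis using N by (simp add: pl_simps)
        next
          case (xt a u)
          then have "lin (pl n) (fs a)" "Dl (pl n) (fs a) u (fs a) u" using N by (simp_all add: pl_simps)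
          then show ?thesis using Dl_irrefl[OF D1_pl _ fin_fs fin_fs subset_refl xt(4)] by blast
        qed
      qed
    next
      fix s t assume N: "s + t = N" and PF: "PF n s" "PF n t"
      have mx: "pl n (mt m) (xt b v) \<or> pl n (xt b v) (mt m)"
        if "mt m + xt b v \<le> N" "PF n (mt m)" "PF n (xt b v)" for m b v
      proof (cases "\<exists>r\<in>fs b. pl n (mt m) r \<or> mt m = r")
        case True
        then show ?thesis using that by (simp add: pl_simps PF_mt)
      next
        case False
        have "pl n r (mt m)" if r: "r \<in> fs b" for r
        proof -
          have "mt m + r < mt m + xt b v" using fs_xt[OF r] by simp
          then have "mt m + r < N" using \<open>mt m + xt b v \<le> N\<close> by (rule less_le_trans)
          from total[OF this] show ?thesis using that False PF_fs[OF \<open>PF n (xt b v)\<close>] r \<open>PF n (mt m)\<close> by blast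
        qed
        then show ?thesis using that by (simp add: pl_simps PF_mt)
      qed
      from PF(1) show "pl n s t \<or> s = t \<or> pl n t s"
      proof (cases rule: PF_cases)
        case s: (mt m)
        from PF(2) show ?thesis
        proof (cases rule: PF_cases)
          case t: (mt k)
          then show ?thesis using s less_linear[of m k] by (auto simp: pl_simps)
        next
          case t: (xt b v)
          then show ?thesis using mx[of m b v] s PF N by auto
        qed
      next
        case s: (xt a u)
        from PF(2) show ?thesis
        proof (cases rule: PF_cases)
          case t: (mt k)
          then show ?thesis using mx[of k a u] s PF N by (auto simp: add.commute)
        next
          case t: (xt b v)
          have l: "lin (pl n) (fs a \<union> fs b)"
          proof (rule lin_step[OF trans irrefl total]; assumption?)
            show "PF n x" if "x \<in> fs a \<union> fs b" for x using s(3) t(3) that by blast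
            show "x + y + z < N" if "x \<in> fs a \<union> fs b" "y \<in> fs a \<union> fs b" "z \<in> fs a \<union> fs b" for x y z
              using fs_xt_Un[OF that, of u v] N unfolding s(1) t(1) by (simp only:)
          qed
          then have l': "lin (pl n) (fs b \<union> fs a)" by (simp add: Un_commute)
          have "Dl (pl n) (fs a) u (fs b) v \<or> fs a = fs b \<and> u = v \<or> Dl (pl n) (fs b) v (fs a) u"
            by (rule Dl_total[OF D1_pl l _ fin_fs _ s(4) fin_fs _ t(4)]) auto
          then show ?thesis
            using l l' PF isf_unique[OF s(2) t(2)] unfolding s(1) t(1) pl_simps tm_inject by blast
        qed
      qed
    qed
  qed
qed

lemma P_linear: "s_linear (sObj P n)"
  unfolding s_linear_def
proof (intro conjI allI impI)
  show "PF n x" "PF n y" if "pl n x y" for x y using pl_PF[OF that] by blast+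
  show "\<not> pl n x x" for x using pl_order by blast
  show "pl n x z" if "pl n x y \<and> pl n y z" for x y z
    using conjunct1[OF pl_order[of "x + y + z" n], rule_format, of x y z] that
    by (simp add: add_increasing add_increasing2)
  show "pl n x y \<or> x = y \<or> pl n y x" if "PF n x \<and> PF n y" for x y
    using conjunct2[OF conjunct2[OF pl_order[of "x + y" n]], rule_format, of x y] that
    by (simp add: add_increasing add_increasing2)
qed

lemma lin_P: "(\<And>x. x \<in> C \<Longrightarrow> PF n x) \<Longrightarrow> lin (pl n) C"
  using linear_lin[OF P_linear] by blast

section \<open>Embeddings of the term systems\<close>

definition xp :: "nn \<Rightarrow> nn \<Rightarrow> nn" where
  "xp a u = (if \<exists>m. fs a = {mt m} \<and> u = mu 1 0 then the_elem (fs a) else xt a u)"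

lemma xp_cases:
  assumes D: "s_D_fld T (sObj P n) (pr a u)"
  obtains (mt) m where "m < n" "fs a = {mt m}" "u = mu 1 0" "xp a u = mt m"
  | (xt) "xp a u = xt a u" "PF n (xt a u)"
proof (cases "\<exists>m. fs a = {mt m} \<and> u = mu 1 0")
  case True
  then obtain m where m: "fs a = {mt m}" "u = mu 1 0" by blast
  then have "m < n" using D unfolding D_fld_pr by (auto simp: PF_mt)
  then show ?thesis using m by (intro mt[of m]) (auto simp: xp_def)
next
  case False
  then show ?thesis using D unfolding D_fld_pr by (intro xt) (auto simp: xp_def PF_xt)
qed

lemma xp_xt: "PF n (xt a u) \<Longrightarrow> s_D_fld T (sObj P n) (pr a u) \<and> xp a u = xt a u"
  unfolding PF_xt D_fld_pr xp_def using PF_mt by fastforce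

lemma xp_mt: "xp (code {mt m}) (mu 1 0) = mt m"
  by (simp add: xp_def)

lemma xp_PF: "s_D_fld T (sObj P n) (pr a u) \<Longrightarrow> PF n (xp a u)"
  by (cases rule: xp_cases) (auto simp: PF_mt)

lemma xp_less:
  assumes D: "s_D_fld T (sObj P n) (pr a u)" "s_D_fld T (sObj P n) (pr b v)"
    and less: "Dl (pl n) (fs a) u (fs b) v"
  shows "pl n (xp a u) (xp b v)"
proof -
  have De: "De (fs a) u" "De (fs b) v" using D by (simp_all add: D_fld_pr)
  have l: "lin (pl n) (fs a \<union> fs b)" using D by (intro lin_P) (auto simp: D_fld_pr)
  note dl = D1_pl l fin_Un[OF fin_fs fin_fs]
  have A: "fin (fs a)" "fs a \<subseteq> fs a \<union> fs b" "De (fs a) u" using De by auto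
  have B: "fin (fs b)" "fs b \<subseteq> fs a \<union> fs b" "De (fs b) v" using De by auto
  from D(1) show ?thesis
  proof (cases rule: xp_cases)
    case a: (mt m)
    from D(2) show ?thesis
    proof (cases rule: xp_cases)
      case b: (mt k)
      then show ?thesis using Dl_mu[OF dl A, of "mt k"] less a by simp
    next
      case b: xt
      obtain r where "r \<in> fs b" "pl n (mt m) r \<or> mt m = r"
        using Dl_cofinal[OF dl A B less, of "mt m"] a by auto
      then show ?thesis using a b by (auto simp: pl_simps)
    qed
  next
    case a: xt
    from D(2) show ?thesis
    proof (cases rule: xp_cases)
      case b: (mt k)
      then show ?thesis using Dl_mu[OF dl A, of "mt k"] less a by (simp add: pl_simps)
    next
      case b: xt
      then show ?thesis using a less l by (simp add: pl_simps)
    qed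
  qed
qed

text \<open>This covers both the action \<open>\<partial>T\<^sub>f\<close> and the morphism into a given upper derivative.\<close>

lemma embedding:
  assumes D1_lt: "D1 (\<lambda>p. sLt Q (fst p) (snd p))" and D1_fld: "D1 (sFld Q)" and lin: "s_linear Q" and G: "F1 G"
    and mt: "\<And>m. m < n \<Longrightarrow> sFld Q (G (mt m))"
    and mt_less: "\<And>m k. m < k \<Longrightarrow> k < n \<Longrightarrow> sLt Q (G (mt m)) (G (mt k))"
    and x: "\<And>a u. s_D_fld T Q (pr a u) \<Longrightarrow> sFld Q (x a u)"
    and x_less: "\<And>a u b v. s_D_fld T Q (pr a u) \<Longrightarrow> s_D_fld T Q (pr b v) \<Longrightarrow>
      Dl (sLt Q) (fs a) u (fs b) v \<Longrightarrow> sLt Q (x a u) (x b v)"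
    and x_mt: "\<And>m. m < n \<Longrightarrow> x (code {G (mt m)}) (mu 1 0) = G (mt m)"
    and G_xt: "\<And>a u. PF n (xt a u) \<Longrightarrow> G (xt a u) = x (code (G ` fs a)) u"
  shows embedding_fld: "PF n s \<Longrightarrow> sFld Q (G s)" and embedding_less: "pl n s t \<Longrightarrow> sLt Q (G s) (G t)"
proof -
  let ?Q = "\<lambda>N. (PF n N \<longrightarrow> sFld Q (G N)) \<and> (\<forall>s\<le>N. \<forall>t\<le>N. s + t = N \<and> pl n s t \<longrightarrow> sLt Q (G s) (G t))"
  have fs_G [simp]: "fs (code (G ` fs a)) = G ` fs a" "isf (code (G ` fs a))" for a
    using fin_image[OF fin_fs G] by simp_all
  have "D1 ?Q" by (intro comp_rules D1_P D1_comp2[OF D1_lt] D1_comp[OF D1_fld] F1_comp[OF G])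
  then have Q: "?Q N" for N
  proof (induction N rule: D1_less_induct)
    case (less N)
    have fld: "sFld Q (G s)" if "s < N" "PF n s" for s using less that by blast
    have mono: "sLt Q (G s) (G t)" if "s + t < N" "pl n s t" for s t
      using less[OF that(1), THEN conjunct2, rule_format, of s t] that
      by (simp add: add_increasing add_increasing2)
    have inj: "s = t" if "G s = G t" "s + t < N" "PF n s" "PF n t" for s t
    proof (rule ccontr)
      assume "s \<noteq> t"
      moreover have "t + s < N" using that(2) by (simp only: add.commute)
      ultimately have "sLt Q (G s) (G t) \<or> sLt Q (G t) (G s)"
        using P_linear[of n] mono[OF that(2)] mono[of t s] that(3,4) unfolding s_linear_def by blast
      then show False using lin that(1) unfolding s_linear_def by auto
    qed
    have D_G: "s_D_fld T Q (pr (code (G ` fs a)) u)" if a: "PF n (xt a u)" "xt a u \<le> N" for a u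
    proof -
      have r: "r < N" "PF n r" if "r \<in> fs a" for r
        using fs_xt[OF that, of u] a PF_fs that by auto
      have "x + y < N" if "x \<in> fs a" "y \<in> fs a" for x y
        using le_less_trans[OF sum_le(2) less_le_trans[OF fs_xt3[OF that that(2)] a(2)]] .
      then have "x \<in> fs a \<Longrightarrow> y \<in> fs a \<Longrightarrow> pl n x y \<Longrightarrow> sLt Q (G x) (G y)" for x y using mono by blast
      moreover have "lin (sLt Q) (G ` fs a)" using r fld by (intro linear_lin[OF lin]) auto
      moreover have "lin (pl n) (fs a)" using r by (intro lin_P) auto
      ultimately have "De (G ` fs a) u \<longleftrightarrow> De (fs a) u"
        by (intro De_G[OF D1_pl D1_lt _ _ fin_fs G _ fin_fs subset_refl])
      then show ?thesis using a r fld by (auto simp: D_fld_pr PF_xt)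
    qed
    have fldN: "sFld Q (G s)" if "PF n s" "s \<le> N" for s
      using that(1)
    proof (cases rule: PF_cases)
      case (xt a u)
      then show ?thesis using G_xt[of a u] x[OF D_G[of a u]] that by simp
    qed (simp add: mt)
    have "sLt Q (G s) (G t)" if N: "s + t = N" and l: "pl n s t" for s t
    proof -
      have le: "s \<le> N" "t \<le> N" by (simp_all add: N[symmetric] add_increasing add_increasing2)
      have PF: "PF n s" "PF n t" using pl_PF[OF l] by blast+
      from PF(1) show ?thesis
      proof (cases rule: PF_cases)
        case s: (mt m)
        from PF(2) show ?thesis
        proof (cases rule: PF_cases)
          case t: (mt k)
          then show ?thesis using mt_less[of m k] s l by (simp add: pl_simps)
        next
          case t: (xt b v)
          have r: "PF n r" "mt m + r < N" "sFld Q (G r)" if "r \<in> fs b" for r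
          proof -
            have "mt m + r < mt m + xt b v" using fs_xt[OF that] by simp
            then show less: "mt m + r < N" using N unfolding s(1) t(1) by (simp only:)
            show "PF n r" using t(3)[OF that] .
            then show "sFld Q (G r)"
              using fldN[of r] order_trans[OF _ less_imp_le[OF less], of r] by (simp add: add_increasing)
          qed
          obtain r where r': "r \<in> fs b" "pl n (mt m) r \<or> mt m = r"
            using l unfolding s t pl_simps by blast
          have less_r: "sLt Q (G (mt m)) (G r) \<or> G (mt m) = G r"
            using r'(2) mono[OF r(2)[OF r'(1)]] by blast
          let ?C = "insert (G (mt m)) (G ` fs b)"
          have lC: "lin (sLt Q) ?C" using r(3) mt[OF s(2)] by (intro linear_lin[OF lin]) auto
          have D: "s_D_fld T Q (pr (code (G ` fs b)) v)" using D_G PF(2) le(2) unfolding t(1) by blast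
          have "fin ?C" using fin_image[OF fin_fs G] by simp
          from Dl_mu_le[OF D1_lt lC this, of "G ` fs b" v "G (mt m)" "G r"]
          have "Dl (sLt Q) {G (mt m)} (mu 1 0) (G ` fs b) v \<or> G ` fs b = {G (mt m)} \<and> v = mu 1 0"
            using D r'(1) less_r fin_image[OF fin_fs G] by (auto simp: D_fld_pr)
          then show ?thesis
          proof
            assume "Dl (sLt Q) {G (mt m)} (mu 1 0) (G ` fs b) v"
            moreover have "s_D_fld T Q (pr (code {G (mt m)}) (mu 1 0))"
              using mt[OF s(2)] De_mu by (simp add: D_fld_pr)
            ultimately have "sLt Q (x (code {G (mt m)}) (mu 1 0)) (x (code (G ` fs b)) v)"
              using x_less[OF _ D] by simp
            then show ?thesis using x_mt[OF s(2)] G_xt[of b v] PF(2) s(1) t(1) by simp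
          next
            assume *: "G ` fs b = {G (mt m)} \<and> v = mu 1 0"
            then have "x = mt m" if "x \<in> fs b" for x
            proof -
              have "G x \<in> {G (mt m)}" using * that by blast
              then show ?thesis using inj[of "mt m" x] r[OF that] PF(1) s(1) by auto
            qed
            then have "fs b = {mt m}" using r'(1) by blast
            then show ?thesis using t(5)[OF s(2)] * by blast
          qed
        qed
      next
        case s: (xt a u)
        have Ds: "s_D_fld T Q (pr (code (G ` fs a)) u)" using D_G PF(1) le(1) unfolding s(1) by blast
        from PF(2) show ?thesis
        proof (cases rule: PF_cases)
          case t: (mt k)
          have r: "sLt Q (G r) (G (mt k))" "sFld Q (G r)" if "r \<in> fs a" for r
          proof -
            have "r + mt k < xt a u + mt k" using fs_xt[OF that] by simp
            then have "r + mt k < N" using N unfolding s(1) t(1) by (simp only:)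
            then show "sLt Q (G r) (G (mt k))"
              using mono[of r "mt k"] l that unfolding s(1) t(1) pl_simps by blast
            then show "sFld Q (G r)" using lin unfolding s_linear_def by blast
          qed
          let ?C = "insert (G (mt k)) (G ` fs a)"
          have lC: "lin (sLt Q) ?C" using r(2) mt[OF t(2)] by (intro linear_lin[OF lin]) auto
          have "fin ?C" using fin_image[OF fin_fs G] by simp
          from Dl_mu[OF D1_lt lC this, of "G ` fs a" u "G (mt k)"]
          have "Dl (sLt Q) (G ` fs a) u {G (mt k)} (mu 1 0)"
            using Ds r(1) fin_image[OF fin_fs G] by (auto simp: D_fld_pr)
          moreover have "s_D_fld T Q (pr (code {G (mt k)}) (mu 1 0))"
            using mt[OF t(2)] De_mu by (simp add: D_fld_pr)
          ultimately have "sLt Q (x (code (G ` fs a)) u) (x (code {G (mt k)}) (mu 1 0))"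
            using x_less[OF Ds] by simp
          then show ?thesis using x_mt[OF t(2)] G_xt[of a u] PF(1) s(1) t(1) by simp
        next
          case t: (xt b v)
          have Dt: "s_D_fld T Q (pr (code (G ` fs b)) v)" using D_G PF(2) le(2) unfolding t(1) by blast
          let ?C = "fs a \<union> fs b"
          have C: "PF n r" "sFld Q (G r)" if "r \<in> ?C" for r
            using that s(3) t(3) Ds Dt by (auto simp: D_fld_pr)
          have "x + y < N" if "x \<in> ?C" "y \<in> ?C" for x y
            using le_less_trans[OF sum_le(2) fs_xt_Un[OF that that(2), of u v]] N unfolding s(1) t(1) by simp
          then have m: "x \<in> ?C \<Longrightarrow> y \<in> ?C \<Longrightarrow> pl n x y \<Longrightarrow> sLt Q (G x) (G y)" for x y using mono by blast
          have "lin (sLt Q) (G ` ?C)" using C by (intro linear_lin[OF lin]) auto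
          moreover have "lin (pl n) ?C" using C by (intro lin_P) auto
          ultimately have "Dl (sLt Q) (G ` fs a) u (G ` fs b) v \<longleftrightarrow> Dl (pl n) (fs a) u (fs b) v"
            by (intro Dl_G[OF D1_pl D1_lt _ _ fin_Un[OF fin_fs fin_fs] G m]) auto
          then have "Dl (sLt Q) (G ` fs a) u (G ` fs b) v" using l unfolding s(1) t(1) pl_simps by blast
          then have "sLt Q (x (code (G ` fs a)) u) (x (code (G ` fs b)) v)"
            using x_less[OF Ds Dt] by simp
          then show ?thesis using G_xt[of a u] G_xt[of b v] PF s(1) t(1) by simp
        qed
      qed
    qed
    then show ?case using fldN[of N] by simp
  qed
  show "sFld Q (G s)" if "PF n s" using Q[of s] that by blast
  show "sLt Q (G s) (G t)" if "pl n s t"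
    using Q[of "s + t", THEN conjunct2, rule_format, of s t] that
    by (simp add: add_increasing add_increasing2)
qed

section \<open>The term systems form a normal prae-dilator\<close>

lemma ap_inject: assumes "s_is_mor f n m" "i < n" "j < n" shows "ap f i = ap f j \<longleftrightarrow> i = j"
  using mor_mono[OF assms(1)] assms(2,3) by (metis less_irrefl less_linear)

context
  fixes f n l
  assumes f: "s_is_mor f n l"
begin

lemma F1_pact1: "F1 (pact f)" by (rule F1_pact[OF F1_const F1_id])

lemma pact_xp: assumes a: "PF n (xt a u)" shows "pact f (xt a u) = xp (code (pact f ` fs a)) u"
proof -
  have False if m: "pact f ` fs a = {mt m}" "u = mu 1 0" for m
  proof -
    have ex: "\<exists>k<n. x = mt k \<and> ap f k = m" if x: "x \<in> fs a" for x
    proof -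
      have "pact f x = mt m" using m x by blast
      with PF_fs[OF a x] show ?thesis by (cases rule: PF_cases) auto
    qed
    obtain x where "x \<in> fs a" using m by blast
    then obtain k where k: "mt k \<in> fs a" "k < n" "ap f k = m" using ex by blast
    then have "fs a = {mt k}" using ex ap_inject[OF f] by blast
    then show False using a k m by (auto simp: PF_xt)
  qed
  then show ?thesis by (auto simp: xp_def)
qed

lemma PF_pact: "PF n s \<Longrightarrow> PF l (pact f s)" and pl_pact: "pl n s t \<Longrightarrow> pl l (pact f s) (pact f t)"
proof -
  have m: "PF l (pact f (mt m))" if "m < n" for m using mor_bound[OF f that] by (simp add: PF_mt)
  have mm: "pl l (pact f (mt m)) (pact f (mt k))" if "m < k" "k < n" for m k
    using mor_mono[OF f that] mor_bound[OF f that(2)] by (simp add: pl_simps)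
  have mp: "xp (code {pact f (mt m)}) (mu 1 0) = pact f (mt m)" for m by (simp add: xp_mt)
  have D: "D1 (PF l)" by (intro D1_P F1_rules)
  note e = D1_pl D P_linear F1_pact1 m mm xp_PF xp_less mp pact_xp
  show "PF n s \<Longrightarrow> PF l (pact f s)" by (rule embedding_fld[OF e])
  show "pl n s t \<Longrightarrow> pl l (pact f s) (pact f t)" by (rule embedding_less[OF e])
qed

end

lemma PF_induct [consumes 2, case_names mt xt]:
  assumes "PF n t" and D1: "D1 R"
    and mt: "\<And>m. m < n \<Longrightarrow> R (mt m)"
    and xt: "\<And>a u. PF n (xt a u) \<Longrightarrow> (\<And>r. r \<in> fs a \<Longrightarrow> R r) \<Longrightarrow> R (xt a u)"
  shows "R t"
proof -
  have "D1 (\<lambda>t. PF n t \<longrightarrow> R t)" by (intro comp_rules D1_P D1_comp[OF D1])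
  then have "PF n t \<longrightarrow> R t"
  proof (induction t rule: D1_less_induct)
    case (less t)
    show ?case
    proof
      assume t: "PF n t"
      then show "R t"
      proof (cases rule: PF_cases)
        case (xt a u)
        then show ?thesis using assms(4)[of a u] t less fs_xt PF_fs by blast
      qed (simp add: mt)
    qed
  qed
  with assms(1) show ?thesis by blast
qed

lemma isf_psup: "PF n t \<Longrightarrow> isf (psup t)"
  by (cases rule: PF_cases) (auto simp: isf_psup)

lemma psup_bound: "PF n t \<Longrightarrow> i \<in> fs (psup t) \<Longrightarrow> i < n"
proof -
  assume t: "PF n t"
  have "D1 (\<lambda>t. \<forall>i\<in>fs (psup t). i < n)" by (intro comp_rules F1_psup)
  with t have "\<forall>i\<in>fs (psup t). i < n"
    by (induction rule: PF_induct) auto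
  then show "i \<in> fs (psup t) \<Longrightarrow> i < n" by blast
qed

lemma psup_pact: "PF n t \<Longrightarrow> fs (psup (pact f t)) = ap f ` fs (psup t)"
proof -
  assume t: "PF n t"
  have "D1 (\<lambda>t. fs (psup (pact f t)) = ap f ` fs (psup t))" by (intro comp_rules F1_psup F1_pact F1_ap)
  with t show ?thesis
    by (induction rule: PF_induct) auto
qed

lemma pact_id: "PF n t \<Longrightarrow> (\<And>i. i < n \<Longrightarrow> ap f i = i) \<Longrightarrow> pact f t = t"
proof -
  assume t: "PF n t" and f: "\<And>i. i < n \<Longrightarrow> ap f i = i"
  have "D1 (\<lambda>t. pact f t = t)" by (intro comp_rules F1_pact)
  with t show ?thesis
    by (induction rule: PF_induct) (auto simp: f PF_xt)
qed

lemma pact_pact: "PF n t \<Longrightarrow> (\<And>i. i < n \<Longrightarrow> ap g (ap f i) = ap h i) \<Longrightarrow> pact g (pact f t) = pact h t"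
proof -
  assume t: "PF n t" and h: "\<And>i. i < n \<Longrightarrow> ap g (ap f i) = ap h i"
  have "D1 (\<lambda>t. pact g (pact f t) = pact h t)" by (intro comp_rules F1_pact)
  with t show ?thesis
  proof (induction rule: PF_induct)
    case (xt a u)
    then have "pact g ` pact f ` fs a = pact h ` fs a" unfolding image_image by (intro image_cong) auto
    then show ?case by simp
  qed (simp add: h)
qed

lemma less_mt: assumes "m < n" "PF n t" shows "pl n t (mt m) \<longleftrightarrow> (\<forall>i\<in>fs (psup t). i < m)"
proof -
  have "D1 (\<lambda>t. pl n t (mt m) \<longleftrightarrow> (\<forall>i\<in>fs (psup t). i < m))" by (intro comp_rules D1_P F1_psup)
  with assms(2) show ?thesis
    by (induction rule: PF_induct) (auto simp: pl_simps assms(1))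
qed

lemma pact_preimage:
  assumes f: "s_is_mor f k n" and t: "PF n t" "fs (psup t) \<subseteq> ap f ` {..<k}"
  shows "\<exists>y. PF k y \<and> pact f y = t"
proof -
  have "S1 (\<lambda>t. \<not> (PF n t \<and> (\<forall>i\<in>fs (psup t). i \<in> ap f ` {..<k})) \<or> (\<exists>y. PF k y \<and> pact f y = t))"
    by (intro S1_disj S1_exI D1_S1 comp_rules D1_P F1_psup F1_pact F1_ap)
  then have "\<not> (PF n t \<and> (\<forall>i\<in>fs (psup t). i \<in> ap f ` {..<k})) \<or> (\<exists>y. PF k y \<and> pact f y = t)"
  proof (induction t rule: S1_less_induct)
    case (less t)
    show ?case
      unfolding disj_imp not_not
    proof (intro impI, elim conjE)
      assume t: "PF n t" and sup: "\<forall>i\<in>fs (psup t). i \<in> ap f ` {..<k}"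
      from t show "\<exists>y. PF k y \<and> pact f y = t"
      proof (cases rule: PF_cases)
        case (mt m)
        then obtain i where "i < k" "ap f i = m" using sup by auto
        then show ?thesis using mt by (intro exI[of _ "mt i"]) (simp add: PF_mt)
      next
        case (xt a u)
        have ex: "\<exists>y. PF k y \<and> pact f y = r" if r: "r \<in> fs a" for r
        proof -
          have "r < t" using fs_xt[OF r] xt(1) by simp
          moreover have "\<forall>i\<in>fs (psup r). i \<in> ap f ` {..<k}" using sup r xt(1) by auto
          ultimately show ?thesis using less xt(3)[OF r] by blast
        qed
        have "D1 (\<lambda>p. fst p \<notin> fs a \<or> PF k (snd p) \<and> pact f (snd p) = fst p)"
          by (intro comp_rules D1_P F1_pact)
        from collection[OF this, of a] obtain b where
          b: "\<forall>x<a. \<exists>y<b. x \<notin> fs a \<or> PF k y \<and> pact f y = x" using ex by blast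
        let ?A = "{y. y < b \<and> PF k y \<and> pact f y \<in> fs a}"
        have fin: "fin ?A" by (rule finI[of _ b]) (intro comp_rules D1_P F1_pact, blast)
        have im: "pact f ` ?A = fs a"
        proof
          show "fs a \<subseteq> pact f ` ?A"
          proof
            fix x assume x: "x \<in> fs a"
            then obtain y where "y < b" "PF k y \<and> pact f y = x" using b fs_bound[OF x] by blast
            then show "x \<in> pact f ` ?A" using x by (intro image_eqI[of _ _ y]) auto
          qed
        qed blast
        have "lin (pl n) (pact f ` ?A)" using xt(3) im by (intro lin_P) blast
        moreover have "lin (pl k) ?A" by (intro lin_P) blast
        ultimately have "De (pact f ` ?A) u \<longleftrightarrow> De ?A u"
          using pl_pact[OF f] by (intro De_G[OF D1_pl D1_pl _ _ fin F1_pact1[OF f] _ fin subset_refl])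
        then have De: "De ?A u" using xt(4) im by simp
        have "\<not> (?A = {mt m} \<and> u = mu 1 0)" if "m < k" for m
        proof
          assume A: "?A = {mt m} \<and> u = mu 1 0"
          then have "fs a = {mt (ap f m)}" using im by auto
          then show False using xt(5)[OF mor_bound[OF f that]] A by blast
        qed
        then have "PF k (xt (code ?A) u)" using De fin by (auto simp: PF_xt)
        moreover have "pact f (xt (code ?A) u) = t" using im fin xt(1,2) by simp
        ultimately show ?thesis by blast
      qed
    qed
  qed
  then show ?thesis using t by blast
qed

lemma P_normal: "s_is_normal_praedilator P"
proof -
  have emb: "s_embeds (sObj P n) (sObj P l) (sAct P f)" if f: "s_is_mor f n l" for f n l
    using P_act_iff[OF f] PF_pact[OF f] pl_pact[OF f] by (intro s_embedsI) auto
  have "sAct P f x x" if "s_is_mor f n n" "\<forall>i. i < n \<longrightarrow> s_app f i i" "PF n x" for f n x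
    using P_act_iff[OF that(1)] mor_app[OF that(1)] pact_id[OF that(3), of f] that by auto
  moreover have "sAct P h x z"
    if f: "s_is_mor f n m" and g: "s_is_mor g m l" and h: "s_is_mor h n l"
      and c: "\<forall>i j k. s_app f i j \<and> s_app g j k \<longrightarrow> s_app h i k" and s: "sAct P f x y" "sAct P g y z"
    for f g h n m l x y z
  proof -
    have "ap g (ap f i) = ap h i" if "i < n" for i
      using c mor_app[OF f] mor_app[OF g] mor_app[OF h] mor_bound[OF f that] that by blast
    then show ?thesis using s pact_pact[of n x g f h] unfolding P_act_iff[OF f] P_act_iff[OF g] P_act_iff[OF h]
      by auto
  qed
  ultimately have fun_P: "s_is_functor P"
    unfolding s_is_functor_def using P_linear emb by blast
  have maps: "s_maps (PF n) (\<lambda>a. isf a \<and> (\<forall>i. i \<in> fs a \<longrightarrow> i < n)) (sSupp P n)" for n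
    unfolding s_maps_def P_supp_iff using isf_psup psup_bound by blast
  have supp_nat: "j \<in> fs b \<longleftrightarrow> (\<exists>i. i \<in> fs a \<and> s_app f i j)"
    if f: "s_is_mor f n m" and s: "sAct P f x y" "sSupp P n x a" "sSupp P m y b" for f n m x y a b j
  proof -
    have "PF n x" "fs b = ap f ` fs a" using s psup_pact unfolding P_act_iff[OF f] P_supp_iff by auto
    then show ?thesis using mor_app[OF f] psup_bound s(2) unfolding P_supp_iff by blast
  qed
  have supp_cond: "\<exists>k u f y. s_enum (s_below n) a k u \<and> s_is_mor f k n \<and> (\<forall>i j. s_app f i j \<longleftrightarrow> pr i j \<in> fs u)
    \<and> PF k y \<and> sAct P f y x" if s: "sSupp P n x a" for n x a
  proof -
    have x: "PF n x" "a = psup x" using s unfolding P_supp_iff by blast+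
    have bound: "i < n" if "i \<in> fs a" for i using psup_bound[OF x(1)] that x(2) by blast
    have "D1 (\<lambda>p. sLt (s_below n) (fst p) (snd p))" unfolding s_below_simps by (intro comp_rules)
    moreover have "lin (sLt (s_below n)) (fs a)" unfolding lin_def using bound by auto
    ultimately obtain k u where u: "s_enum (s_below n) a k u" using enum_iff by blast
    define f where "f = pr k (pr n u)"
    have app: "s_app f i j \<longleftrightarrow> pr i j \<in> fs u" for i j unfolding f_def by (rule mor_app_graph)
    have e: "s_embeds (s_below k) (s_restrict (s_below n) a) (\<lambda>i x. pr i x \<in> fs u)" and
      sur: "\<And>j. j \<in> fs a \<Longrightarrow> \<exists>i. pr i j \<in> fs u" and isf: "isf u" "\<forall>z. z \<in> fs u \<longrightarrow> (\<exists>i x. z = pr i x)"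
      using u unfolding s_enum_def by blast+
    have "s_embeds (s_below k) (s_below n) (s_app f)"
      using s_embedsD[OF e] bound unfolding app by (intro s_embedsI) (auto simp: s_restrict_def)
    then have f: "s_is_mor f k n" unfolding s_is_mor_def using isf f_def by blast
    have "fs (psup x) \<subseteq> ap f ` {..<k}"
    proof
      fix j assume "j \<in> fs (psup x)"
      then obtain i where "s_app f i j" using sur x(2) unfolding app by blast
      then show "j \<in> ap f ` {..<k}" using mor_app[OF f] by blast
    qed
    from pact_preimage[OF f x(1) this] obtain y where "PF k y" "pact f y = x" by blast
    then show ?thesis using u f app P_act_iff[OF f] by blast
  qed
  have prae: "s_is_praedilator P"
    unfolding s_is_praedilator_def using fun_P maps supp_nat supp_cond by blast
  have mu_emb: "s_embeds (s_below n) (sObj P n) (sMu P n)" for n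
    unfolding P_mu_iff by (intro s_embedsI) (auto simp: P_mu_iff PF_mt pl_simps)
  have mu_nat: "sAct P f x y" if f: "s_is_mor f n m" and "s_app f i j" "sMu P n i x" "sMu P m j y" for f n m i j x y
    using that mor_app[OF f] unfolding P_mu_iff P_act_iff[OF f] by (auto simp: PF_mt)
  have "pl n y x \<longleftrightarrow> (\<forall>i. i \<in> fs a \<longrightarrow> i < m)" if "m < n" "sMu P n m x" "PF n y" "sSupp P n y a" for n m x y a
    using that less_mt unfolding P_mu_iff P_supp_iff by auto
  then show ?thesis
    unfolding s_is_normal_praedilator_def using prae mu_emb mu_nat by blast
qed

end

section \<open>Initiality\<close>

context normal_dil
begin

lemma D_map_iff:
  assumes R: "\<And>x y. sFld X x \<Longrightarrow> R x y \<longleftrightarrow> y = g x" and g: "F1 g"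
  shows "s_D_map T X R p q \<longleftrightarrow> (\<exists>a u. p = pr a u \<and> s_D_fld T X (pr a u) \<and> q = pr (code (g ` fs a)) u)"
proof -
  have "s_is_fset b (\<lambda>y. \<exists>x. x \<in> fs a \<and> R x y) \<longleftrightarrow> b = code (g ` fs a)"
    if "s_D_fld T X (pr a u)" for a u b
  proof -
    have "x \<in> fs a \<Longrightarrow> R x y \<longleftrightarrow> y = g x" for x y using R that unfolding D_fld_pr by blast
    then have "(\<exists>x. x \<in> fs a \<and> R x y) \<longleftrightarrow> y \<in> g ` fs a" for y by blast
    then show ?thesis
      unfolding s_is_fset_def using code_eq_iff[OF fin_image[OF fin_fs g], of b a] by blast
  qed
  then show ?thesis unfolding s_D_map_def by metis
qed

lemma D_obj_less_iff:
  assumes "D1 (\<lambda>p. sLt X (fst p) (snd p))" "s_linear X"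
  shows "sLt (s_D_obj T X) p q \<longleftrightarrow> (\<exists>a u b v. p = pr a u \<and> q = pr b v \<and> s_D_fld T X (pr a u)
    \<and> s_D_fld T X (pr b v) \<and> Dl (sLt X) (fs a) u (fs b) v)"
proof -
  have "s_D_less T X a u b v \<longleftrightarrow> Dl (sLt X) (fs a) u (fs b) v"
    if "s_D_fld T X (pr a u)" "s_D_fld T X (pr b v)" for a u b v
    using that linear_lin[OF assms(2), of "fs a \<union> fs b"]
    by (intro D_less_iff[OF assms(1)]) (auto simp: D_fld_pr)
  then show ?thesis unfolding s_D_obj_def s_order.select_convs by blast
qed

lemma D_fld_cases: assumes "s_D_fld T X p" obtains a u where "p = pr a u" "s_D_fld T X (pr a u)"
proof -
  obtain a u where "p = pr a u" using assms unfolding D_fld_iff by blast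
  then show ?thesis using that assms by blast
qed

lemma D_obj_fld: "sFld (s_D_obj T X) p \<longleftrightarrow> s_D_fld T X p"
  by (simp add: s_D_obj_def)

lemma mu_singleton: "s_is_fset a (\<lambda>z. z = x) \<longleftrightarrow> a = code {x}"
  unfolding s_is_fset_def using code_eq_iff[of "{x}" a] by auto

lemma compose_mu_iff: "sMu (s_compose T S) n m p \<longleftrightarrow> (\<exists>x. sMu S n m x \<and> p = pr (code {x}) (mu 1 0))"
  unfolding s_compose_def s_praedil.select_convs mu_singleton mu_iff by auto

end

context term_system
begin

lemma xi_iff: "xi n p t \<longleftrightarrow> (\<exists>a u. p = pr a u \<and> s_D_fld T (sObj P n) (pr a u) \<and> t = xp a u)"
proof -
  have "(\<exists>m. m < n \<and> s_is_mu_pair T m a u \<and> t = mt m)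
      \<or> (\<not> (\<exists>m. m < n \<and> s_is_mu_pair T m a u) \<and> t = xt a u) \<longleftrightarrow> t = xp a u"
    if D: "s_D_fld T (sObj P n) (pr a u)" for a u
    using D
  proof (cases rule: xp_cases)
    case (mt m)
    then show ?thesis using D unfolding D_fld_pr mu_pair_iff by auto
  next
    case xt
    then show ?thesis unfolding mu_pair_iff PF_xt by auto
  qed
  then show ?thesis using xi unfolding s_is_xi_def by metis
qed

lemma D_pact:
  assumes f: "s_is_mor f n l" and D: "s_D_fld T (sObj P n) (pr a u)"
  shows "xp (code (pact f ` fs a)) u = pact f (xp a u)"
  using D
proof (cases rule: xp_cases)
  case (mt m)
  then show ?thesis by (simp add: xp_mt)
next
  case xt
  then show ?thesis using pact_xp[OF f] by simp
qed

lemma xi_upper: "s_upper_derivative T P xi"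
proof -
  have "s_embeds (s_D_obj T (sObj P n)) (sObj P n) (xi n)" for n
  proof (rule s_embedsI)
    show "sFld (s_D_obj T (sObj P n)) p \<and> PF n t" if "xi n p t" for p t
      using that xp_PF unfolding xi_iff D_obj_fld by blast
    show "\<exists>t. xi n p t \<and> (\<forall>t'. xi n p t' \<longrightarrow> t' = t)" if "sFld (s_D_obj T (sObj P n)) p" for p
      using that[unfolded D_obj_fld] by (rule D_fld_cases) (auto simp: xi_iff)
    show "pl n s t" if "xi n p s" "xi n q t" "sLt (s_D_obj T (sObj P n)) p q" for p q s t
      using that xp_less unfolding xi_iff D_obj_less_iff[OF D1_pl P_linear] by auto
  qed
  moreover have "xi l q v"
    if f: "s_is_mor f n l" and h: "sAct (s_compose T P) f p q" "xi n p t" "sAct P f t v" for f n l p q t v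
  proof -
    obtain n' l' where "s_is_mor f n' l'" "s_D_map T (sObj P n') (sAct P f) p q"
      using h(1) unfolding s_compose_def by auto
    moreover from this(1) have "n' = n" using mor_pr f by metis
    ultimately have "s_D_map T (sObj P n) (sAct P f) p q" by blast
    moreover have "PF n x \<Longrightarrow> sAct P f x y \<longleftrightarrow> y = pact f x" for x y using P_act_iff[OF f] by blast
    ultimately obtain a u where a: "p = pr a u" "s_D_fld T (sObj P n) (pr a u)"
      "q = pr (code (pact f ` fs a)) u"
      using D_map_iff[of "sObj P n" "sAct P f" "pact f" p q] F1_pact1[OF f] by blast
    have t: "t = xp a u" using h(2) a(1) unfolding xi_iff by auto
    have v: "v = pact f t" using h(3) P_act_iff[OF f] by blast
    have r: "PF n x" if "x \<in> fs a" for x using a(2) that by (simp add: D_fld_pr)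
    have "lin (pl n) (fs a)" "lin (pl l) (pact f ` fs a)"
      using r PF_pact[OF f] by (auto intro!: lin_P)
    then have "De (pact f ` fs a) u \<longleftrightarrow> De (fs a) u"
      by (intro De_G[OF D1_pl D1_pl _ _ fin_fs F1_pact1[OF f] pl_pact[OF f] fin_fs subset_refl])
    then have "s_D_fld T (sObj P l) (pr (code (pact f ` fs a)) u)"
      using a(2) PF_pact[OF f] by (auto simp: D_fld_pr)
    then show ?thesis unfolding xi_iff using a(3) v t D_pact[OF f a(2)] by auto
  qed
  moreover have "sMu P n m t" if "sMu (s_compose T P) n m p" "xi n p t" for n m p t
    using that unfolding xi_iff compose_mu_iff P_mu_iff by (auto simp: xp_mt)
  moreover have "sObj (s_compose T P) n = s_D_obj T (sObj P n)" for n by (simp add: s_compose_def)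
  ultimately show ?thesis
    unfolding s_upper_derivative_def s_normal_morphism_def s_nat_trans_def
    using P_normal by (simp only:) blast
qed

end

locale upper_dil = normal_dil T for T +
  fixes S :: s_praedil and x :: "nn \<Rightarrow> nn \<Rightarrow> nn \<Rightarrow> bool"
  assumes comp_S: "comp_dil S" and D1_x: "D1 (\<lambda>p. x (fst p) (fst (snd p)) (snd (snd p)))"
    and upper: "s_upper_derivative T S x"
begin

sublocale S: normal_dil S
  using comp_S upper by unfold_locales (simp_all add: s_upper_derivative_def)

lemma D1_slt: "D1 (\<lambda>p. S.tlt n (fst p) (snd p))"
  by (intro S.D1_tlt F1_rules)

lemma D1_D_S: "F1 n \<Longrightarrow> F1 a \<Longrightarrow> F1 u \<Longrightarrow> D1 (\<lambda>e. s_D_fld T (sObj S (n e)) (pr (a e) (u e)))"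
proof -
  have "D1 (\<lambda>e. s_D_fld T (sObj S (fst e)) (pr (fst (snd e)) (snd (snd e))))"
    unfolding D_fld_pr by (intro comp_rules S.D1_TF D1_isf D1_De)
  then show "F1 n \<Longrightarrow> F1 a \<Longrightarrow> F1 u \<Longrightarrow> D1 (\<lambda>e. s_D_fld T (sObj S (n e)) (pr (a e) (u e)))"
    by (rule D1_comp3)
qed

definition xv :: "nn \<Rightarrow> nn \<Rightarrow> nn \<Rightarrow> nn" where
  "xv n a u = (LEAST q. x n (pr a u) q \<or> \<not> s_D_fld T (sObj S n) (pr a u))"

lemma x_embeds: "s_embeds (s_D_obj T (sObj S n)) (sObj S n) (x n)"
  using upper unfolding s_upper_derivative_def s_normal_morphism_def s_nat_trans_def
  by (simp add: s_compose_def)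

lemma x_iff: "x n p q \<longleftrightarrow> (\<exists>a u. p = pr a u \<and> s_D_fld T (sObj S n) (pr a u) \<and> q = xv n a u)"
proof -
  note E = s_embedsD[OF x_embeds[of n], unfolded D_obj_fld]
  have *: "x n (pr a u) (xv n a u)" if D: "s_D_fld T (sObj S n) (pr a u)" for a u
  proof -
    have "D1 (\<lambda>q. x n (pr a u) q \<or> \<not> s_D_fld T (sObj S n) (pr a u))"
      by (intro comp_rules D1_comp3[OF D1_x])
    moreover obtain q where "x n (pr a u) q" using E(2)[OF D] by blast
    ultimately show ?thesis using D1_LeastI(1)[of "\<lambda>q. x n (pr a u) q \<or> \<not> s_D_fld T (sObj S n) (pr a u)" q] D
      unfolding xv_def by blast
  qed
  show ?thesis
  proof
    assume q: "x n p q"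
    then obtain a u where p: "p = pr a u" "s_D_fld T (sObj S n) (pr a u)"
      using E(1) D_fld_cases by blast
    then have "q = xv n a u" using q * E(2)[of "pr a u"] by blast
    then show "\<exists>a u. p = pr a u \<and> s_D_fld T (sObj S n) (pr a u) \<and> q = xv n a u" using p by blast
  qed (use * in blast)
qed

lemma x_xv: "s_D_fld T (sObj S n) (pr a u) \<Longrightarrow> x n (pr a u) (xv n a u)"
  and x_eq: "x n (pr a u) q \<Longrightarrow> q = xv n a u"
  using x_iff by auto

lemma F1_xv: "F1 n \<Longrightarrow> F1 a \<Longrightarrow> F1 u \<Longrightarrow> F1 (\<lambda>e. xv (n e) (a e) (u e))"
proof -
  have "\<exists>q. x n (pr a u) q \<or> \<not> s_D_fld T (sObj S n) (pr a u)" for n a u using x_iff by blast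
  then have "F1 (\<lambda>p. xv (fst p) (fst (snd p)) (snd (snd p)))"
    unfolding xv_def by (intro F1_Least comp_rules D1_comp3[OF D1_x] D1_D_S)
  then show "F1 n \<Longrightarrow> F1 a \<Longrightarrow> F1 u \<Longrightarrow> F1 (\<lambda>e. xv (n e) (a e) (u e))" by (rule F1_comp3)
qed

lemma xv_fld: "s_D_fld T (sObj S n) (pr a u) \<Longrightarrow> S.TF n (xv n a u)"
  using s_embedsD(1)[OF x_embeds] x_xv by blast

lemma xv_less:
  assumes "s_D_fld T (sObj S n) (pr a u)" "s_D_fld T (sObj S n) (pr b v)" "Dl (S.tlt n) (fs a) u (fs b) v"
  shows "S.tlt n (xv n a u) (xv n b v)"
proof (rule s_embedsD(3)[OF x_embeds])
  show "x n (pr a u) (xv n a u)" "x n (pr b v) (xv n b v)" using assms x_xv by blast+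
  show "sLt (s_D_obj T (sObj S n)) (pr a u) (pr b v)"
    unfolding D_obj_less_iff[OF D1_slt S.linear] using assms by blast
qed

lemma xv_mu: assumes m: "m < n" shows "xv n (code {S.mu n m}) (mu 1 0) = S.mu n m"
proof -
  have D: "s_D_fld T (sObj S n) (pr (code {S.mu n m}) (mu 1 0))"
    using S.mu_TF[OF m] De_mu by (simp add: D_fld_pr)
  then have "x n (pr (code {S.mu n m}) (mu 1 0)) (xv n (code {S.mu n m}) (mu 1 0))"
    by (rule x_xv)
  moreover have "sMu (s_compose T S) n m (pr (code {S.mu n m}) (mu 1 0))"
    unfolding compose_mu_iff S.mu_iff using m by blast
  ultimately have "sMu S n m (xv n (code {S.mu n m}) (mu 1 0))"
    using upper unfolding s_upper_derivative_def s_normal_morphism_def by blast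
  then show ?thesis unfolding S.mu_iff by blast
qed

lemma xv_act:
  assumes f: "s_is_mor f n l" and D: "s_D_fld T (sObj S n) (pr a u)"
  shows "S.act f (xv n a u) = xv l (code (S.act f ` fs a)) u"
proof -
  have R: "S.TF n y \<Longrightarrow> sAct S f y z \<longleftrightarrow> z = S.act f y" for y z using S.act_iff[OF f] by blast
  have F: "F1 (S.act f)" by (intro S.F1_act F1_rules)
  have "s_D_map T (sObj S n) (sAct S f) (pr a u) (pr (code (S.act f ` fs a)) u)"
    by (rule D_map_iff[THEN iffD2, OF R F], assumption) (use D in blast)
  then have "sAct (s_compose T S) f (pr a u) (pr (code (S.act f ` fs a)) u)"
    unfolding s_compose_def using f by auto
  moreover have "x n (pr a u) (xv n a u)" using D by (rule x_xv)
  moreover have "sAct S f (xv n a u) (S.act f (xv n a u))" using S.act_iff[OF f] xv_fld[OF D] by blast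
  ultimately have "x l (pr (code (S.act f ` fs a)) u) (S.act f (xv n a u))"
    using upper f unfolding s_upper_derivative_def s_normal_morphism_def s_nat_trans_def by blast
  then show ?thesis by (rule x_eq)
qed

end

locale initial = term_system T P xi + upper_dil T S x for T P xi S x
begin

lemma nu_ex: "\<exists>f. F1 (\<lambda>p. f (fst p) (snd p)) \<and> (\<forall>n m. f n (mt m) = S.mu n m)
  \<and> (\<forall>n a u. f n (xt a u) = xv n (code (f n ` fs a)) u)"
proof -
  let ?H = "\<lambda>n g t. if p1 t = 0 then S.mu n (p2 t) else xv n (code (g ` fs (p1 (p2 t)))) (p2 (p2 t))"
  have 1: "F1 (\<lambda>p. ?H (fst p) (lookup (fst (snd p))) (snd (snd p)))"
    by (intro F1_if comp_rules F1_p1 F1_p2 S.F1_mu F1_xv F1_code_image F1_lookup)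
  have 2: "?H e g t = ?H e g' t" if "\<And>y. y < t \<Longrightarrow> g y = g' y" for e g g' t
  proof -
    have "y < t" if "y \<in> fs (p1 (p2 t))" for y
      using fs_bound[OF that] p_le(1)[of "p2 t"] p_le(2)[of t] by simp
    then have "g ` fs (p1 (p2 t)) = g' ` fs (p1 (p2 t))" using that by (intro image_cong) auto
    then show ?thesis by (simp only:)
  qed
  show ?thesis
  proof (rule cov_rec[of ?H, OF 1 2], assumption, intro exI conjI allI)
    fix f assume f: "F1 (\<lambda>p. f (fst p) (snd p))" "\<And>e t. f e t = ?H e (f e) t"
    show "F1 (\<lambda>p. f (fst p) (snd p))" by (rule f)
    show "f n (mt m) = S.mu n m" for n m by (subst f(2)) (simp add: s_mu_tm_def)
    show "f n (xt a u) = xv n (code (f n ` fs a)) u" for n a u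
      by (subst f(2)) (simp add: s_xi_tm_def)
  qed
qed

definition nu :: "nn \<Rightarrow> nn \<Rightarrow> nn" where
  "nu = (SOME f. F1 (\<lambda>p. f (fst p) (snd p)) \<and> (\<forall>n m. f n (mt m) = S.mu n m)
    \<and> (\<forall>n a u. f n (xt a u) = xv n (code (f n ` fs a)) u))"

lemma F1_nu0: "F1 (\<lambda>p. nu (fst p) (snd p))"
  and nu_mt [simp]: "nu n (mt m) = S.mu n m"
  and nu_xt: "nu n (xt a u) = xv n (code (nu n ` fs a)) u"
  using someI_ex[OF nu_ex] unfolding nu_def by blast+

lemmas F1_nu = F1_comp2[OF F1_nu0]

lemma F1_nu1: "F1 (nu n)" by (rule F1_nu[OF F1_const F1_id])

lemma nu_fld: "PF n s \<Longrightarrow> S.TF n (nu n s)" and nu_less: "pl n s t \<Longrightarrow> S.tlt n (nu n s) (nu n t)"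
proof -
  have m: "S.TF n (nu n (mt m))" if "m < n" for m using S.mu_TF[OF that] by simp
  have mm: "S.tlt n (nu n (mt m)) (nu n (mt k))" if "m < k" "k < n" for m k
    using S.mu_less[OF that] by simp
  have mp: "xv n (code {nu n (mt m)}) (mu 1 0) = nu n (mt m)" if "m < n" for m using xv_mu[OF that] by simp
  have D: "D1 (S.TF n)" by (intro S.D1_TF F1_rules)
  note e = D1_slt D S.linear F1_nu1 m mm xv_fld xv_less mp nu_xt
  show "PF n s \<Longrightarrow> S.TF n (nu n s)" by (rule embedding_fld[OF e])
  show "pl n s t \<Longrightarrow> S.tlt n (nu n s) (nu n t)" by (rule embedding_less[OF e])
qed

lemma D_nu:
  assumes D: "s_D_fld T (sObj P n) (pr a u)" shows "s_D_fld T (sObj S n) (pr (code (nu n ` fs a)) u)"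
proof -
  have r: "PF n y" if "y \<in> fs a" for y using D that by (simp add: D_fld_pr)
  have "lin (pl n) (fs a)" using r by (rule lin_P)
  moreover have "lin (S.tlt n) (nu n ` fs a)" using r nu_fld by (intro linear_lin[OF S.linear]) auto
  ultimately have "De (nu n ` fs a) u \<longleftrightarrow> De (fs a) u"
    by (intro De_G[OF D1_pl D1_slt _ _ fin_fs F1_nu1 nu_less fin_fs subset_refl])
  then show ?thesis using D nu_fld fin_image[OF fin_fs F1_nu1] by (auto simp: D_fld_pr)
qed

lemma nu_xp: assumes D: "s_D_fld T (sObj P n) (pr a u)" shows "nu n (xp a u) = xv n (code (nu n ` fs a)) u"
  using D by (cases rule: xp_cases) (auto simp: xv_mu nu_xt)

lemma nu_pact: assumes f: "s_is_mor f n l" and t: "PF n t" shows "nu l (pact f t) = S.act f (nu n t)"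
proof -
  have "D1 (\<lambda>t. nu l (pact f t) = S.act f (nu n t))" by (intro comp_rules F1_nu F1_pact S.F1_act)
  with t show ?thesis
  proof (induction rule: PF_induct)
    case (mt m)
    then show ?case using S.act_mu[OF f] by simp
  next
    case (xt a u)
    have D: "s_D_fld T (sObj P n) (pr a u)" using xp_xt[OF xt(1)] by blast
    have "nu l ` pact f ` fs a = S.act f ` nu n ` fs a"
      unfolding image_image using xt(2) by (intro image_cong) auto
    then show ?case using xv_act[OF f D_nu[OF D]] fin_image[OF fin_fs F1_nu1] by (simp add: nu_xt)
  qed
qed

abbreviation "Nu \<equiv> \<lambda>n s y. PF n s \<and> y = nu n s"

lemma D_map_nu: "(\<And>y z. PF n y \<Longrightarrow> R y z \<longleftrightarrow> z = nu n y) \<Longrightarrow> s_D_map T (sObj P n) R p q \<longleftrightarrow>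
  (\<exists>a u. p = pr a u \<and> s_D_fld T (sObj P n) (pr a u) \<and> q = pr (code (nu n ` fs a)) u)"
  by (rule D_map_iff[OF _ F1_nu1])

lemma Nu_morphism: "s_upper_morphism T P xi S x Nu"
proof -
  have "s_embeds (sObj P n) (sObj S n) (Nu n)" for n
    using nu_fld nu_less by (intro s_embedsI) auto
  moreover have "Nu l y v" if "s_is_mor f n l" "sAct P f s y" "Nu n s u" "sAct S f u v" for f n l s y u v
    using that nu_pact PF_pact unfolding P_act_iff[OF that(1)] S.act_iff[OF that(1)] by auto
  moreover have "sMu S n m y" if "sMu P n m s" "Nu n s y" for n m s y
    using that unfolding P_mu_iff S.mu_iff by auto
  moreover have "\<exists>t q y. xi n p t \<and> Nu n t y \<and> s_D_map T (sObj P n) (Nu n) p q \<and> x n q y"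
    if D: "s_D_fld T (sObj P n) p" for n p
  proof -
    obtain a u where p: "p = pr a u" using D unfolding D_fld_iff by blast
    note D = D[unfolded p]
    have "s_D_map T (sObj P n) (Nu n) p (pr (code (nu n ` fs a)) u)"
      using D p by (subst D_map_nu) auto
    moreover have "xi n p (xp a u)" unfolding xi_iff using p D by blast
    moreover have "Nu n (xp a u) (nu n (xp a u))" using xp_PF[OF D] by blast
    moreover have "x n (pr (code (nu n ` fs a)) u) (nu n (xp a u))"
      unfolding nu_xp[OF D] using D_nu[OF D] by (rule x_xv)
    ultimately show ?thesis by blast
  qed
  ultimately show ?thesis
    unfolding s_upper_morphism_def s_normal_morphism_def s_nat_trans_def by blast
qed

lemma Nu_unique:
  assumes D1_R: "D1 (\<lambda>p. R (fst p) (fst (snd p)) (snd (snd p)))" and R: "s_upper_morphism T P xi S x R"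
  shows "R n s y \<longleftrightarrow> Nu n s y"
proof -
  have "s_embeds (sObj P n) (sObj S n) (R n)"
    using R unfolding s_upper_morphism_def s_normal_morphism_def s_nat_trans_def by blast
  note E = s_embedsD[OF this]
  have mu: "sMu S n m y" if "sMu P n m s" "R n s y" for m s y
    using R that unfolding s_upper_morphism_def s_normal_morphism_def by blast
  have xi: "\<exists>t q y. xi n p t \<and> R n t y \<and> s_D_map T (sObj P n) (R n) p q \<and> x n q y"
    if "s_D_fld T (sObj P n) p" for p
    using R that unfolding s_upper_morphism_def by blast
  have *: "R n s (nu n s)" if s: "PF n s" for s
  proof -
    have "D1 (\<lambda>s. R n s (nu n s))" by (intro D1_comp3[OF D1_R] comp_rules F1_nu)
    with s show ?thesis
    proof (induction rule: PF_induct)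
      case (mt m)
      then obtain y where "R n (mt m) y" using E(2)[of "mt m"] by (auto simp: PF_mt)
      then show ?case using mu[of m "mt m" y] mt by (simp add: P_mu_iff S.mu_iff)
    next
      case (xt a u)
      have D: "s_D_fld T (sObj P n) (pr a u)" "xp a u = xt a u" using xp_xt[OF xt(1)] by blast+
      obtain t q y where t: "xi n (pr a u) t" "R n t y" "s_D_map T (sObj P n) (R n) (pr a u) q" "x n q y"
        using xi[OF D(1)] by blast
      have "t = xt a u" using t(1) D(2) unfolding xi_iff by auto
      have R': "R n z z' \<longleftrightarrow> z' = nu n z" if "z \<in> fs a" for z z'
        using xt(2)[OF that] E(1,2) by metis
      have "q = pr (code (nu n ` fs a)) u"
      proof -
        have "(\<exists>z. z \<in> fs a \<and> R n z z') \<longleftrightarrow> z' \<in> nu n ` fs a" for z' using R' by blast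
        then show ?thesis
          using t(3) code_eq_iff[OF fin_image[OF fin_fs F1_nu1], of _ n a]
          unfolding s_D_map_def s_is_fset_def by auto
      qed
      then have "y = nu n (xt a u)" using t(4) x_eq unfolding nu_xt by blast
      then show ?case using t(2) \<open>t = xt a u\<close> by simp
    qed
  qed
  then show ?thesis using E(1,2) by metis
qed

end

lemma derivative_in_model:
  assumes "A \<in> Sets" "B \<in> Sets" "C \<in> Sets" "D \<in> Sets" "E \<in> Sets"
    and normal: "s_is_normal_praedilator (s_coded A B C D E)"
  shows "(\<exists>A'\<in>Sets. \<exists>B'\<in>Sets. \<exists>C'\<in>Sets. \<exists>D'\<in>Sets. \<exists>E'\<in>Sets. \<exists>X\<in>Sets.
      s_is_partial (s_coded A B C D E) (s_coded A' B' C' D' E')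
      \<and> s_is_xi (s_coded A B C D E) (s_coded A' B' C' D' E') (s_family X))
    \<and> (\<forall>A'\<in>Sets. \<forall>B'\<in>Sets. \<forall>C'\<in>Sets. \<forall>D'\<in>Sets. \<forall>E'\<in>Sets. \<forall>X\<in>Sets.
      s_is_partial (s_coded A B C D E) (s_coded A' B' C' D' E')
      \<and> s_is_xi (s_coded A B C D E) (s_coded A' B' C' D' E') (s_family X)
      \<longrightarrow> s_is_derivative (s_coded A B C D E) (s_coded A' B' C' D' E') (s_family X))"
proof -
  let ?T = "s_coded A B C D E"
  interpret normal_dil ?T using comp_dil_coded assms by unfold_locales
  have der: "s_is_derivative ?T P xi" if "comp_dil P" "s_is_partial ?T P" "s_is_xi ?T P xi" for P xi
  proof -
    interpret P: term_system ?T P xi using that by unfold_locales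
    have init: "\<exists>N\<in>Sets. s_upper_morphism ?T P xi (s_coded A' B' C' D' E') (s_family X) (s_family N)
            \<and> (\<forall>N'\<in>Sets. s_upper_morphism ?T P xi (s_coded A' B' C' D' E') (s_family X) (s_family N') \<longrightarrow>
                  (\<forall>n x y. s_family N' n x y \<longleftrightarrow> s_family N n x y))"
      if S: "A' \<in> Sets" "B' \<in> Sets" "C' \<in> Sets" "D' \<in> Sets" "E' \<in> Sets" "X \<in> Sets"
        "s_upper_derivative ?T (s_coded A' B' C' D' E') (s_family X)" for A' B' C' D' E' X
    proof -
      interpret S: initial ?T P xi "s_coded A' B' C' D' E'" "s_family X"
        using comp_dil_coded D1_family S by unfold_locales
      have "D1 (\<lambda>p. S.Nu (fst p) (fst (snd p)) (snd (snd p)))"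
        by (intro comp_rules P.D1_P S.F1_nu)
      then obtain N where N: "N \<in> Sets" "s_family N = S.Nu" using Sets_family[of S.Nu] by blast
      have "s_family N' n x y \<longleftrightarrow> s_family N n x y"
        if "N' \<in> Sets" "s_upper_morphism ?T P xi (s_coded A' B' C' D' E') (s_family X) (s_family N')"
        for N' n x y
        unfolding N(2) by (rule S.Nu_unique[OF D1_family[OF that(1)] that(2)])
      moreover have "s_upper_morphism ?T P xi (s_coded A' B' C' D' E') (s_family X) (s_family N)"
        unfolding N(2) by (rule S.Nu_morphism)
      ultimately show ?thesis using N(1) by blast
    qed
    show ?thesis
      unfolding s_is_derivative_def
      by (intro conjI P.xi_upper ballI impI; rule init; assumption)
  qed
  show ?thesis
    by (intro conjI partial_ex ballI impI; elim conjE; rule der; (assumption | rule comp_dil_coded)+)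
qed

theorem theorem4p12:
  shows "provable_in_RCA0
    (\<^bold>\<forall>\<^sub>PT. is_normal_praedilator T \<^bold>\<longrightarrow>
       (\<^bold>\<exists>\<^sub>PP. \<^bold>\<exists>\<^sub>Fxi. is_partial T P \<^bold>\<and> is_xi T P xi)
       \<^bold>\<and> (\<^bold>\<forall>\<^sub>PP. \<^bold>\<forall>\<^sub>Fxi. is_partial T P \<^bold>\<and> is_xi T P xi \<^bold>\<longrightarrow> is_derivative T P xi))"
  using sat_goal[OF derivative_in_model] unfolding provable_in_RCA0_def goal_def .

end
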